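(* Let $M$ be an unstable module and let $n,t\ge 0$ be integers. Write $E_{2}^{s,t}(S^{n},M)=\mathrm{Ext}_{\mathcal{U}}^{s}(\Sigma^{n}\mathbb{F}_2,\Sigma^{t}M)$. Then there exists a long exact sequence $$\cdots\xrightarrow{H}E_{2}^{s-2,t}(S^{2n+1},M)\xrightarrow{P}E_{2}^{s,t}(S^{n},M)\xrightarrow{E}E_{2}^{s,t+1}(S^{n+1},M)\xrightarrow{H}E_{2}^{s-1,t}(S^{2n+1},M)\xrightarrow{P}\cdots$$ where $s$ runs through the integers $s\ge 2$.
   Context: Let $\mathcal{A}_2$ be the mod $2$ Steenrod algebra and $\mathcal{U}$ the abelian category of unstable $\mathcal{A}_2$-modules, i.e. $\mathbb{N}$-graded $\mathcal{A}_2$-modules $M$ with $Sq^{k}x=0$ for all $x\in M^{n}$ and $k>n$. The suspension functor $\Sigma:\mathcal{U}\to\mathcal{U}$ is given by $(\Sigma M)^{n}=M^{n-1}$ with $Sq^{k}\Sigma x=\Sigma Sq^{k}x$, and $\Sigma^{t}$ is its $t$-fold iterate. $\Sigma^{n}\mathbb{F}_2$ is the unstable module which is $\mathbb{F}_2$ in degree $n$ and zero elsewhere. *)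

theory Defs
  imports "HOL-Algebra.Algebra"
begin

section \<open>The mod 2 Steenrod algebra\<close>

text \<open>
  The free associative unital algebra over the field with two elements on generators
  \<open>Sq\<^sup>1, Sq\<^sup>2, \<dots>\<close>. A word \<open>[i\<^sub>1, \<dots>, i\<^sub>r]\<close> of positive integers stands for the monomial
  \<open>Sq\<^bsup>i\<^sub>1\<^esup> \<dots> Sq\<^bsup>i\<^sub>r\<^esup>\<close>, and an element of the algebra is the finite set of the monomials that occur
  in it with coefficient 1.
\<close>

definition free_Sq_algebra :: "nat list set ring" where
  "free_Sq_algebra =
    \<lparr>carrier = {p. finite p \<and> (\<forall>w\<in>p. 0 \<notin> set w)},
     monoid.mult = (\<lambda>p q. {w. odd (card {(u, v). u \<in> p \<and> v \<in> q \<and> u @ v = w})}),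
     one = {[]},
     ring.zero = {},
     add = (\<lambda>p q. (p - q) \<union> (q - p))\<rparr>"

definition free_Sq :: "nat \<Rightarrow> nat list set" where
  "free_Sq k = (if k = 0 then {[]} else {[k]})"

text \<open>
  The binomial coefficient below has its usual meaning: \<open>0 < a < 2b\<close> and \<open>j \<le> a/2\<close> give \<open>j < b\<close>,
  so neither subtraction truncates.
\<close>

definition Adem_relation :: "nat \<Rightarrow> nat \<Rightarrow> nat list set" where
  "Adem_relation a b =
    (free_Sq a \<otimes>\<^bsub>free_Sq_algebra\<^esub> free_Sq b) \<ominus>\<^bsub>free_Sq_algebra\<^esub>
    (\<Oplus>\<^bsub>free_Sq_algebra\<^esub>j\<in>{0..a div 2}.
       if odd ((b - 1 - j) choose (a - 2 * j))
       then free_Sq (a + b - j) \<otimes>\<^bsub>free_Sq_algebra\<^esub> free_Sq j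
       else \<zero>\<^bsub>free_Sq_algebra\<^esub>)"

definition Adem_ideal :: "nat list set set" where
  "Adem_ideal = Idl\<^bsub>free_Sq_algebra\<^esub> {Adem_relation a b |a b. 0 < a \<and> a < 2 * b}"

definition Steenrod :: "nat list set set ring" where
  "Steenrod = free_Sq_algebra Quot Adem_ideal"

definition Sq :: "nat \<Rightarrow> nat list set set" where
  "Sq k = Adem_ideal +>\<^bsub>free_Sq_algebra\<^esub> free_Sq k"

definition Steenrod_deg :: "nat \<Rightarrow> nat list set set set" where
  "Steenrod_deg k =
    {Adem_ideal +>\<^bsub>free_Sq_algebra\<^esub> p |p.
       p \<in> carrier free_Sq_algebra \<and> (\<forall>w\<in>p. sum_list w = k)}"


section \<open>Unstable modules\<close>

text \<open>
  A graded object is the family \<open>comp M n\<close> of its homogeneous components, which are abelian groups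
  in the library's multiplicative notation: \<open>\<otimes>\<close> is the addition of the module and \<open>\<one>\<close> its zero.
  \<open>act M k n r x\<close> is \<open>r x\<close> for \<open>r\<close> of degree \<open>k\<close> in the Steenrod algebra and \<open>x\<close> of degree \<open>n\<close> in the
  module; \<open>k\<close> is an argument because \<open>0\<close> is homogeneous of every degree. The components are vector
  spaces over the field with two elements since \<open>1 + 1 = 0\<close> in the Steenrod algebra.
\<close>

record 'a gmod =
  comp :: "nat \<Rightarrow> 'a monoid"
  act :: "nat \<Rightarrow> nat \<Rightarrow> nat list set set \<Rightarrow> 'a \<Rightarrow> 'a"

definition graded_Steenrod_module :: "'a gmod \<Rightarrow> bool" where
  "graded_Steenrod_module M \<longleftrightarrow>
    (\<forall>n. comm_group (comp M n)) \<and>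
    (\<forall>k n. \<forall>r\<in>Steenrod_deg k. act M k n r \<in> hom (comp M n) (comp M (n + k))) \<and>
    (\<forall>k n. \<forall>r\<in>Steenrod_deg k. \<forall>s\<in>Steenrod_deg k. \<forall>x\<in>carrier (comp M n).
       act M k n (r \<oplus>\<^bsub>Steenrod\<^esub> s) x = act M k n r x \<otimes>\<^bsub>comp M (n + k)\<^esub> act M k n s x) \<and>
    (\<forall>k l n. \<forall>r\<in>Steenrod_deg k. \<forall>s\<in>Steenrod_deg l. \<forall>x\<in>carrier (comp M n).
       act M (k + l) n (r \<otimes>\<^bsub>Steenrod\<^esub> s) x = act M k (n + l) r (act M l n s x)) \<and>
    (\<forall>n. \<forall>x\<in>carrier (comp M n). act M 0 n \<one>\<^bsub>Steenrod\<^esub> x = x)"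

definition unstable_module :: "'a gmod \<Rightarrow> bool" where
  "unstable_module M \<longleftrightarrow> graded_Steenrod_module M \<and>
    (\<forall>n. \<forall>k>n. \<forall>x\<in>carrier (comp M n). act M k n (Sq k) x = \<one>\<^bsub>comp M (n + k)\<^esub>)"

text \<open>
  Morphisms are degree-preserving; they are made extensional so that equal morphisms are equal
  functions.
\<close>

definition Hom_U :: "'a gmod \<Rightarrow> 'b gmod \<Rightarrow> (nat \<Rightarrow> 'a \<Rightarrow> 'b) set" where
  "Hom_U M N =
    {f. (\<forall>n. f n \<in> hom (comp M n) (comp N n) \<inter> extensional (carrier (comp M n))) \<and>
        (\<forall>k n. \<forall>r\<in>Steenrod_deg k. \<forall>x\<in>carrier (comp M n).
           f (n + k) (act M k n r x) = act N k n r (f n x))}"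

definition comp_U :: "'a gmod \<Rightarrow> (nat \<Rightarrow> 'b \<Rightarrow> 'c) \<Rightarrow> (nat \<Rightarrow> 'a \<Rightarrow> 'b) \<Rightarrow> nat \<Rightarrow> 'a \<Rightarrow> 'c" where
  "comp_U M g f n = compose (carrier (comp M n)) (g n) (f n)"

definition Hom_group :: "'a gmod \<Rightarrow> 'b gmod \<Rightarrow> (nat \<Rightarrow> 'a \<Rightarrow> 'b) monoid" where
  "Hom_group M N =
    \<lparr>carrier = Hom_U M N,
     monoid.mult = (\<lambda>f g n. \<lambda>x\<in>carrier (comp M n). f n x \<otimes>\<^bsub>comp N n\<^esub> g n x),
     one = (\<lambda>n. \<lambda>x\<in>carrier (comp M n). \<one>\<^bsub>comp N n\<^esub>)\<rparr>"

definition suspension :: "'a gmod \<Rightarrow> 'a gmod" where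
  "suspension M =
    \<lparr>comp = (\<lambda>n. case n of 0 \<Rightarrow> singleton_group \<one>\<^bsub>comp M 0\<^esub> | Suc m \<Rightarrow> comp M m),
     act = (\<lambda>k n r x. case n of
              0 \<Rightarrow> (case k of 0 \<Rightarrow> \<one>\<^bsub>comp M 0\<^esub> | Suc l \<Rightarrow> \<one>\<^bsub>comp M l\<^esub>)
            | Suc m \<Rightarrow> act M k m r x)\<rparr>"

definition F2_module :: "int gmod" where
  "F2_module =
    \<lparr>comp = (\<lambda>n. if n = 0 then integer_mod_group 2 else singleton_group 0),
     act = (\<lambda>k n r x. if k = 0 \<and> r = \<one>\<^bsub>Steenrod\<^esub> then x else 0)\<rparr>"


section \<open>Ext in the category of unstable modules\<close>

text \<open>
  The test modules \<open>M\<close> and \<open>N\<close> range over unstable modules on the same type \<open>'u\<close> as \<open>P\<close>. For infinite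
  \<open>'u\<close> this is projectivity in the whole category: as the Steenrod algebra is countable, the free
  unstable module on all homogeneous elements of \<open>P\<close> has at most as many elements as \<open>'u\<close> and hence
  a copy on \<open>'u\<close>, so \<open>P\<close> is a direct summand of a free unstable module. For the same reason every
  unstable module on an infinite type \<open>'u\<close> has a projective resolution by modules on \<open>'u\<close>.
\<close>

definition projective_U :: "'u gmod \<Rightarrow> bool" where
  "projective_U P \<longleftrightarrow> unstable_module P \<and>
    (\<forall>(M :: 'u gmod) (N :: 'u gmod). \<forall>g\<in>Hom_U M N. \<forall>f\<in>Hom_U P N.
       unstable_module M \<and> unstable_module N \<and>
       (\<forall>n. g n ` carrier (comp M n) = carrier (comp N n))
       \<longrightarrow> (\<exists>h\<in>Hom_U P M. comp_U P g h = f))"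

text \<open>\<open>d 0\<close> is the augmentation \<open>P 0 \<rightarrow> A\<close>, and \<open>d (Suc s)\<close> is the differential \<open>P (Suc s) \<rightarrow> P s\<close>.\<close>

definition projective_resolution ::
  "'u gmod \<Rightarrow> (nat \<Rightarrow> 'u gmod) \<Rightarrow> (nat \<Rightarrow> nat \<Rightarrow> 'u \<Rightarrow> 'u) \<Rightarrow> bool" where
  "projective_resolution A P d \<longleftrightarrow>
    (\<forall>s. projective_U (P s)) \<and>
    d 0 \<in> Hom_U (P 0) A \<and>
    (\<forall>s. d (Suc s) \<in> Hom_U (P (Suc s)) (P s)) \<and>
    (\<forall>n. d 0 n ` carrier (comp (P 0) n) = carrier (comp A n)) \<and>
    (\<forall>n. kernel (comp (P 0) n) (comp A n) (d 0 n) = d 1 n ` carrier (comp (P 1) n)) \<and>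
    (\<forall>s n. kernel (comp (P (Suc s)) n) (comp (P s) n) (d (Suc s) n) =
           d (Suc (Suc s)) n ` carrier (comp (P (Suc (Suc s))) n))"

definition cocycles ::
  "(nat \<Rightarrow> 'u gmod) \<Rightarrow> (nat \<Rightarrow> nat \<Rightarrow> 'u \<Rightarrow> 'u) \<Rightarrow> 'b gmod \<Rightarrow> nat \<Rightarrow> (nat \<Rightarrow> 'u \<Rightarrow> 'b) set" where
  "cocycles P d N s =
    kernel (Hom_group (P s) N) (Hom_group (P (Suc s)) N) (\<lambda>f. comp_U (P (Suc s)) f (d (Suc s)))"

definition coboundaries ::
  "(nat \<Rightarrow> 'u gmod) \<Rightarrow> (nat \<Rightarrow> nat \<Rightarrow> 'u \<Rightarrow> 'u) \<Rightarrow> 'b gmod \<Rightarrow> nat \<Rightarrow> (nat \<Rightarrow> 'u \<Rightarrow> 'b) set" where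
  "coboundaries P d N s =
    (case s of
       0 \<Rightarrow> {\<one>\<^bsub>Hom_group (P 0) N\<^esub>}
     | Suc r \<Rightarrow> (\<lambda>f. comp_U (P (Suc r)) f (d (Suc r))) ` Hom_U (P r) N)"

definition Ext_U :: "nat \<Rightarrow> 'u gmod \<Rightarrow> 'b gmod \<Rightarrow> (nat \<Rightarrow> 'u \<Rightarrow> 'b) set monoid" where
  "Ext_U s A N =
    (let (P, d) = (SOME (P, d). projective_resolution A P d)
     in (Hom_group (P s) N)\<lparr>carrier := cocycles P d N s\<rparr> Mod coboundaries P d N s)"

text \<open>\<open>E2 s t n M\<close> is the group \<open>E\<^sub>2\<^bsup>s,t\<^esup>(S\<^sup>n, M)\<close>.\<close>

definition E2 :: "nat \<Rightarrow> nat \<Rightarrow> nat \<Rightarrow> 'a gmod \<Rightarrow> (nat \<Rightarrow> int \<Rightarrow> 'a) set monoid" where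
  "E2 s t n M = Ext_U s ((suspension ^^ n) F2_module) ((suspension ^^ t) M)"

end

theory Submission
  imports Defs "HOL-Library.Z2" "HOL-Library.Countable_Set" "HOL-Computational_Algebra.Formal_Power_Series"
begin

text \<open>
  The suspension has the left adjoint \<open>\<Omega>\<close>, where \<open>\<Omega> M\<close> is the desuspension of the cokernel of the top
  square \<open>x \<mapsto> Sq\<^bsup>n\<^esup> x\<close>, \<open>n\<close> being the degree of \<open>x\<close>. It preserves projectives, so for a projective
  resolution \<open>P\<close> of the sphere \<open>\<Sigma>\<^bsup>n+1\<^esup> F\<^sub>2\<close> the groups \<open>E\<^sub>2\<^bsup>s,t+1\<^esup>(S\<^bsup>n+1\<^esup>, M)\<close> are the cohomology of
  \<open>Hom (\<Omega> P, \<Sigma>\<^sup>t M)\<close>. The top square is injective on projectives, which are direct summands of free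
  modules: these embed into sums of tensor powers of \<open>F(1)\<close>, inside polynomial rings, where it is the
  squaring map. Comparing \<open>P\<close>, its image under the top square and the quotient therefore shows that
  \<open>\<Omega> P\<close> has homology \<open>\<Sigma>\<^sup>n F\<^sub>2\<close> in degree 0, \<open>\<Sigma>\<^bsup>2n+1\<^esup> F\<^sub>2\<close> in degree 1 and nothing else. A projective
  resolution \<open>R\<close> of \<open>\<Sigma>\<^bsup>2n+1\<^esup> F\<^sub>2\<close> maps to \<open>\<Omega> P\<close>, raising degrees by 1, and the mapping cone is a
  projective resolution of \<open>\<Sigma>\<^sup>n F\<^sub>2\<close>. The long exact sequence of the cone, mapped into \<open>\<Sigma>\<^sup>t M\<close>, is the
  sequence sought.
\<close>

section \<open>The Steenrod algebra\<close>

text \<open>Let \<Phi> double degrees; it is exact. For a reduced P the top square gives an exact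
  sequence 0 -> \<Phi> P -> P -> \<Sigma> \<Omega> P -> 0. For a resolution P the only homology of
  \<Phi> P is one class in degree 2n+2, and it dies in H_0 of P because the top square of
  \<Sigma>^(n+1) F_2 is zero, n+1 being positive. So the connecting map finds it in H_1 of \<Sigma>
  \<Omega> P, and one desuspension gives 2n+1. \<Phi> is never constructed: on elements, a cycle y
  has d y = Sq z, and the class of z decides whether y bounds.

  Two obstacles shape the rest. The Adem relations must be verified in the polynomial model, by
  extracting one coefficient from the Bullett-Macdonald identity. And projectivity and Ext are tied
  to one type, here \<open>int\<close>: quotients consist of representatives, pairs are coded by
  integers, free modules are countable copies. The resolution inside Ext is an arbitrary choice, so
  chain maps \<open>a\<close> and \<open>b\<close> compare it with the cone. The cone has
  \<open>R j\<close> in degree j+2, whence s >= 2.\<close>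

declare add_bit_eq_xor [simp del] mult_bit_eq_and [simp del]

lemma bit_add_self [simp]: "(x::bit) + x = 0"
  by (cases x) auto

lemma of_nat_bit: "(of_nat n :: bit) = of_bool (odd n)"
  by (induction n) auto

lemma sum_singleton: "sum f {a} = (f a :: 'a::comm_monoid_add)"
  by simp

text \<open>The intersection is counted twice on the right and drops out in characteristic
  2.\<close>

lemma sum_symdiff:
  fixes h :: "'a \<Rightarrow> bit"
  assumes "finite p" "finite q"
  shows "sum h ((p - q) \<union> (q - p)) = sum h p + sum h q"
proof -
  have "sum h p = sum h (p \<inter> q) + sum h (p - q)"
    by (rule sum.Int_Diff[OF assms(1)])
  moreover have "sum h q = sum h (p \<inter> q) + sum h (q - p)"
    using sum.Int_Diff[OF assms(2), of h p] by (simp only: Int_commute)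
  moreover have "sum h ((p - q) \<union> (q - p)) = sum h (p - q) + sum h (q - p)"
    using assms by (intro sum.union_disjoint) auto
  ultimately show ?thesis
    by (cases "sum h (p \<inter> q)"; cases "sum h (p - q)"; cases "sum h (q - p)") simp_all
qed

text \<open>The indicator function of a point detects membership. This reduces identities between
  elements of the free algebra, which are sets, to identities between sums in
  \<open>bit\<close>.\<close>

lemma set_eq_if_sum_eq:
  fixes p q :: "'a set"
  assumes "finite p" "finite q" "\<And>h. (sum h p :: bit) = sum h q"
  shows "p = q"
proof -
  have *: "(\<Sum>x\<in>r. of_bool (x = w) :: bit) = of_bool (w \<in> r)" if "finite r" for r :: "'a set" and w
    using that by (simp add: of_bool_def)
  have "of_bool (w \<in> p) = (of_bool (w \<in> q) :: bit)" for w
    using assms(3)[of "\<lambda>x. of_bool (x = w)"] *[OF assms(1)] *[OF assms(2)] by simp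
  then have "w \<in> p \<longleftrightarrow> w \<in> q" for w
    by (metis of_bool_eq_iff)
  then show ?thesis by auto
qed

section \<open>The free algebra as a ring of characteristic 2\<close>

abbreviation "FA \<equiv> free_Sq_algebra"

lemma carrier_free: "carrier FA = {p. finite p \<and> (\<forall>w\<in>p. 0 \<notin> set w)}"
  and mult_free: "p \<otimes>\<^bsub>FA\<^esub> q = {w. odd (card {(u, v). u \<in> p \<and> v \<in> q \<and> u @ v = w})}"
  and one_free: "\<one>\<^bsub>FA\<^esub> = {[]}"
  and zero_free: "\<zero>\<^bsub>FA\<^esub> = {}"
  and add_free: "p \<oplus>\<^bsub>FA\<^esub> q = (p - q) \<union> (q - p)"
  by (simp_all add: free_Sq_algebra_def)

lemma mult_free_subset: "p \<otimes>\<^bsub>FA\<^esub> q \<subseteq> (\<lambda>(u, v). u @ v) ` (p \<times> q)"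
proof
  fix w assume "w \<in> p \<otimes>\<^bsub>FA\<^esub> q"
  then have "odd (card {(u, v). u \<in> p \<and> v \<in> q \<and> u @ v = w})"
    unfolding mult_free by (rule CollectD)
  then have "{(u, v). u \<in> p \<and> v \<in> q \<and> u @ v = w} \<noteq> {}"
    by (rule contrapos_nn) (simp only: card.empty even_zero)
  then show "w \<in> (\<lambda>(u, v). u @ v) ` (p \<times> q)" by force
qed

text \<open>A word belongs to the product when it has an odd number of factorisations, so grouping
  the pairs by their concatenation leaves exactly the words of the product. Associativity and
  distributivity become rearrangements of double sums.\<close>

lemma sum_mult_free:
  fixes h :: "nat list \<Rightarrow> bit"
  assumes "finite p" "finite q"
  shows "sum h (p \<otimes>\<^bsub>FA\<^esub> q) = (\<Sum>u\<in>p. \<Sum>v\<in>q. h (u @ v))"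
proof -
  let ?A = "p \<times> q" and ?f = "\<lambda>(u, v). u @ v"
  have fin: "finite (?f ` ?A)" using assms by simp
  have "(\<Sum>u\<in>p. \<Sum>v\<in>q. h (u @ v)) = (\<Sum>z\<in>?A. h (?f z))"
    by (simp add: sum.cartesian_product case_prod_unfold)
  also have "\<dots> = (\<Sum>w\<in>?f ` ?A. \<Sum>z\<in>{z\<in>?A. ?f z = w}. h (?f z))"
    using assms by (intro sum.image_gen) simp
  also have "\<dots> = (\<Sum>w\<in>?f ` ?A. of_bool (w \<in> p \<otimes>\<^bsub>FA\<^esub> q) * h w)"
  proof (rule sum.cong[OF refl])
    fix w
    have eq: "{z\<in>?A. ?f z = w} = {(u, v). u \<in> p \<and> v \<in> q \<and> u @ v = w}" by auto
    have "(\<Sum>z\<in>{z\<in>?A. ?f z = w}. h (?f z)) = (\<Sum>z\<in>{z\<in>?A. ?f z = w}. h w)"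
      by (rule sum.cong) auto
    also have "\<dots> = of_nat (card {z\<in>?A. ?f z = w}) * h w" by simp
    finally show "(\<Sum>z\<in>{z\<in>?A. ?f z = w}. h (?f z)) = of_bool (w \<in> p \<otimes>\<^bsub>FA\<^esub> q) * h w"
      by (simp add: eq mult_free of_nat_bit)
  qed
  also have "\<dots> = (\<Sum>w\<in>p \<otimes>\<^bsub>FA\<^esub> q. of_bool (w \<in> p \<otimes>\<^bsub>FA\<^esub> q) * h w)"
    by (rule sum.mono_neutral_right[OF fin mult_free_subset]) auto
  also have "\<dots> = sum h (p \<otimes>\<^bsub>FA\<^esub> q)" by (rule sum.cong) auto
  finally show ?thesis by simp
qed

lemma finite_mult_free: "finite p \<Longrightarrow> finite q \<Longrightarrow> finite (p \<otimes>\<^bsub>FA\<^esub> q)"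
  by (rule finite_subset[OF mult_free_subset]) simp

lemma mult_free_closed: "p \<in> carrier FA \<Longrightarrow> q \<in> carrier FA \<Longrightarrow> p \<otimes>\<^bsub>FA\<^esub> q \<in> carrier FA"
  using mult_free_subset[of p q] finite_mult_free[of p q] by (fastforce simp: carrier_free)

lemma add_free_closed: "p \<in> carrier FA \<Longrightarrow> q \<in> carrier FA \<Longrightarrow> p \<oplus>\<^bsub>FA\<^esub> q \<in> carrier FA"
  by (auto simp: carrier_free add_free)

lemma sum_add_free:
  fixes h :: "nat list \<Rightarrow> bit"
  shows "finite p \<Longrightarrow> finite q \<Longrightarrow> sum h (p \<oplus>\<^bsub>FA\<^esub> q) = sum h p + sum h q"
  by (simp add: add_free sum_symdiff)

lemma finite_free: "p \<in> carrier FA \<Longrightarrow> finite p"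
  by (simp add: carrier_free)

lemma ring_free: "ring FA"
proof (rule ringI)
  show "abelian_group FA"
  proof (rule abelian_groupI)
    fix x y z assume "x \<in> carrier FA" "y \<in> carrier FA" "z \<in> carrier FA"
    show "(x \<oplus>\<^bsub>FA\<^esub> y) \<oplus>\<^bsub>FA\<^esub> z = x \<oplus>\<^bsub>FA\<^esub> (y \<oplus>\<^bsub>FA\<^esub> z)" by (auto simp: add_free)
  next
    fix x assume "x \<in> carrier FA"
    then show "\<exists>y\<in>carrier FA. y \<oplus>\<^bsub>FA\<^esub> x = \<zero>\<^bsub>FA\<^esub>"
      by (intro bexI[of _ x]) (auto simp: add_free zero_free)
  qed (auto simp: add_free_closed, auto simp: add_free zero_free carrier_free)
  show "Group.monoid FA"
  proof (rule monoidI)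
    fix x y z assume c: "x \<in> carrier FA" "y \<in> carrier FA" "z \<in> carrier FA"
    show "(x \<otimes>\<^bsub>FA\<^esub> y) \<otimes>\<^bsub>FA\<^esub> z = x \<otimes>\<^bsub>FA\<^esub> (y \<otimes>\<^bsub>FA\<^esub> z)"
      by (rule set_eq_if_sum_eq)
        (simp_all add: sum_mult_free finite_mult_free finite_free c)
  next
    fix x assume c: "x \<in> carrier FA"
    have 1: "finite (\<one>\<^bsub>FA\<^esub>)" by (simp add: one_free)
    have "sum h (\<one>\<^bsub>FA\<^esub> \<otimes>\<^bsub>FA\<^esub> x) = sum h x" "sum h (x \<otimes>\<^bsub>FA\<^esub> \<one>\<^bsub>FA\<^esub>) = sum h x" for h :: "nat list \<Rightarrow> bit"
      unfolding sum_mult_free[OF 1 finite_free[OF c]] sum_mult_free[OF finite_free[OF c] 1]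
      by (simp_all only: one_free sum_singleton append_Nil append_Nil2)
    note * = this
    show "\<one>\<^bsub>FA\<^esub> \<otimes>\<^bsub>FA\<^esub> x = x"
      by (intro set_eq_if_sum_eq finite_mult_free finite_free 1 c *)
    show "x \<otimes>\<^bsub>FA\<^esub> \<one>\<^bsub>FA\<^esub> = x"
      by (intro set_eq_if_sum_eq finite_mult_free finite_free 1 c *)
  qed (auto simp: mult_free_closed, auto simp: one_free carrier_free)
  fix x y z assume c: "x \<in> carrier FA" "y \<in> carrier FA" "z \<in> carrier FA"
  have f: "finite (p \<oplus>\<^bsub>FA\<^esub> q)" if "finite p" "finite q" for p q using that by (simp add: add_free)
  show "(x \<oplus>\<^bsub>FA\<^esub> y) \<otimes>\<^bsub>FA\<^esub> z = x \<otimes>\<^bsub>FA\<^esub> z \<oplus>\<^bsub>FA\<^esub> y \<otimes>\<^bsub>FA\<^esub> z"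
    by (rule set_eq_if_sum_eq)
      (simp_all add: sum_mult_free sum_add_free finite_mult_free f finite_free c)
  show "z \<otimes>\<^bsub>FA\<^esub> (x \<oplus>\<^bsub>FA\<^esub> y) = z \<otimes>\<^bsub>FA\<^esub> x \<oplus>\<^bsub>FA\<^esub> z \<otimes>\<^bsub>FA\<^esub> y"
    by (rule set_eq_if_sum_eq)
      (simp_all add: sum_mult_free sum_add_free finite_mult_free f finite_free c sum.distrib)
qed

interpretation FA: ring FA by (rule ring_free)

lemma self_add_free: "p \<in> carrier FA \<Longrightarrow> p \<oplus>\<^bsub>FA\<^esub> p = \<zero>\<^bsub>FA\<^esub>"
  by (simp add: add_free zero_free)

lemma minus_free: "p \<in> carrier FA \<Longrightarrow> q \<in> carrier FA \<Longrightarrow> p \<ominus>\<^bsub>FA\<^esub> q = p \<oplus>\<^bsub>FA\<^esub> q"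
  using FA.minus_equality[OF self_add_free] by (simp add: FA.minus_eq)

lemma free_Sq_closed [simp]: "free_Sq k \<in> carrier FA"
  by (simp add: free_Sq_def carrier_free)

lemma finsum_free_homogeneous:
  assumes "finite J" "\<And>j. j \<in> J \<Longrightarrow> t j \<in> carrier FA"
    "\<And>j. j \<in> J \<Longrightarrow> \<forall>w\<in>t j. sum_list w = k"
  shows "\<forall>w\<in>finsum FA t J. sum_list w = k"
  using assms
proof (induction J rule: finite_induct)
  case (insert j J)
  then have "finsum FA t (insert j J) = t j \<oplus>\<^bsub>FA\<^esub> finsum FA t J"
    by (intro FA.finsum_insert) auto
  with insert show ?case by (auto simp: add_free)
qed (simp add: zero_free)

lemma mult_free_homogeneous:
  assumes "\<forall>w\<in>p. sum_list w = k" "\<forall>w\<in>q. sum_list w = l"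
  shows "\<forall>w\<in>p \<otimes>\<^bsub>FA\<^esub> q. sum_list w = k + l"
  using mult_free_subset[of p q] assms by fastforce

lemma free_Sq_homogeneous: "\<forall>w\<in>free_Sq k. sum_list w = k"
  by (simp add: free_Sq_def)

section \<open>The Adem ideal and the homogeneous elements of the quotient\<close>

definition Adem_term :: "nat \<Rightarrow> nat \<Rightarrow> nat \<Rightarrow> nat list set" where
  "Adem_term a b j = (if odd ((b - 1 - j) choose (a - 2 * j))
       then free_Sq (a + b - j) \<otimes>\<^bsub>FA\<^esub> free_Sq j else \<zero>\<^bsub>FA\<^esub>)"

lemma Adem_term_closed [simp]: "Adem_term a b j \<in> carrier FA"
  by (simp add: Adem_term_def)

lemma Adem_relation_eq:
  "Adem_relation a b = free_Sq a \<otimes>\<^bsub>FA\<^esub> free_Sq b \<oplus>\<^bsub>FA\<^esub> finsum FA (Adem_term a b) {0..a div 2}"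
  unfolding Adem_relation_def Adem_term_def[symmetric] by (rule minus_free) (simp_all add: FA.finsum_closed)

lemma Adem_relation_closed [simp]: "Adem_relation a b \<in> carrier FA"
  by (simp add: Adem_relation_eq FA.finsum_closed)

lemma Adem_ideal: "ideal Adem_ideal FA"
  unfolding Adem_ideal_def by (rule FA.genideal_ideal) auto

lemma Adem_subgroup: "abelian_subgroup Adem_ideal FA"
  by (rule abelian_subgroupI3[OF ideal.axioms(1)[OF Adem_ideal] FA.is_abelian_group])

lemma Adem_relation_mem: "0 < a \<Longrightarrow> a < 2 * b \<Longrightarrow> Adem_relation a b \<in> Adem_ideal"
  unfolding Adem_ideal_def by (rule subsetD[OF FA.genideal_self]) auto

text \<open>Facts about all elements of the Adem ideal are obtained by exhibiting an ideal that
  contains the relations: below the words of positive length, later the annihilator of the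
  polynomial model.\<close>

lemma Adem_ideal_least:
  assumes "ideal I FA" "\<And>a b. 0 < a \<Longrightarrow> a < 2 * b \<Longrightarrow> Adem_relation a b \<in> I"
  shows "Adem_ideal \<subseteq> I"
  unfolding Adem_ideal_def by (rule FA.genideal_minimal[OF assms(1)]) (use assms(2) in auto)

abbreviation St :: "nat list set \<Rightarrow> nat list set set" where
  "St p \<equiv> Adem_ideal +>\<^bsub>FA\<^esub> p"

lemma St_ops:
  assumes "p \<in> carrier FA" "q \<in> carrier FA"
  shows "St p \<otimes>\<^bsub>Steenrod\<^esub> St q = St (p \<otimes>\<^bsub>FA\<^esub> q)"
    and "St p \<oplus>\<^bsub>Steenrod\<^esub> St q = St (p \<oplus>\<^bsub>FA\<^esub> q)"
  using assms by (simp_all add: Steenrod_def FactRing_def ideal.rcoset_mult_add[OF Adem_ideal] abelian_subgroup.a_rcos_sum[OF Adem_subgroup])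

lemma Steenrod_one: "\<one>\<^bsub>Steenrod\<^esub> = St {[]}"
  by (simp add: Steenrod_def FactRing_def one_free)

lemma St_eq_iff:
  assumes "p \<in> carrier FA" "q \<in> carrier FA"
  shows "St p = St q \<longleftrightarrow> p \<oplus>\<^bsub>FA\<^esub> q \<in> Adem_ideal"
  using ring.quotient_eq_iff_same_a_r_cos[OF ring_free Adem_ideal assms] minus_free[OF assms] by simp

lemma Steenrod_zero: "\<zero>\<^bsub>Steenrod\<^esub> = St {}"
  using abelian_subgroup.a_rcos_const[OF Adem_subgroup, of "\<zero>\<^bsub>FA\<^esub>"]
    additive_subgroup.zero_closed[OF ideal.axioms(1)[OF Adem_ideal]]
  unfolding Steenrod_def FactRing_def by (simp only: zero_free ring.simps)

lemma Steenrod_degI: "p \<in> carrier FA \<Longrightarrow> \<forall>w\<in>p. sum_list w = k \<Longrightarrow> St p \<in> Steenrod_deg k"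
  unfolding Steenrod_deg_def by blast

lemma Steenrod_degE:
  assumes "r \<in> Steenrod_deg k"
  obtains p where "p \<in> carrier FA" "\<forall>w\<in>p. sum_list w = k" "r = St p"
  using assms unfolding Steenrod_deg_def by blast

lemma Steenrod_deg_zero [simp]: "\<zero>\<^bsub>Steenrod\<^esub> \<in> Steenrod_deg k"
  unfolding Steenrod_zero by (rule Steenrod_degI) (auto simp: carrier_free)

lemma Steenrod_deg_one [simp]: "\<one>\<^bsub>Steenrod\<^esub> \<in> Steenrod_deg 0"
  unfolding Steenrod_one by (rule Steenrod_degI) (auto simp: carrier_free)

lemma Steenrod_deg_add [simp]:
  assumes "r \<in> Steenrod_deg k" "s \<in> Steenrod_deg k"
  shows "r \<oplus>\<^bsub>Steenrod\<^esub> s \<in> Steenrod_deg k"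
proof -
  obtain p where p: "p \<in> carrier FA" "\<forall>w\<in>p. sum_list w = k" "r = St p"
    by (rule Steenrod_degE[OF assms(1)])
  obtain q where q: "q \<in> carrier FA" "\<forall>w\<in>q. sum_list w = k" "s = St q"
    by (rule Steenrod_degE[OF assms(2)])
  have "\<forall>w\<in>p \<oplus>\<^bsub>FA\<^esub> q. sum_list w = k" using p(2) q(2) by (auto simp: add_free)
  then show ?thesis unfolding p(3) q(3) St_ops(2)[OF p(1) q(1)]
    by (rule Steenrod_degI[OF add_free_closed[OF p(1) q(1)]])
qed

lemma Steenrod_deg_mult:
  assumes "r \<in> Steenrod_deg k" "s \<in> Steenrod_deg l"
  shows "r \<otimes>\<^bsub>Steenrod\<^esub> s \<in> Steenrod_deg (k + l)"
proof -
  obtain p where p: "p \<in> carrier FA" "\<forall>w\<in>p. sum_list w = k" "r = St p"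
    by (rule Steenrod_degE[OF assms(1)])
  obtain q where q: "q \<in> carrier FA" "\<forall>w\<in>q. sum_list w = l" "s = St q"
    by (rule Steenrod_degE[OF assms(2)])
  show ?thesis unfolding p(3) q(3) St_ops(1)[OF p(1) q(1)]
    by (rule Steenrod_degI[OF mult_free_closed[OF p(1) q(1)] mult_free_homogeneous[OF p(2) q(2)]])
qed

lemma Sq_deg [simp]: "Sq k \<in> Steenrod_deg k"
  unfolding Sq_def by (rule Steenrod_degI) (auto simp: free_Sq_homogeneous)

lemma Sq_0: "Sq 0 = \<one>\<^bsub>Steenrod\<^esub>"
  by (simp add: Sq_def free_Sq_def Steenrod_one)

lemma Steenrod_self_add:
  assumes "r \<in> Steenrod_deg k"
  shows "r \<oplus>\<^bsub>Steenrod\<^esub> r = \<zero>\<^bsub>Steenrod\<^esub>"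
proof -
  obtain p where p: "p \<in> carrier FA" "r = St p" by (rule Steenrod_degE[OF assms])
  show ?thesis
    unfolding p(2) St_ops(2)[OF p(1) p(1)] self_add_free[OF p(1)] Steenrod_zero zero_free ..
qed

lemma Steenrod_add_zero:
  assumes "r \<in> Steenrod_deg k"
  shows "r \<oplus>\<^bsub>Steenrod\<^esub> \<zero>\<^bsub>Steenrod\<^esub> = r" "\<zero>\<^bsub>Steenrod\<^esub> \<oplus>\<^bsub>Steenrod\<^esub> r = r"
proof -
  obtain p where p: "p \<in> carrier FA" "r = St p" using Steenrod_degE[OF assms] by blast
  have "{} \<in> carrier FA" by (simp add: carrier_free)
  then show "r \<oplus>\<^bsub>Steenrod\<^esub> \<zero>\<^bsub>Steenrod\<^esub> = r" "\<zero>\<^bsub>Steenrod\<^esub> \<oplus>\<^bsub>Steenrod\<^esub> r = r"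
    using p by (simp_all add: Steenrod_zero St_ops add_free)
qed

lemma Steenrod_mult_one:
  assumes "r \<in> Steenrod_deg k"
  shows "r \<otimes>\<^bsub>Steenrod\<^esub> \<one>\<^bsub>Steenrod\<^esub> = r"
proof -
  obtain p where p: "p \<in> carrier FA" "r = St p" by (rule Steenrod_degE[OF assms])
  show ?thesis
    unfolding p(2) Steenrod_one one_free[symmetric] St_ops(1)[OF p(1) FA.one_closed] FA.r_one[OF p(1)] ..
qed

text \<open>The letters of a word are split off one by one.\<close>

lemma Steenrod_deg_induct [consumes 1, case_names zero one add Sq]:
  assumes r: "r \<in> Steenrod_deg k"
    and zero: "\<And>k. Q k \<zero>\<^bsub>Steenrod\<^esub>"
    and one: "Q 0 \<one>\<^bsub>Steenrod\<^esub>"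
    and add: "\<And>k r s. r \<in> Steenrod_deg k \<Longrightarrow> s \<in> Steenrod_deg k \<Longrightarrow> Q k r \<Longrightarrow> Q k s \<Longrightarrow> Q k (r \<oplus>\<^bsub>Steenrod\<^esub> s)"
    and Sq: "\<And>i l r. 0 < i \<Longrightarrow> r \<in> Steenrod_deg l \<Longrightarrow> Q l r \<Longrightarrow> Q (i + l) (Sq i \<otimes>\<^bsub>Steenrod\<^esub> r)"
  shows "Q k r"
proof -
  have word: "Q (sum_list w) (St {w})" if "0 \<notin> set w" for w
    using that
  proof (induction w)
    case Nil
    then show ?case using one by (simp add: Steenrod_one)
  next
    case (Cons i w)
    then have i: "0 < i" and w: "{w} \<in> carrier FA" by (auto simp: carrier_free)
    have "free_Sq i \<otimes>\<^bsub>FA\<^esub> {w} = {i # w}"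
      using i by (intro set_eq_if_sum_eq) (simp_all add: finite_mult_free sum_mult_free free_Sq_def)
    then have "Sq i \<otimes>\<^bsub>Steenrod\<^esub> St {w} = St {i # w}"
      using w by (simp add: Sq_def St_ops)
    moreover have "St {w} \<in> Steenrod_deg (sum_list w)" using w by (intro Steenrod_degI) auto
    ultimately show ?case using Sq[OF i, of "St {w}" "sum_list w"] Cons by simp
  qed
  obtain p where p: "p \<in> carrier FA" "\<forall>w\<in>p. sum_list w = k" "r = St p" by (rule Steenrod_degE[OF r])
  have "finite p" using p(1) by (rule finite_free)
  then have "p \<in> carrier FA \<Longrightarrow> \<forall>w\<in>p. sum_list w = k \<Longrightarrow> Q k (St p)"
  proof (induction p rule: finite_induct)
    case empty
    then show ?case using zero by (simp add: Steenrod_zero)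
  next
    case (insert w p)
    then have w: "{w} \<in> carrier FA" "p \<in> carrier FA" by (auto simp: carrier_free)
    have "insert w p = {w} \<oplus>\<^bsub>FA\<^esub> p" using insert by (auto simp: add_free)
    then have "St (insert w p) = St {w} \<oplus>\<^bsub>Steenrod\<^esub> St p" using w by (simp add: St_ops)
    moreover have "St {w} \<in> Steenrod_deg k" "St p \<in> Steenrod_deg k"
      using insert w by (auto intro!: Steenrod_degI)
    moreover have "Q k (St {w})" "Q k (St p)" using word[of w] insert w by (auto simp: carrier_free)
    ultimately show ?case using add by simp
  qed
  then show ?thesis using p by simp
qed

text \<open>Every monomial of the relation has degree \<open>a + b > 0\<close>, while the empty word
  has degree 0.\<close>

lemma Adem_relation_Nil: "0 < a \<Longrightarrow> a < 2 * b \<Longrightarrow> [] \<notin> Adem_relation a b"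
proof
  assume ab: "0 < a" "a < 2 * b" and "[] \<in> Adem_relation a b"
  moreover have "\<forall>w\<in>free_Sq a \<otimes>\<^bsub>FA\<^esub> free_Sq b. sum_list w = a + b"
    by (rule mult_free_homogeneous) (rule free_Sq_homogeneous)+
  moreover have "\<forall>w\<in>finsum FA (Adem_term a b) {0..a div 2}. sum_list w = a + b"
  proof (rule finsum_free_homogeneous)
    fix j assume "j \<in> {0..a div 2}"
    then have "\<forall>w\<in>free_Sq (a + b - j) \<otimes>\<^bsub>FA\<^esub> free_Sq j. sum_list w = a + b"
      using mult_free_homogeneous[OF free_Sq_homogeneous free_Sq_homogeneous, of "a + b - j" j] by simp
    then show "\<forall>w\<in>Adem_term a b j. sum_list w = a + b"
      by (simp add: Adem_term_def zero_free)
  qed auto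
  moreover have "[] \<in> free_Sq a \<otimes>\<^bsub>FA\<^esub> free_Sq b \<or> [] \<in> finsum FA (Adem_term a b) {0..a div 2}"
    using \<open>[] \<in> Adem_relation a b\<close> by (auto simp: Adem_relation_eq add_free)
  ultimately have "sum_list [] = a + b" by metis
  with ab show False by simp
qed

text \<open>The polynomials without constant term form a two-sided ideal that contains all Adem
  relations but not 1. The action on \<open>F2_module\<close> is defined by comparing with 1, so it
  is sound only because of this.\<close>

lemma Steenrod_zero_neq_one: "\<zero>\<^bsub>Steenrod\<^esub> \<noteq> \<one>\<^bsub>Steenrod\<^esub>"
proof -
  let ?I = "{p \<in> carrier FA. [] \<notin> p}"
  have "ideal ?I FA"
  proof (rule idealI[OF ring_free])
    show "subgroup ?I (add_monoid FA)"
    proof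
      fix x assume x: "x \<in> ?I"
      then have "inv\<^bsub>add_monoid FA\<^esub> x = x"
        using FA.minus_equality[of x x] self_add_free[of x] by (simp add: a_inv_def)
      then show "inv\<^bsub>add_monoid FA\<^esub> x \<in> ?I" using x by simp
    qed (auto simp: add_free_closed, auto simp: add_free zero_free)
  next
    fix a x assume "a \<in> ?I" "x \<in> carrier FA"
    then show "x \<otimes>\<^bsub>FA\<^esub> a \<in> ?I" "a \<otimes>\<^bsub>FA\<^esub> x \<in> ?I"
      using mult_free_subset[of x a] mult_free_subset[of a x] by auto
  qed
  then have "Adem_ideal \<subseteq> ?I"
    by (rule Adem_ideal_least) (simp add: Adem_relation_Nil)
  moreover have "{} \<oplus>\<^bsub>FA\<^esub> {[]} = {[]}" by (simp add: add_free)
  ultimately have "{} \<oplus>\<^bsub>FA\<^esub> {[]} \<notin> Adem_ideal" by auto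
  moreover have "{} \<in> carrier FA" "{[]} \<in> carrier FA" by (auto simp: carrier_free)
  ultimately show ?thesis
    unfolding Steenrod_zero Steenrod_one by (simp only: St_eq_iff not_False_eq_True)
qed

text \<open>Letters are positive, so the empty word is the only monomial of degree 0.\<close>

lemma Steenrod_deg_0:
  assumes "r \<in> Steenrod_deg 0"
  shows "r = \<zero>\<^bsub>Steenrod\<^esub> \<or> r = \<one>\<^bsub>Steenrod\<^esub>"
proof -
  obtain p where p: "p \<in> carrier FA" "\<forall>w\<in>p. sum_list w = 0" "r = St p" by (rule Steenrod_degE[OF assms])
  have "w = []" if "w \<in> p" for w using that p by (cases w) (auto simp: carrier_free)
  then have "p = {} \<or> p = {[]}" by auto
  then show ?thesis using p by (auto simp: Steenrod_zero Steenrod_one)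
qed

text \<open>Keeps countably generated modules countable, so that they have copies on
  \<open>int\<close>.\<close>

lemma countable_Steenrod_deg: "countable (Steenrod_deg k)"
proof -
  have "Steenrod_deg k \<subseteq> St ` {p. finite p}"
    unfolding Steenrod_deg_def by (auto simp: carrier_free)
  then show ?thesis
    by (rule countable_subset) (simp add: countable_Collect_finite)
qed

section \<open>Graded modules and morphisms\<close>

abbreviation "elts M n \<equiv> carrier (comp M n)"
abbreviation "pl M n \<equiv> monoid.mult (comp M n)"
abbreviation "zr M n \<equiv> one (comp M n)"
abbreviation "gm \<equiv> graded_Steenrod_module"
abbreviation "um \<equiv> unstable_module"

lemma um_gm [simp]: "um M \<Longrightarrow> gm M"
  by (simp add: unstable_module_def)

lemma gm_comm_group [simp]: "gm M \<Longrightarrow> comm_group (comp M n)"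
  by (simp add: graded_Steenrod_module_def)

lemma gm_group [simp]: "gm M \<Longrightarrow> group (comp M n)"
  using gm_comm_group[of M n] by (rule comm_group.axioms(2))

lemma gm_monoid [simp]: "gm M \<Longrightarrow> Group.monoid (comp M n)"
  using gm_group[of M n] by (rule group.is_monoid)

lemma zr_closed [simp]: "gm M \<Longrightarrow> zr M n \<in> elts M n"
  by (rule monoid.one_closed) simp

lemma pl_closed [simp]: "gm M \<Longrightarrow> x \<in> elts M n \<Longrightarrow> y \<in> elts M n \<Longrightarrow> pl M n x y \<in> elts M n"
  by (rule monoid.m_closed) simp_all

lemma pl_assoc: "gm M \<Longrightarrow> x \<in> elts M n \<Longrightarrow> y \<in> elts M n \<Longrightarrow> z \<in> elts M n \<Longrightarrow>
    pl M n (pl M n x y) z = pl M n x (pl M n y z)"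
  by (rule monoid.m_assoc) simp_all

lemma pl_comm: "gm M \<Longrightarrow> x \<in> elts M n \<Longrightarrow> y \<in> elts M n \<Longrightarrow> pl M n x y = pl M n y x"
  using comm_monoid.m_comm[OF comm_group.axioms(1)[OF gm_comm_group]] by metis

lemma pl_zr [simp]:
  "gm M \<Longrightarrow> x \<in> elts M n \<Longrightarrow> pl M n x (zr M n) = x"
  "gm M \<Longrightarrow> x \<in> elts M n \<Longrightarrow> pl M n (zr M n) x = x"
  by (simp_all add: monoid.r_one monoid.l_one)

lemma act_closed:
  assumes "gm M" "r \<in> Steenrod_deg k" "x \<in> elts M n"
  shows "act M k n r x \<in> elts M (n + k)"
  using assms unfolding graded_Steenrod_module_def hom_def by blast

lemma act_closedI [simp]:
  "gm M \<Longrightarrow> r \<in> Steenrod_deg k \<Longrightarrow> x \<in> elts M n \<Longrightarrow> m = n + k \<Longrightarrow> act M k n r x \<in> elts M m"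
  by (simp add: act_closed)

lemma act_pl:
  assumes "gm M" "r \<in> Steenrod_deg k" "x \<in> elts M n" "y \<in> elts M n"
  shows "act M k n r (pl M n x y) = pl M (n + k) (act M k n r x) (act M k n r y)"
  using assms unfolding graded_Steenrod_module_def hom_def by blast

lemma act_plus:
  assumes "gm M" "r \<in> Steenrod_deg k" "s \<in> Steenrod_deg k" "x \<in> elts M n"
  shows "act M k n (r \<oplus>\<^bsub>Steenrod\<^esub> s) x = pl M (n + k) (act M k n r x) (act M k n s x)"
  using assms unfolding graded_Steenrod_module_def by blast

lemma act_mult:
  assumes "gm M" "r \<in> Steenrod_deg k" "s \<in> Steenrod_deg l" "x \<in> elts M n"
  shows "act M (k + l) n (r \<otimes>\<^bsub>Steenrod\<^esub> s) x = act M k (n + l) r (act M l n s x)"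
  using assms unfolding graded_Steenrod_module_def by blast

lemma act_one [simp]: "gm M \<Longrightarrow> x \<in> elts M n \<Longrightarrow> act M 0 n \<one>\<^bsub>Steenrod\<^esub> x = x"
  unfolding graded_Steenrod_module_def by blast

lemma idem_zr: "gm M \<Longrightarrow> x \<in> elts M n \<Longrightarrow> pl M n x x = x \<Longrightarrow> x = zr M n"
  by (metis gm_group group.r_cancel_one)

lemma act_zero [simp]:
  assumes "gm M" "x \<in> elts M n"
  shows "act M k n \<zero>\<^bsub>Steenrod\<^esub> x = zr M (n + k)"
proof (rule idem_zr)
  show "pl M (n + k) (act M k n \<zero>\<^bsub>Steenrod\<^esub> x) (act M k n \<zero>\<^bsub>Steenrod\<^esub> x) = act M k n \<zero>\<^bsub>Steenrod\<^esub> x"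
    using act_plus[OF assms(1) Steenrod_deg_zero Steenrod_deg_zero assms(2), of k]
    by (simp add: Steenrod_self_add[OF Steenrod_deg_zero])
qed (use assms in simp_all)

lemma act_zr [simp]:
  assumes "gm M" "r \<in> Steenrod_deg k"
  shows "act M k n r (zr M n) = zr M (n + k)"
  using act_pl[OF assms zr_closed zr_closed] assms by (intro idem_zr) simp_all

lemma pl_self [simp]:
  assumes "gm M" "x \<in> elts M n"
  shows "pl M n x x = zr M n"
  using act_plus[OF assms(1) Steenrod_deg_one Steenrod_deg_one assms(2)] assms
  by (simp add: Steenrod_self_add[OF Steenrod_deg_one])

lemma pl_lcomm: "gm M \<Longrightarrow> x \<in> elts M n \<Longrightarrow> y \<in> elts M n \<Longrightarrow> z \<in> elts M n \<Longrightarrow>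
    pl M n x (pl M n y z) = pl M n y (pl M n x z)"
  by (metis pl_assoc pl_comm)

lemma pl_self_left [simp]: "gm M \<Longrightarrow> x \<in> elts M n \<Longrightarrow> y \<in> elts M n \<Longrightarrow>
    pl M n x (pl M n x y) = y"
  by (simp flip: pl_assoc)

lemmas pl_ac = pl_assoc pl_comm pl_lcomm

lemma pl_eq_zr_iff: "gm M \<Longrightarrow> x \<in> elts M n \<Longrightarrow> y \<in> elts M n \<Longrightarrow> pl M n x y = zr M n \<longleftrightarrow> x = y"
  by (metis pl_self_left pl_zr(1) pl_self)

text \<open>The condition that each element is its own inverse stands in for the existence of
  inverses; by \<open>pl_self\<close> it holds in every graded module.\<close>

lemma gmI:
  assumes "\<And>n. zr M n \<in> elts M n"
    and "\<And>n x y. x \<in> elts M n \<Longrightarrow> y \<in> elts M n \<Longrightarrow> pl M n x y \<in> elts M n"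
    and "\<And>n x y z. x \<in> elts M n \<Longrightarrow> y \<in> elts M n \<Longrightarrow> z \<in> elts M n \<Longrightarrow>
      pl M n (pl M n x y) z = pl M n x (pl M n y z)"
    and "\<And>n x y. x \<in> elts M n \<Longrightarrow> y \<in> elts M n \<Longrightarrow> pl M n x y = pl M n y x"
    and "\<And>n x. x \<in> elts M n \<Longrightarrow> pl M n (zr M n) x = x"
    and "\<And>n x. x \<in> elts M n \<Longrightarrow> pl M n x x = zr M n"
    and "\<And>k n r x. r \<in> Steenrod_deg k \<Longrightarrow> x \<in> elts M n \<Longrightarrow> act M k n r x \<in> elts M (n + k)"
    and "\<And>k n r x y. r \<in> Steenrod_deg k \<Longrightarrow> x \<in> elts M n \<Longrightarrow> y \<in> elts M n \<Longrightarrow>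
      act M k n r (pl M n x y) = pl M (n + k) (act M k n r x) (act M k n r y)"
    and "\<And>k n r s x. r \<in> Steenrod_deg k \<Longrightarrow> s \<in> Steenrod_deg k \<Longrightarrow> x \<in> elts M n \<Longrightarrow>
      act M k n (r \<oplus>\<^bsub>Steenrod\<^esub> s) x = pl M (n + k) (act M k n r x) (act M k n s x)"
    and "\<And>k l n r s x. r \<in> Steenrod_deg k \<Longrightarrow> s \<in> Steenrod_deg l \<Longrightarrow> x \<in> elts M n \<Longrightarrow>
      act M (k + l) n (r \<otimes>\<^bsub>Steenrod\<^esub> s) x = act M k (n + l) r (act M l n s x)"
    and "\<And>n x. x \<in> elts M n \<Longrightarrow> act M 0 n \<one>\<^bsub>Steenrod\<^esub> x = x"
  shows "gm M"
proof -
  have "comm_group (comp M n)" for n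
    by (rule comm_groupI) (use assms(1-6) in blast)+
  then show ?thesis
    unfolding graded_Steenrod_module_def hom_def by (simp add: Pi_iff assms(7-))
qed

lemma umI: "gm M \<Longrightarrow> (\<And>n k x. n < k \<Longrightarrow> x \<in> elts M n \<Longrightarrow> act M k n (Sq k) x = zr M (n + k)) \<Longrightarrow> um M"
  by (simp add: unstable_module_def)

lemma um_Sq: "um M \<Longrightarrow> n < k \<Longrightarrow> x \<in> elts M n \<Longrightarrow> act M k n (Sq k) x = zr M (n + k)"
  by (simp add: unstable_module_def)

text \<open>Morphisms, without the extensionality of \<^const>\<open>Hom_U\<close>.\<close>

definition mor :: "'a gmod \<Rightarrow> 'b gmod \<Rightarrow> (nat \<Rightarrow> 'a \<Rightarrow> 'b) \<Rightarrow> bool" where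
  "mor M N f \<longleftrightarrow> (\<forall>n. \<forall>x\<in>elts M n. f n x \<in> elts N n) \<and>
    (\<forall>n. \<forall>x\<in>elts M n. \<forall>y\<in>elts M n. f n (pl M n x y) = pl N n (f n x) (f n y)) \<and>
    (\<forall>k n. \<forall>r\<in>Steenrod_deg k. \<forall>x\<in>elts M n. f (n + k) (act M k n r x) = act N k n r (f n x))"

lemma morI:
  assumes "\<And>n x. x \<in> elts M n \<Longrightarrow> f n x \<in> elts N n"
    and "\<And>n x y. x \<in> elts M n \<Longrightarrow> y \<in> elts M n \<Longrightarrow> f n (pl M n x y) = pl N n (f n x) (f n y)"
    and "\<And>k n r x. r \<in> Steenrod_deg k \<Longrightarrow> x \<in> elts M n \<Longrightarrow>
      f (n + k) (act M k n r x) = act N k n r (f n x)"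
  shows "mor M N f"
  using assms unfolding mor_def by blast

lemma mor_closed [simp]: "mor M N f \<Longrightarrow> x \<in> elts M n \<Longrightarrow> f n x \<in> elts N n"
  and mor_pl: "mor M N f \<Longrightarrow> x \<in> elts M n \<Longrightarrow> y \<in> elts M n \<Longrightarrow>
    f n (pl M n x y) = pl N n (f n x) (f n y)"
  and mor_act: "mor M N f \<Longrightarrow> r \<in> Steenrod_deg k \<Longrightarrow> x \<in> elts M n \<Longrightarrow>
      f (n + k) (act M k n r x) = act N k n r (f n x)"
  unfolding mor_def by blast+

lemma mor_zr: "gm M \<Longrightarrow> gm N \<Longrightarrow> mor M N f \<Longrightarrow> f n (zr M n) = zr N n"
  using mor_pl[of M N f "zr M n" n "zr M n"] by (intro idem_zr) simp_all

lemma mor_comp: "mor M N f \<Longrightarrow> mor N K g \<Longrightarrow> mor M K (\<lambda>n x. g n (f n x))"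
  by (intro morI) (simp_all add: mor_pl mor_act)

lemma mor_id: "mor M M (\<lambda>n x. x)"
  by (intro morI) simp_all

lemma mor_add:
  assumes "gm N" "mor M N f" "mor M N g"
  shows "mor M N (\<lambda>n x. pl N n (f n x) (g n x))"
  using assms by (intro morI) (simp_all add: mor_pl mor_act act_pl pl_ac)

lemma mor_zero: "gm N \<Longrightarrow> mor M N (\<lambda>n x. zr N n)"
  by (intro morI) simp_all

lemma mor_cong:
  assumes "gm M" "mor M N f" "\<And>n x. x \<in> elts M n \<Longrightarrow> g n x = f n x"
  shows "mor M N g"
  using assms by (intro morI) (simp_all add: mor_pl mor_act)

text \<open>The squares generate the Steenrod algebra, and compatibility passes to sums and
  products. Preservation of zero, needed for the sums, follows from additivity.\<close>

lemma mor_SqI: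
  assumes M: "gm M" and N: "gm N"
    and cl: "\<And>n x. x \<in> elts M n \<Longrightarrow> f n x \<in> elts N n"
    and pl: "\<And>n x y. x \<in> elts M n \<Longrightarrow> y \<in> elts M n \<Longrightarrow> f n (pl M n x y) = pl N n (f n x) (f n y)"
    and Sq: "\<And>k n x. 0 < k \<Longrightarrow> x \<in> elts M n \<Longrightarrow> f (n + k) (act M k n (Sq k) x) = act N k n (Sq k) (f n x)"
  shows "mor M N f"
proof (rule morI[OF cl pl])
  have zr: "f n (zr M n) = zr N n" for n
    using M N cl[of "zr M n" n] pl[of "zr M n" n "zr M n"] by (intro idem_zr) simp_all
  fix k n r x assume "r \<in> Steenrod_deg k" and x: "x \<in> elts M n"
  then show "f (n + k) (act M k n r x) = act N k n r (f n x)"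
  proof (induction rule: Steenrod_deg_induct)
    case (Sq i l r)
    have "f (n + (i + l)) (act M (i + l) n (Sq i \<otimes>\<^bsub>Steenrod\<^esub> r) x)
        = f (n + l + i) (act M i (n + l) (Sq i) (act M l n r x))"
      using Sq M x by (simp add: act_mult add_ac)
    also have "\<dots> = act N (i + l) n (Sq i \<otimes>\<^bsub>Steenrod\<^esub> r) (f n x)"
      using Sq M N x assms(5)[of i "act M l n r x" "n + l"] by (simp add: act_mult cl)
    finally show ?case .
  qed (use M N in \<open>simp_all add: zr cl pl act_plus\<close>)
qed

section \<open>Submodules, quotients and products\<close>

definition submod :: "'a gmod \<Rightarrow> (nat \<Rightarrow> 'a set) \<Rightarrow> bool" where
  "submod M A \<longleftrightarrow> (\<forall>n. A n \<subseteq> elts M n) \<and> (\<forall>n. zr M n \<in> A n) \<and>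
    (\<forall>n. \<forall>x\<in>A n. \<forall>y\<in>A n. pl M n x y \<in> A n) \<and>
    (\<forall>k n. \<forall>r\<in>Steenrod_deg k. \<forall>x\<in>A n. act M k n r x \<in> A (n + k))"

lemma submodI:
  assumes "\<And>n x. x \<in> A n \<Longrightarrow> x \<in> elts M n" "\<And>n. zr M n \<in> A n"
    "\<And>n x y. x \<in> A n \<Longrightarrow> y \<in> A n \<Longrightarrow> pl M n x y \<in> A n"
    "\<And>k n r x. r \<in> Steenrod_deg k \<Longrightarrow> x \<in> A n \<Longrightarrow> act M k n r x \<in> A (n + k)"
  shows "submod M A"
  using assms unfolding submod_def by blast

lemma submodD:
  assumes "submod M A"
  shows "x \<in> A n \<Longrightarrow> x \<in> elts M n" "zr M n \<in> A n" "x \<in> A n \<Longrightarrow> y \<in> A n \<Longrightarrow> pl M n x y \<in> A n"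
    "r \<in> Steenrod_deg k \<Longrightarrow> x \<in> A n \<Longrightarrow> act M k n r x \<in> A (n + k)"
  using assms unfolding submod_def by blast+

text \<open>Again because the squares generate the algebra.\<close>

lemma submod_SqI:
  assumes M: "gm M" and A: "\<And>n x. x \<in> A n \<Longrightarrow> x \<in> elts M n" "\<And>n. zr M n \<in> A n"
    "\<And>n x y. x \<in> A n \<Longrightarrow> y \<in> A n \<Longrightarrow> pl M n x y \<in> A n"
    and Sq: "\<And>k n x. 0 < k \<Longrightarrow> x \<in> A n \<Longrightarrow> act M k n (Sq k) x \<in> A (n + k)"
  shows "submod M A"
proof (rule submodI[OF A])
  fix k n r x assume "r \<in> Steenrod_deg k" and x: "x \<in> A n"
  then show "act M k n r x \<in> A (n + k)"
  proof (induction rule: Steenrod_deg_induct)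
    case (Sq i l r)
    have "act M (i + l) n (Sq i \<otimes>\<^bsub>Steenrod\<^esub> r) x = act M i (n + l) (Sq i) (act M l n r x)"
      using Sq M x A(1) by (simp add: act_mult)
    then show ?case using Sq assms(5)[of i "act M l n r x" "n + l"] x by (simp add: add_ac)
  qed (use M A x in \<open>simp_all add: act_plus\<close>)
qed

definition sub_gmod :: "'a gmod \<Rightarrow> (nat \<Rightarrow> 'a set) \<Rightarrow> 'a gmod" where
  "sub_gmod M A = \<lparr>comp = (\<lambda>n. (comp M n)\<lparr>carrier := A n\<rparr>), act = act M\<rparr>"

lemma sub_gmod_simps [simp]:
  "elts (sub_gmod M A) n = A n" "pl (sub_gmod M A) n = pl M n"
  "zr (sub_gmod M A) n = zr M n" "act (sub_gmod M A) = act M"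
  by (simp_all add: sub_gmod_def)

lemma gm_sub:
  assumes "gm M" "submod M A"
  shows "gm (sub_gmod M A)"
  using assms(1) submodD[OF assms(2)]
  by (intro gmI) (simp_all add: act_pl act_plus act_mult, simp_all add: pl_ac)

lemma um_sub:
  assumes "um M" "submod M A"
  shows "um (sub_gmod M A)"
  using assms submodD[OF assms(2)] by (intro umI) (simp_all add: gm_sub um_Sq)

lemma mor_sub_incl: "submod M A \<Longrightarrow> mor (sub_gmod M A) M (\<lambda>n x. x)"
  by (intro morI) (auto dest: submodD)

lemma mor_into_sub: "mor M N f \<Longrightarrow> (\<And>n x. x \<in> elts M n \<Longrightarrow> f n x \<in> A n) \<Longrightarrow> mor M (sub_gmod N A) f"
  by (intro morI) (simp_all add: mor_pl mor_act)

lemma submod_image: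
  assumes "gm M" "gm N" "mor M N f"
  shows "submod N (\<lambda>n. f n ` elts M n)"
proof (rule submodI)
  fix n show "zr N n \<in> f n ` elts M n"
    using assms mor_zr[of M N f n] by (metis imageI zr_closed)
next
  fix n x y assume "x \<in> f n ` elts M n" "y \<in> f n ` elts M n"
  then show "pl N n x y \<in> f n ` elts M n"
    using assms by (auto simp flip: mor_pl)
next
  fix k n r x assume "r \<in> Steenrod_deg k" "x \<in> f n ` elts M n"
  then show "act N k n r x \<in> f (n + k) ` elts M (n + k)"
    using assms by (auto simp flip: mor_act)
qed (use assms in auto)

lemma submod_kernel:
  assumes "gm M" "gm N" "mor M N f"
  shows "submod M (\<lambda>n. {x \<in> elts M n. f n x = zr N n})"
  using assms by (intro submodI) (auto simp: mor_zr mor_pl mor_act)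

text \<open>
  The structure carried over along maps \<open>h n\<close> with sections \<open>k n\<close>. It yields isomorphic copies on
  another type as well as quotients, whose elements are chosen representatives of the cosets.
\<close>

definition img_gmod :: "(nat \<Rightarrow> 'a \<Rightarrow> 'b) \<Rightarrow> (nat \<Rightarrow> 'b \<Rightarrow> 'a) \<Rightarrow> 'a gmod \<Rightarrow> 'b gmod" where
  "img_gmod h k M =
    \<lparr>comp = (\<lambda>n. \<lparr>carrier = h n ` elts M n, monoid.mult = (\<lambda>x y. h n (pl M n (k n x) (k n y))),
        one = h n (zr M n)\<rparr>),
     act = (\<lambda>j n r x. h (n + j) (act M j n r (k n x)))\<rparr>"

lemma img_gmod_simps [simp]:
  "elts (img_gmod h k M) n = h n ` elts M n"
  "pl (img_gmod h k M) n x y = h n (pl M n (k n x) (k n y))"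
  "zr (img_gmod h k M) n = h n (zr M n)"
  "act (img_gmod h k M) j n r x = h (n + j) (act M j n r (k n x))"
  by (simp_all add: img_gmod_def)

text \<open>The last two assumptions say that the fibres of \<open>h n\<close> form a congruence, so
  that the structure on the image does not depend on which element of a fibre \<open>k n\<close>
  returns.\<close>

locale img_data =
  fixes M :: "'a gmod" and h :: "nat \<Rightarrow> 'a \<Rightarrow> 'b" and k :: "nat \<Rightarrow> 'b \<Rightarrow> 'a"
  assumes M: "gm M"
    and k_closed: "\<And>n x. x \<in> elts M n \<Longrightarrow> k n (h n x) \<in> elts M n"
    and hkh: "\<And>n x. x \<in> elts M n \<Longrightarrow> h n (k n (h n x)) = h n x"
    and h_pl: "\<And>n x x' y y'. x \<in> elts M n \<Longrightarrow> x' \<in> elts M n \<Longrightarrow> y \<in> elts M n \<Longrightarrow> y' \<in> elts M n \<Longrightarrow>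
      h n x = h n x' \<Longrightarrow> h n y = h n y' \<Longrightarrow> h n (pl M n x y) = h n (pl M n x' y')"
    and h_act: "\<And>j n r x x'. r \<in> Steenrod_deg j \<Longrightarrow> x \<in> elts M n \<Longrightarrow> x' \<in> elts M n \<Longrightarrow>
      h n x = h n x' \<Longrightarrow> h (n + j) (act M j n r x) = h (n + j) (act M j n r x')"
begin

lemma img_pl: "x \<in> elts M n \<Longrightarrow> y \<in> elts M n \<Longrightarrow>
    pl (img_gmod h k M) n (h n x) (h n y) = h n (pl M n x y)"
  unfolding img_gmod_simps by (rule h_pl) (simp_all add: k_closed hkh)

lemma img_act: "r \<in> Steenrod_deg j \<Longrightarrow> x \<in> elts M n \<Longrightarrow>
    act (img_gmod h k M) j n r (h n x) = h (n + j) (act M j n r x)"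
  unfolding img_gmod_simps by (rule h_act) (simp_all add: k_closed hkh)

lemma gm_img: "gm (img_gmod h k M)"
proof -
  note simps = img_pl img_act img_gmod_simps(1,3) M
  note [simp del] = img_gmod_simps
  show ?thesis
  proof (rule gmI)
    fix j l n r s x
    assume rs: "r \<in> Steenrod_deg j" "s \<in> Steenrod_deg l" "x \<in> elts (img_gmod h k M) n"
    then obtain y where y: "y \<in> elts M n" "x = h n y" by (auto simp: simps)
    have "act (img_gmod h k M) (j + l) n (r \<otimes>\<^bsub>Steenrod\<^esub> s) x
        = h (n + (j + l)) (act M j (n + l) r (act M l n s y))"
      unfolding y(2) img_act[OF Steenrod_deg_mult[OF rs(1,2)] y(1)] by (simp add: act_mult M rs y)
    also have "\<dots> = act (img_gmod h k M) j (n + l) r (h (n + l) (act M l n s y))"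
      using rs y M by (simp add: img_act add_ac)
    also have "\<dots> = act (img_gmod h k M) j (n + l) r (act (img_gmod h k M) l n s x)"
      using rs y by (simp add: img_act)
    finally show "act (img_gmod h k M) (j + l) n (r \<otimes>\<^bsub>Steenrod\<^esub> s) x
        = act (img_gmod h k M) j (n + l) r (act (img_gmod h k M) l n s x)" .
  qed (auto simp: simps act_pl act_plus pl_assoc simp flip: img_gmod_simps(3), auto simp: simps pl_comm)
qed

lemma mor_img: "mor M (img_gmod h k M) h"
  by (intro morI) (simp_all add: img_pl img_act del: img_gmod_simps(2-4))

lemma um_img:
  assumes "\<And>n j x. n < j \<Longrightarrow> x \<in> elts M n \<Longrightarrow> h (n + j) (act M j n (Sq j) x) = h (n + j) (zr M (n + j))"
  shows "um (img_gmod h k M)"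
proof (rule umI[OF gm_img])
  fix n j x assume "n < j" "x \<in> elts (img_gmod h k M) n"
  then obtain y where "n < j" "y \<in> elts M n" "x = h n y" by auto
  then show "act (img_gmod h k M) j n (Sq j) x = zr (img_gmod h k M) (n + j)"
    by (simp add: img_act assms del: img_gmod_simps(4))
qed

end

definition copy_gmod :: "(nat \<Rightarrow> 'a \<Rightarrow> 'b) \<Rightarrow> 'a gmod \<Rightarrow> 'b gmod" where
  "copy_gmod h M = img_gmod h (\<lambda>n. inv_into (elts M n) (h n)) M"

lemma copy_gmod:
  assumes M: "um M" and inj: "\<And>n. inj_on (h n) (elts M n)"
  shows "um (copy_gmod h M)" "mor M (copy_gmod h M) h" "elts (copy_gmod h M) n = h n ` elts M n"
    "mor (copy_gmod h M) M (\<lambda>n. inv_into (elts M n) (h n))"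
proof -
  let ?k = "\<lambda>n. inv_into (elts M n) (h n)"
  have inv [simp]: "x \<in> elts M n \<Longrightarrow> ?k n (h n x) = x" for n x
    using inj by (simp add: inv_into_f_f)
  have [simp]: "x \<in> elts M n \<Longrightarrow> y \<in> elts M n \<Longrightarrow> h n x = h n y \<longleftrightarrow> x = y" for n x y
    using inj by (auto dest: inj_onD)
  interpret img_data M h ?k
    using M by unfold_locales simp_all
  show "um (copy_gmod h M)" "mor M (copy_gmod h M) h"
    unfolding copy_gmod_def by (rule um_img, simp add: um_Sq[OF assms(1)]) (rule mor_img)
  show "elts (copy_gmod h M) n = h n ` elts M n" by (simp add: copy_gmod_def)
  show "mor (copy_gmod h M) M ?k"
    unfolding copy_gmod_def using M by (intro morI) auto
qed

section \<open>Products of unstable modules\<close>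

definition prod_gmod :: "'i set \<Rightarrow> ('i \<Rightarrow> 'a gmod) \<Rightarrow> ('i \<Rightarrow> 'a) gmod" where
  "prod_gmod I N =
    \<lparr>comp = (\<lambda>n. \<lparr>carrier = (\<Pi>\<^sub>E i\<in>I. elts (N i) n),
        monoid.mult = (\<lambda>x y. \<lambda>i\<in>I. pl (N i) n (x i) (y i)), one = (\<lambda>i\<in>I. zr (N i) n)\<rparr>),
     act = (\<lambda>k n r x. \<lambda>i\<in>I. act (N i) k n r (x i))\<rparr>"

lemma prod_gmod_simps [simp]:
  "elts (prod_gmod I N) n = (\<Pi>\<^sub>E i\<in>I. elts (N i) n)"
  "pl (prod_gmod I N) n x y = (\<lambda>i\<in>I. pl (N i) n (x i) (y i))"
  "zr (prod_gmod I N) n = (\<lambda>i\<in>I. zr (N i) n)"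
  "act (prod_gmod I N) k n r x = (\<lambda>i\<in>I. act (N i) k n r (x i))"
  by (simp_all add: prod_gmod_def)

lemma um_prod:
  assumes "\<And>i. i \<in> I \<Longrightarrow> um (N i)"
  shows "um (prod_gmod I N)"
proof -
  have "gm (prod_gmod I N)"
    by (rule gmI)
      (auto simp: assms PiE_iff act_pl act_plus act_mult pl_assoc act_closed intro!: restrict_ext,
       auto simp: assms PiE_iff pl_comm intro!: extensionalityI[of _ I])
  then show ?thesis
    using assms by (intro umI) (auto simp: um_Sq PiE_iff intro!: restrict_ext)
qed

lemma mor_proj: "i \<in> I \<Longrightarrow> mor (prod_gmod I N) (N i) (\<lambda>n x. x i)"
  by (intro morI) auto

section \<open>Suspension\<close>

lemma suspension_simps [simp]:
  "elts (suspension M) 0 = {zr M 0}" "zr (suspension M) 0 = zr M 0"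
  "pl (suspension M) 0 x y = zr M 0"
  "comp (suspension M) (Suc m) = comp M m"
  "act (suspension M) k (Suc m) = act M k m"
  by (simp_all add: suspension_def singleton_group_def fun_eq_iff)

lemma act_suspension_0 [simp]: "act (suspension M) k 0 r x = zr (suspension M) k"
  by (cases k) (simp_all add: suspension_def singleton_group_def)

lemma gm_suspension [simp]:
  assumes "gm M"
  shows "gm (suspension M)"
proof (rule gmI)
  show "zr (suspension M) n \<in> elts (suspension M) n" for n
    using assms by (cases n) auto
  note zc = this
  fix k l n r s x assume rs: "r \<in> Steenrod_deg k" "s \<in> Steenrod_deg l" "x \<in> elts (suspension M) n"
  have "act (suspension M) k l r (zr (suspension M) l) = zr (suspension M) (k + l)"
    using assms rs by (cases l) (simp_all add: add_ac)
  then show "act (suspension M) (k + l) n (r \<otimes>\<^bsub>Steenrod\<^esub> s) x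
      = act (suspension M) k (n + l) r (act (suspension M) l n s x)"
    using assms rs by (cases n) (simp_all add: act_mult)
next
  fix k n r x assume "r \<in> Steenrod_deg k" "x \<in> elts (suspension M) n"
  then show "act (suspension M) k n r x \<in> elts (suspension M) (n + k)"
    using assms by (cases n; cases k) auto
next
  fix k n r x y assume "r \<in> Steenrod_deg k" "x \<in> elts (suspension M) n" "y \<in> elts (suspension M) n"
  then show "act (suspension M) k n r (pl (suspension M) n x y)
      = pl (suspension M) (n + k) (act (suspension M) k n r x) (act (suspension M) k n r y)"
    using assms by (cases n; cases k) (auto simp: act_pl)
next
  fix k n r s x assume "r \<in> Steenrod_deg k" "s \<in> Steenrod_deg k" "x \<in> elts (suspension M) n"
  then show "act (suspension M) k n (r \<oplus>\<^bsub>Steenrod\<^esub> s) x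
      = pl (suspension M) (n + k) (act (suspension M) k n r x) (act (suspension M) k n s x)"
    using assms by (cases n; cases k) (auto simp: act_plus)
next
  fix n x y z assume "x \<in> elts (suspension M) n" "y \<in> elts (suspension M) n" "z \<in> elts (suspension M) n"
  then show "pl (suspension M) n (pl (suspension M) n x y) z = pl (suspension M) n x (pl (suspension M) n y z)"
    using assms by (cases n) (auto simp: pl_assoc)
next
  fix n x y assume "x \<in> elts (suspension M) n" "y \<in> elts (suspension M) n"
  then show "pl (suspension M) n x y = pl (suspension M) n y x" "pl (suspension M) n x y \<in> elts (suspension M) n"
    using assms by (cases n; auto simp: pl_comm)+
next
  fix n x assume "x \<in> elts (suspension M) n"
  then show "pl (suspension M) n (zr (suspension M) n) x = x" "pl (suspension M) n x x = zr (suspension M) n"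
    "act (suspension M) 0 n \<one>\<^bsub>Steenrod\<^esub> x = x"
    using assms by (cases n; auto)+
qed

lemma um_suspension [simp]:
  assumes "um M"
  shows "um (suspension M)"
proof (rule umI)
  fix n k x assume "n < k" "x \<in> elts (suspension M) n"
  then show "act (suspension M) k n (Sq k) x = zr (suspension M) (n + k)"
    using assms by (cases n) (auto simp: um_Sq)
qed (use assms in simp)

lemma um_suspension_funpow [simp]: "um M \<Longrightarrow> um ((suspension ^^ n) M)"
  by (induction n) simp_all

definition susp_map :: "'b gmod \<Rightarrow> (nat \<Rightarrow> 'a \<Rightarrow> 'b) \<Rightarrow> nat \<Rightarrow> 'a \<Rightarrow> 'b" where
  "susp_map N f n = (case n of 0 \<Rightarrow> (\<lambda>x. zr N 0) | Suc m \<Rightarrow> f m)"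

lemma susp_map_simps [simp]: "susp_map N f 0 x = zr N 0" "susp_map N f (Suc m) = f m"
  by (simp_all add: susp_map_def)

lemma mor_susp:
  assumes "gm M" "gm N" "mor M N f"
  shows "mor (suspension M) (suspension N) (susp_map N f)"
proof (rule morI)
  fix n x assume "x \<in> elts (suspension M) n"
  then show "susp_map N f n x \<in> elts (suspension N) n"
    using assms by (cases n) auto
next
  fix n x y assume "x \<in> elts (suspension M) n" "y \<in> elts (suspension M) n"
  then show "susp_map N f n (pl (suspension M) n x y) = pl (suspension N) n (susp_map N f n x) (susp_map N f n y)"
    using assms by (cases n) (auto simp: mor_pl)
next
  fix k n r x assume "r \<in> Steenrod_deg k" "x \<in> elts (suspension M) n"
  then show "susp_map N f (n + k) (act (suspension M) k n r x) = act (suspension N) k n r (susp_map N f n x)"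
    using assms mor_zr[OF assms] by (cases n) (auto simp: mor_act, cases k, auto)
qed

lemma F2_simps:
  "elts F2_module n = (if n = 0 then {0, 1} else {0})" "zr F2_module n = 0"
  "pl F2_module n x y = (if n = 0 then (x + y) mod 2 else 0)"
  "act F2_module k n r x = (if k = 0 \<and> r = \<one>\<^bsub>Steenrod\<^esub> then x else 0)"
  by (auto simp: F2_module_def carrier_integer_mod_group singleton_group_def)

lemma um_F2 [simp]: "um F2_module"
proof (rule umI[OF gmI])
  note [simp] = F2_simps
  have 01 [simp]: "\<zero>\<^bsub>Steenrod\<^esub> \<noteq> \<one>\<^bsub>Steenrod\<^esub>" by (rule Steenrod_zero_neq_one)
  have e: "{} \<in> carrier FA" "{[]} \<in> carrier FA" by (auto simp: carrier_free)
  have [simp]: "\<zero>\<^bsub>Steenrod\<^esub> \<otimes>\<^bsub>Steenrod\<^esub> \<zero>\<^bsub>Steenrod\<^esub> = \<zero>\<^bsub>Steenrod\<^esub>"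
    "\<one>\<^bsub>Steenrod\<^esub> \<otimes>\<^bsub>Steenrod\<^esub> \<zero>\<^bsub>Steenrod\<^esub> = \<zero>\<^bsub>Steenrod\<^esub>"
    unfolding Steenrod_zero Steenrod_one St_ops(1)[OF e(1) e(1)] St_ops(1)[OF e(2) e(1)]
    by (simp_all add: mult_free)
  note [simp] = Steenrod_mult_one[OF Steenrod_deg_one] Steenrod_mult_one[OF Steenrod_deg_zero]
    Steenrod_self_add[OF Steenrod_deg_zero] Steenrod_self_add[OF Steenrod_deg_one]
    Steenrod_add_zero[OF Steenrod_deg_one]
  show "act F2_module k n (r \<oplus>\<^bsub>Steenrod\<^esub> s) x = pl F2_module (n + k) (act F2_module k n r x) (act F2_module k n s x)"
    if rs: "r \<in> Steenrod_deg k" "s \<in> Steenrod_deg k" "x \<in> elts F2_module n" for k n r s x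
  \<comment> \<open>Only degree 0 of the algebra acts nontrivially, and there it consists of 0 and
    1.\<close>
  proof (cases "k = 0")
    case True
    then have "r = \<zero>\<^bsub>Steenrod\<^esub> \<or> r = \<one>\<^bsub>Steenrod\<^esub>" "s = \<zero>\<^bsub>Steenrod\<^esub> \<or> s = \<one>\<^bsub>Steenrod\<^esub>"
      using rs Steenrod_deg_0 by auto
    moreover have "x = 0 \<or> (n = 0 \<and> x = 1)" using rs by (auto split: if_splits)
    ultimately show ?thesis using True by (elim disjE) simp_all
  qed simp
  show "act F2_module (k + l) n (r \<otimes>\<^bsub>Steenrod\<^esub> s) x = act F2_module k (n + l) r (act F2_module l n s x)"
    if rs: "r \<in> Steenrod_deg k" "s \<in> Steenrod_deg l" "x \<in> elts F2_module n" for k l n r s x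
  proof (cases "k = 0 \<and> l = 0")
    case True
    then have "r = \<zero>\<^bsub>Steenrod\<^esub> \<or> r = \<one>\<^bsub>Steenrod\<^esub>" "s = \<zero>\<^bsub>Steenrod\<^esub> \<or> s = \<one>\<^bsub>Steenrod\<^esub>"
      using rs Steenrod_deg_0 by auto
    then show ?thesis using True
      by (elim disjE) simp_all
  qed auto
  show "act F2_module k n r (pl F2_module n x y)
      = pl F2_module (n + k) (act F2_module k n r x) (act F2_module k n r y)"
    if "r \<in> Steenrod_deg k" "x \<in> elts F2_module n" "y \<in> elts F2_module n" for k n r x y
    by simp
  show "pl F2_module n (pl F2_module n x y) z = pl F2_module n x (pl F2_module n y z)" for n x y z
    by (simp add: mod_simps add.assoc)
  show "pl F2_module n x y = pl F2_module n y x" for n x y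
    by (simp add: add.commute)
  show "pl F2_module n x y \<in> elts F2_module n" for n x y
    by auto
  show "pl F2_module n (zr F2_module n) x = x" if "x \<in> elts F2_module n" for n x
    using that by (auto split: if_splits)
  show "pl F2_module n x x = zr F2_module n" for n x
    by simp
  show "zr F2_module n \<in> elts F2_module n" for n
    by simp
  show "act F2_module k n r x \<in> elts F2_module (n + k)"
    if "r \<in> Steenrod_deg k" "x \<in> elts F2_module n" for k n r x
    using that by (auto split: if_splits)
  show "act F2_module 0 n \<one>\<^bsub>Steenrod\<^esub> x = x" for n x
    by simp
  show "act F2_module k n (Sq k) x = zr F2_module (n + k)"
    if "n < k" "x \<in> elts F2_module n" for n k x
    using that by simp
qed

lemma suspension_F2:
  "elts ((suspension ^^ n) F2_module) j = (if j = n then {0, 1} else {0})"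
  "zr ((suspension ^^ n) F2_module) j = 0"
proof -
  have "elts ((suspension ^^ n) F2_module) j = (if j = n then {0, 1} else {0}) \<and>
      zr ((suspension ^^ n) F2_module) j = 0"
  proof (induction n arbitrary: j)
    case 0
    then show ?case by (auto simp: F2_module_def carrier_integer_mod_group singleton_group_def)
  next
    case (Suc n)
    then show ?case by (cases j) auto
  qed
  then show "elts ((suspension ^^ n) F2_module) j = (if j = n then {0, 1} else {0})"
    "zr ((suspension ^^ n) F2_module) j = 0" by auto
qed

section \<open>The top square and the functor \<open>\<Omega>\<close>\<close>

lemma act_Sq_Sq:
  assumes "gm M" "x \<in> elts M n"
  shows "act M (k + l) n (St (free_Sq k \<otimes>\<^bsub>FA\<^esub> free_Sq l)) x = act M k (n + l) (Sq k) (act M l n (Sq l) x)"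
  using act_mult[OF assms(1) Sq_deg Sq_deg assms(2), of k l] by (simp add: Sq_def St_ops)

lemma St_Adem:
  assumes "0 < a" "a < 2 * b"
  shows "St (free_Sq a \<otimes>\<^bsub>FA\<^esub> free_Sq b) = St (finsum FA (Adem_term a b) {0..a div 2})"
  using Adem_relation_mem[OF assms]
  by (subst St_eq_iff) (simp_all add: Adem_relation_eq ring.ring_simprules[OF ring_free] abelian_monoid.finsum_closed
      ring.is_abelian_group[OF ring_free] abelian_group.axioms)

text \<open>The term with index i of the Adem relation applies Sq^(k+j-i) to a class of degree j+i.
  For 2i < k this vanishes by instability, so only i = k/2 survives, with a binomial coefficient
  whose lower entry is 0. This is what makes the image of the top square a submodule.\<close>

lemma Adem_top:
  assumes M: "um M" and x: "x \<in> elts M j" and k: "0 < k" "k < 2 * j"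
  shows "act M k (j + j) (Sq k) (act M j j (Sq j) x) =
    (if even k then act M (j + k div 2) (j + k div 2) (Sq (j + k div 2)) (act M (k div 2) j (Sq (k div 2)) x)
     else zr M (j + j + k))"
proof -
  interpret FA: ring FA by (rule ring_free)
  note gm = um_gm[OF M]
  let ?t = "Adem_term k j" and ?h = "k div 2"
  have deg: "St (finsum FA ?t J) \<in> Steenrod_deg (k + j)" if "finite J" "J \<subseteq> {0..?h}" for J
  proof (rule Steenrod_degI)
    show "\<forall>w\<in>finsum FA ?t J. sum_list w = k + j"
    proof (rule finsum_free_homogeneous[OF that(1)])
      fix i assume "i \<in> J"
      then have "i \<le> ?h" using that by auto
      then have "\<forall>w\<in>free_Sq (k + j - i) \<otimes>\<^bsub>FA\<^esub> free_Sq i. sum_list w = k + j"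
        using mult_free_homogeneous[OF free_Sq_homogeneous free_Sq_homogeneous, of "k + j - i" i] by simp
      then show "\<forall>w\<in>?t i. sum_list w = k + j" by (simp add: Adem_term_def zero_free)
    qed simp
  qed (simp add: FA.finsum_closed)
  have single: "act M (k + j) j (St (?t i)) x =
      (if 2 * i = k then act M (j + ?h) (j + ?h) (Sq (j + ?h)) (act M ?h j (Sq ?h) x) else zr M (j + (k + j)))"
    if i: "i \<le> ?h" for i
  proof (cases "2 * i = k")
    case True
    then have h: "?h = i" and e: "j + i + i = k + j" "even k" by auto
    have "?t i = free_Sq (j + i) \<otimes>\<^bsub>FA\<^esub> free_Sq i"
      using k True by (auto simp: Adem_term_def add.commute)
    then have "act M (k + j) j (St (?t i)) x = act M (j + i) (j + i) (Sq (j + i)) (act M i j (Sq i) x)"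
      using act_Sq_Sq[OF gm x, of "j + i" i] unfolding e(1) by simp
    then show ?thesis unfolding h using True by simp
  next
    case False
    show ?thesis
    proof (cases "odd ((j - 1 - i) choose (k - 2 * i))")
      case True
      have "k + j - i + i = k + j" using i by simp
      then have "act M (k + j) j (St (?t i)) x = act M (k + j - i) (j + i) (Sq (k + j - i)) (act M i j (Sq i) x)"
        using True act_Sq_Sq[OF gm x, of "k + j - i" i] by (simp add: Adem_term_def)
      also have "\<dots> = zr M (j + i + (k + j - i))"
        using i False gm x by (intro um_Sq[OF M]) auto
      finally show ?thesis using False i by simp
    qed (use False gm x in \<open>simp add: Adem_term_def zero_free flip: Steenrod_zero\<close>)
  qed
  have *: "act M (k + j) j (St (finsum FA ?t J)) x =
      (if even k \<and> ?h \<in> J then act M (j + ?h) (j + ?h) (Sq (j + ?h)) (act M ?h j (Sq ?h) x) else zr M (j + (k + j)))"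
    if "finite J" "J \<subseteq> {0..?h}" for J
    using that
  proof (induction J rule: finite_induct)
    case empty
    then show ?case using gm x by (simp add: zero_free flip: Steenrod_zero)
  next
    case (insert i J)
    have "finsum FA ?t (insert i J) = ?t i \<oplus>\<^bsub>FA\<^esub> finsum FA ?t J"
      using insert by (intro FA.finsum_insert) auto
    then have "St (finsum FA ?t (insert i J)) = St (?t i) \<oplus>\<^bsub>Steenrod\<^esub> St (finsum FA ?t J)"
      by (simp add: St_ops FA.finsum_closed)
    moreover have "St (?t i) \<in> Steenrod_deg (k + j)"
      using deg[of "{i}"] insert by (simp add: FA.finsum_insert)
    ultimately have "act M (k + j) j (St (finsum FA ?t (insert i J))) x =
        pl M (j + (k + j)) (act M (k + j) j (St (?t i)) x) (act M (k + j) j (St (finsum FA ?t J)) x)"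
      using insert x gm deg[of J] by (simp add: act_plus)
    also have "\<dots> = (if even k \<and> ?h \<in> insert i J then act M (j + ?h) (j + ?h) (Sq (j + ?h)) (act M ?h j (Sq ?h) x) else zr M (j + (k + j)))"
    proof -
      have i: "i \<le> ?h" and IH: "act M (k + j) j (St (finsum FA ?t J)) x = (if even k \<and> ?h \<in> J then act M (j + ?h) (j + ?h) (Sq (j + ?h)) (act M ?h j (Sq ?h) x) else zr M (j + (k + j)))"
        using insert by auto
      have deg2: "j + ?h + (j + ?h) = j + (k + j)" if "even k" using that by auto
      have v: "act M (j + ?h) (j + ?h) (Sq (j + ?h)) (act M ?h j (Sq ?h) x) \<in> elts M (j + (k + j))" if "even k"
        using gm x deg2[OF that] by (intro act_closedI) auto
      have "2 * i = k \<longleftrightarrow> even k \<and> i = ?h" by auto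
      then show ?thesis
        unfolding IH single[OF i] using v gm insert(2) by auto
    qed
    finally show ?case .
  qed
  have "act M (k + j) j (St (free_Sq k \<otimes>\<^bsub>FA\<^esub> free_Sq j)) x = act M k (j + j) (Sq k) (act M j j (Sq j) x)"
    by (rule act_Sq_Sq[OF gm x])
  then show ?thesis using *[of "{0..?h}"] by (simp add: St_Adem[OF k] add_ac)
qed

definition im_top :: "'a gmod \<Rightarrow> nat \<Rightarrow> 'a set" where
  "im_top M n = {y. y = zr M n \<or> (\<exists>k. \<exists>x\<in>elts M k. n = k + k \<and> y = act M k k (Sq k) x)}"

lemma im_topI: "x \<in> elts M k \<Longrightarrow> act M k k (Sq k) x \<in> im_top M (k + k)"
  by (auto simp: im_top_def)

lemma im_topE:
  assumes "y \<in> im_top M n"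
  obtains "y = zr M n" | k x where "x \<in> elts M k" "n = k + k" "y = act M k k (Sq k) x"
  using assms by (auto simp: im_top_def)

text \<open>On a top square of degree 2j, a square Sq^k gives zero by instability if k > 2j, is
  itself a top square if k = 2j, and is handled by \<open>Adem_top\<close> if 0 < k < 2j.\<close>

lemma submod_im_top:
  assumes M: "um M"
  shows "submod M (im_top M)"
proof (rule submod_SqI)
  show "gm M" using M by simp
  show "y \<in> elts M n" if "y \<in> im_top M n" for n y
    using that M by (elim im_topE) auto
  show "zr M n \<in> im_top M n" for n by (simp add: im_top_def)
  show "pl M n x y \<in> im_top M n" if mem: "x \<in> im_top M n" "y \<in> im_top M n" for n x y
  proof (cases "x = zr M n \<or> y = zr M n")
    case True
    then show ?thesis
      using that \<open>\<And>y n. y \<in> im_top M n \<Longrightarrow> y \<in> elts M n\<close>[OF that(1)]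
        \<open>\<And>y n. y \<in> im_top M n \<Longrightarrow> y \<in> elts M n\<close>[OF that(2)] M by auto
  next
    case False
    then obtain k x' where x: "x' \<in> elts M k" "n = k + k" "x = act M k k (Sq k) x'"
      using mem(1) by (auto simp: im_top_def)
    obtain l y' where y: "y' \<in> elts M l" "n = l + l" "y = act M l l (Sq l) y'"
      using mem(2) False by (auto simp: im_top_def)
    have "l = k" using x(2) y(2) by simp
    then have y: "y' \<in> elts M k" "y = act M k k (Sq k) y'" using y by simp_all
    show ?thesis
      using x y M im_topI[of "pl M k x' y'" M k] act_pl[of M "Sq k" k x' k y'] by simp
  qed
  fix k n :: nat and y assume k: "0 < k" and "y \<in> im_top M n"
  from this(2) show "act M k n (Sq k) y \<in> im_top M (n + k)"
  proof (cases rule: im_topE)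
    case 1
    then show ?thesis using M by (simp add: im_top_def)
  next
    case (2 j x)
    note n = 2(2) and y = 2
    consider "2 * j < k" | "k = 2 * j" | "k < 2 * j" by linarith
    then show ?thesis
    proof cases
      case 1
      then show ?thesis using y M by (subst um_Sq) (auto simp: im_top_def)
    next
      case 2
      then have "k = n" using n by simp
      then show ?thesis using im_topI[of "act M j j (Sq j) x" M k] y M by simp
    next
      case 3
      let ?m = "j + k div 2"
      have "act M (k div 2) j (Sq (k div 2)) x \<in> elts M ?m" using y M by simp
      note top = im_topI[OF this]
      show ?thesis
      proof (cases "even k")
        case True
        then have e: "n + k = ?m + ?m" using n by auto
        have "act M k n (Sq k) y = act M ?m ?m (Sq ?m) (act M (k div 2) j (Sq (k div 2)) x)"
          using Adem_top[OF M y(1) k 3] y True by simp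
        then show ?thesis unfolding e using top by simp
      next
        case False
        then show ?thesis using Adem_top[OF M y(1) k 3] y by (simp add: im_top_def)
      qed
    qed
  qed
qed

text \<open>In characteristic 2 sums are differences, so the predicate under \<open>SOME\<close>
  depends only on the coset of \<open>x\<close>; elements of one coset therefore receive literally
  the same representative.\<close>

definition coset_rep :: "'a gmod \<Rightarrow> (nat \<Rightarrow> 'a set) \<Rightarrow> nat \<Rightarrow> 'a \<Rightarrow> 'a" where
  "coset_rep M A n x = (SOME y. y \<in> elts M n \<and> pl M n x y \<in> A n)"

lemma coset_rep:
  assumes "gm M" "submod M A" "x \<in> elts M n"
  shows "coset_rep M A n x \<in> elts M n" "pl M n x (coset_rep M A n x) \<in> A n"
proof -
  have "x \<in> elts M n \<and> pl M n x x \<in> A n" using assms submodD(2)[OF assms(2)] by simp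
  then show "coset_rep M A n x \<in> elts M n" "pl M n x (coset_rep M A n x) \<in> A n"
    unfolding coset_rep_def using someI_ex[of "\<lambda>y. y \<in> elts M n \<and> pl M n x y \<in> A n"] by blast+
qed

lemma coset_rep_eq_iff:
  assumes M: "gm M" and A: "submod M A" and x: "x \<in> elts M n" "y \<in> elts M n"
  shows "coset_rep M A n x = coset_rep M A n y \<longleftrightarrow> pl M n x y \<in> A n"
proof
  note c = coset_rep[OF M A]
  assume "coset_rep M A n x = coset_rep M A n y"
  then have "pl M n (pl M n x (coset_rep M A n x)) (pl M n y (coset_rep M A n x)) \<in> A n"
    using c x submodD(3)[OF A] by metis
  then show "pl M n x y \<in> A n" using c x M by (simp add: pl_ac)
next
  assume xy: "pl M n x y \<in> A n"
  have "pl M n x z \<in> A n \<longleftrightarrow> pl M n y z \<in> A n" if z: "z \<in> elts M n" for z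
  proof
    have "pl M n (pl M n x y) (pl M n x z) = pl M n y z" "pl M n (pl M n x y) (pl M n y z) = pl M n x z"
      using x z M by (simp_all add: pl_ac)
    then show "pl M n x z \<in> A n \<Longrightarrow> pl M n y z \<in> A n" "pl M n y z \<in> A n \<Longrightarrow> pl M n x z \<in> A n"
      using submodD(3)[OF A xy] by metis+
  qed
  then show "coset_rep M A n x = coset_rep M A n y"
    unfolding coset_rep_def by (intro arg_cong[where f = Eps]) auto
qed

text \<open>
  \<open>\<Omega> M\<close> is the desuspension of the quotient of \<open>M\<close> by the image of the top square, realised on the type
  of \<open>M\<close> by coset representatives.
\<close>

definition shift_down :: "'a gmod \<Rightarrow> 'a gmod" where
  "shift_down M = \<lparr>comp = (\<lambda>n. comp M (Suc n)), act = (\<lambda>k n. act M k (Suc n))\<rparr>"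

definition omega_proj :: "'a gmod \<Rightarrow> nat \<Rightarrow> 'a \<Rightarrow> 'a" where
  "omega_proj M n = coset_rep M (im_top M) (Suc n)"

definition Omega :: "'a gmod \<Rightarrow> 'a gmod" where
  "Omega M = img_gmod (omega_proj M) (\<lambda>n x. x) (shift_down M)"

lemma shift_down_simps [simp]:
  "comp (shift_down M) n = comp M (Suc n)" "act (shift_down M) k n = act M k (Suc n)"
  by (simp_all add: shift_down_def)

lemma gm_shift_down: "gm M \<Longrightarrow> gm (shift_down M)"
  by (rule gmI) (simp_all add: act_pl act_plus act_mult, simp_all add: pl_ac)

context
  fixes M :: "'a gmod"
  assumes uM: "um M"
begin

lemma omega_proj_eq_iff: "x \<in> elts M (Suc n) \<Longrightarrow> y \<in> elts M (Suc n) \<Longrightarrow>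
    omega_proj M n x = omega_proj M n y \<longleftrightarrow> pl M (Suc n) x y \<in> im_top M (Suc n)"
  unfolding omega_proj_def using uM by (intro coset_rep_eq_iff) (auto intro: submod_im_top)

lemma omega_proj_closed: "x \<in> elts M (Suc n) \<Longrightarrow> omega_proj M n x \<in> elts M (Suc n)"
  unfolding omega_proj_def using uM by (intro coset_rep) (auto intro: submod_im_top)

lemma omega_proj_idem: "x \<in> elts M (Suc n) \<Longrightarrow> omega_proj M n (omega_proj M n x) = omega_proj M n x"
  using coset_rep(2)[OF um_gm[OF uM] submod_im_top[OF uM], of x "Suc n"] uM omega_proj_closed[of x n]
  by (subst omega_proj_eq_iff) (auto simp: omega_proj_def pl_comm)

interpretation img_data "shift_down M" "omega_proj M" "\<lambda>n x. x"
proof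
  note A = submodD[OF submod_im_top[OF uM]] and gm = um_gm[OF uM]
  show "gm (shift_down M)" by (simp add: gm gm_shift_down)
  fix n x x' y y'
  assume "x \<in> elts (shift_down M) n" "x' \<in> elts (shift_down M) n"
    "y \<in> elts (shift_down M) n" "y' \<in> elts (shift_down M) n"
  then have c: "x \<in> elts M (Suc n)" "x' \<in> elts M (Suc n)" "y \<in> elts M (Suc n)" "y' \<in> elts M (Suc n)" by simp_all
  assume "omega_proj M n x = omega_proj M n x'" "omega_proj M n y = omega_proj M n y'"
  then have "pl M (Suc n) (pl M (Suc n) x x') (pl M (Suc n) y y') \<in> im_top M (Suc n)"
    using c omega_proj_eq_iff A(3) by simp
  then show "omega_proj M n (pl (shift_down M) n x y) = omega_proj M n (pl (shift_down M) n x' y')"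
    using c gm by (simp add: omega_proj_eq_iff pl_ac)
next
  note A = submodD[OF submod_im_top[OF uM]] and gm = um_gm[OF uM]
  fix j n r x x'
  assume r: "r \<in> Steenrod_deg j" and "x \<in> elts (shift_down M) n" "x' \<in> elts (shift_down M) n"
  then have c: "x \<in> elts M (Suc n)" "x' \<in> elts M (Suc n)" by simp_all
  assume "omega_proj M n x = omega_proj M n x'"
  then have "act M j (Suc n) r (pl M (Suc n) x x') \<in> im_top M (Suc n + j)"
    using c omega_proj_eq_iff A(4)[OF r, of "pl M (Suc n) x x'" "Suc n"] by simp
  then show "omega_proj M (n + j) (act (shift_down M) j n r x) = omega_proj M (n + j) (act (shift_down M) j n r x')"
    using c gm r by (simp add: omega_proj_eq_iff act_pl)
qed (simp_all add: omega_proj_closed omega_proj_idem)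

text \<open>Shifting down spoils instability in just one place: on degree n the square Sq^(n+1) is
  the top square of \<open>M\<close> in degree n+1. Dividing by its image repairs this.\<close>

lemma um_Omega: "um (Omega M)"
  unfolding Omega_def
proof (rule um_img)
  fix n j x assume "n < j" and x: "x \<in> elts (shift_down M) n"
  then consider "j = Suc n" | "Suc n < j" by linarith
  then show "omega_proj M (n + j) (act (shift_down M) j n (Sq j) x) = omega_proj M (n + j) (zr (shift_down M) (n + j))"
    using x uM im_topI[of x M "Suc n"] by cases (simp_all add: omega_proj_eq_iff um_Sq)
qed

lemma Omega_elts: "elts (Omega M) n = omega_proj M n ` elts M (Suc n)"
  by (simp add: Omega_def)

lemma Omega_elts_closed: "x \<in> elts (Omega M) n \<Longrightarrow> x \<in> elts M (Suc n)"
  by (auto simp: Omega_elts omega_proj_closed)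

lemma Omega_elts_fixed: "x \<in> elts (Omega M) n \<Longrightarrow> omega_proj M n x = x"
  by (auto simp: Omega_elts omega_proj_idem)

lemma omega_proj_mem: "x \<in> elts M (Suc n) \<Longrightarrow> omega_proj M n x \<in> elts (Omega M) n"
  by (simp add: Omega_elts)

lemma omega_proj_zr_iff: "x \<in> elts M (Suc n) \<Longrightarrow> omega_proj M n x = zr (Omega M) n \<longleftrightarrow> x \<in> im_top M (Suc n)"
  using uM by (simp add: Omega_def omega_proj_eq_iff)

lemma mor_omega_proj: "mor (shift_down M) (Omega M) (omega_proj M)"
  unfolding Omega_def by (rule mor_img)

text \<open>The unit of the adjunction. Degree 0 needs an argument, since there the suspension of
  \<open>Omega M\<close> is trivial and all operations on classes of degree 0 have to die in the
  quotient.\<close>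

lemma mor_omega_unit: "mor M (suspension (Omega M)) (susp_map (Omega M) (omega_proj M))"
proof (rule morI)
  note m = mor_omega_proj and gm = um_gm[OF uM] um_gm[OF um_Omega]
  show "susp_map (Omega M) (omega_proj M) n x \<in> elts (suspension (Omega M)) n" if "x \<in> elts M n" for n x
    using that by (cases n) (simp_all add: omega_proj_mem)
  show "susp_map (Omega M) (omega_proj M) n (pl M n x y) =
      pl (suspension (Omega M)) n (susp_map (Omega M) (omega_proj M) n x) (susp_map (Omega M) (omega_proj M) n y)"
    if "x \<in> elts M n" "y \<in> elts M n" for n x y
    using that mor_pl[OF m] by (cases n) simp_all
  show "susp_map (Omega M) (omega_proj M) (n + k) (act M k n r x) =
      act (suspension (Omega M)) k n r (susp_map (Omega M) (omega_proj M) n x)"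
    if r: "r \<in> Steenrod_deg k" and x: "x \<in> elts M n" for k n r x
  proof (cases n)
    case 0
    show ?thesis
    proof (cases k)
      case (Suc j)
      \<comment> \<open>A class of degree 0 is its own top square, as Sq^0 is the identity, and the
        image of the top square is a submodule.\<close>
      have "act M k 0 r x \<in> im_top M k"
        using r x unfolding 0
      proof (induction rule: Steenrod_deg_induct)
        case one
        then show ?case using im_topI[of x M 0] gm by (simp add: Sq_0)
      next
        case (add k r s)
        then show ?case using submodD(3)[OF submod_im_top[OF uM]] gm by (simp add: act_plus)
      next
        case (Sq i l r)
        then show ?case using submodD(4)[OF submod_im_top[OF uM], of "Sq i" i "act M l 0 r x" l] gm
          by (simp add: act_mult add_ac)
      qed (use gm submodD(2)[OF submod_im_top[OF uM]] in simp)
      then show ?thesis using 0 Suc r x gm by (simp add: omega_proj_zr_iff)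
    qed (simp add: 0)
  next
    case (Suc m)
    then show ?thesis using mor_act[OF m r, of x m] x by simp
  qed
qed

text \<open>A map into a suspension kills top squares: a class of degree k in the suspension has
  degree k-1 in \<open>N\<close>, where Sq^k vanishes by instability. So the map depends only on the
  representative chosen by \<open>omega_proj\<close>.\<close>

lemma omega_adjoint:
  fixes N :: "'b gmod"
  assumes N: "um N" and f: "mor M (suspension N) f"
  shows omega_adjoint_proj: "\<And>n x. x \<in> elts M (Suc n) \<Longrightarrow> f (Suc n) (omega_proj M n x) = f (Suc n) x"
    and omega_adjoint_mor: "mor (Omega M) N (\<lambda>n. f (Suc n))"
proof -
  note gm = um_gm[OF uM] um_gm[OF N]
  have top: "f (Suc n) y = zr N n" if "y \<in> im_top M (Suc n)" for n y
    using that
  proof (cases rule: im_topE)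
    case 1
    then show ?thesis using mor_zr[OF _ _ f, of "Suc n"] gm by simp
  next
    case (2 k x)
    then obtain j where k: "k = Suc j" by (cases k) auto
    have "f (k + k) y = act (suspension N) k k (Sq k) (f k x)"
      unfolding 2(3) by (rule mor_act[OF f Sq_deg 2(1)])
    moreover have "f k x \<in> elts N j" using mor_closed[OF f 2(1)] by (simp add: k)
    ultimately have "f (k + k) y = zr N (j + k)"
      using um_Sq[OF N, of j k "f k x"] by (simp add: k)
    then show ?thesis using 2(2) k by simp
  qed
  show proj: "f (Suc n) (omega_proj M n x) = f (Suc n) x" if x: "x \<in> elts M (Suc n)" for n x
  proof -
    have c: "omega_proj M n x \<in> elts M (Suc n)" by (rule omega_proj_closed[OF x])
    have "pl M (Suc n) (omega_proj M n x) x \<in> im_top M (Suc n)"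
      using omega_proj_eq_iff[OF c x] omega_proj_idem[OF x] by simp
    then have "pl N n (f (Suc n) (omega_proj M n x)) (f (Suc n) x) = zr N n"
      using top mor_pl[OF f c x] by simp
    then show ?thesis
      using gm mor_closed[OF f c] mor_closed[OF f x] by (simp add: pl_eq_zr_iff)
  qed
  show "mor (Omega M) N (\<lambda>n. f (Suc n))"
  proof (rule morI)
    fix n x assume x: "x \<in> elts (Omega M) n"
    show "f (Suc n) x \<in> elts N n" using mor_closed[OF f Omega_elts_closed[OF x]] by simp
    fix y assume y: "y \<in> elts (Omega M) n"
    have "pl (Omega M) n x y = omega_proj M n (pl M (Suc n) x y)"
      by (simp add: Omega_def)
    then show "f (Suc n) (pl (Omega M) n x y) = pl N n (f (Suc n) x) (f (Suc n) y)"
      using proj[of "pl M (Suc n) x y" n] gm Omega_elts_closed[OF x] Omega_elts_closed[OF y] mor_pl[OF f] by simp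
  next
    fix k n r x assume r: "r \<in> Steenrod_deg k" and x: "x \<in> elts (Omega M) n"
    have "act (Omega M) k n r x = omega_proj M (n + k) (act M k (Suc n) r x)"
      by (simp add: Omega_def)
    then show "f (Suc (n + k)) (act (Omega M) k n r x) = act N k n r (f (Suc n) x)"
      using proj[of "act M k (Suc n) r x" "n + k"] gm Omega_elts_closed[OF x] mor_act[OF f r, of x "Suc n"] r by simp
  qed
qed

end

lemma omega_adjoint_inv:
  assumes M: "um M" and N: "um N" and g: "mor (Omega M) N g"
  shows "mor M (suspension N) (susp_map N (\<lambda>n x. g n (omega_proj M n x)))"
proof -
  have "mor M (suspension N) (\<lambda>n x. susp_map N g n (susp_map (Omega M) (omega_proj M) n x))"
    using M N g by (intro mor_comp[OF mor_omega_unit mor_susp]) (simp_all add: um_Omega)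
  then show ?thesis
    by (rule mor_cong[OF um_gm[OF M]]) (simp add: susp_map_def split: nat.split)
qed

definition Omega_map :: "'b gmod \<Rightarrow> (nat \<Rightarrow> 'a \<Rightarrow> 'b) \<Rightarrow> nat \<Rightarrow> 'a \<Rightarrow> 'b" where
  "Omega_map N f n x = omega_proj N n (f (Suc n) x)"

lemma Omega_map:
  assumes M: "um M" and N: "um N" and f: "mor M N f"
  shows mor_Omega_map: "mor (Omega M) (Omega N) (Omega_map N f)"
    and Omega_map_proj: "x \<in> elts M (Suc n) \<Longrightarrow> Omega_map N f n (omega_proj M n x) = omega_proj N n (f (Suc n) x)"
proof -
  have m: "mor M (suspension (Omega N)) (\<lambda>n x. susp_map (Omega N) (omega_proj N) n (f n x))"
    by (rule mor_comp[OF f mor_omega_unit[OF N]])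
  show "mor (Omega M) (Omega N) (Omega_map N f)"
    using omega_adjoint_mor[OF M um_Omega[OF N] m] by (simp add: Omega_map_def[abs_def])
  show "x \<in> elts M (Suc n) \<Longrightarrow> Omega_map N f n (omega_proj M n x) = omega_proj N n (f (Suc n) x)"
    using omega_adjoint_proj[OF M um_Omega[OF N] m, of x n] by (simp add: Omega_map_def)
qed

section \<open>Projective modules\<close>

lemma Hom_U_iff: "f \<in> Hom_U M N \<longleftrightarrow> mor M N f \<and> (\<forall>n. f n \<in> extensional (elts M n))"
  unfolding Hom_U_def mor_def hom_def by (auto simp: Pi_iff)

definition restr :: "'a gmod \<Rightarrow> (nat \<Rightarrow> 'a \<Rightarrow> 'b) \<Rightarrow> nat \<Rightarrow> 'a \<Rightarrow> 'b" where
  "restr M f n = restrict (f n) (elts M n)"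

lemma restr_apply [simp]: "x \<in> elts M n \<Longrightarrow> restr M f n x = f n x"
  by (simp add: restr_def)

lemma restr_Hom_U: "gm M \<Longrightarrow> mor M N f \<Longrightarrow> restr M f \<in> Hom_U M N"
  unfolding Hom_U_iff by (auto intro: mor_cong simp: restr_def)

lemma restr_eqI: "f \<in> Hom_U M N \<Longrightarrow> (\<And>n x. x \<in> elts M n \<Longrightarrow> g n x = f n x) \<Longrightarrow> restr M g = f"
  unfolding Hom_U_iff restr_def by (intro ext) (metis extensional_arb restrict_def)

lemma comp_U_eq: "comp_U M g f = restr M (\<lambda>n x. g n (f n x))"
  by (simp add: comp_U_def restr_def compose_def fun_eq_iff)

lemma projective_um [simp]: "projective_U P \<Longrightarrow> um P"
  by (simp add: projective_U_def)

text \<open>Surjectivity of \<open>g\<close> onto all of \<open>N\<close> can be weakened to the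
  hypothesis on images by replacing \<open>N\<close> with the submodule g(M). Extensionality of
  morphisms is dealt with here once and for all.\<close>

lemma projective_lift:
  fixes M N P :: "'u gmod"
  assumes P: "projective_U P" and M: "um M" and N: "um N" and g: "mor M N g" and f: "mor P N f"
    and im: "\<And>n x. x \<in> elts P n \<Longrightarrow> f n x \<in> g n ` elts M n"
  obtains h where "mor P M h" "\<And>n x. x \<in> elts P n \<Longrightarrow> g n (h n x) = f n x"
proof -
  let ?I = "sub_gmod N (\<lambda>n. g n ` elts M n)"
  have I: "submod N (\<lambda>n. g n ` elts M n)" using M N g by (intro submod_image) simp_all
  have "restr M g \<in> Hom_U M ?I" "restr P f \<in> Hom_U P ?I"
    using M P g f im by (auto intro!: restr_Hom_U mor_into_sub)
  moreover have "\<forall>n. restr M g n ` elts M n = elts ?I n" by (auto intro!: image_eqI)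
  ultimately obtain h where h: "h \<in> Hom_U P M" "comp_U P (restr M g) h = restr P f"
    using P M um_sub[OF N I] unfolding projective_U_def by blast
  have m: "mor P M h" using h(1) by (simp add: Hom_U_iff)
  have "g n (h n x) = f n x" if "x \<in> elts P n" for n x
    using fun_cong[OF fun_cong[OF h(2)], of n x] that m by (simp add: comp_U_eq)
  with m show ?thesis by (rule that)
qed

lemma projectiveI:
  fixes P :: "'u gmod"
  assumes P: "um P"
    and lift: "\<And>(M :: 'u gmod) (N :: 'u gmod) g f. um M \<Longrightarrow> um N \<Longrightarrow> mor M N g \<Longrightarrow> mor P N f \<Longrightarrow>
      (\<And>n. g n ` elts M n = elts N n) \<Longrightarrow> \<exists>h. mor P M h \<and> (\<forall>n. \<forall>x\<in>elts P n. g n (h n x) = f n x)"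
  shows "projective_U P"
  unfolding projective_U_def
proof (intro conjI allI ballI impI P)
  fix M N :: "'u gmod" and g f
  assume g: "g \<in> Hom_U M N" and f: "f \<in> Hom_U P N"
    and *: "um M \<and> um N \<and> (\<forall>n. g n ` elts M n = elts N n)"
  then obtain h where h: "mor P M h" "\<forall>n. \<forall>x\<in>elts P n. g n (h n x) = f n x"
    using lift[of M N g f] by (auto simp: Hom_U_iff)
  have "comp_U P g (restr P h) = f"
    unfolding comp_U_eq using h by (intro restr_eqI[OF f]) simp
  then show "\<exists>h\<in>Hom_U P M. comp_U P g h = f" using restr_Hom_U[OF _ h(1)] P by auto
qed

text \<open>Suspension preserves surjections and stays on the same type, so the adjoint of a lifting
  problem for \<open>Omega P\<close> is a lifting problem for \<open>P\<close>.\<close>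

lemma projective_Omega:
  fixes P :: "'u gmod"
  assumes P: "projective_U P"
  shows "projective_U (Omega P)"
proof (rule projectiveI)
  note um = projective_um[OF P]
  show "um (Omega P)" by (rule um_Omega[OF um])
  fix M N :: "'u gmod" and g f
  assume M: "um M" and N: "um N" and g: "mor M N g" and f: "mor (Omega P) N f"
    and surj: "\<And>n. g n ` elts M n = elts N n"
  have f': "mor P (suspension N) (susp_map N (\<lambda>n x. f n (omega_proj P n x)))"
    by (rule omega_adjoint_inv[OF um N f])
  have g': "mor (suspension M) (suspension N) (susp_map N g)"
    by (rule mor_susp[OF um_gm[OF M] um_gm[OF N] g])
  have s': "y \<in> susp_map N g n ` elts (suspension M) n" if "y \<in> elts (suspension N) n" for n y
    using that surj by (cases n) auto
  obtain h where h: "mor P (suspension M) h"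
    "\<And>n x. x \<in> elts P n \<Longrightarrow> susp_map N g n (h n x) = susp_map N (\<lambda>n x. f n (omega_proj P n x)) n x"
    using projective_lift[OF P um_suspension[OF M] um_suspension[OF N] g' f' s'[OF mor_closed[OF f']]] by blast
  have "g n (h (Suc n) x) = f n x" if "x \<in> elts (Omega P) n" for n x
    using h(2)[OF Omega_elts_closed[OF um that]] Omega_elts_fixed[OF um that] by simp
  then show "\<exists>h. mor (Omega P) M h \<and> (\<forall>n. \<forall>x\<in>elts (Omega P) n. g n (h n x) = f n x)"
    using omega_adjoint_mor[OF um M h(1)] by blast
qed

section \<open>Chain complexes and resolutions\<close>

text \<open>
  \<open>d (Suc s)\<close> is the differential \<open>Z (Suc s) \<rightarrow> Z s\<close>; \<open>d 0\<close> is irrelevant here, and an augmentation in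
  \<open>resolution\<close>.
\<close>

definition chain_complex :: "(nat \<Rightarrow> 'a gmod) \<Rightarrow> (nat \<Rightarrow> nat \<Rightarrow> 'a \<Rightarrow> 'a) \<Rightarrow> bool" where
  "chain_complex Z d \<longleftrightarrow> (\<forall>s. um (Z s)) \<and> (\<forall>s. mor (Z (Suc s)) (Z s) (d (Suc s))) \<and>
    (\<forall>s n. \<forall>x\<in>elts (Z (Suc (Suc s))) n. d (Suc s) n (d (Suc (Suc s)) n x) = zr (Z s) n)"

definition exact_positive :: "(nat \<Rightarrow> 'a gmod) \<Rightarrow> (nat \<Rightarrow> nat \<Rightarrow> 'a \<Rightarrow> 'a) \<Rightarrow> bool" where
  "exact_positive Z d \<longleftrightarrow> (\<forall>s n. \<forall>x\<in>elts (Z (Suc s)) n. d (Suc s) n x = zr (Z s) n \<longrightarrow>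
    x \<in> d (Suc (Suc s)) n ` elts (Z (Suc (Suc s))) n)"

definition chain_map where
  "chain_map Z d Y e f \<longleftrightarrow> (\<forall>s. mor (Z s) (Y s) (f s)) \<and>
    (\<forall>s n. \<forall>x\<in>elts (Z (Suc s)) n. e (Suc s) n (f (Suc s) n x) = f s n (d (Suc s) n x))"

lemma chain_complexD:
  assumes "chain_complex Z d"
  shows "um (Z s)" "gm (Z s)" "mor (Z (Suc s)) (Z s) (d (Suc s))"
    "x \<in> elts (Z (Suc (Suc s))) n \<Longrightarrow> d (Suc s) n (d (Suc (Suc s)) n x) = zr (Z s) n"
  using assms unfolding chain_complex_def by auto

lemma chain_mapD:
  assumes "chain_map Z d Y e f"
  shows "mor (Z s) (Y s) (f s)"
    "x \<in> elts (Z (Suc s)) n \<Longrightarrow> e (Suc s) n (f (Suc s) n x) = f s n (d (Suc s) n x)"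
  using assms unfolding chain_map_def by auto

text \<open>The comparison theorem with augmentations replaced by their consequence that
  \<open>f0\<close> sends boundaries to boundaries. In this form it also applies to the shift of the
  complex \<open>Omega P\<close>, which is not a resolution of the module resolved by the
  source.\<close>

lemma chain_lift:
  fixes P Z :: "nat \<Rightarrow> 'u gmod"
  assumes P: "chain_complex P d" "\<And>s. projective_U (P s)"
    and Z: "chain_complex Z e" "exact_positive Z e"
    and f0: "mor (P 0) (Z 0) f0"
      "\<And>n x. x \<in> elts (P 1) n \<Longrightarrow> f0 n (d 1 n x) \<in> e 1 n ` elts (Z 1) n"
  obtains f where "f 0 = f0" "chain_map P d Z e f"
proof -
  note Pd = chain_complexD[OF P(1)] and Zd = chain_complexD[OF Z(1)]
  \<comment> \<open>The last conjunct is the lifting condition for the next map and has to be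
    carried through the recursion.\<close>
  let ?P = "\<lambda>s f. mor (P s) (Z s) f \<and> (s = 0 \<longrightarrow> f = f0) \<and>
    (\<forall>n. \<forall>x\<in>elts (P (Suc s)) n. f n (d (Suc s) n x) \<in> e (Suc s) n ` elts (Z (Suc s)) n)"
  let ?Q = "\<lambda>s f g. \<forall>n. \<forall>x\<in>elts (P (Suc s)) n. e (Suc s) n (g n x) = f n (d (Suc s) n x)"
  have "\<exists>f. \<forall>s. ?P s (f s) \<and> ?Q s (f s) (f (Suc s))"
  proof (rule dependent_nat_choice)
    show "\<exists>f. ?P 0 f" using f0 by auto
    fix f s assume f: "?P s f"
    have m: "mor (P (Suc s)) (Z s) (\<lambda>n x. f n (d (Suc s) n x))"
      using f by (intro mor_comp[OF Pd(3)]) auto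
    obtain g where g: "mor (P (Suc s)) (Z (Suc s)) g"
      "\<And>n x. x \<in> elts (P (Suc s)) n \<Longrightarrow> e (Suc s) n (g n x) = f n (d (Suc s) n x)"
      using projective_lift[OF P(2) Zd(1) Zd(1) Zd(3) m] f by blast
    have "g n (d (Suc (Suc s)) n x) \<in> e (Suc (Suc s)) n ` elts (Z (Suc (Suc s))) n"
      if x: "x \<in> elts (P (Suc (Suc s))) n" for n x
    proof -
      have dx: "d (Suc (Suc s)) n x \<in> elts (P (Suc s)) n" by (rule mor_closed[OF Pd(3) x])
      have "e (Suc s) n (g n (d (Suc (Suc s)) n x)) = f n (zr (P s) n)"
        using g(2)[OF dx] Pd(4)[OF x] by simp
      also have "\<dots> = zr (Z s) n" using f Pd(2) Zd(2) by (intro mor_zr) auto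
      finally show ?thesis using Z(2) mor_closed[OF g(1) dx] unfolding exact_positive_def by blast
    qed
    then show "\<exists>g. ?P (Suc s) g \<and> ?Q s f g" using g by auto
  qed
  then obtain f where "\<forall>s. ?P s (f s) \<and> ?Q s (f s) (f (Suc s))" ..
  then show ?thesis by (intro that[of f]) (auto simp: chain_map_def)
qed

text \<open>The usual construction of a contracting homotopy for a map that is zero on H_0; in
  characteristic 2 it carries no signs.\<close>

lemma chain_homotopy:
  fixes P Z :: "nat \<Rightarrow> 'u gmod"
  assumes P: "chain_complex P d" "\<And>s. projective_U (P s)"
    and Z: "chain_complex Z e" "exact_positive Z e"
    and f: "chain_map P d Z e f"
    and f0: "\<forall>n. \<forall>x\<in>elts (P 0) n. f 0 n x \<in> e 1 n ` elts (Z 1) n"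
  shows "\<exists>h. (\<forall>s. mor (P s) (Z (Suc s)) (h s)) \<and>
    (\<forall>n. \<forall>x\<in>elts (P 0) n. f 0 n x = e 1 n (h 0 n x)) \<and>
    (\<forall>s n. \<forall>x\<in>elts (P (Suc s)) n.
      f (Suc s) n x = pl (Z (Suc s)) n (e (Suc (Suc s)) n (h (Suc s) n x)) (h s n (d (Suc s) n x)))"
proof -
  note Pd = chain_complexD[OF P(1)] and Zd = chain_complexD[OF Z(1)] and fd = chain_mapD[OF f]
  \<comment> \<open>The last conjunct makes f + h d a cycle in the next degree, hence a boundary
    that can be lifted.\<close>
  let ?P = "\<lambda>s h. mor (P s) (Z (Suc s)) h \<and> (s = 0 \<longrightarrow> (\<forall>n. \<forall>x\<in>elts (P 0) n. e 1 n (h n x) = f 0 n x)) \<and>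
    (\<forall>n. \<forall>x\<in>elts (P (Suc s)) n. e (Suc s) n (h n (d (Suc s) n x)) = f s n (d (Suc s) n x))"
  let ?Q = "\<lambda>s h h'. \<forall>n. \<forall>x\<in>elts (P (Suc s)) n.
    e (Suc (Suc s)) n (h' n x) = pl (Z (Suc s)) n (f (Suc s) n x) (h n (d (Suc s) n x))"
  have "\<exists>h. \<forall>s. ?P s (h s) \<and> ?Q s (h s) (h (Suc s))"
  proof (rule dependent_nat_choice)
    have m: "mor (Z 1) (Z 0) (e 1)" using Zd(3)[of 0] by simp
    obtain h where h: "mor (P 0) (Z 1) h" "\<And>n x. x \<in> elts (P 0) n \<Longrightarrow> e 1 n (h n x) = f 0 n x"
      using projective_lift[OF P(2) Zd(1) Zd(1) m fd(1) f0[rule_format]] by blast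
    then have "?P 0 h" using mor_closed[OF Pd(3)[of 0]] by auto
    then show "\<exists>h. ?P 0 h" by blast
    fix h s assume h: "?P s h"
    have m: "mor (P (Suc s)) (Z (Suc s)) (\<lambda>n x. pl (Z (Suc s)) n (f (Suc s) n x) (h n (d (Suc s) n x)))"
      using h by (intro mor_add Zd fd mor_comp[OF Pd(3)]) auto
    have im: "pl (Z (Suc s)) n (f (Suc s) n x) (h n (d (Suc s) n x)) \<in> e (Suc (Suc s)) n ` elts (Z (Suc (Suc s))) n"
      if x: "x \<in> elts (P (Suc s)) n" for n x
    proof -
      have c: "f (Suc s) n x \<in> elts (Z (Suc s)) n" "h n (d (Suc s) n x) \<in> elts (Z (Suc s)) n"
        "f s n (d (Suc s) n x) \<in> elts (Z s) n"
        using x h mor_closed[OF fd(1)] mor_closed[OF Pd(3)] by auto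
      have "e (Suc s) n (pl (Z (Suc s)) n (f (Suc s) n x) (h n (d (Suc s) n x))) = zr (Z s) n"
        using h x fd(2)[OF x] c Zd(2)[of s] by (simp add: mor_pl[OF Zd(3)])
      then show ?thesis using Z(2) mor_closed[OF m x] unfolding exact_positive_def by blast
    qed
    obtain g where g: "mor (P (Suc s)) (Z (Suc (Suc s))) g"
      "\<And>n x. x \<in> elts (P (Suc s)) n \<Longrightarrow> e (Suc (Suc s)) n (g n x) = pl (Z (Suc s)) n (f (Suc s) n x) (h n (d (Suc s) n x))"
      using projective_lift[OF P(2) Zd(1) Zd(1) Zd(3) m im] by blast
    have "e (Suc (Suc s)) n (g n (d (Suc (Suc s)) n x)) = f (Suc s) n (d (Suc (Suc s)) n x)"
      if x: "x \<in> elts (P (Suc (Suc s))) n" for n x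
    proof -
      have dx: "d (Suc (Suc s)) n x \<in> elts (P (Suc s)) n" by (rule mor_closed[OF Pd(3) x])
      have "h n (zr (P s) n) = zr (Z (Suc s)) n" using h Pd(2) Zd(2) by (intro mor_zr) auto
      then show ?thesis
        using g(2)[OF dx] Pd(4)[OF x] mor_closed[OF fd(1) dx] Zd(2) by simp
    qed
    then show "\<exists>g. ?P (Suc s) g \<and> ?Q s h g" using g by auto
  qed
  then obtain h where h: "\<forall>s. ?P s (h s) \<and> ?Q s (h s) (h (Suc s))" ..
  show ?thesis
  proof (intro exI[of _ h] conjI allI ballI)
    show "mor (P s) (Z (Suc s)) (h s)" for s using h by blast
    show "f 0 n x = e 1 n (h 0 n x)" if "x \<in> elts (P 0) n" for n x using h that by simp
    fix s n x assume x: "x \<in> elts (P (Suc s)) n"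
    have "h s n (d (Suc s) n x) \<in> elts (Z (Suc s)) n"
      using h mor_closed[OF Pd(3) x] by (blast intro: mor_closed)
    then show "f (Suc s) n x = pl (Z (Suc s)) n (e (Suc (Suc s)) n (h (Suc s) n x)) (h s n (d (Suc s) n x))"
      using h x Zd(2)[of "Suc s"] mor_closed[OF fd(1) x] by (simp add: pl_assoc)
  qed
qed

text \<open>Agrees with \<open>projective_resolution\<close> up to restricting the differentials to
  the elements of the modules, which lets maps be given by arbitrary formulas.\<close>

definition resolution :: "'u gmod \<Rightarrow> (nat \<Rightarrow> 'u gmod) \<Rightarrow> (nat \<Rightarrow> nat \<Rightarrow> 'u \<Rightarrow> 'u) \<Rightarrow> bool" where
  "resolution A P d \<longleftrightarrow> (\<forall>s. projective_U (P s)) \<and> chain_complex P d \<and> exact_positive P d \<and>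
    mor (P 0) A (d 0) \<and> (\<forall>n. d 0 n ` elts (P 0) n = elts A n) \<and>
    (\<forall>n. \<forall>x\<in>elts (P 0) n. d 0 n x = zr A n \<longleftrightarrow> x \<in> d 1 n ` elts (P 1) n)"

lemma resolution_if_projective_resolution:
  assumes "projective_resolution A P d"
  shows "resolution A P d"
proof -
  have um: "um (P s)" and m: "mor (P (Suc s)) (P s) (d (Suc s))" and k: "kernel (comp (P (Suc s)) n) (comp (P s) n) (d (Suc s) n) =
           d (Suc (Suc s)) n ` elts (P (Suc (Suc s))) n" for s n
    using assms by (simp_all add: projective_resolution_def Hom_U_iff)
  have k': "kernel (comp (P 0) n) (comp A n) (d 0 n) = d 1 n ` elts (P 1) n" for n
    using assms by (simp add: projective_resolution_def)
  have "chain_complex P d"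
    unfolding chain_complex_def
  proof (intro conjI allI ballI um m)
    fix s n x assume "x \<in> elts (P (Suc (Suc s))) n"
    then have "d (Suc (Suc s)) n x \<in> kernel (comp (P (Suc s)) n) (comp (P s) n) (d (Suc s) n)"
      unfolding k by blast
    then show "d (Suc s) n (d (Suc (Suc s)) n x) = zr (P s) n" by (simp add: kernel_def)
  qed
  moreover have "exact_positive P d"
    unfolding exact_positive_def using k by (auto simp: kernel_def)
  moreover have "d 0 n x = zr A n \<longleftrightarrow> x \<in> d 1 n ` elts (P 1) n" if "x \<in> elts (P 0) n" for n x
    using that unfolding k'[symmetric] by (simp add: kernel_def)
  ultimately show ?thesis
    using assms by (simp add: resolution_def projective_resolution_def Hom_U_iff)
qed

lemma projective_resolution_if_resolution:
  assumes "resolution A P d"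
  shows "projective_resolution A P (\<lambda>s. restr (P s) (d s))"
proof -
  have c: "chain_complex P d" using assms by (simp add: resolution_def)
  note cd = chain_complexD[OF c]
  have im: "restr (P s) (d s) n ` elts (P s) n = d s n ` elts (P s) n" for s n
    by (rule image_cong) simp_all
  have k: "{x \<in> elts (P (Suc s)) n. restr (P (Suc s)) (d (Suc s)) n x = zr (P s) n}
      = d (Suc (Suc s)) n ` elts (P (Suc (Suc s))) n" for s n
    using assms cd(4) mor_closed[OF cd(3)] unfolding resolution_def exact_positive_def by auto
  have k0: "{x \<in> elts (P 0) n. restr (P 0) (d 0) n x = zr A n} = d 1 n ` elts (P 1) n" for n
    using assms mor_closed[OF cd(3)[of 0]] unfolding resolution_def by auto
  show ?thesis
    unfolding projective_resolution_def kernel_def im k k0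
    using assms cd by (auto simp: resolution_def intro!: restr_Hom_U)
qed

lemma resolutionD:
  assumes "resolution A P d"
  shows "projective_U (P s)" "chain_complex P d" "exact_positive P d" "mor (P 0) A (d 0)"
    "d 0 n ` elts (P 0) n = elts A n"
    "x \<in> elts (P 0) n \<Longrightarrow> d 0 n x = zr A n \<longleftrightarrow> x \<in> d 1 n ` elts (P 1) n"
  using assms unfolding resolution_def by auto

text \<open>Each stage of the recursion holds a module together with a projective cover of it; the
  next module is the kernel of the cover, a submodule and thus on the same type.\<close>

lemma resolution_exists_if_covers:
  fixes A :: "'u gmod"
  assumes cover: "\<And>M :: 'u gmod. um M \<Longrightarrow> \<exists>(P :: 'u gmod) f. projective_U P \<and> mor P M f \<and> (\<forall>n. f n ` elts P n = elts M n)"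
    and A: "um A"
  obtains P d where "resolution A P d"
proof -
  define K :: "'u gmod \<Rightarrow> 'u gmod \<Rightarrow> (nat \<Rightarrow> 'u \<Rightarrow> 'u) \<Rightarrow> 'u gmod" where
    "K = (\<lambda>M P f. sub_gmod P (\<lambda>n. {x \<in> elts P n. f n x = zr M n}))"
  let ?P = "\<lambda>(s::nat) (M :: 'u gmod, P :: 'u gmod, f). um M \<and> projective_U P \<and> mor P M f \<and> (\<forall>n. f n ` elts P n = elts M n) \<and> (s = 0 \<longrightarrow> M = A)"
  let ?Q = "\<lambda>(s::nat) (M, P, f) (M' :: 'u gmod, P' :: 'u gmod, f' :: nat \<Rightarrow> 'u \<Rightarrow> 'u). M' = K M P f"
  have "\<exists>c. \<forall>s. ?P s (c s) \<and> ?Q s (c s) (c (Suc s))"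
  proof (rule dependent_nat_choice)
    obtain P :: "'u gmod" and f where "projective_U P" "mor P A f" "\<forall>n. f n ` elts P n = elts A n"
      using cover[OF A] by blast
    then have "?P 0 (A, P, f)" using A by simp
    then show "\<exists>c. ?P 0 c" by (rule exI)
    fix c s assume c: "?P s c"
    obtain M P f where [simp]: "c = (M, P, f)" by (cases c)
    have "um (K M P f)"
      unfolding K_def using c by (intro um_sub submod_kernel[where N = M]) auto
    moreover obtain P' :: "'u gmod" and f' where "projective_U P'" "mor P' (K M P f) f'" "\<forall>n. f' n ` elts P' n = elts (K M P f) n"
      using cover[OF \<open>um (K M P f)\<close>] by blast
    ultimately have "?P (Suc s) (K M P f, P', f') \<and> ?Q s c (K M P f, P', f')" by simp
    then show "\<exists>c'. ?P (Suc s) c' \<and> ?Q s c c'" by (rule exI)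
  qed
  then obtain c where c: "\<And>s. ?P s (c s) \<and> ?Q s (c s) (c (Suc s))" by blast
  define M where "M s = fst (c s)" for s
  define P where "P s = fst (snd (c s))" for s
  define f where "f s = snd (snd (c s))" for s
  have M0: "M 0 = A" and MS: "M (Suc s) = K (M s) (P s) (f s)" and umM: "um (M s)"
    and P: "projective_U (P s)" and f: "mor (P s) (M s) (f s)" and im: "f s n ` elts (P s) n = elts (M s) n" for s n
  proof -
    have e: "c s = (M s, P s, f s)" for s by (simp add: M_def P_def f_def)
    show "M 0 = A" "M (Suc s) = K (M s) (P s) (f s)" "um (M s)" "projective_U (P s)" "mor (P s) (M s) (f s)"
      "f s n ` elts (P s) n = elts (M s) n" for s n
      using c[of s] c[of 0] unfolding e by simp_all
  qed
  have elM: "elts (M (Suc s)) n = {x \<in> elts (P s) n. f s n x = zr (M s) n}"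
    and plM: "pl (M (Suc s)) n = pl (P s) n" and zrM: "zr (M (Suc s)) n = zr (P s) n"
    and actM: "act (M (Suc s)) = act (P s)" for s n
    by (simp_all add: MS K_def)
  have fS: "mor (P (Suc s)) (P s) (f (Suc s))" for s
    using mor_closed[OF f[of "Suc s"]] mor_pl[OF f[of "Suc s"]] mor_act[OF f[of "Suc s"]]
    by (intro morI) (auto simp: elM plM actM)
  have cc: "chain_complex P f"
    unfolding chain_complex_def
  proof (intro conjI allI ballI fS)
    fix s n x assume x: "x \<in> elts (P (Suc (Suc s))) n"
    have "f (Suc (Suc s)) n x \<in> elts (M (Suc (Suc s))) n" by (rule mor_closed[OF f x])
    then show "f (Suc s) n (f (Suc (Suc s)) n x) = zr (P s) n" by (simp add: elM zrM)
  qed (use P in simp)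
  have ex: "exact_positive P f"
    unfolding exact_positive_def
  proof (intro allI ballI impI)
    fix s n x assume "x \<in> elts (P (Suc s)) n" "f (Suc s) n x = zr (P s) n"
    then have "x \<in> elts (M (Suc (Suc s))) n" by (simp add: elM zrM)
    then show "x \<in> f (Suc (Suc s)) n ` elts (P (Suc (Suc s))) n" by (simp add: im)
  qed
  have "f 0 n x = zr A n \<longleftrightarrow> x \<in> f 1 n ` elts (P 1) n" if "x \<in> elts (P 0) n" for n x
    using that im[of "Suc 0" n] elM[of 0 n] M0 by simp
  then have "resolution A P f"
    unfolding resolution_def using P cc ex f[of 0] im[of 0] M0 by simp
  then show ?thesis by (rule that)
qed

lemma resolution_chain_map:
  assumes P: "resolution A P d" and Q: "resolution A Q e" and A: "um A"
  obtains a where "chain_map P d Q e a" "\<And>n x. x \<in> elts (P 0) n \<Longrightarrow> e 0 n (a 0 n x) = d 0 n x"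
proof -
  note Pd = resolutionD[OF P] and Qd = resolutionD[OF Q]
  have "d 0 n x \<in> e 0 n ` elts (Q 0) n" if "x \<in> elts (P 0) n" for n x
    unfolding Qd(5) using mor_closed[OF Pd(4) that] .
  then obtain f0 where f0: "mor (P 0) (Q 0) f0" "\<And>n x. x \<in> elts (P 0) n \<Longrightarrow> e 0 n (f0 n x) = d 0 n x"
    using projective_lift[OF Pd(1) projective_um[OF Qd(1)] A Qd(4) Pd(4)] by blast
  have "f0 n (d 1 n x) \<in> e 1 n ` elts (Q 1) n" if x: "x \<in> elts (P 1) n" for n x
  proof -
    have dx: "d 1 n x \<in> elts (P 0) n"
      using mor_closed[OF chain_complexD(3)[OF Pd(2), of 0]] x by simp
    then have "d 0 n (d 1 n x) = zr A n" using Pd(6) x by blast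
    then show ?thesis using Qd(6)[OF mor_closed[OF f0(1) dx]] f0(2)[OF dx] by simp
  qed
  then obtain a where "a 0 = f0" "chain_map P d Q e a"
    using chain_lift[OF Pd(2,1) Qd(2,3) f0(1)] by blast
  then show ?thesis using that f0(2) by simp
qed

text \<open>The sum of \<open>f\<close> and the identity is zero on homology, so
  \<open>chain_homotopy\<close> contracts it. The formula is stated in positive degrees, where
  cochains will be compared.\<close>

lemma resolution_homotopy:
  assumes P: "resolution A P d" and A: "um A" and f: "chain_map P d P d f"
    and f0: "\<forall>n. \<forall>x\<in>elts (P 0) n. d 0 n (f 0 n x) = d 0 n x"
  shows "\<exists>h. (\<forall>s. mor (P s) (P (Suc s)) (h s)) \<and> (\<forall>s n. \<forall>x\<in>elts (P (Suc s)) n.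
      f (Suc s) n x = pl (P (Suc s)) n x (pl (P (Suc s)) n (d (Suc (Suc s)) n (h (Suc s) n x)) (h s n (d (Suc s) n x))))"
proof -
  note Pd = resolutionD[OF P] and cd = chain_complexD[OF resolutionD(2)[OF P]] and fd = chain_mapD[OF f]
  let ?g = "\<lambda>s n x. pl (P s) n (f s n x) x"
  have g: "chain_map P d P d ?g"
    unfolding chain_map_def
  proof (intro conjI allI ballI)
    show "mor (P s) (P s) (?g s)" for s by (intro mor_add cd fd mor_id)
    show "d (Suc s) n (?g (Suc s) n x) = ?g s n (d (Suc s) n x)" if "x \<in> elts (P (Suc s)) n" for s n x
      using that mor_closed[OF fd(1) that] by (simp add: mor_pl[OF cd(3)] fd(2))
  qed
  have "?g 0 n x \<in> d 1 n ` elts (P 1) n" if x: "x \<in> elts (P 0) n" for n x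
  proof -
    have c: "f 0 n x \<in> elts (P 0) n" by (rule mor_closed[OF fd(1) x])
    have "d 0 n (?g 0 n x) = zr A n"
      using mor_pl[OF Pd(4) c x] f0 x mor_closed[OF Pd(4) x] A by simp
    then show ?thesis using Pd(6)[of "?g 0 n x" n] c x cd(2)[of 0] by simp
  qed
  then have g0: "\<forall>n. \<forall>x\<in>elts (P 0) n. ?g 0 n x \<in> d 1 n ` elts (P 1) n" by blast
  obtain h where h: "\<forall>s. mor (P s) (P (Suc s)) (h s)"
    "\<forall>s n. \<forall>x\<in>elts (P (Suc s)) n.
      ?g (Suc s) n x = pl (P (Suc s)) n (d (Suc (Suc s)) n (h (Suc s) n x)) (h s n (d (Suc s) n x))"
    using chain_homotopy[OF Pd(2,1) Pd(2,3) g g0] by (elim exE conjE) (rule that)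
  show ?thesis
  proof (intro exI[of _ h] conjI h(1) allI ballI)
    fix s n x assume x: "x \<in> elts (P (Suc s)) n"
    have "f (Suc s) n x = pl (P (Suc s)) n x (?g (Suc s) n x)"
      using x mor_closed[OF fd(1) x] cd(2) by (simp add: pl_ac)
    then show "f (Suc s) n x = pl (P (Suc s)) n x (pl (P (Suc s)) n (d (Suc (Suc s)) n (h (Suc s) n x)) (h s n (d (Suc s) n x)))"
      using h(2) x by simp
  qed
qed

section \<open>Free unstable modules\<close>

inductive gspan :: "'a gmod \<Rightarrow> (nat \<times> 'a) set \<Rightarrow> nat \<Rightarrow> 'a \<Rightarrow> bool" for M E where
  zero: "gspan M E n (zr M n)"
| gen: "(n, x) \<in> E \<Longrightarrow> gspan M E n x"
| add: "gspan M E n x \<Longrightarrow> gspan M E n y \<Longrightarrow> gspan M E n (pl M n x y)"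
| act: "gspan M E n x \<Longrightarrow> r \<in> Steenrod_deg k \<Longrightarrow> gspan M E (n + k) (act M k n r x)"

lemma span_closed:
  assumes "gm M" "\<And>n x. (n, x) \<in> E \<Longrightarrow> x \<in> elts M n" "gspan M E n x"
  shows "x \<in> elts M n"
  using assms(3,1,2) by induction auto

lemma submod_span:
  assumes "gm M" "\<And>n x. (n, x) \<in> E \<Longrightarrow> x \<in> elts M n"
  shows "submod M (\<lambda>n. {x. gspan M E n x})"
  by (rule submodI) (auto intro: gspan.intros span_closed[OF assms])

text \<open>A countable syntax for the elements of a span: \<open>Gen\<close> and \<open>Act\<close>
  refer to enumerations of the generators and of the homogeneous algebra elements by natural
  numbers.\<close>

datatype span_term = Zero nat | Gen nat | Add span_term span_term | Act nat nat span_term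

instance span_term :: countable by countable_datatype

primrec span_val :: "'a gmod \<Rightarrow> (nat \<times> 'a) set \<Rightarrow> span_term \<Rightarrow> nat \<times> 'a" where
  "span_val M E (Zero n) = (n, zr M n)"
| "span_val M E (Gen i) = from_nat_into E i"
| "span_val M E (Add s t) = (let n = fst (span_val M E s) in (n, pl M n (snd (span_val M E s)) (snd (span_val M E t))))"
| "span_val M E (Act k i t) = (let n = fst (span_val M E t) in
     (n + k, act M k n (from_nat_into (Steenrod_deg k) i) (snd (span_val M E t))))"

lemma countable_span:
  assumes "countable E"
  shows "countable {x. gspan M E n x}"
proof -
  have "\<exists>t. span_val M E t = (n, x)" if "gspan M E n x" for x
    using that
  proof induction
    case (zero n)
    show ?case by (rule exI[of _ "Zero n"]) simp
  next
    case (gen n x)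
    then show ?case
      using assms by (intro exI[of _ "Gen (to_nat_on E (n, x))"]) simp
  next
    case (add n x y)
    then obtain s t where "span_val M E s = (n, x)" "span_val M E t = (n, y)" by blast
    then show ?case by (intro exI[of _ "Add s t"]) simp
  next
    case (act n x r k)
    then obtain t where "span_val M E t = (n, x)" by blast
    then show ?case
      using act(2) countable_Steenrod_deg[of k]
      by (intro exI[of _ "Act k (to_nat_on (Steenrod_deg k) r) t"]) simp
  qed
  then have "{x. gspan M E n x} \<subseteq> snd ` range (span_val M E)"
    by (auto simp: image_iff) (metis snd_conv)
  then show ?thesis by (rule countable_subset) simp
qed

text \<open>An enumeration of the span transports its structure to \<open>int\<close>. Thus modules
  built on large types, such as products and spaces of polynomials, yield modules to which
  \<open>projective_U\<close> on \<open>int\<close> applies.\<close>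

lemma span_copy:
  fixes M :: "'a gmod"
  assumes M: "um M" and E: "countable E" "\<And>n x. (n, x) \<in> E \<Longrightarrow> x \<in> elts M n"
  shows "\<exists>(F :: int gmod) i. um F \<and> mor F M i \<and> (\<forall>n. inj_on (i n) (elts F n)) \<and>
    (\<forall>n. i n ` elts F n = {x. gspan M E n x})"
proof -
  let ?A = "\<lambda>n. {x. gspan M E n x}"
  let ?S = "sub_gmod M ?A"
  define h where "h n x = int (to_nat_on (?A n) x)" for n x
  have A: "submod M ?A" by (rule submod_span[OF um_gm[OF M] E(2)])
  have inj: "inj_on (h n) (elts ?S n)" for n
    using inj_on_to_nat_on[OF countable_span[OF E(1)], of M n] by (auto simp: inj_on_def h_def)
  note F = copy_gmod[OF um_sub[OF M A] inj]
  let ?k = "\<lambda>n. inv_into (?A n) (h n)"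
  have "mor (copy_gmod h ?S) M ?k"
    using mor_comp[OF F(4) mor_sub_incl[OF A]] by simp
  moreover have "inj_on (?k n) (elts (copy_gmod h ?S) n)" for n
    unfolding F(3) by (simp add: inj_on_inv_into)
  moreover have "?k n ` elts (copy_gmod h ?S) n = ?A n" for n
    unfolding F(3) using inj[of n] by (simp add: inv_into_image_cancel)
  ultimately show ?thesis using F(1) by blast
qed

text \<open>Every expression in the generators can be evaluated in \<open>F\<close> already. When
  \<open>i\<close> is injective, this shows that \<open>F\<close> is generated by the preimages of
  the generators.\<close>

lemma span_reflect:
  assumes F: "gm F" and i: "mor F M i" "gm M" and E: "\<And>n x. (n, x) \<in> E \<Longrightarrow> \<exists>y. (n, y) \<in> E' \<and> i n y = x"
    and E': "\<And>n y. (n, y) \<in> E' \<Longrightarrow> y \<in> elts F n"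
    and "gspan M E n x"
  shows "\<exists>y. gspan F E' n y \<and> i n y = x"
  using assms(6)
proof induction
  case (zero n)
  then show ?case using mor_zr[OF F i(2,1)] gspan.zero by metis
next
  case (gen n x)
  then show ?case using E gspan.gen by metis
next
  case (add n x y)
  then obtain x' y' where "gspan F E' n x'" "i n x' = x" "gspan F E' n y'" "i n y' = y" by blast
  then show ?case
    using mor_pl[OF i(1), of x' n y'] span_closed[OF F E'] gspan.add by metis
next
  case (act n x r k)
  then obtain x' where "gspan F E' n x'" "i n x' = x" by blast
  then show ?case
    using mor_act[OF i(1) act(2), of x' n] span_closed[OF F E'] gspan.act act(2) by metis
qed

text \<open>\<open>G\<close> consists of labels with their degrees. Maps are required to exist only
  into modules on \<open>int\<close>, the range of the quantifiers in projectivity on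
  \<open>int\<close>; generation is a separate clause and gives uniqueness for targets on any
  type.\<close>

definition is_free :: "(nat \<times> int) set \<Rightarrow> int gmod \<Rightarrow> (nat \<Rightarrow> int \<Rightarrow> int) \<Rightarrow> bool" where
  "is_free G F e \<longleftrightarrow> um F \<and> (\<forall>(n, x)\<in>G. e n x \<in> elts F n) \<and>
    (\<forall>(M :: int gmod) \<phi>. um M \<and> (\<forall>(n, x)\<in>G. \<phi> n x \<in> elts M n) \<longrightarrow>
      (\<exists>f. mor F M f \<and> (\<forall>(n, x)\<in>G. f n (e n x) = \<phi> n x))) \<and>
    (\<forall>n. \<forall>y\<in>elts F n. gspan F ((\<lambda>(n, x). (n, e n x)) ` G) n y)"

text \<open>
  The free module is generated by the tautological families inside the product of all targets
  \<open>(M, \<phi>)\<close> of the generators, so that its universal property is a projection. It has a copy on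
  \<^typ>\<open>int\<close> because it is countable.
\<close>

lemma free_exists: "\<exists>F e. is_free G F e"
proof -
  define I :: "(int gmod \<times> (nat \<Rightarrow> int \<Rightarrow> int)) set" where
    "I = {(M, \<phi>). um M \<and> (\<forall>(n, x)\<in>G. \<phi> n x \<in> elts M n)}"
  define T where "T = prod_gmod I fst"
  define \<epsilon> where "\<epsilon> n x = (\<lambda>i\<in>I. snd i n x)" for n x
  define E where "E = (\<lambda>(n, x). (n, \<epsilon> n x)) ` G"
  have T: "um T" unfolding T_def by (rule um_prod) (auto simp: I_def)
  have \<epsilon>: "\<epsilon> n x \<in> elts T n" if "(n, x) \<in> G" for n x
    using that by (auto simp: \<epsilon>_def T_def I_def)
  have E: "countable E" "\<And>n x. (n, x) \<in> E \<Longrightarrow> x \<in> elts T n"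
    using \<epsilon> by (auto simp: E_def)
  obtain F :: "int gmod" and i where F: "um F" "mor F T i" "\<forall>n. inj_on (i n) (elts F n)"
    "\<forall>n. i n ` elts F n = {x. gspan T E n x}" using span_copy[OF T E] by blast
  define e where "e n x = inv_into (elts F n) (i n) (\<epsilon> n x)" for n x
  have "\<epsilon> n x \<in> i n ` elts F n" if "(n, x) \<in> G" for n x
    using F(4) that by (auto simp: E_def intro!: gspan.gen)
  then have e: "e n x \<in> elts F n" "i n (e n x) = \<epsilon> n x" if "(n, x) \<in> G" for n x
    unfolding e_def using that by (simp_all add: inv_into_into f_inv_into_f)
  have "\<exists>f. mor F M f \<and> (\<forall>(n, x)\<in>G. f n (e n x) = \<phi> n x)"
    if "um M" "\<forall>(n, x)\<in>G. \<phi> n x \<in> elts M n" for M :: "int gmod" and \<phi>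
  proof -
    have I: "(M, \<phi>) \<in> I" using that by (simp add: I_def)
    have m: "mor F M (\<lambda>n y. i n y (M, \<phi>))"
      using mor_comp[OF F(2)[unfolded T_def] mor_proj[OF I]] by simp
    have "i n (e n x) (M, \<phi>) = \<phi> n x" if "(n, x) \<in> G" for n x
      using e(2)[OF that] I by (simp add: \<epsilon>_def)
    with m show ?thesis by blast
  qed
  moreover have "gspan F ((\<lambda>(n, x). (n, e n x)) ` G) n y" if y: "y \<in> elts F n" for n y
  proof -
    let ?E = "(\<lambda>(n, x). (n, e n x)) ` G"
    have 1: "\<exists>y. (n, y) \<in> ?E \<and> i n y = z" if nz: "(n, z) \<in> E" for n z
    proof -
      obtain x where x: "(n, x) \<in> G" "z = \<epsilon> n x" using nz by (auto simp: E_def)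
      then show ?thesis using e(2)[OF x(1)] by (intro exI[of _ "e n x"]) auto
    qed
    have 2: "y \<in> elts F n" if "(n, y) \<in> ?E" for n y
      using that e(1) by auto
    have "gspan T E n (i n y)" using F(4) y by blast
    then obtain y' where y': "gspan F ((\<lambda>(n, x). (n, e n x)) ` G) n y'" "i n y' = i n y"
      using span_reflect[OF um_gm[OF F(1)] F(2) um_gm[OF T] 1 2] by blast
    have "y' \<in> elts F n"
      by (rule span_closed[OF um_gm[OF F(1)] 2 y'(1)])
    then have "y' = y" using inj_onD[OF F(3)[rule_format] y'(2)] y by blast
    then show ?thesis using y'(1) by simp
  qed
  ultimately have "is_free G F e" using F(1) e by (auto simp: is_free_def)
  then show ?thesis by blast
qed

context
  fixes G F e assumes free: "is_free G F e"
begin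

lemma free_um: "um F" using free by (simp add: is_free_def)

lemma free_gen: "(n, x) \<in> G \<Longrightarrow> e n x \<in> elts F n" using free by (auto simp: is_free_def)

lemma free_span: "y \<in> elts F n \<Longrightarrow> gspan F ((\<lambda>(n, x). (n, e n x)) ` G) n y"
  using free by (auto simp: is_free_def)

lemma free_map:
  fixes M :: "int gmod"
  assumes "um M" "\<And>n x. (n, x) \<in> G \<Longrightarrow> \<phi> n x \<in> elts M n"
  obtains f where "mor F M f" "\<And>n x. (n, x) \<in> G \<Longrightarrow> f n (e n x) = \<phi> n x"
proof -
  have "um M \<and> (\<forall>(n, x)\<in>G. \<phi> n x \<in> elts M n)" using assms by auto
  then obtain f where "mor F M f" "\<forall>(n, x)\<in>G. f n (e n x) = \<phi> n x"
    using free unfolding is_free_def by blast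
  then show ?thesis by (intro that[of f]) auto
qed

lemma free_map_unique:
  assumes N: "gm N" and f: "mor F N f" and g: "mor F N g"
    and eq: "\<And>n x. (n, x) \<in> G \<Longrightarrow> f n (e n x) = g n (e n x)" and y: "y \<in> elts F n"
  shows "f n y = g n y"
proof -
  note gm = um_gm[OF free_um]
  have "y \<in> elts F n \<and> f n y = g n y"
    using free_span[OF y]
  proof induction
    case (zero n)
    then show ?case using mor_zr[OF gm N f] mor_zr[OF gm N g] gm by simp
  next
    case (gen n x)
    then show ?case using eq free_gen by auto
  next
    case (add n x y)
    then show ?case using mor_pl[OF f] mor_pl[OF g] gm by simp
  next
    case (act n x r k)
    then show ?case using mor_act[OF f] mor_act[OF g] gm by simp
  qed
  then show ?thesis ..
qed

lemma free_projective: "projective_U F"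
proof (rule projectiveI[OF free_um])
  fix M N :: "int gmod" and g f
  assume M: "um M" and N: "um N" and g: "mor M N g" and f: "mor F N f"
    and surj: "\<And>n. g n ` elts M n = elts N n"
  define \<phi> where "\<phi> n x = inv_into (elts M n) (g n) (f n (e n x))" for n x
  have "f n (e n x) \<in> g n ` elts M n" if "(n, x) \<in> G" for n x
    unfolding surj using mor_closed[OF f free_gen[OF that]] .
  then have \<phi>: "\<phi> n x \<in> elts M n" "g n (\<phi> n x) = f n (e n x)" if "(n, x) \<in> G" for n x
    using that by (simp_all add: \<phi>_def inv_into_into f_inv_into_f)
  obtain h where h: "mor F M h" "\<And>n x. (n, x) \<in> G \<Longrightarrow> h n (e n x) = \<phi> n x"
    using free_map[OF M, of \<phi>] \<phi> by metis
  have "g n (h n y) = f n y" if "y \<in> elts F n" for n y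
    by (rule free_map_unique[OF um_gm[OF N] mor_comp[OF h(1) g] f _ that]) (simp add: h \<phi>)
  with h show "\<exists>h. mor F M h \<and> (\<forall>n. \<forall>x\<in>elts F n. g n (h n x) = f n x)" by blast
qed

end

text \<open>Elements of \<open>M\<close> are integers and can serve as labels, so all homogeneous
  elements are taken as generators.\<close>

lemma free_cover:
  fixes M :: "int gmod"
  assumes "um M"
  obtains G F e f where "is_free G F e" "mor F M f" "\<forall>n. f n ` elts F n = elts M n"
proof -
  define G where "G = {(n, x). x \<in> elts M n}"
  obtain F e where F: "is_free G F e" using free_exists by blast
  obtain f where f: "mor F M f" "\<And>n x. (n, x) \<in> G \<Longrightarrow> f n (e n x) = x"
    using free_map[OF F assms, of "\<lambda>n x. x"] by (auto simp: G_def)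
  have "f n ` elts F n = elts M n" for n
  proof
    show "f n ` elts F n \<subseteq> elts M n" using f(1) by auto
    show "elts M n \<subseteq> f n ` elts F n"
    proof
      fix x assume "x \<in> elts M n"
      then have "(n, x) \<in> G" by (simp add: G_def)
      then show "x \<in> f n ` elts F n"
        using f(2) free_gen[OF F] by (metis imageI)
    qed
  qed
  then show ?thesis using that F f(1) by blast
qed

lemma resolution_exists:
  fixes A :: "int gmod"
  assumes "um A"
  obtains P d where "resolution A P d"
proof (rule resolution_exists_if_covers[OF _ assms])
  fix M :: "int gmod" assume "um M"
  then obtain G F e f where "is_free G F e" "mor F M f" "\<forall>n. f n ` elts F n = elts M n"
    by (rule free_cover)
  then show "\<exists>(P :: int gmod) f. projective_U P \<and> mor P M f \<and> (\<forall>n. f n ` elts P n = elts M n)"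
    using free_projective by blast
qed

section \<open>Tensor powers of the free module on one generator of degree one\<close>

text \<open>
  A list \<open>[a\<^sub>1, \<dots>, a\<^sub>m]\<close> stands for the monomial \<open>x\<^sub>1\<^bsup>2^a\<^sub>1\<^esup> \<dots> x\<^sub>m\<^bsup>2^a\<^sub>m\<^esup>\<close> in the cohomology of an elementary
  abelian 2-group, and vectors are coefficient functions. The square of degree \<open>k\<close> replaces \<open>a\<^sub>i\<close> by
  \<open>a\<^sub>i + 1\<close> for all \<open>i\<close> in some \<open>J\<close> with \<open>(\<Sum>i\<in>J. 2^a\<^sub>i) = k\<close>; the equations below compute the coefficient of the
  target monomial.
\<close>

fun sqc :: "nat \<Rightarrow> (nat list \<Rightarrow> 'r :: comm_ring_1) \<Rightarrow> nat list \<Rightarrow> 'r" where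
  "sqc k g [] = (if k = 0 then g [] else 0)"
| "sqc k g (0 # c) = sqc k (\<lambda>l. g (0 # l)) c"
| "sqc k g (Suc j # c) = sqc k (\<lambda>l. g (Suc j # l)) c +
     (if 2 ^ j \<le> k then sqc (k - 2 ^ j) (\<lambda>l. g (j # l)) c else 0)"

definition mdeg :: "nat list \<Rightarrow> nat" where
  "mdeg l = (\<Sum>a\<leftarrow>l. 2 ^ a)"

lemma mdeg_simps [simp]: "mdeg [] = 0" "mdeg (a # l) = 2 ^ a + mdeg l"
  by (simp_all add: mdeg_def)

lemma sqc_zero [simp]: "sqc k (\<lambda>l. 0) c = 0"
  by (induction k "\<lambda>l::nat list. 0::'a" c rule: sqc.induct) auto

lemma sqc_add: "sqc k (\<lambda>l. g l + h l) c = sqc k g c + sqc k h c"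
  by (induction k g c arbitrary: h rule: sqc.induct) simp_all

lemma sqc_scale: "sqc k (\<lambda>l. a * g l) c = a * sqc k g c"
  by (induction k g c rule: sqc.induct) (simp_all add: distrib_left)

lemma sqc_sum: "sqc k (\<lambda>l. \<Sum>i\<in>I. g i l) c = (\<Sum>i\<in>I. sqc k (g i) c)"
  by (induction I rule: infinite_finite_induct) (simp_all add: sqc_add)

text \<open>Squaring a factor of degree 2^a adds 2^a to the degree. Hence Sq^k reaches
  \<open>c\<close> only from monomials of degree \<open>mdeg c - k\<close>, and the squared factors
  alone have degree k, so \<open>k \<le> mdeg l\<close>. The second bound is the source of
  instability.\<close>

lemma sqc_cong:
  assumes "\<And>l. mdeg l + k = mdeg c \<Longrightarrow> k \<le> mdeg l \<Longrightarrow> g l = h l"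
  shows "sqc k g c = sqc k h c"
  using assms
proof (induction k g c arbitrary: h rule: sqc.induct)
  case (3 k g j c)
  have "sqc k (\<lambda>l. g (Suc j # l)) c = sqc k (\<lambda>l. h (Suc j # l)) c"
    using 3(3) by (intro 3(1)) auto
  moreover have "sqc (k - 2 ^ j) (\<lambda>l. g (j # l)) c = sqc (k - 2 ^ j) (\<lambda>l. h (j # l)) c" if "2 ^ j \<le> k"
    using 3(3) that by (intro 3(2)) auto
  ultimately show ?case by simp
qed auto

lemma sqc_eq_zero:
  assumes "\<And>l. mdeg l + k = mdeg c \<Longrightarrow> k \<le> mdeg l \<Longrightarrow> g l = 0"
  shows "sqc k g c = 0"
  using sqc_cong[of k c g "\<lambda>l. 0"] assms by simp

lemma sqc_0 [simp]: "sqc 0 g c = g c"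
  by (induction "0::nat" g c rule: sqc.induct) auto

text \<open>The top square is the squaring map: the coefficient of \<open>l\<close> reappears at the
  monomial with all exponents doubled.\<close>

lemma sqc_map_Suc: "sqc (mdeg l) g (map Suc l) = g l"
proof (induction l arbitrary: g)
  case (Cons j l)
  have d: "mdeg (map Suc l) = 2 * mdeg l" by (induction l) simp_all
  \<comment> \<open>If the first factor is not squared, the others would have to absorb a square of
    degree exceeding their own.\<close>
  have "sqc (2 ^ j + mdeg l) (\<lambda>l. g (Suc j # l)) (map Suc l) = 0"
  proof (rule sqc_eq_zero)
    fix l' assume "mdeg l' + (2 ^ j + mdeg l) = mdeg (map Suc l)" "2 ^ j + mdeg l \<le> mdeg l'"
    moreover have "(0::nat) < 2 ^ j" by simp
    ultimately show "g (Suc j # l') = 0" unfolding d by linarith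
  qed
  with Cons show ?case by simp
qed simp

text \<open>The total square, with its homogeneous components weighted by powers of \<open>\<alpha>\<close>.\<close>

fun tsq :: "'r :: comm_ring_1 \<Rightarrow> (nat list \<Rightarrow> 'r) \<Rightarrow> nat list \<Rightarrow> 'r" where
  "tsq \<alpha> g [] = g []"
| "tsq \<alpha> g (0 # c) = tsq \<alpha> (\<lambda>l. g (0 # l)) c"
| "tsq \<alpha> g (Suc j # c) = tsq \<alpha> (\<lambda>l. g (Suc j # l)) c + \<alpha> ^ 2 ^ j * tsq \<alpha> (\<lambda>l. g (j # l)) c"

lemma tsq_add: "tsq \<alpha> (\<lambda>l. g l + h l) c = tsq \<alpha> g c + tsq \<alpha> h c"
  by (induction \<alpha> g c arbitrary: h rule: tsq.induct) (simp_all add: distrib_left)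

lemma tsq_scale: "tsq \<alpha> (\<lambda>l. a * g l) c = a * tsq \<alpha> g c"
  by (induction \<alpha> g c rule: tsq.induct) (simp_all add: algebra_simps)

lemma sum_shift_le:
  assumes "q \<le> (K::nat)"
  shows "(\<Sum>k\<le>K. if q \<le> k then f k else 0) = (\<Sum>k\<le>K - q. f (k + q))"
proof -
  have "(\<Sum>k\<le>K. if q \<le> k then f k else 0) = (\<Sum>k\<in>{q..K}. f k)"
    by (rule sum.mono_neutral_cong_right) auto
  also have "\<dots> = (\<Sum>k\<le>K - q. f (k + q))"
    using assms by (intro sum.reindex_bij_witness[of _ "\<lambda>k. k + q" "\<lambda>k. k - q"]) auto
  finally show ?thesis .
qed

lemma tsq_eq_sum: "mdeg c \<le> K \<Longrightarrow> tsq \<alpha> g c = (\<Sum>k\<le>K. \<alpha> ^ k * sqc k g c)"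
proof (induction \<alpha> g c arbitrary: K rule: tsq.induct)
  case (1 \<alpha> g)
  have "(\<Sum>k\<le>K. \<alpha> ^ k * sqc k g []) = (\<Sum>k\<in>{0}. \<alpha> ^ k * sqc k g [])"
    by (rule sum.mono_neutral_right) auto
  then show ?case by simp
next
  case (3 \<alpha> g j c)
  have q: "2 ^ j \<le> K" "mdeg c \<le> K - 2 ^ j" "mdeg c \<le> K" using 3(3) by auto
  have "(\<Sum>k\<le>K. \<alpha> ^ k * sqc k g (Suc j # c)) = (\<Sum>k\<le>K. \<alpha> ^ k * sqc k (\<lambda>l. g (Suc j # l)) c) +
      (\<Sum>k\<le>K. if 2 ^ j \<le> k then \<alpha> ^ k * sqc (k - 2 ^ j) (\<lambda>l. g (j # l)) c else 0)"
    unfolding sum.distrib[symmetric] by (rule sum.cong) (simp_all add: distrib_left)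
  also have "(\<Sum>k\<le>K. if 2 ^ j \<le> k then \<alpha> ^ k * sqc (k - 2 ^ j) (\<lambda>l. g (j # l)) c else 0)
      = \<alpha> ^ 2 ^ j * (\<Sum>k\<le>K - 2 ^ j. \<alpha> ^ k * sqc k (\<lambda>l. g (j # l)) c)"
    by (simp add: sum_shift_le[OF q(1)] power_add sum_distrib_left mult_ac)
  finally show ?case using 3(1)[OF q(3)] 3(2)[OF q(2)] by simp
qed auto

lemma tsq_tsq_eq_sum:
  assumes "mdeg c \<le> K"
  shows "tsq \<alpha> (tsq \<beta> g) c = (\<Sum>k\<le>K. \<Sum>m\<le>K. \<alpha> ^ k * \<beta> ^ m * sqc k (sqc m g) c)"
proof -
  have "sqc k (tsq \<beta> g) c = (\<Sum>m\<le>K. \<beta> ^ m * sqc k (sqc m g) c)" for k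
  proof -
    have "sqc k (tsq \<beta> g) c = sqc k (\<lambda>l. \<Sum>m\<le>K. \<beta> ^ m * sqc m g l) c"
      using assms by (intro sqc_cong tsq_eq_sum) simp
    then show ?thesis by (simp add: sqc_sum sqc_scale)
  qed
  then show ?thesis by (simp add: tsq_eq_sum[OF assms] sum_distrib_left mult.assoc)
qed

lemma frobenius:
  assumes "(1::'r::comm_ring_1) + 1 = 0"
  shows "(a + b :: 'r) ^ 2 ^ n = a ^ 2 ^ n + b ^ 2 ^ n"
proof (induction n)
  case (Suc n)
  have "2 * x = (0::'r)" for x using assms by (metis mult_2 distrib_right mult_1 mult_zero_left)
  then have sq: "(x + y)\<^sup>2 = x\<^sup>2 + y\<^sup>2" for x y :: 'r by (simp add: power2_sum mult.assoc)
  have "(a + b) ^ 2 ^ Suc n = ((a + b) ^ 2 ^ n)\<^sup>2" by (simp add: power_mult mult.commute flip: power_mult)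
  then show ?case by (simp add: Suc sq) (simp add: mult.commute flip: power_mult)
qed simp

text \<open>The Bullett--Macdonald identity.\<close>

lemma tsq_tsq_cong:
  fixes \<alpha> \<beta> \<alpha>' \<beta>' :: "'r::comm_ring_1"
  assumes char2: "(1::'r) + 1 = 0" and s: "\<alpha> + \<beta> = \<alpha>' + \<beta>'" and p: "\<alpha>\<^sup>2 * \<beta> = \<alpha>'\<^sup>2 * \<beta>'"
  shows "tsq \<alpha> (tsq \<beta> g) c = tsq \<alpha>' (tsq \<beta>' g) c"
proof -
  \<comment> \<open>For a single variable the composite sends x^(2^i) to the sum of x^(2^i),
    (\<alpha> + \<beta>)^(2^i) x^(2^(i+1)) and (\<alpha>^2 \<beta>)^(2^i) x^(2^(i+2)). Only the sum
    and \<alpha>^2 \<beta> enter, and the total square is multiplicative.\<close>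
  have expand: "tsq \<alpha> (tsq \<beta> g) (Suc j # c) = tsq \<alpha> (tsq \<beta> (\<lambda>l. g (Suc j # l))) c +
      (\<alpha> + \<beta>) ^ 2 ^ j * tsq \<alpha> (tsq \<beta> (\<lambda>l. g (j # l))) c +
      (case j of 0 \<Rightarrow> 0 | Suc i \<Rightarrow> (\<alpha>\<^sup>2 * \<beta>) ^ 2 ^ i * tsq \<alpha> (tsq \<beta> (\<lambda>l. g (i # l))) c)"
    for \<alpha> \<beta> :: 'r and g j c
  proof -
    let ?D = "\<lambda>i. tsq \<alpha> (tsq \<beta> (\<lambda>l. g (i # l))) c"
    have S: "tsq \<alpha> (\<lambda>l. tsq \<beta> g (Suc i # l)) c = ?D (Suc i) + \<beta> ^ 2 ^ i * ?D i" for i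
      by (simp add: tsq_add tsq_scale)
    have alg: "(x + b * y) + a * (y + b' * z) = x + (a + b) * y + (a * b') * z" for a b b' x y z :: 'r
      by (simp add: distrib_left distrib_right add_ac mult_ac)
    show ?thesis
    proof (cases j)
      case 0
      then show ?thesis using S[of 0] alg[of "?D 1" \<beta> "?D 0" \<alpha> 0 0] by simp
    next
      case (Suc i)
      have "\<alpha> ^ 2 ^ Suc i * \<beta> ^ 2 ^ i = (\<alpha>\<^sup>2 * \<beta>) ^ 2 ^ i"
        unfolding power_mult_distrib by (simp flip: power_mult)
      then show ?thesis
        using S[of j] S[of i] alg[of "?D (Suc j)" "\<beta> ^ 2 ^ j" "?D j" "\<alpha> ^ 2 ^ j" "\<beta> ^ 2 ^ i" "?D i"]
        unfolding Suc frobenius[OF char2] by (simp only: tsq.simps nat.case)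
    qed
  qed
  show ?thesis
  proof (induction c arbitrary: g)
    case (Cons j c)
    show ?case
    proof (cases j)
      case (Suc i)
      then show ?thesis by (simp only: expand Cons s p)
    qed (simp add: Cons)
  qed simp
qed

subsection \<open>Extraction of the Adem relations\<close>

text \<open>\<open>binser A\<close> is the power series of \<open>1 / (1 + x)\<^bsup>A + 1\<^esup>\<close> in characteristic 2.\<close>

definition binser :: "nat \<Rightarrow> bit fps" where
  "binser A = Abs_fps (\<lambda>d. of_nat ((A + d) choose d))"

lemma fps_bit_char2: "(1 :: bit fps) + 1 = 0"
  by (rule fps_ext) (simp only: fps_add_nth bit_add_self fps_zero_nth)

text \<open>Pascal's rule, read modulo 2.\<close>

lemma binser_Suc: "(1 + fps_X) * binser (Suc A) = binser A"
proof (rule fps_ext)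
  fix d
  have "of_nat ((Suc A + Suc d) choose Suc d) + of_nat ((Suc A + d) choose d) = (of_nat ((A + Suc d) choose Suc d) :: bit)" for d
  proof -
    have "(Suc A + Suc d) choose Suc d = (Suc A + d choose d) + (A + Suc d choose Suc d)" by simp
    then show ?thesis by (simp only: of_nat_add) (metis add.commute add.left_commute add.right_neutral bit_add_self)
  qed
  then show "fps_nth ((1 + fps_X) * binser (Suc A)) d = fps_nth (binser A) d"
    by (cases d) (simp_all add: distrib_right binser_def del: binomial_Suc_Suc)
qed

lemma binser_0: "(1 + fps_X) * binser 0 = 1"
proof (rule fps_ext)
  fix d show "fps_nth ((1 + fps_X) * binser 0) d = fps_nth 1 d"
    by (cases d) (simp_all add: distrib_right binser_def)
qed

lemma binser_power: "k \<le> A \<Longrightarrow> (1 + fps_X) ^ k * binser A = binser (A - k)"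
proof (induction k)
  case (Suc k)
  then obtain B where "A - k = Suc B" "A - Suc k = B" by (metis Suc_diff_Suc Suc_le_eq)
  then show ?case using Suc binser_Suc[of B] by (simp only: power_Suc mult.assoc Suc_leD)
qed simp

lemma binser_power_Suc: "(1 + fps_X) ^ (Suc A + k) * binser A = (1 + fps_X) ^ k"
proof -
  have "(1 + fps_X) ^ (Suc A + k) * binser A = (1 + fps_X) ^ k * ((1 + fps_X) * ((1 + fps_X) ^ A * binser A))"
    by (simp add: power_add mult_ac)
  then show ?thesis using binser_power[of A A] by (simp add: binser_0)
qed

text \<open>Central binomial coefficients are even in positive degree. This is why the coefficient
  extracted below isolates one composite of squares.\<close>

lemma binser_diagonal: "fps_nth (binser d) d = of_bool (d = 0)"
proof (cases d)
  case (Suc e)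
  have "(d + d) choose d = 2 * ((e + d) choose e)"
  proof -
    have "(e + d) choose d = (e + d) choose e" using binomial_symmetric[of d "e + d"] by simp
    then show ?thesis using Suc by simp
  qed
  then show ?thesis using Suc by (simp add: binser_def of_nat_bit)
qed (simp add: binser_def)

lemma fps_nth_one_plus_X_power: "fps_nth ((1 + fps_X) ^ k :: bit fps) d = of_nat (k choose d)"
proof (induction k arbitrary: d)
  case (Suc k)
  show ?case
    by (cases d) (simp_all add: Suc distrib_right)
next
  case 0
  show ?case by (cases d) simp_all
qed

lemma sqc_const: "sqc k (\<lambda>l. fps_const (g l)) c = fps_const (sqc k g c)"
  by (induction k g c rule: sqc.induct) simp_all

text \<open>The Bullett-Macdonald identity is taken at (x^2 + x, 1) and (1 + x, x^2), multiplied by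
  (1 + x)^(-A-1), and the coefficients of x^A are compared. On the left the term of Sq^k has
  coefficient C(2(A-k), A-k), which is even unless k = A. On the right the term of Sq^j contributes
  the coefficient of x^(A-2j) in (1 + x)^(B-1-j), the Adem coefficient. Homogeneity of
  \<open>g\<close> leaves only composites of total degree A + B.\<close>

lemma sqc_Adem_homogeneous:
  fixes g :: "nat list \<Rightarrow> bit"
  assumes ab: "A < 2 * B" and g: "\<And>l. g l \<noteq> 0 \<Longrightarrow> mdeg l + (A + B) = mdeg c"
  shows "sqc A (sqc B g) c = (\<Sum>j\<le>A div 2. of_nat ((B - 1 - j) choose (A - 2 * j)) * sqc (A + B - j) (sqc j g) c)"
proof -
  define w where "w k m = sqc k (sqc m g) c" for k m
  let ?m = "A + B" and ?K = "mdeg c + A + B"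
  let ?x = "fps_X :: bit fps"
  have w0: "w k m = 0" if "k + m \<noteq> ?m" for k m
    unfolding w_def
  proof (rule sqc_eq_zero)
    fix l assume l: "mdeg l + k = mdeg c"
    show "sqc m g l = 0"
    proof (rule sqc_eq_zero)
      fix l' assume "mdeg l' + m = mdeg l"
      then have "mdeg l' + ?m \<noteq> mdeg c" using l that by linarith
      then show "g l' = 0" using g by blast
    qed
  qed
  have conv: "tsq \<alpha> (tsq \<beta> (\<lambda>l. fps_const (g l))) c = (\<Sum>k\<le>?m. \<alpha> ^ k * \<beta> ^ (?m - k) * fps_const (w k (?m - k)))" for \<alpha> \<beta>
  proof -
    have "tsq \<alpha> (tsq \<beta> (\<lambda>l. fps_const (g l))) c = (\<Sum>k\<le>?K. \<Sum>m\<le>?K. \<alpha> ^ k * \<beta> ^ m * fps_const (w k m))"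
    proof -
      have 1: "sqc m (\<lambda>l. fps_const (g l)) = (\<lambda>l. fps_const (sqc m g l))" for m
        by (rule ext) (rule sqc_const)
      have 2: "sqc k (sqc m (\<lambda>l. fps_const (g l))) c = fps_const (w k m)" for k m
        unfolding 1 w_def by (rule sqc_const)
      have "mdeg c \<le> ?K" by simp
      from tsq_tsq_eq_sum[OF this, of \<alpha> \<beta> "\<lambda>l. fps_const (g l)"] show ?thesis unfolding 2 .
    qed
    also have "\<dots> = (\<Sum>k\<le>?m. \<alpha> ^ k * \<beta> ^ (?m - k) * fps_const (w k (?m - k)))"
    proof (rule sum.mono_neutral_cong_right)
      show "\<forall>k\<in>{..?K} - {..?m}. (\<Sum>m\<le>?K. \<alpha> ^ k * \<beta> ^ m * fps_const (w k m)) = 0"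
        by (intro ballI sum.neutral) (simp add: w0)
      fix k assume k: "k \<in> {..?m}"
      have "(\<Sum>m\<le>?K. \<alpha> ^ k * \<beta> ^ m * fps_const (w k m)) = (\<Sum>m\<in>{?m - k}. \<alpha> ^ k * \<beta> ^ m * fps_const (w k m))"
      proof (rule sum.mono_neutral_right)
        show "\<forall>m\<in>{..?K} - {?m - k}. \<alpha> ^ k * \<beta> ^ m * fps_const (w k m) = 0"
        proof
          fix m assume "m \<in> {..?K} - {?m - k}"
          then have "k + m \<noteq> ?m" by auto
          then show "\<alpha> ^ k * \<beta> ^ m * fps_const (w k m) = 0" by (simp add: w0)
        qed
      qed auto
      then show "(\<Sum>m\<le>?K. \<alpha> ^ k * \<beta> ^ m * fps_const (w k m)) = \<alpha> ^ k * \<beta> ^ (?m - k) * fps_const (w k (?m - k))"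
        by simp
    qed auto
    finally show ?thesis .
  qed
  have "tsq (?x\<^sup>2 + ?x) (tsq 1 (\<lambda>l. fps_const (g l))) c = tsq (1 + ?x) (tsq (?x\<^sup>2) (\<lambda>l. fps_const (g l))) c"
  proof (rule tsq_tsq_cong[OF fps_bit_char2])
    have "(?x\<^sup>2 + ?x)\<^sup>2 = (1 + ?x)\<^sup>2 * ?x\<^sup>2" by (simp add: power2_eq_square algebra_simps)
    then show "(?x\<^sup>2 + ?x)\<^sup>2 * 1 = (1 + ?x)\<^sup>2 * ?x\<^sup>2" by simp
  qed simp
  then have "(\<Sum>k\<le>?m. (?x\<^sup>2 + ?x) ^ k * fps_const (w k (?m - k)))
      = (\<Sum>k\<le>?m. (1 + ?x) ^ k * (?x\<^sup>2) ^ (?m - k) * fps_const (w k (?m - k)))"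
    by (simp add: conv)
  then have "fps_nth ((\<Sum>k\<le>?m. (?x\<^sup>2 + ?x) ^ k * fps_const (w k (?m - k))) * binser A) A
      = fps_nth ((\<Sum>k\<le>?m. (1 + ?x) ^ k * (?x\<^sup>2) ^ (?m - k) * fps_const (w k (?m - k))) * binser A) A" by simp
  moreover have "fps_nth ((\<Sum>k\<le>?m. (?x\<^sup>2 + ?x) ^ k * fps_const (w k (?m - k))) * binser A) A = w A B"
  proof -
    have "fps_nth ((?x\<^sup>2 + ?x) ^ k * fps_const (w k (?m - k)) * binser A) A = (if k = A then w A B else 0)" for k
    proof -
      have "?x\<^sup>2 + ?x = ?x * (1 + ?x)" by (simp add: power2_eq_square algebra_simps)
      then have "(?x\<^sup>2 + ?x) ^ k * fps_const (w k (?m - k)) * binser A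
          = fps_const (w k (?m - k)) * (?x ^ k * ((1 + ?x) ^ k * binser A))"
        by (simp add: power_mult_distrib mult_ac)
      then have "fps_nth ((?x\<^sup>2 + ?x) ^ k * fps_const (w k (?m - k)) * binser A) A
          = w k (?m - k) * (if A < k then 0 else fps_nth ((1 + ?x) ^ k * binser A) (A - k))"
        by (simp only: fps_mult_left_const_nth fps_X_power_mult_nth)
      then show ?thesis by (auto simp: binser_power binser_diagonal)
    qed
    then show ?thesis by (simp add: sum_distrib_right fps_sum_nth)
  qed
  moreover have "fps_nth ((\<Sum>k\<le>?m. (1 + ?x) ^ k * (?x\<^sup>2) ^ (?m - k) * fps_const (w k (?m - k))) * binser A) A
      = (\<Sum>j\<le>A div 2. of_nat ((B - 1 - j) choose (A - 2 * j)) * w (?m - j) j)"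
  proof -
    have t: "fps_nth ((1 + ?x) ^ k * (?x\<^sup>2) ^ (?m - k) * fps_const (w k (?m - k)) * binser A) A
        = (if A < 2 * (?m - k) then 0 else w k (?m - k) * fps_nth ((1 + ?x) ^ k * binser A) (A - 2 * (?m - k)))" for k
    proof -
      have "(1 + ?x) ^ k * (?x\<^sup>2) ^ (?m - k) * fps_const (w k (?m - k)) * binser A
          = fps_const (w k (?m - k)) * (?x ^ (2 * (?m - k)) * ((1 + ?x) ^ k * binser A))"
        by (simp add: mult_ac power_mult)
      then show ?thesis by (simp only: fps_mult_left_const_nth fps_X_power_mult_nth mult_zero_right if_distrib[of "(*) _"])
    qed
    have "fps_nth ((\<Sum>k\<le>?m. (1 + ?x) ^ k * (?x\<^sup>2) ^ (?m - k) * fps_const (w k (?m - k))) * binser A) A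
        = (\<Sum>k\<le>?m. if A < 2 * (?m - k) then 0 else w k (?m - k) * fps_nth ((1 + ?x) ^ k * binser A) (A - 2 * (?m - k)))"
      by (simp add: sum_distrib_right fps_sum_nth t)
    also have "\<dots> = (\<Sum>j\<le>?m. if A < 2 * j then 0 else w (?m - j) j * fps_nth ((1 + ?x) ^ (?m - j) * binser A) (A - 2 * j))"
      by (rule sum.reindex_bij_witness[of _ "\<lambda>j. ?m - j" "\<lambda>j. ?m - j"]) auto
    also have "\<dots> = (\<Sum>j\<le>A div 2. of_nat ((B - 1 - j) choose (A - 2 * j)) * w (?m - j) j)"
    proof (rule sum.mono_neutral_cong_right)
      fix j assume "j \<in> {..A div 2}"
      then have j: "2 * j \<le> A" by auto
      \<comment> \<open>No subtraction truncates, since 2j \<le> A < 2B gives j < B.\<close>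
      have "?m - j = Suc A + (B - 1 - j)" using j ab by auto
      then have "(1 + ?x) ^ (?m - j) * binser A = (1 + ?x) ^ (B - 1 - j)"
        by (simp only: binser_power_Suc)
      then show "(if A < 2 * j then 0 else w (?m - j) j * fps_nth ((1 + ?x) ^ (?m - j) * binser A) (A - 2 * j))
          = of_nat ((B - 1 - j) choose (A - 2 * j)) * w (?m - j) j"
        using j by (simp add: fps_nth_one_plus_X_power mult.commute)
    qed auto
    finally show ?thesis .
  qed
  ultimately show ?thesis by (simp add: w_def)
qed

text \<open>All composites have degree A + B, so the coefficient at \<open>c\<close> sees only one
  homogeneous component of \<open>g\<close>.\<close>

lemma sqc_Adem:
  fixes g :: "nat list \<Rightarrow> bit"
  assumes ab: "A < 2 * B"
  shows "sqc A (sqc B g) c = (\<Sum>j\<le>A div 2. of_nat ((B - 1 - j) choose (A - 2 * j)) * sqc (A + B - j) (sqc j g) c)"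
proof -
  define h where "h l = (if mdeg l + (A + B) = mdeg c then g l else 0)" for l
  have *: "sqc k (sqc m g) c = sqc k (sqc m h) c" if "k + m = A + B" for k m
  proof (rule sqc_cong)
    fix l assume l: "mdeg l + k = mdeg c"
    show "sqc m g l = sqc m h l"
      using l that by (intro sqc_cong) (simp add: h_def)
  qed
  have "sqc A (sqc B h) c = (\<Sum>j\<le>A div 2. of_nat ((B - 1 - j) choose (A - 2 * j)) * sqc (A + B - j) (sqc j h) c)"
    by (rule sqc_Adem_homogeneous[OF ab]) (simp add: h_def split: if_splits)
  moreover have "sqc (A + B - j) (sqc j g) c = sqc (A + B - j) (sqc j h) c" if "j \<le> A div 2" for j
    using that by (intro *) auto
  ultimately show ?thesis by (simp add: *)
qed

subsection \<open>The unstable module structure\<close>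

definition sqT :: "nat \<Rightarrow> ('i \<Rightarrow> nat list \<Rightarrow> bit) \<Rightarrow> 'i \<Rightarrow> nat list \<Rightarrow> bit" where
  "sqT k f x = sqc k (f x)"

primrec sqT_word :: "nat list \<Rightarrow> ('i \<Rightarrow> nat list \<Rightarrow> bit) \<Rightarrow> 'i \<Rightarrow> nat list \<Rightarrow> bit" where
  "sqT_word [] f = f"
| "sqT_word (i # w) f = sqT i (sqT_word w f)"

definition sqT_poly :: "nat list set \<Rightarrow> ('i \<Rightarrow> nat list \<Rightarrow> bit) \<Rightarrow> 'i \<Rightarrow> nat list \<Rightarrow> bit" where
  "sqT_poly p f x c = (\<Sum>w\<in>p. sqT_word w f x c)"

definition tensor_gmod :: "('i \<Rightarrow> nat list \<Rightarrow> bit) gmod" where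
  "tensor_gmod =
    \<lparr>comp = (\<lambda>n. \<lparr>carrier = {f. \<forall>x l. mdeg l \<noteq> n \<longrightarrow> f x l = 0},
        monoid.mult = (\<lambda>f g x l. f x l + g x l), one = (\<lambda>x l. 0)\<rparr>),
     act = (\<lambda>k n r. sqT_poly (SOME p. p \<in> carrier FA \<and> (\<forall>w\<in>p. sum_list w = k) \<and> r = St p))\<rparr>"

lemma tensor_simps [simp]:
  "elts tensor_gmod n = {f. \<forall>x l. mdeg l \<noteq> n \<longrightarrow> f x l = 0}"
  "pl tensor_gmod n f g = (\<lambda>x l. f x l + g x l)" "zr tensor_gmod n = (\<lambda>x l. 0)"
  by (simp_all add: tensor_gmod_def)

lemma sqT_elts: "f \<in> elts tensor_gmod n \<Longrightarrow> sqT k f \<in> elts tensor_gmod (n + k)"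
  by (auto simp: sqT_def intro!: sqc_eq_zero)

lemma sqT_sum: "sqT k (\<lambda>x c. \<Sum>i\<in>I. g i x c) = (\<lambda>x c. \<Sum>i\<in>I. sqT k (g i) x c)"
  by (intro ext) (simp add: sqT_def sqc_sum)

lemma sqT_add: "sqT k (\<lambda>x c. f x c + g x c) = (\<lambda>x c. sqT k f x c + sqT k g x c)"
  by (intro ext) (simp add: sqT_def sqc_add)

lemma sqT_0 [simp]: "sqT 0 f = f"
  by (intro ext) (simp add: sqT_def)

lemma sqT_word_elts: "f \<in> elts tensor_gmod n \<Longrightarrow> sqT_word w f \<in> elts tensor_gmod (n + sum_list w)"
proof (induction w)
  case (Cons i w)
  then show ?case using sqT_elts[of "sqT_word w f" "n + sum_list w" i] by (simp only: sqT_word.simps sum_list.Cons add_ac)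
qed simp

lemma sqT_word_append: "sqT_word (u @ v) f = sqT_word u (sqT_word v f)"
  by (induction u) simp_all

lemma sqT_word_sum: "sqT_word w (\<lambda>x c. \<Sum>i\<in>I. g i x c) = (\<lambda>x c. \<Sum>i\<in>I. sqT_word w (g i) x c)"
  by (induction w) (simp_all add: sqT_sum)

lemma sqT_word_add: "sqT_word w (\<lambda>x c. f x c + g x c) = (\<lambda>x c. sqT_word w f x c + sqT_word w g x c)"
  by (induction w) (simp_all add: sqT_add)

lemma sqT_poly_add:
  "finite p \<Longrightarrow> finite q \<Longrightarrow> sqT_poly (p \<oplus>\<^bsub>FA\<^esub> q) f x c = sqT_poly p f x c + sqT_poly q f x c"
  unfolding sqT_poly_def by (rule sum_add_free)

lemma sqT_poly_mult:
  assumes "finite p" "finite q"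
  shows "sqT_poly (p \<otimes>\<^bsub>FA\<^esub> q) f = sqT_poly p (sqT_poly q f)"
proof (intro ext)
  fix x c
  have "sqT_poly (p \<otimes>\<^bsub>FA\<^esub> q) f x c = (\<Sum>u\<in>p. \<Sum>v\<in>q. sqT_word u (sqT_word v f) x c)"
    unfolding sqT_poly_def sum_mult_free[OF assms] sqT_word_append ..
  also have "\<dots> = (\<Sum>u\<in>p. sqT_word u (\<lambda>x c. \<Sum>v\<in>q. sqT_word v f x c) x c)"
    by (simp only: sqT_word_sum)
  also have "\<dots> = sqT_poly p (sqT_poly q f) x c"
    by (simp only: sqT_poly_def[abs_def])
  finally show "sqT_poly (p \<otimes>\<^bsub>FA\<^esub> q) f x c = sqT_poly p (sqT_poly q f) x c" .
qed

lemma sqT_poly_empty: "sqT_poly {} f = (\<lambda>x c. 0)"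
  by (simp add: sqT_poly_def[abs_def])

lemma sqT_poly_free_Sq: "sqT_poly (free_Sq k) f = sqT k f"
  by (intro ext) (simp add: sqT_poly_def free_Sq_def)

lemma sqT_poly_zero: "sqT_poly p (\<lambda>x c. 0) = (\<lambda>(x :: 'i) c. 0)"
proof (intro ext)
  fix x :: 'i and c
  have "sqT_word w (\<lambda>x c. 0) = (\<lambda>(x :: 'i) c. 0)" for w using sqT_word_sum[of w _ "{}"] by simp
  then show "sqT_poly p (\<lambda>x c. 0) x c = 0" by (simp add: sqT_poly_def)
qed

lemma sqT_poly_finsum:
  assumes "finite J" "\<And>j. j \<in> J \<Longrightarrow> t j \<in> carrier FA"
  shows "sqT_poly (finsum FA t J) f x c = (\<Sum>j\<in>J. sqT_poly (t j) f x c)"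
proof -
  interpret FA: ring FA by (rule ring_free)
  from assms show ?thesis
  proof (induction J rule: finite_induct)
    case empty
    then show ?case by (simp add: zero_free sqT_poly_empty)
  next
    case (insert j J)
    then have "finsum FA t (insert j J) = t j \<oplus>\<^bsub>FA\<^esub> finsum FA t J"
      by (intro FA.finsum_insert) auto
    moreover have "finsum FA t J \<in> carrier FA" using insert by (intro FA.finsum_closed) auto
    ultimately show ?case using insert by (simp add: sqT_poly_add finite_free)
  qed
qed

lemma sqT_Adem_relation:
  assumes "a < 2 * b"
  shows "sqT_poly (Adem_relation a b) f = (\<lambda>x c. 0)"
proof (intro ext)
  interpret FA: ring FA by (rule ring_free)
  fix x c
  have FAc: "finsum FA (Adem_term a b) {0..a div 2} \<in> carrier FA" by (simp add: FA.finsum_closed)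
  have t: "sqT_poly (Adem_term a b j) f x c = of_nat ((b - 1 - j) choose (a - 2 * j)) * sqT (a + b - j) (sqT j f) x c" for j
    by (simp add: Adem_term_def sqT_poly_mult finite_free sqT_poly_free_Sq sqT_poly_empty zero_free of_nat_bit)
  have "sqT_poly (free_Sq a \<otimes>\<^bsub>FA\<^esub> free_Sq b) f x c = sqT_poly (finsum FA (Adem_term a b) {0..a div 2}) f x c"
    unfolding sqT_poly_mult[OF finite_free[OF free_Sq_closed] finite_free[OF free_Sq_closed]] sqT_poly_free_Sq
    using sqc_Adem[OF assms, of "f x" c]
    by (subst sqT_poly_finsum) (simp_all add: t atMost_atLeast0, simp add: sqT_def[abs_def])
  then show "sqT_poly (Adem_relation a b) f x c = 0"
    unfolding Adem_relation_eq
    by (subst sqT_poly_add) (simp_all add: finite_free FAc)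
qed

text \<open>The annihilator is a two-sided ideal containing the Adem relations. For closure under
  right multiplication it must refer to elements of all degrees at once, since the words of the
  right factor move \<open>f\<close> to other degrees.\<close>

lemma sqT_Adem_ideal:
  assumes "p \<in> Adem_ideal" "f \<in> elts tensor_gmod n"
  shows "sqT_poly p f = (\<lambda>x c. 0)"
proof -
  interpret FA: ring FA by (rule ring_free)
  define I where "I = {p \<in> carrier FA. \<forall>n. \<forall>f\<in>elts tensor_gmod n. sqT_poly p (f :: 'a \<Rightarrow> nat list \<Rightarrow> bit) = (\<lambda>x c. 0)}"
  have add: "p \<oplus>\<^bsub>FA\<^esub> q \<in> I" if "p \<in> I" "q \<in> I" for p q
    using that by (auto simp: I_def fun_eq_iff sqT_poly_add finite_free)
  have "ideal I FA"
  proof (rule idealI[OF ring_free])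
    show "subgroup I (add_monoid FA)"
    proof
      fix x assume x: "x \<in> I"
      then have "inv\<^bsub>add_monoid FA\<^esub> x = x"
        using FA.minus_equality[of x x] self_add_free[of x] by (simp add: a_inv_def I_def)
      then show "inv\<^bsub>add_monoid FA\<^esub> x \<in> I" using x by simp
    qed (use add in \<open>auto simp: I_def sqT_poly_empty zero_free FA.zero_closed[unfolded zero_free]\<close>)
  next
    fix p q assume p: "p \<in> I" and q: "q \<in> carrier FA"
    then have fin: "finite p" "finite q" and pc: "p \<in> carrier FA" by (auto simp: I_def finite_free)
    show "q \<otimes>\<^bsub>FA\<^esub> p \<in> I"
      using p pc q by (simp add: I_def sqT_poly_mult[OF fin(2,1)] sqT_poly_zero)
    have "sqT_poly (p \<otimes>\<^bsub>FA\<^esub> q) f = (\<lambda>x c. 0)" if f: "f \<in> elts tensor_gmod n" for n and f :: "'a \<Rightarrow> nat list \<Rightarrow> bit"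
    proof (intro ext)
      fix x c
      have *: "sqT_poly p (sqT_word v f) = (\<lambda>x c. 0)" for v
        using p sqT_word_elts[OF f] unfolding I_def by blast
      have "sqT_poly (p \<otimes>\<^bsub>FA\<^esub> q) f x c = (\<Sum>u\<in>p. \<Sum>v\<in>q. sqT_word u (sqT_word v f) x c)"
        unfolding sqT_poly_def sum_mult_free[OF fin] sqT_word_append ..
      also have "\<dots> = (\<Sum>v\<in>q. sqT_poly p (sqT_word v f) x c)"
        unfolding sqT_poly_def by (rule sum.swap)
      finally show "sqT_poly (p \<otimes>\<^bsub>FA\<^esub> q) f x c = 0" by (simp only: * sum.neutral_const)
    qed
    then show "p \<otimes>\<^bsub>FA\<^esub> q \<in> I" using pc q unfolding I_def by blast
  qed
  then have "Adem_ideal \<subseteq> I"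
    by (rule Adem_ideal_least) (simp add: I_def sqT_Adem_relation)
  then show ?thesis using assms unfolding I_def by blast
qed

lemma act_tensor:
  fixes f :: "'i \<Rightarrow> nat list \<Rightarrow> bit"
  assumes p: "p \<in> carrier FA" "\<forall>w\<in>p. sum_list w = k" and f: "f \<in> elts tensor_gmod n"
  shows "act tensor_gmod k m (St p) f = sqT_poly p f"
proof -
  define q where "q = (SOME q. q \<in> carrier FA \<and> (\<forall>w\<in>q. sum_list w = k) \<and> St p = St q)"
  have q: "q \<in> carrier FA" "St p = St q"
    using someI[of "\<lambda>q. q \<in> carrier FA \<and> (\<forall>w\<in>q. sum_list w = k) \<and> St p = St q" p] p
    unfolding q_def by blast+
  then have "sqT_poly (p \<oplus>\<^bsub>FA\<^esub> q) f = (\<lambda>x c. 0)"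
    using f p by (intro sqT_Adem_ideal) (simp_all add: St_eq_iff)
  then have "sqT_poly p f x c + sqT_poly q f x c = 0" for x c
    using p q by (simp add: fun_eq_iff sqT_poly_add finite_free)
  then have "sqT_poly q f x c = sqT_poly p f x c" for x c
    by (metis add.commute add.left_commute add.right_neutral bit_add_self)
  moreover have "act tensor_gmod k m (St p) f = sqT_poly q f"
    unfolding tensor_gmod_def q_def by simp
  ultimately show ?thesis by (simp add: fun_eq_iff)
qed

lemma act_tensor_Sq: "f \<in> elts tensor_gmod n \<Longrightarrow> act tensor_gmod k m (Sq k) f = sqT k f"
  unfolding Sq_def by (subst act_tensor[of _ _ f n]) (simp_all add: free_Sq_homogeneous sqT_poly_free_Sq)

lemma sqT_poly_elts:
  assumes p: "\<forall>w\<in>p. sum_list w = k" and f: "f \<in> elts tensor_gmod n"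
  shows "sqT_poly p f \<in> elts tensor_gmod (n + k)"
proof -
  have "sqT_word w f x l = 0" if "w \<in> p" "mdeg l \<noteq> n + k" for w x l
    using sqT_word_elts[OF f, of w] p that by simp
  then show ?thesis by (simp add: sqT_poly_def)
qed

lemma gm_tensor: "gm (tensor_gmod :: ('i \<Rightarrow> nat list \<Rightarrow> bit) gmod)"
proof (rule gmI)
  let ?T = "tensor_gmod :: ('i \<Rightarrow> nat list \<Rightarrow> bit) gmod"
  note [simp del] = tensor_simps(1)
  fix k n r and f :: "'i \<Rightarrow> nat list \<Rightarrow> bit"
  assume r: "r \<in> Steenrod_deg k" and f: "f \<in> elts ?T n"
  obtain p where p: "p \<in> carrier FA" "\<forall>w\<in>p. sum_list w = k" "r = St p" by (rule Steenrod_degE[OF r])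
  show "act ?T k n r f \<in> elts ?T (n + k)"
    unfolding p(3) act_tensor[OF p(1,2) f] by (rule sqT_poly_elts[OF p(2) f])
next
  let ?T = "tensor_gmod :: ('i \<Rightarrow> nat list \<Rightarrow> bit) gmod"
  fix k n r and f g :: "'i \<Rightarrow> nat list \<Rightarrow> bit"
  assume r: "r \<in> Steenrod_deg k" and f: "f \<in> elts ?T n" and g: "g \<in> elts ?T n"
  obtain p where p: "p \<in> carrier FA" "\<forall>w\<in>p. sum_list w = k" "r = St p" by (rule Steenrod_degE[OF r])
  have fg: "pl ?T n f g \<in> elts ?T n" using f g by simp
  show "act ?T k n r (pl ?T n f g) = pl ?T (n + k) (act ?T k n r f) (act ?T k n r g)"
    unfolding p(3) act_tensor[OF p(1,2) f] act_tensor[OF p(1,2) g] act_tensor[OF p(1,2) fg]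
    unfolding tensor_simps sqT_poly_def[abs_def] sqT_word_add sum.distrib ..
next
  let ?T = "tensor_gmod :: ('i \<Rightarrow> nat list \<Rightarrow> bit) gmod"
  fix k n r s and f :: "'i \<Rightarrow> nat list \<Rightarrow> bit"
  assume r: "r \<in> Steenrod_deg k" and s: "s \<in> Steenrod_deg k" and f: "f \<in> elts ?T n"
  obtain p where p: "p \<in> carrier FA" "\<forall>w\<in>p. sum_list w = k" "r = St p" by (rule Steenrod_degE[OF r])
  obtain q where q: "q \<in> carrier FA" "\<forall>w\<in>q. sum_list w = k" "s = St q" by (rule Steenrod_degE[OF s])
  have pq: "p \<oplus>\<^bsub>FA\<^esub> q \<in> carrier FA" "\<forall>w\<in>p \<oplus>\<^bsub>FA\<^esub> q. sum_list w = k"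
    using p q by (auto simp: add_free_closed) (auto simp: add_free)
  show "act ?T k n (r \<oplus>\<^bsub>Steenrod\<^esub> s) f = pl ?T (n + k) (act ?T k n r f) (act ?T k n s f)"
    unfolding p(3) q(3) St_ops(2)[OF p(1) q(1)] act_tensor[OF pq f] act_tensor[OF p(1,2) f] act_tensor[OF q(1,2) f]
    by (intro ext) (simp add: sqT_poly_add finite_free p(1) q(1))
next
  let ?T = "tensor_gmod :: ('i \<Rightarrow> nat list \<Rightarrow> bit) gmod"
  fix k l n r s and f :: "'i \<Rightarrow> nat list \<Rightarrow> bit"
  assume r: "r \<in> Steenrod_deg k" and s: "s \<in> Steenrod_deg l" and f: "f \<in> elts ?T n"
  obtain p where p: "p \<in> carrier FA" "\<forall>w\<in>p. sum_list w = k" "r = St p" by (rule Steenrod_degE[OF r])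
  obtain q where q: "q \<in> carrier FA" "\<forall>w\<in>q. sum_list w = l" "s = St q" by (rule Steenrod_degE[OF s])
  show "act ?T (k + l) n (r \<otimes>\<^bsub>Steenrod\<^esub> s) f = act ?T k (n + l) r (act ?T l n s f)"
    unfolding p(3) q(3) St_ops(1)[OF p(1) q(1)]
      act_tensor[OF mult_free_closed[OF p(1) q(1)] mult_free_homogeneous[OF p(2) q(2)] f]
      act_tensor[OF q(1,2) f] act_tensor[OF p(1,2) sqT_poly_elts[OF q(2) f]]
    by (rule sqT_poly_mult) (simp_all add: finite_free p(1) q(1))
next
  let ?T = "tensor_gmod :: ('i \<Rightarrow> nat list \<Rightarrow> bit) gmod"
  fix n and f :: "'i \<Rightarrow> nat list \<Rightarrow> bit"
  assume "f \<in> elts ?T n"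
  then show "act ?T 0 n \<one>\<^bsub>Steenrod\<^esub> f = f"
    unfolding Sq_0[symmetric] by (simp only: act_tensor_Sq sqT_0)
qed (auto simp: add_ac)

lemma um_tensor: "um tensor_gmod"
proof (rule umI[OF gm_tensor])
  fix n k and f :: "'i \<Rightarrow> nat list \<Rightarrow> bit" assume k: "n < k" and f: "f \<in> elts tensor_gmod n"
  have "sqc k (f x) c = 0" for x c
    using k f by (intro sqc_eq_zero) auto
  then show "act tensor_gmod k n (Sq k) f = zr tensor_gmod (n + k)"
    unfolding act_tensor_Sq[OF f] by (simp add: sqT_def fun_eq_iff)
qed

section \<open>Free unstable modules are reduced\<close>

definition reduced :: "'a gmod \<Rightarrow> bool" where
  "reduced M \<longleftrightarrow> (\<forall>k. \<forall>x\<in>elts M k. act M k k (Sq k) x = zr M (k + k) \<longrightarrow> x = zr M k)"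

text \<open>By \<open>sqc_map_Suc\<close> each coefficient of \<open>f\<close> can be read off from
  its top square.\<close>

lemma reduced_tensor: "reduced tensor_gmod"
  unfolding reduced_def
proof (intro allI ballI impI)
  fix k and f :: "'i \<Rightarrow> nat list \<Rightarrow> bit"
  assume f: "f \<in> elts tensor_gmod k" and "act tensor_gmod k k (Sq k) f = zr tensor_gmod (k + k)"
  then have 0: "sqc k (f x) c = 0" for x c
    unfolding act_tensor_Sq[OF f] by (simp add: sqT_def[abs_def] fun_eq_iff)
  have "f x l = 0" for x l
  proof (cases "mdeg l = k")
    case True
    then show ?thesis using sqc_map_Suc[of l "f x"] 0 by simp
  qed (use f in simp)
  then show "f = zr tensor_gmod k" by (simp add: fun_eq_iff)
qed

definition monomial :: "'i \<Rightarrow> nat list \<Rightarrow> 'i \<Rightarrow> nat list \<Rightarrow> bit" where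
  "monomial x l = (\<lambda>x' l'. of_bool (x' = x \<and> l' = l))"

lemma mdeg_replicate [simp]: "mdeg (replicate n 0) = n"
  by (induction n) simp_all

text \<open>The list \<open>replicate n 0\<close> is the product of n distinct variables, the image
  of the generator of F(n) in the n-th tensor power of F(1).\<close>

lemma monomial_elts: "monomial x (replicate n 0) \<in> elts tensor_gmod n"
  by (auto simp: monomial_def)

text \<open>The part of degree 1 in the first variable, as a polynomial in the others.\<close>

definition linear_part :: "nat \<Rightarrow> ('i \<Rightarrow> nat list \<Rightarrow> bit) \<Rightarrow> 'i \<Rightarrow> nat list \<Rightarrow> bit" where
  "linear_part n f x l = (if n = 0 then 0 else f x (0 # l))"

text \<open>A monomial containing the first variable to the power 1 arises only from such monomials,
  and then the square acts on the other variables alone, exactly as on a suspension.\<close>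

lemma mor_linear_part: "mor tensor_gmod (suspension tensor_gmod) linear_part"
proof (rule mor_SqI[OF gm_tensor gm_suspension[OF gm_tensor]])
  let ?T = "tensor_gmod :: ('i \<Rightarrow> nat list \<Rightarrow> bit) gmod"
  show cl: "linear_part n f \<in> elts (suspension ?T) n" if "f \<in> elts ?T n" for n and f :: "'i \<Rightarrow> nat list \<Rightarrow> bit"
    using that by (cases n) (auto simp: linear_part_def fun_eq_iff)
  show "linear_part n (pl ?T n f g) = pl (suspension ?T) n (linear_part n f) (linear_part n g)"
    for n and f g :: "'i \<Rightarrow> nat list \<Rightarrow> bit"
    by (cases n) (auto simp: linear_part_def fun_eq_iff)
  fix k n :: nat and f :: "'i \<Rightarrow> nat list \<Rightarrow> bit" assume k: "0 < k" and f: "f \<in> elts ?T n"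
  have sq: "linear_part (n + k) (sqT k f) x l = sqc k (\<lambda>l. f x (0 # l)) l" for x l
    using k by (simp add: linear_part_def sqT_def)
  show "linear_part (n + k) (act ?T k n (Sq k) f) = act (suspension ?T) k n (Sq k) (linear_part n f)"
  proof (cases n)
    case 0
    then have "(\<lambda>l. f x (0 # l)) = (\<lambda>l. 0)" for x using f by (auto simp: fun_eq_iff)
    then have "linear_part (n + k) (sqT k f) x l = 0" for x l unfolding sq by simp
    moreover obtain j where "k = Suc j" using k by (cases k) auto
    ultimately show ?thesis
      unfolding act_tensor_Sq[OF f] using 0 by (simp add: fun_eq_iff)
  next
    case (Suc m)
    have "linear_part n f \<in> elts ?T m" using cl[OF f] Suc by simp
    from act_tensor_Sq[OF this, of k m] show ?thesis
      unfolding act_tensor_Sq[OF f] using Suc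
      by (intro ext, subst sq) (simp add: sqT_def linear_part_def[abs_def])
  qed
qed

text \<open>The universal property of \<open>is_free\<close> concerns targets on \<open>int\<close>,
  so the map is first constructed into an \<open>int\<close> copy of the countable span of the
  monomials.\<close>

lemma free_to_tensor:
  assumes F: "is_free G F e"
  obtains \<theta> where "mor F tensor_gmod \<theta>" "\<forall>(n, x)\<in>G. \<theta> n (e n x) = monomial x (replicate n 0)"
proof -
  define E where "E = range (\<lambda>(n, x::int). (n, monomial x (replicate n 0)))"
  have E: "countable E" "\<And>n f. (n, f) \<in> E \<Longrightarrow> f \<in> elts tensor_gmod n"
    by (auto simp: E_def simp del: tensor_simps(1) intro: monomial_elts)
  obtain F' :: "int gmod" and i where F': "um F'" "mor F' tensor_gmod i"
    "\<forall>n. i n ` elts F' n = {x. gspan tensor_gmod E n x}"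
    using span_copy[OF um_tensor E] by blast
  define \<phi> where "\<phi> n x = inv_into (elts F' n) (i n) (monomial x (replicate n 0))" for n x
  have "monomial x (replicate n 0) \<in> i n ` elts F' n" for n x
    using F'(3) by (auto simp: E_def intro!: gspan.gen)
  then have \<phi>: "\<phi> n x \<in> elts F' n" "i n (\<phi> n x) = monomial x (replicate n 0)" for n x
    by (simp_all add: \<phi>_def inv_into_into f_inv_into_f)
  obtain f where f: "mor F F' f" "\<And>n x. (n, x) \<in> G \<Longrightarrow> f n (e n x) = \<phi> n x"
    using free_map[OF F F'(1), of \<phi>] \<phi>(1) by metis
  show ?thesis
    by (rule that[OF mor_comp[OF f(1) F'(2)]]) (auto simp: f(2) \<phi>(2))
qed

text \<open>Operations never lower degrees and the algebra is F_2 in degree 0, so the generators of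
  degree 0 span that degree. A linear combination is a finite set, and addition is symmetric
  difference.\<close>

lemma free_degree_0:
  assumes F: "is_free G F e" and y: "y \<in> elts F 0"
  obtains Y where "finite Y" "\<forall>x\<in>Y. (0, x) \<in> G" "y = finprod (comp F 0) (e 0) Y"
proof -
  note gm = um_gm[OF free_um[OF F]]
  interpret F0: comm_group "comp F 0" using gm by simp
  have "n = 0 \<Longrightarrow> \<exists>Y. finite Y \<and> (\<forall>x\<in>Y. (0, x) \<in> G) \<and> y = finprod (comp F 0) (e 0) Y"
    if "gspan F ((\<lambda>(n, x). (n, e n x)) ` G) n y" for n y
    using that
  proof induction
    case (zero n)
    then show ?case by (intro exI[of _ "{}"]) simp
  next
    case (gen n y)
    then obtain x where x: "(0, x) \<in> G" "y = e 0 x" by auto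
    have "e 0 x \<in> elts F 0" by (rule free_gen[OF F x(1)])
    then show ?case using x by (intro exI[of _ "{x}"]) (simp add: F0.finprod_insert)
  next
    case (add n y z)
    then obtain Y Z where Y: "finite Y" "\<forall>x\<in>Y. (0, x) \<in> G" "y = finprod (comp F 0) (e 0) Y"
      and Z: "finite Z" "\<forall>x\<in>Z. (0, x) \<in> G" "z = finprod (comp F 0) (e 0) Z" by blast
    have cl: "e 0 \<in> A \<rightarrow> elts F 0" if "A \<subseteq> Y \<union> Z" for A
      using that Y(2) Z(2) free_gen[OF F] by blast
    let ?p = "finprod (comp F 0) (e 0)"
    have un: "?p (A \<union> B) = pl F 0 (?p A) (?p B)" if "A \<subseteq> Y \<union> Z" "B \<subseteq> Y \<union> Z" "A \<inter> B = {}" for A B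
      using that Y(1) Z(1) cl by (intro F0.finprod_Un_disjoint) (auto intro: finite_subset)
    have "?p Y = pl F 0 (?p (Y - Z)) (?p (Y \<inter> Z))" "?p Z = pl F 0 (?p (Z - Y)) (?p (Y \<inter> Z))"
    proof -
      have "Y - Z \<union> Y \<inter> Z = Y" "Z - Y \<union> Y \<inter> Z = Z" by blast+
      moreover have "?p (Y - Z \<union> Y \<inter> Z) = pl F 0 (?p (Y - Z)) (?p (Y \<inter> Z))"
        "?p (Z - Y \<union> Y \<inter> Z) = pl F 0 (?p (Z - Y)) (?p (Y \<inter> Z))"
        by (rule un; blast)+
      ultimately show "?p Y = pl F 0 (?p (Y - Z)) (?p (Y \<inter> Z))" "?p Z = pl F 0 (?p (Z - Y)) (?p (Y \<inter> Z))"
        by simp_all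
    qed
    moreover have "?p (Y - Z \<union> (Z - Y)) = pl F 0 (?p (Y - Z)) (?p (Z - Y))"
      by (rule un) auto
    moreover have "?p (Y - Z) \<in> elts F 0" "?p (Z - Y) \<in> elts F 0" "?p (Y \<inter> Z) \<in> elts F 0"
      using cl by (auto intro!: F0.finprod_closed)
    ultimately have "pl F 0 y z = ?p (Y - Z \<union> (Z - Y))"
      unfolding Y(3) Z(3) using gm by (simp add: pl_ac)
    then show ?case using Y Z add by (intro exI[of _ "Y - Z \<union> (Z - Y)"]) auto
  next
    case (act n y r k)
    then obtain Y where Y: "finite Y" "\<forall>x\<in>Y. (0, x) \<in> G" "y = finprod (comp F 0) (e 0) Y" by blast
    have y: "y \<in> elts F 0" unfolding Y(3) using Y(2) free_gen[OF F] by (intro F0.finprod_closed) auto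
    have "k = 0" "n = 0" using act by auto
    then have "r = \<zero>\<^bsub>Steenrod\<^esub> \<or> r = \<one>\<^bsub>Steenrod\<^esub>" using act Steenrod_deg_0 by auto
    then show ?case
    proof
      assume "r = \<zero>\<^bsub>Steenrod\<^esub>"
      then show ?thesis using y gm \<open>k = 0\<close> \<open>n = 0\<close> by (intro exI[of _ "{}"]) simp
    next
      assume "r = \<one>\<^bsub>Steenrod\<^esub>"
      then show ?thesis using y gm Y \<open>k = 0\<close> \<open>n = 0\<close> by auto
    qed
  qed
  then show ?thesis using free_span[OF F y] that by blast
qed

text \<open>
  By induction on the degree. Modulo the image of the top square, the free module is the suspension
  of a free module, on which the linear part of \<open>\<theta>\<close> is injective; and \<open>\<theta>\<close> turns the top square into
  the injective squaring map.
\<close>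

lemma free_to_tensor_injective:
  assumes "is_free G F e" "mor F tensor_gmod \<theta>" "\<forall>(n, x)\<in>G. \<theta> n (e n x) = monomial x (replicate n 0)"
    and "y \<in> elts F d" "\<theta> d y = zr tensor_gmod d"
  shows "y = zr F d"
  using assms
proof (induction d arbitrary: G F e \<theta> y rule: less_induct)
  case (less d)
  note F = less.prems(1) and \<theta> = less.prems(2,3) and y = less.prems(4,5)
  note um = free_um[OF F] and gm = um_gm[OF free_um[OF F]]
  show ?case
  proof (cases d)
    case 0
    interpret F0: comm_group "comp F 0" using gm by simp
    obtain Y where Y: "finite Y" "\<forall>x\<in>Y. (0, x) \<in> G" "y = finprod (comp F 0) (e 0) Y"
      using free_degree_0[OF F] y 0 by blast
    have "\<theta> 0 (finprod (comp F 0) (e 0) Y) = (\<lambda>x l. of_bool (x \<in> Y \<and> l = []))"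
      using Y(1,2)
    proof (induction Y rule: finite_induct)
      case empty
      then show ?case using mor_zr[OF gm gm_tensor \<theta>(1), of 0] by simp
    next
      case (insert x Y)
      have cl: "e 0 \<in> Y \<rightarrow> elts F 0" "e 0 x \<in> elts F 0" using insert free_gen[OF F] by auto
      have "finprod (comp F 0) (e 0) (insert x Y) = pl F 0 (e 0 x) (finprod (comp F 0) (e 0) Y)"
        using insert cl by (intro F0.finprod_insert) auto
      moreover have "\<theta> 0 (e 0 x) = monomial x []" using \<theta>(2) insert by auto
      ultimately show ?case
        using insert mor_pl[OF \<theta>(1) cl(2) F0.finprod_closed[OF cl(1)]]
        by (auto simp: fun_eq_iff monomial_def)
    qed
    then have "x \<notin> Y" for x using y 0 Y(3) by (simp add: fun_eq_iff)
    then have "Y = {}" by blast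
    then show ?thesis using Y(3) 0 by simp
  next
    case (Suc m)
    \<comment> \<open>The generators of the desuspension. Those of degree 0 disappear, being their
      own top squares.\<close>
    define G' where "G' = {(n, x). (Suc n, x) \<in> G}"
    obtain F' e' where F': "is_free G' F' e'" using free_exists by blast
    note um' = free_um[OF F'] and gm' = um_gm[OF free_um[OF F']]
    obtain \<theta>' where \<theta>': "mor F' tensor_gmod \<theta>'" "\<forall>(n, x)\<in>G'. \<theta>' n (e' n x) = monomial x (replicate n 0)"
      by (rule free_to_tensor[OF F'])
    define \<phi> where "\<phi> n x = (case n of 0 \<Rightarrow> zr F' 0 | Suc n \<Rightarrow> e' n x)" for n x
    have "\<phi> n x \<in> elts (suspension F') n" if "(n, x) \<in> G" for n x
      using that free_gen[OF F'] by (cases n) (auto simp: \<phi>_def G'_def)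
    then obtain \<pi> where \<pi>: "mor F (suspension F') \<pi>" "\<And>n x. (n, x) \<in> G \<Longrightarrow> \<pi> n (e n x) = \<phi> n x"
      using free_map[OF F um_suspension[OF um'], of \<phi>] by metis
    \<comment> \<open>Both sides are morphisms and agree on generators: the linear part of the
      product of n + 1 variables is the product of the remaining n.\<close>
    have "linear_part n (\<theta> n z) = susp_map tensor_gmod \<theta>' n (\<pi> n z)" if "z \<in> elts F n" for n z
    proof (rule free_map_unique[OF F gm_suspension[OF gm_tensor] _ _ _ that])
      show "mor F (suspension tensor_gmod) (\<lambda>n z. linear_part n (\<theta> n z))"
        by (rule mor_comp[OF \<theta>(1) mor_linear_part])
      show "mor F (suspension tensor_gmod) (\<lambda>n z. susp_map tensor_gmod \<theta>' n (\<pi> n z))"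
        by (rule mor_comp[OF \<pi>(1) mor_susp[OF gm' gm_tensor \<theta>'(1)]])
      fix n x assume nx: "(n, x) \<in> G"
      show "linear_part n (\<theta> n (e n x)) = susp_map tensor_gmod \<theta>' n (\<pi> n (e n x))"
      proof (cases n)
        case 0
        then show ?thesis by (simp add: fun_eq_iff linear_part_def)
      next
        case (Suc j)
        then have "(j, x) \<in> G'" using nx by (simp add: G'_def)
        then show ?thesis
          using bspec[OF \<theta>(2) nx] bspec[OF \<theta>'(2), of "(j, x)"] Suc \<pi>(2)[OF nx]
          by (simp add: fun_eq_iff linear_part_def \<phi>_def monomial_def)
      qed
    qed
    from this[OF y(1)] have "\<theta>' m (\<pi> d y) = zr tensor_gmod m"
      using y(2) Suc by (simp add: fun_eq_iff linear_part_def)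
    then have \<pi>y: "\<pi> d y = zr F' m"
      using less.IH[OF _ F' \<theta>', of m "\<pi> d y"] mor_closed[OF \<pi>(1) y(1)] Suc by simp
    \<comment> \<open>The projection onto \<open>Omega F\<close> factors through \<pi> by way of
      \<chi>, so what \<pi> kills lies in the image of the top square.\<close>
    obtain \<chi> where \<chi>: "mor F' (Omega F) \<chi>" "\<And>n x. (n, x) \<in> G' \<Longrightarrow> \<chi> n (e' n x) = omega_proj F n (e (Suc n) x)"
      using free_map[OF F' um_Omega[OF um], of "\<lambda>n x. omega_proj F n (e (Suc n) x)"]
        omega_proj_mem[OF um] free_gen[OF F] by (auto simp: G'_def)
    have "susp_map (Omega F) (omega_proj F) n z = susp_map (Omega F) \<chi> n (\<pi> n z)" if "z \<in> elts F n" for n z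
    proof (rule free_map_unique[OF F um_gm[OF um_suspension[OF um_Omega[OF um]]] _ _ _ that])
      show "mor F (suspension (Omega F)) (susp_map (Omega F) (omega_proj F))"
        by (rule mor_omega_unit[OF um])
      show "mor F (suspension (Omega F)) (\<lambda>n z. susp_map (Omega F) \<chi> n (\<pi> n z))"
        by (rule mor_comp[OF \<pi>(1) mor_susp[OF gm' um_gm[OF um_Omega[OF um]] \<chi>(1)]])
      fix n x assume nx: "(n, x) \<in> G"
      show "susp_map (Omega F) (omega_proj F) n (e n x) = susp_map (Omega F) \<chi> n (\<pi> n (e n x))"
      proof (cases n)
        case (Suc j)
        then have "(j, x) \<in> G'" using nx by (simp add: G'_def)
        then show ?thesis using \<chi>(2) \<pi>(2)[OF nx] Suc by (simp add: \<phi>_def)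
      qed simp
    qed
    from this[OF y(1)] have "omega_proj F m y = zr (Omega F) m"
      using \<pi>y Suc mor_zr[OF gm' um_gm[OF um_Omega[OF um]] \<chi>(1)] by simp
    then have "y \<in> im_top F d" using omega_proj_zr_iff[OF um, of y m] y(1) Suc by simp
    then show ?thesis
    proof (cases rule: im_topE)
      case (2 k z)
      have "act tensor_gmod k k (Sq k) (\<theta> k z) = \<theta> d y"
        unfolding 2(2,3) by (rule mor_act[OF \<theta>(1) Sq_deg 2(1), symmetric])
      then have "act tensor_gmod k k (Sq k) (\<theta> k z) = zr tensor_gmod (k + k)"
        using y(2) by simp
      then have "\<theta> k z = zr tensor_gmod k"
        using reduced_tensor mor_closed[OF \<theta>(1) 2(1)] unfolding reduced_def by blast
      moreover have "k < d" using 2(2) Suc by simp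
      ultimately have "z = zr F k" using less.IH[OF _ F \<theta>] 2(1) by blast
      then show ?thesis using 2 gm by simp
    qed
  qed
qed

lemma reduced_free:
  assumes F: "is_free G F e"
  shows "reduced F"
  unfolding reduced_def
proof (intro allI ballI impI)
  fix k x assume x: "x \<in> elts F k" and 0: "act F k k (Sq k) x = zr F (k + k)"
  obtain \<theta> where \<theta>: "mor F tensor_gmod \<theta>" "\<forall>(n, x)\<in>G. \<theta> n (e n x) = monomial x (replicate n 0)"
    by (rule free_to_tensor[OF F])
  have "act tensor_gmod k k (Sq k) (\<theta> k x) = zr tensor_gmod (k + k)"
    using mor_act[OF \<theta>(1) Sq_deg[of k] x] 0
      mor_zr[OF um_gm[OF free_um[OF F]] gm_tensor \<theta>(1), of "k + k"] by simp
  then have "\<theta> k x = zr tensor_gmod k"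
    using reduced_tensor mor_closed[OF \<theta>(1) x] unfolding reduced_def by blast
  then show "x = zr F k" by (rule free_to_tensor_injective[OF F \<theta> x])
qed

text \<open>A projective module is a retract of a free one, and retracts of reduced modules are
  reduced.\<close>

lemma reduced_projective:
  fixes P :: "int gmod"
  assumes P: "projective_U P"
  shows "reduced P"
  unfolding reduced_def
proof (intro allI ballI impI)
  note um = projective_um[OF P]
  obtain G F e f where F: "is_free G F e" "mor F P f" "\<forall>n. f n ` elts F n = elts P n"
    by (rule free_cover[OF um])
  obtain h where h: "mor P F h" "\<And>n x. x \<in> elts P n \<Longrightarrow> f n (h n x) = x"
  proof -
    have "x \<in> f n ` elts F n" if "x \<in> elts P n" for n x using F(3) that by simp
    then show ?thesis using projective_lift[OF P free_um[OF F(1)] um F(2) mor_id] that by metis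
  qed
  note gm = um_gm[OF um] um_gm[OF free_um[OF F(1)]]
  fix k x assume x: "x \<in> elts P k" and 0: "act P k k (Sq k) x = zr P (k + k)"
  have "act F k k (Sq k) (h k x) = zr F (k + k)"
    using mor_act[OF h(1) Sq_deg[of k] x] 0 mor_zr[OF gm h(1), of "k + k"] by simp
  then have "h k x = zr F k"
    using reduced_free[OF F(1)] mor_closed[OF h(1) x] unfolding reduced_def by blast
  then show "x = zr P k" using h(2)[OF x] mor_zr[OF gm(2,1) F(2)] by simp
qed

section \<open>The homology of \<open>\<Omega>\<close> of a resolution\<close>

lemma suspension_F2_top: "comp ((suspension ^^ n) F2_module) n = comp F2_module 0"
  by (induction n) simp_all

text \<open>The quotient Z/D consists of the single nonzero class of \<open>y0\<close> in degree
  \<open>N\<close>. The map tests membership in \<open>D\<close>: it is additive because degree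
  \<open>N\<close> has just two cosets, and it respects positive squares because they leave degree
  \<open>N\<close>, away from which \<open>Z\<close> and \<open>D\<close> agree.\<close>

lemma mor_to_sphere:
  fixes M :: "'a gmod"
  assumes M: "um M" and Z: "submod M Z" and D: "submod M D" and DZ: "\<And>m. D m \<subseteq> Z m"
    and off: "\<And>m. m \<noteq> N \<Longrightarrow> Z m \<subseteq> D m"
    and y0: "y0 \<in> Z N" "y0 \<notin> D N" "\<And>y. y \<in> Z N \<Longrightarrow> y \<in> D N \<or> pl M N y y0 \<in> D N"
  shows "\<exists>\<omega>. mor (sub_gmod M Z) ((suspension ^^ N) F2_module) \<omega> \<and>
    (\<forall>m. \<omega> m ` Z m = elts ((suspension ^^ N) F2_module) m) \<and>
    (\<forall>m. \<forall>y\<in>Z m. \<omega> m y = zr ((suspension ^^ N) F2_module) m \<longleftrightarrow> y \<in> D m)"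
proof -
  let ?S = "(suspension ^^ N) F2_module"
  define \<omega> where "\<omega> m y = (if y \<in> D m then 0 else 1 :: int)" for m y
  have S: "um ?S" by simp
  note gm = um_gm[OF M] and Zd = submodD[OF Z] and Dd = submodD[OF D]
  have cl: "\<omega> m y \<in> elts ?S m" if "y \<in> Z m" for m y
    using that off[of m] by (auto simp: \<omega>_def suspension_F2)
  have m: "mor (sub_gmod M Z) ?S \<omega>"
  proof (rule mor_SqI[OF gm_sub[OF gm Z] um_gm[OF S]])
    show "\<omega> m y \<in> elts ?S m" if "y \<in> elts (sub_gmod M Z) m" for m y using that cl by simp
    fix m x y assume "x \<in> elts (sub_gmod M Z) m" "y \<in> elts (sub_gmod M Z) m"
    then have x: "x \<in> Z m" and y: "y \<in> Z m" by simp_all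
    note c = Zd(1)[OF x] Zd(1)[OF y]
    show "\<omega> m (pl (sub_gmod M Z) m x y) = pl ?S m (\<omega> m x) (\<omega> m y)"
    proof (cases "m = N")
      case False
      then have "x \<in> D m" "y \<in> D m" using off x y by auto
      moreover from this have "pl M m x y \<in> D m" by (rule Dd(3))
      ultimately show ?thesis
        using pl_zr(1)[OF um_gm[OF S] zr_closed[OF um_gm[OF S]], of m] by (simp add: \<omega>_def suspension_F2)
    next
      case True
      have absorb: "v \<in> D m" if "u \<in> D m" "pl M m u v \<in> D m" "v \<in> elts M m" for u v
      proof -
        have "pl M m u (pl M m u v) \<in> D m" using that(1,2) by (rule Dd(3))
        then show ?thesis using that Dd(1) gm by simp
      qed
      have plS: "pl ?S m = pl F2_module 0" using True by (simp add: suspension_F2_top)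
      consider "x \<in> D m" "y \<in> D m" | "x \<in> D m" "y \<notin> D m" | "x \<notin> D m" "y \<in> D m" | "x \<notin> D m" "y \<notin> D m"
        by blast
      then show ?thesis
      proof cases
        case 1
        then have "pl M m x y \<in> D m" by (rule Dd(3))
        then show ?thesis using 1 by (simp add: \<omega>_def plS F2_simps)
      next
        case 2
        then have "pl M m x y \<notin> D m" using absorb c by blast
        then show ?thesis using 2 by (simp add: \<omega>_def plS F2_simps)
      next
        case 3
        then have "pl M m x y \<notin> D m" using absorb[of y x] c pl_comm[OF gm c] by metis
        then show ?thesis using 3 by (simp add: \<omega>_def plS F2_simps)
      next
        case 4
        then have "pl M m x y0 \<in> D m" "pl M m y y0 \<in> D m" using y0(3) x y True by auto
        then have "pl M m (pl M m x y0) (pl M m y y0) \<in> D m" by (rule Dd(3))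
        moreover have "pl M m (pl M m x y0) (pl M m y y0) = pl M m x y"
          using c Zd(1)[OF y0(1)] gm True by (simp add: pl_ac)
        ultimately show ?thesis using 4 by (simp add: \<omega>_def plS F2_simps)
      qed
    qed
  next
    fix k m :: nat and y assume k: "0 < k" and "y \<in> elts (sub_gmod M Z) m"
    then have y: "y \<in> Z m" by simp
    have "act M k m (Sq k) y \<in> D (m + k)"
    proof (cases "m = N")
      case True
      then show ?thesis using off[of "m + k"] k Zd(4)[OF Sq_deg y, of k] by auto
    next
      case False
      then show ?thesis using off[of m] y Dd(4)[OF Sq_deg] by blast
    qed
    moreover have "act ?S k m (Sq k) (\<omega> m y) = 0"
    proof (cases "m = N")
      case True
      have "act ?S k m (Sq k) (\<omega> m y) \<in> elts ?S (m + k)"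
        using cl[OF y] um_gm[OF S] by simp
      then show ?thesis using True k by (simp add: suspension_F2)
    next
      case False
      then have "\<omega> m y = zr ?S m" using cl[OF y] by (simp add: suspension_F2)
      then show ?thesis using act_zr[OF um_gm[OF S] Sq_deg, of k m] by (simp add: suspension_F2)
    qed
    ultimately show "\<omega> (m + k) (act (sub_gmod M Z) k m (Sq k) y) = act ?S k m (Sq k) (\<omega> m y)"
      by (simp add: \<omega>_def)
  qed
  have im: "\<omega> m ` Z m = elts ?S m" for m
  proof
    show "\<omega> m ` Z m \<subseteq> elts ?S m" using cl by blast
    have "0 \<in> \<omega> m ` Z m" using Dd(2)[of m] Zd(2)[of m] by (auto simp: \<omega>_def intro!: image_eqI[of _ _ "zr M m"])
    moreover have "1 \<in> \<omega> m ` Z m" if "m = N" using y0 that by (auto simp: \<omega>_def intro!: image_eqI[of _ _ y0])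
    ultimately show "elts ?S m \<subseteq> \<omega> m ` Z m" by (auto simp: suspension_F2)
  qed
  show ?thesis using m im by (intro exI[of _ \<omega>]) (simp add: \<omega>_def suspension_F2)
qed

locale omega_resolution =
  fixes n :: nat and P :: "nat \<Rightarrow> int gmod" and d
  assumes res: "resolution ((suspension ^^ Suc n) F2_module) P d"
begin

abbreviation "A \<equiv> (suspension ^^ Suc n) F2_module"
abbreviation "B \<equiv> (suspension ^^ n) F2_module"

definition "C s = Omega (P s)"
definition "dC s = Omega_map (P (s - 1)) (d s)"
text \<open>\<open>A\<close> is the suspension of \<open>B\<close>, so the adjoint of
  \<open>d 0\<close> is an augmentation of \<open>Omega (P 0)\<close> to \<open>B\<close>.\<close>

definition "aug m = d 0 (Suc m)"

lemma umA: "um A" and umB: "um B"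
  by (rule um_suspension_funpow, simp)+

lemmas resD = resolutionD[OF res] and cD = chain_complexD[OF resolutionD(2)[OF res]]

lemma umC: "um (C s)" unfolding C_def by (rule um_Omega[OF cD(1)])

lemma projC: "projective_U (C s)" unfolding C_def by (rule projective_Omega[OF resD(1)])

lemma redP: "reduced (P s)" by (rule reduced_projective[OF resD(1)])

lemma C_E:
  assumes "x \<in> elts (C s) m"
  shows "x \<in> elts (P s) (Suc m)" "omega_proj (P s) m x = x"
  using assms Omega_elts_closed[OF cD(1)] Omega_elts_fixed[OF cD(1)] unfolding C_def by blast+

lemma proj_C: "x \<in> elts (P s) (Suc m) \<Longrightarrow> omega_proj (P s) m x \<in> elts (C s) m"
  unfolding C_def by (rule omega_proj_mem[OF cD(1)])

lemma proj_C_zr: "x \<in> elts (P s) (Suc m) \<Longrightarrow> omega_proj (P s) m x = zr (C s) m \<longleftrightarrow> x \<in> im_top (P s) (Suc m)"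
  unfolding C_def by (rule omega_proj_zr_iff[OF cD(1)])

lemma mor_dC: "mor (C (Suc s)) (C s) (dC (Suc s))"
  unfolding C_def dC_def using mor_Omega_map[OF cD(1,1,3)] by simp

lemma dC_proj: "x \<in> elts (P (Suc s)) (Suc m) \<Longrightarrow>
    dC (Suc s) m (omega_proj (P (Suc s)) m x) = omega_proj (P s) m (d (Suc s) (Suc m) x)"
  unfolding dC_def using Omega_map_proj[OF cD(1,1,3)] by simp

lemma dC_zr_iff:
  assumes "x \<in> elts (C (Suc s)) m"
  shows "dC (Suc s) m x = zr (C s) m \<longleftrightarrow> d (Suc s) (Suc m) x \<in> im_top (P s) (Suc m)"
  using dC_proj[OF C_E(1)[OF assms]] C_E(2)[OF assms] proj_C_zr[OF mor_closed[OF cD(3) C_E(1)[OF assms]]] by simp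

lemma chain_C: "chain_complex C dC"
  unfolding chain_complex_def
proof (intro conjI allI ballI umC mor_dC)
  fix s m x assume x: "x \<in> elts (C (Suc (Suc s))) m"
  note c = C_E[OF x]
  have dx: "d (Suc (Suc s)) (Suc m) x \<in> elts (P (Suc s)) (Suc m)" by (rule mor_closed[OF cD(3) c(1)])
  have "dC (Suc (Suc s)) m x = omega_proj (P (Suc s)) m (d (Suc (Suc s)) (Suc m) x)"
    using dC_proj[OF c(1)] c(2) by simp
  then have "dC (Suc s) m (dC (Suc (Suc s)) m x) = omega_proj (P s) m (zr (P s) (Suc m))"
    using dC_proj[OF dx] cD(4)[OF c(1)] by simp
  also have "\<dots> = zr (C s) m"
    by (subst proj_C_zr) (simp_all add: cD(2) im_top_def)
  finally show "dC (Suc s) m (dC (Suc (Suc s)) m x) = zr (C s) m" .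
qed

text \<open>In even degrees zero is the top square of zero, so the extra alternative is confined to
  odd degrees.\<close>

lemma im_topE':
  assumes "y \<in> im_top (P s) N"
  obtains k z where "z \<in> elts (P s) k" "y = act (P s) k k (Sq k) z" "N = k + k" | "y = zr (P s) N" "odd N"
  using assms
proof (cases rule: im_topE)
  case 1
  show ?thesis
  proof (cases "even N")
    case True
    then obtain k where "N = k + k" by (metis evenE mult_2)
    then show ?thesis using that(1)[of "zr (P s) k" k] 1 cD(2)[of s] by simp
  qed (use that 1 in blast)
qed (use that in blast)

text \<open>As \<open>d (y - Sq\<^sup>k w) = 0\<close>, exactness of \<open>P\<close> makes \<open>y\<close> a boundary modulo the image of the top square.\<close>

lemma boundary_mod_top:
  assumes y: "y \<in> elts (C (Suc s)) m" and w: "w \<in> elts (P (Suc s)) k" and m: "Suc m = k + k"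
    and dy: "d (Suc s) (Suc m) y = act (P s) k k (Sq k) (d (Suc s) k w)"
  shows "y \<in> dC (Suc (Suc s)) m ` elts (C (Suc (Suc s))) m"
proof -
  let ?N = "Suc m"
  let ?w = "act (P (Suc s)) k k (Sq k) w"
  note c = C_E[OF y] and gm = cD(2)
  have w': "?w \<in> elts (P (Suc s)) ?N" using w gm m by simp
  let ?u = "pl (P (Suc s)) ?N y ?w"
  have u: "?u \<in> elts (P (Suc s)) ?N" using c w' gm by simp
  have "d (Suc s) ?N ?w = act (P s) k k (Sq k) (d (Suc s) k w)"
    unfolding m by (rule mor_act[OF cD(3) Sq_deg w])
  then have "d (Suc s) ?N ?u = zr (P s) ?N"
    using mor_pl[OF cD(3) c(1) w'] dy mor_closed[OF cD(3) w'] gm by simp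
  then obtain v where v: "v \<in> elts (P (Suc (Suc s))) ?N" "?u = d (Suc (Suc s)) ?N v"
    using resD(3) u unfolding exact_positive_def by blast
  have "pl (P (Suc s)) ?N y ?u = ?w" using c(1) w' gm by simp
  then have "pl (P (Suc s)) ?N y ?u \<in> im_top (P (Suc s)) ?N"
    using im_topI[OF w] m by simp
  then have "y = omega_proj (P (Suc s)) m ?u"
    using omega_proj_eq_iff[OF cD(1) c(1) u] c(2) by simp
  also have "\<dots> = dC (Suc (Suc s)) m (omega_proj (P (Suc (Suc s))) m v)"
    using dC_proj[OF v(1)] v(2) by simp
  finally show ?thesis using proj_C[OF v(1)] by blast
qed

lemma boundary_odd:
  assumes y: "y \<in> elts (C (Suc s)) m" and dy: "d (Suc s) (Suc m) y = zr (P s) (Suc m)"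
  shows "y \<in> dC (Suc (Suc s)) m ` elts (C (Suc (Suc s))) m"
proof -
  note c = C_E[OF y]
  obtain v where v: "v \<in> elts (P (Suc (Suc s))) (Suc m)" "y = d (Suc (Suc s)) (Suc m) v"
    using resD(3) c(1) dy unfolding exact_positive_def by blast
  then have "y = dC (Suc (Suc s)) m (omega_proj (P (Suc (Suc s))) m v)"
    using dC_proj[OF v(1)] c(2) by simp
  then show ?thesis using proj_C[OF v(1)] by blast
qed

text \<open>If d y is the top square of z, then d z has vanishing top square, so d z = 0 as
  \<open>P\<close> is reduced. In these degrees exactness yields z = d w, and
  \<open>boundary_mod_top\<close> applies. One degree lower z need only be a boundary modulo the
  class it has in \<open>A\<close>, which is where homology arises.\<close>

lemma exact_C: "exact_positive (\<lambda>s. C (Suc s)) (\<lambda>s. dC (Suc s))"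
  unfolding exact_positive_def
proof (intro allI ballI impI)
  fix s m y assume y: "y \<in> elts (C (Suc (Suc s))) m" and "dC (Suc (Suc s)) m y = zr (C (Suc s)) m"
  then have "d (Suc (Suc s)) (Suc m) y \<in> im_top (P (Suc s)) (Suc m)" by (simp only: dC_zr_iff)
  then show "y \<in> dC (Suc (Suc (Suc s))) m ` elts (C (Suc (Suc (Suc s)))) m"
  proof (cases rule: im_topE')
    case (1 k z)
    have "act (P s) k k (Sq k) (d (Suc s) k z) = d (Suc s) (Suc m) (d (Suc (Suc s)) (Suc m) y)"
      unfolding 1(2) unfolding 1(3) by (rule mor_act[OF cD(3) Sq_deg 1(1), symmetric])
    also have "\<dots> = zr (P s) (k + k)" using cD(4)[OF C_E(1)[OF y]] 1(3) by simp
    finally have "d (Suc s) k z = zr (P s) k"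
      using redP mor_closed[OF cD(3) 1(1)] unfolding reduced_def by blast
    then obtain w where "w \<in> elts (P (Suc (Suc s))) k" "z = d (Suc (Suc s)) k w"
      using resD(3) 1(1) unfolding exact_positive_def by blast
    then show ?thesis using boundary_mod_top[OF y _ 1(3)] 1(2) by simp
  qed (rule boundary_odd[OF y])
qed

lemma mor_aug: "mor (C 0) B aug"
  unfolding C_def aug_def[abs_def]
  by (rule omega_adjoint_mor[OF cD(1) umB]) (use resD(4) in simp)

lemma aug_proj: "x \<in> elts (P 0) (Suc m) \<Longrightarrow> aug m (omega_proj (P 0) m x) = d 0 (Suc m) x"
  unfolding aug_def
  by (rule omega_adjoint_proj[OF cD(1) umB]) (use resD(4) in simp_all)

lemma aug_surj: "aug m ` elts (C 0) m = elts B m"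
proof
  show "aug m ` elts (C 0) m \<subseteq> elts B m" using mor_aug by auto
  show "elts B m \<subseteq> aug m ` elts (C 0) m"
  proof
    fix b assume "b \<in> elts B m"
    then have "b \<in> d 0 (Suc m) ` elts (P 0) (Suc m)" using resD(5)[of "Suc m"] by simp
    then obtain x where "b = d 0 (Suc m) x" and x: "x \<in> elts (P 0) (Suc m)" by (rule imageE)
    then have "b = aug m (omega_proj (P 0) m x)" by (simp only: aug_proj)
    then show "b \<in> aug m ` elts (C 0) m" using proj_C[OF x] by (rule image_eqI)
  qed
qed

text \<open>Right exactness of the left adjoint \<open>Omega\<close>, spelled out on
  elements.\<close>

lemma aug_zr_iff:
  assumes x: "x \<in> elts (C 0) m"
  shows "aug m x = zr B m \<longleftrightarrow> x \<in> dC 1 m ` elts (C 1) m"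
proof
  note c = C_E[OF x]
  assume "aug m x = zr B m"
  then have "d 0 (Suc m) x = zr A (Suc m)" by (simp add: aug_def)
  then obtain v where v: "v \<in> elts (P 1) (Suc m)" "x = d 1 (Suc m) v" using resD(6)[OF c(1)] by blast
  then have "x = dC 1 m (omega_proj (P 1) m v)" using dC_proj[of v 0] c(2) by simp
  then show "x \<in> dC 1 m ` elts (C 1) m" using proj_C[OF v(1)] by blast
next
  assume "x \<in> dC 1 m ` elts (C 1) m"
  then obtain v where v: "v \<in> elts (C 1) m" "x = dC 1 m v" by blast
  note c = C_E[OF v(1)]
  have dv: "d 1 (Suc m) v \<in> elts (P 0) (Suc m)" using mor_closed[OF cD(3)[of 0]] c by simp
  have "x = dC 1 m (omega_proj (P 1) m v)" using c(2) v(2) by simp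
  then have "x = omega_proj (P 0) m (d 1 (Suc m) v)" using dC_proj[of v 0 m] c(1) by simp
  then have "aug m x = d 0 (Suc m) (d 1 (Suc m) v)" using aug_proj[OF dv] by simp
  also have "\<dots> = zr A (Suc m)" using resD(6)[OF dv] c(1) by blast
  finally show "aug m x = zr B m" by simp
qed

section \<open>The homology of \<open>Omega P\<close> in degree 1\<close>

definition "Z1 m = {x \<in> elts (C 1) m. dC 1 m x = zr (C 0) m}"
definition "D1 m = dC 2 m ` elts (C 2) m"

lemma submod_Z1: "submod (C 1) Z1"
  unfolding Z1_def[abs_def] using mor_dC[of 0] by (intro submod_kernel[where N = "C 0"]) (simp_all add: umC)

lemma submod_D1: "submod (C 1) D1"
  unfolding D1_def[abs_def] using mor_dC[of 1] by (intro submod_image) (simp_all add: umC numeral_2_eq_2)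

text \<open>The square doubles a positive degree, whereas \<open>A\<close> is nonzero in degree n+1
  only.\<close>

lemma A_top_zero: "a \<in> elts A k \<Longrightarrow> 0 < k \<Longrightarrow> act A k k (Sq k) a = zr A (k + k)"
proof -
  assume a: "a \<in> elts A k" and k: "0 < k"
  have gm: "gm A" by (rule um_gm[OF umA])
  show ?thesis
  proof (cases "k = Suc n")
    case True
    have "act A k k (Sq k) a \<in> elts A (k + k)" using a gm by (intro act_closedI) auto
    then show ?thesis using True unfolding suspension_F2 by simp
  next
    case False
    then have "a = zr A k" using a unfolding suspension_F2 by simp
    then show ?thesis using act_zr[OF gm Sq_deg] by metis
  qed
qed

text \<open>The connecting map sends a cycle y with d y = Sq z to the class of z in
  \<open>A\<close>. It can be nonzero only when z has degree n+1, so that d y has degree 2n+2 and y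
  has degree 2n+1 in \<open>Omega (P 1)\<close>.\<close>

lemma omega_exists:
  "\<exists>\<omega>. mor (sub_gmod (C 1) Z1) ((suspension ^^ (2 * n + 1)) F2_module) \<omega> \<and>
    (\<forall>m. \<omega> m ` Z1 m = elts ((suspension ^^ (2 * n + 1)) F2_module) m) \<and>
    (\<forall>m. \<forall>y\<in>Z1 m. \<omega> m y = zr ((suspension ^^ (2 * n + 1)) F2_module) m \<longleftrightarrow> y \<in> D1 m)"
proof -
  have gmP: "gm (P s)" for s by (rule cD(2))
  have m1: "mor (P 1) (P 0) (d 1)" using cD(3)[of 0] by simp
  have DZ: "D1 m \<subseteq> Z1 m" for m
    using chain_complexD(4)[OF chain_C, of _ 0 m] mor_closed[OF mor_dC[of 1]]
    by (auto simp: D1_def Z1_def numeral_2_eq_2)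
  \<comment> \<open>Cycles on which the connecting map vanishes are boundaries: z = d w, and then
    \<open>boundary_mod_top\<close> applies.\<close>
  have top: "y \<in> D1 m" if y: "y \<in> Z1 m" and m: "Suc m = k + k" and z: "z \<in> elts (P 0) k"
    and dy: "d 1 (Suc m) y = act (P 0) k k (Sq k) z" and ez: "d 0 k z = zr A k" for y m k z
  proof -
    obtain w where w: "w \<in> elts (P 1) k" "z = d 1 k w" using resD(6)[OF z] ez by blast
    show ?thesis
      using boundary_mod_top[of y 0 m w k] y m dy w by (simp add: Z1_def D1_def numeral_2_eq_2)
  qed
  have cases: "y \<in> D1 m \<or> (m = 2 * n + 1 \<and> (\<exists>z\<in>elts (P 0) (Suc n).
      d 1 (Suc m) y = act (P 0) (Suc n) (Suc n) (Sq (Suc n)) z \<and> d 0 (Suc n) z = 1))" if y: "y \<in> Z1 m" for y m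
  proof -
    have yc: "y \<in> elts (C (Suc 0)) m" using y by (simp add: Z1_def)
    have "d 1 (Suc m) y \<in> im_top (P 0) (Suc m)" using y dC_zr_iff[OF yc] by (simp add: Z1_def)
    then show ?thesis
    proof (cases rule: im_topE')
      case (1 k z)
      show ?thesis
      proof (cases "d 0 k z = zr A k")
        case True
        from top[OF y 1(3,1,2) this] show ?thesis ..
      next
        case False
        have "d 0 k z \<in> elts A k" by (rule mor_closed[OF resD(4) 1(1)])
        with False have k: "k = Suc n" and dz: "d 0 k z = 1"
          unfolding suspension_F2 by (auto split: if_splits)
        have "m = 2 * n + 1" using 1(3) k by simp
        moreover have "z \<in> elts (P 0) (Suc n)" "d 0 (Suc n) z = 1"
          "d 1 (Suc m) y = act (P 0) (Suc n) (Suc n) (Sq (Suc n)) z"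
          using 1(1,2) dz unfolding k by (assumption | simp only: One_nat_def)+
        ultimately show ?thesis by (intro disjI2 conjI bexI[of _ z])
      qed
    next
      case 2
      have "d (Suc 0) (Suc m) y = zr (P 0) (Suc m)" using 2(1) by simp
      from boundary_odd[OF yc this] have "y \<in> D1 m" by (simp add: D1_def numeral_2_eq_2)
      then show ?thesis ..
    qed
  qed
  let ?k = "Suc n"
  define N where "N = 2 * n + 1"
  have NN: "Suc N = ?k + ?k" by (simp add: N_def)
  \<comment> \<open>The generator of the homology comes from a lift \<open>z0\<close> of the nonzero
    element of \<open>A\<close>: its top square maps to zero in \<open>A\<close>, hence is the
    boundary of some \<open>y1\<close>, whose projection is a cycle.\<close>
  obtain z0 where z0: "z0 \<in> elts (P 0) ?k" "d 0 ?k z0 = 1"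
  proof -
    have "1 \<in> elts A ?k" unfolding suspension_F2 by simp
    then show ?thesis using resD(5)[of ?k] that by (metis imageE)
  qed
  let ?Sz = "\<lambda>z. act (P 0) ?k ?k (Sq ?k) z"
  have "d 0 (?k + ?k) (?Sz z0) = act A ?k ?k (Sq ?k) (d 0 ?k z0)"
    by (rule mor_act[OF resD(4) Sq_deg z0(1)])
  also have "\<dots> = zr A (?k + ?k)" using A_top_zero[OF mor_closed[OF resD(4) z0(1)]] by simp
  finally have "?Sz z0 \<in> d 1 (?k + ?k) ` elts (P 1) (?k + ?k)"
    using resD(6)[of "?Sz z0" "?k + ?k"] z0 gmP by simp
  then obtain y1 where "?Sz z0 = d 1 (?k + ?k) y1" "y1 \<in> elts (P 1) (?k + ?k)" by (rule imageE)
  then have y1: "y1 \<in> elts (P 1) (Suc N)" "d 1 (Suc N) y1 = ?Sz z0" unfolding NN by simp_all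
  let ?y0 = "omega_proj (P 1) N y1"
  have y0c: "?y0 \<in> elts (C 1) N" by (rule proj_C[OF y1(1)])
  have "dC 1 N ?y0 = omega_proj (P 0) N (?Sz z0)" using dC_proj[of y1 0] y1 by simp
  also have "\<dots> = zr (C 0) N"
  proof -
    have "?Sz z0 \<in> elts (P 0) (Suc N)" using z0(1) gmP NN by (intro act_closedI) auto
    then show ?thesis using im_topI[OF z0(1), folded NN] proj_C_zr by blast
  qed
  finally have y0: "?y0 \<in> Z1 N" using y0c by (simp add: Z1_def)
  \<comment> \<open>If the generator were a boundary, injectivity of the top square would make
    \<open>z0\<close> a boundary, against its value 1 in \<open>A\<close>.\<close>
  have y0_not: "?y0 \<notin> D1 N"
  proof
    assume "?y0 \<in> D1 N"
    then obtain v where v: "v \<in> elts (C 2) N" "?y0 = dC 2 N v" by (auto simp: D1_def)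
    note cv = C_E[OF v(1)]
    have dv: "d 2 (Suc N) v \<in> elts (P 1) (Suc N)"
      using mor_closed[OF cD(3)[of 1]] cv(1) by (simp add: numeral_2_eq_2)
    have "?y0 = dC 2 N (omega_proj (P 2) N v)" using v(2) cv(2) by simp
    then have "?y0 = omega_proj (P 1) N (d 2 (Suc N) v)"
      using dC_proj[of v 1 N] cv(1) by (simp add: numeral_2_eq_2)
    then have "pl (P 1) (Suc N) y1 (d 2 (Suc N) v) \<in> im_top (P 1) (Suc N)"
      using omega_proj_eq_iff[OF cD(1) y1(1) dv] by simp
    then obtain w where w: "w \<in> elts (P 1) ?k" "pl (P 1) (Suc N) y1 (d 2 (Suc N) v) = act (P 1) ?k ?k (Sq ?k) w"
    proof (cases rule: im_topE')
      case (1 k z)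
      then have "k = ?k" using NN by simp
      then show ?thesis using that 1 by blast
    qed (simp add: N_def)
    have dd: "d 1 (Suc N) (d 2 (Suc N) v) = zr (P 0) (Suc N)"
      using cD(4)[of v 0] cv(1) by (simp add: numeral_2_eq_2)
    have "?Sz z0 = d 1 (Suc N) (pl (P 1) (Suc N) y1 (d 2 (Suc N) v))"
      using mor_pl[OF m1 y1(1) dv] y1(2) dd act_closed[OF gmP Sq_deg z0(1), of ?k] gmP NN by simp
    also have "\<dots> = ?Sz (d 1 ?k w)"
      unfolding w(2) unfolding NN by (rule mor_act[OF m1 Sq_deg w(1)])
    finally have e: "?Sz z0 = ?Sz (d 1 ?k w)" .
    have dw: "d 1 ?k w \<in> elts (P 0) ?k" by (rule mor_closed[OF m1 w(1)])
    have "?Sz (pl (P 0) ?k z0 (d 1 ?k w)) = zr (P 0) (?k + ?k)"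
      using act_pl[OF gmP Sq_deg z0(1) dw] e dw gmP by simp
    then have "pl (P 0) ?k z0 (d 1 ?k w) = zr (P 0) ?k"
      using redP[of 0] z0(1) dw gmP unfolding reduced_def by (meson pl_closed)
    then have "z0 = d 1 ?k w" using pl_eq_zr_iff[OF gmP z0(1) dw] by simp
    then have "d 0 ?k z0 = zr A ?k" using resD(6)[OF z0(1)] w(1) by blast
    then show False using z0(2) unfolding suspension_F2 by simp
  qed
  \<comment> \<open>Otherwise \<open>y\<close>, \<open>?y0\<close> and their sum would all have
    connecting value 1. The sum is computed in \<open>P 1\<close> up to a top square, so the three
    classes \<open>z\<close>, \<open>z0\<close> and \<open>z'\<close> add up to a boundary; but 1 +
    1 + 1 = 1 in F_2.\<close>
  have diff: "y \<in> D1 N \<or> pl (C 1) N y ?y0 \<in> D1 N" if y: "y \<in> Z1 N" for y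
  proof (rule disjCI, rule ccontr)
    assume "\<not> y \<in> D1 N" and n2: "pl (C 1) N y ?y0 \<notin> D1 N"
    then obtain z where z: "z \<in> elts (P 0) ?k" "d 1 (Suc N) y = ?Sz z" "d 0 ?k z = 1"
      using cases[OF y] by blast
    let ?y' = "pl (C 1) N y ?y0" and ?u = "pl (P 1) (Suc N) y y1"
    have yc: "y \<in> elts (C 1) N" using y by (simp add: Z1_def)
    note yP = C_E[OF yc]
    have y': "?y' \<in> Z1 N" using submodD(3)[OF submod_Z1 y y0] .
    then obtain z' where z': "z' \<in> elts (P 0) ?k" "d 1 (Suc N) ?y' = ?Sz z'" "d 0 ?k z' = 1"
      using cases[OF y'] n2 by blast
    have y'c: "?y' \<in> elts (C 1) N" using y' by (simp add: Z1_def)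
    note y'P = C_E[OF y'c]
    have u: "?u \<in> elts (P 1) (Suc N)" using yP y1 gmP by simp
    have "?y' = omega_proj (P 1) N ?u"
      using mor_pl[OF mor_omega_proj[OF cD(1)], of y 1 N y1] yP y1(1) by (simp add: C_def)
    then have "pl (P 1) (Suc N) ?u ?y' \<in> im_top (P 1) (Suc N)"
      using omega_proj_eq_iff[OF cD(1) u y'P(1)] y'P(2) by simp
    then obtain w where w: "w \<in> elts (P 1) ?k" "pl (P 1) (Suc N) ?u ?y' = act (P 1) ?k ?k (Sq ?k) w"
    proof (cases rule: im_topE')
      case (1 k z)
      then have "k = ?k" using NN by simp
      then show ?thesis using that 1 by blast
    qed (simp add: N_def)
    have dw: "d 1 ?k w \<in> elts (P 0) ?k" by (rule mor_closed[OF m1 w(1)])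
    let ?z = "pl (P 0) ?k (pl (P 0) ?k z z0) z'"
    have "?Sz (d 1 ?k w) = d 1 (Suc N) (pl (P 1) (Suc N) ?u ?y')"
      unfolding w(2) unfolding NN by (rule mor_act[OF m1 Sq_deg w(1), symmetric])
    also have "\<dots> = pl (P 0) (Suc N) (pl (P 0) (Suc N) (?Sz z) (?Sz z0)) (?Sz z')"
      using mor_pl[OF m1 u y'P(1)] mor_pl[OF m1 yP(1) y1(1)] z(2) y1(2) z'(2) by simp
    also have "\<dots> = ?Sz ?z"
      unfolding NN using act_pl[OF gmP Sq_deg, of _ 0 ?k _ ?k] z(1) z0(1) z'(1) gmP by simp
    finally have e: "?Sz (d 1 ?k w) = ?Sz ?z" .
    have zc: "?z \<in> elts (P 0) ?k" using z z0 z' gmP by simp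
    have "?Sz (pl (P 0) ?k (d 1 ?k w) ?z) = zr (P 0) (?k + ?k)"
      using act_pl[OF gmP Sq_deg dw zc] e zc gmP by simp
    then have "pl (P 0) ?k (d 1 ?k w) ?z = zr (P 0) ?k"
      using redP[of 0] zc dw gmP unfolding reduced_def by (meson pl_closed)
    then have "d 1 ?k w = ?z" using pl_eq_zr_iff[OF gmP dw zc] by simp
    then have "?z \<in> d 1 ?k ` elts (P 1) ?k" using w(1) by (rule image_eqI[OF sym])
    then have "d 0 ?k ?z = zr A ?k" by (rule iffD2[OF resD(6)[OF zc]])
    moreover have "d 0 ?k ?z = pl A ?k (pl A ?k 1 1) 1"
      using mor_pl[OF resD(4), of _ ?k] z z0 z' gmP by simp
    ultimately show False
      unfolding suspension_F2 suspension_F2_top by (simp add: F2_simps)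
  qed
  have off: "Z1 m \<subseteq> D1 m" if "m \<noteq> N" for m using cases that unfolding N_def by blast
  show ?thesis
    unfolding N_def[symmetric]
  proof (rule mor_to_sphere[OF umC submod_Z1 submod_D1 DZ _ y0 y0_not])
    show "Z1 m \<subseteq> D1 m" if "m \<noteq> N" for m using that by (rule off)
    show "y \<in> D1 N \<or> pl (C 1) N y ?y0 \<in> D1 N" if "y \<in> Z1 N" for y using that by (rule diff)
  qed
qed

end

section \<open>The mapping cone\<close>

text \<open>Coding pairs by integers keeps direct sums on \<open>int\<close>, the type on which Ext
  of the spheres is computed.\<close>

definition dpair :: "int \<Rightarrow> int \<Rightarrow> int" where "dpair x y = int (to_nat (x, y))"
definition dfst :: "int \<Rightarrow> int" where "dfst z = fst (from_nat (nat z) :: int \<times> int)"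
definition dsnd :: "int \<Rightarrow> int" where "dsnd z = snd (from_nat (nat z) :: int \<times> int)"

lemma dpair_simps [simp]: "dfst (dpair x y) = x" "dsnd (dpair x y) = y"
  by (simp_all add: dpair_def dfst_def dsnd_def)

lemma dpair_eq_iff [simp]: "dpair x y = dpair x' y' \<longleftrightarrow> x = x' \<and> y = y'"
  by (metis dpair_simps)

definition dsum :: "int gmod \<Rightarrow> int gmod \<Rightarrow> int gmod" where
  "dsum M N =
    \<lparr>comp = (\<lambda>n. \<lparr>carrier = (\<lambda>(x, y). dpair x y) ` (elts M n \<times> elts N n),
        monoid.mult = (\<lambda>z w. dpair (pl M n (dfst z) (dfst w)) (pl N n (dsnd z) (dsnd w))),
        one = dpair (zr M n) (zr N n)\<rparr>),
     act = (\<lambda>k n r z. dpair (act M k n r (dfst z)) (act N k n r (dsnd z)))\<rparr>"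

lemma dsum_simps [simp]:
  "pl (dsum M N) n z w = dpair (pl M n (dfst z) (dfst w)) (pl N n (dsnd z) (dsnd w))"
  "zr (dsum M N) n = dpair (zr M n) (zr N n)"
  "act (dsum M N) k n r z = dpair (act M k n r (dfst z)) (act N k n r (dsnd z))"
  by (simp_all add: dsum_def)

lemma dsum_elts: "elts (dsum M N) n = (\<lambda>(x, y). dpair x y) ` (elts M n \<times> elts N n)"
  by (simp add: dsum_def)

lemma dpair_mem [simp]: "dpair x y \<in> elts (dsum M N) n \<longleftrightarrow> x \<in> elts M n \<and> y \<in> elts N n"
  by (auto simp: dsum_elts)

lemma dsum_E:
  assumes "z \<in> elts (dsum M N) n"
  obtains x y where "z = dpair x y" "x \<in> elts M n" "y \<in> elts N n"
  using assms by (auto simp: dsum_elts)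

lemma gm_dsum:
  assumes "gm M" "gm N"
  shows "gm (dsum M N)"
  by (rule gmI) (auto elim!: dsum_E simp: assms act_pl act_plus act_mult pl_assoc act_closed,
    auto simp: assms pl_comm)

lemma um_dsum:
  assumes "um M" "um N"
  shows "um (dsum M N)"
  by (rule umI) (use assms in \<open>auto elim!: dsum_E simp: gm_dsum um_Sq\<close>)

lemma mor_dfst: "mor (dsum M N) M (\<lambda>n. dfst)"
  by (rule morI) (auto elim!: dsum_E)

lemma mor_dsnd: "mor (dsum M N) N (\<lambda>n. dsnd)"
  by (rule morI) (auto elim!: dsum_E)

lemma mor_dpair: "mor K M f \<Longrightarrow> mor K N g \<Longrightarrow> mor K (dsum M N) (\<lambda>n x. dpair (f n x) (g n x))"
  by (rule morI) (simp_all add: mor_pl mor_act)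

lemma mor_inl: "gm N \<Longrightarrow> mor M (dsum M N) (\<lambda>n x. dpair x (zr N n))"
  by (intro mor_dpair mor_id mor_zero)

lemma mor_inr: "gm M \<Longrightarrow> mor N (dsum M N) (\<lambda>n y. dpair (zr M n) y)"
  by (intro mor_dpair mor_id mor_zero)

lemma mor_dsum_split:
  assumes "gm M" "gm N" and f: "mor (dsum M N) K f" and "x \<in> elts M n" "y \<in> elts N n"
  shows "f n (dpair x y) = pl K n (f n (dpair x (zr N n))) (f n (dpair (zr M n) y))"
  using mor_pl[OF f, of "dpair x (zr N n)" n "dpair (zr M n) y"] assms by simp

lemma projective_dsum:
  assumes "projective_U P" "projective_U Q"
  shows "projective_U (dsum P Q)"
proof (rule projectiveI)
  note um = projective_um[OF assms(1)] projective_um[OF assms(2)]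
  note gm = um_gm[OF um(1)] um_gm[OF um(2)]
  show "um (dsum P Q)" by (rule um_dsum[OF um])
  fix M N :: "int gmod" and g f
  assume M: "um M" and N: "um N" and g: "mor M N g" and f: "mor (dsum P Q) N f"
    and surj: "\<And>n. g n ` elts M n = elts N n"
  have 1: "mor P N (\<lambda>n x. f n (dpair x (zr Q n)))" by (rule mor_comp[OF mor_inl[OF gm(2)] f])
  have 2: "mor Q N (\<lambda>n y. f n (dpair (zr P n) y))" by (rule mor_comp[OF mor_inr[OF gm(1)] f])
  obtain h where h: "mor P M h" "\<And>n x. x \<in> elts P n \<Longrightarrow> g n (h n x) = f n (dpair x (zr Q n))"
    by (rule projective_lift[OF assms(1) M N g 1]) (use surj mor_closed[OF 1] in auto)
  obtain k where k: "mor Q M k" "\<And>n y. y \<in> elts Q n \<Longrightarrow> g n (k n y) = f n (dpair (zr P n) y)"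
    by (rule projective_lift[OF assms(2) M N g 2]) (use surj mor_closed[OF 2] in auto)
  let ?h = "\<lambda>n z. pl M n (h n (dfst z)) (k n (dsnd z))"
  have m: "mor (dsum P Q) M ?h"
    by (rule mor_add[OF um_gm[OF M] mor_comp[OF mor_dfst h(1)] mor_comp[OF mor_dsnd k(1)]])
  have "g n (?h n z) = f n z" if "z \<in> elts (dsum P Q) n" for n z
    using that
  proof (rule dsum_E)
    fix x y assume z: "z = dpair x y" "x \<in> elts P n" "y \<in> elts Q n"
    then show ?thesis
      using mor_pl[OF g mor_closed[OF h(1) z(2)] mor_closed[OF k(1) z(3)]] h(2)[OF z(2)] k(2)[OF z(3)]
        mor_dsum_split[OF gm f z(2,3)] by simp
  qed
  with m show "\<exists>h. mor (dsum P Q) M h \<and> (\<forall>n. \<forall>x\<in>elts (dsum P Q) n. g n (h n x) = f n x)" by blast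
qed

definition zero_gmod :: "int gmod" where
  "zero_gmod = \<lparr>comp = (\<lambda>n. singleton_group 0), act = (\<lambda>k n r x. 0)\<rparr>"

lemma zero_gmod_simps [simp]:
  "elts zero_gmod n = {0}" "zr zero_gmod n = 0" "pl zero_gmod n x y = 0" "act zero_gmod k n r x = 0"
  by (simp_all add: zero_gmod_def singleton_group_def)

lemma um_zero: "um zero_gmod"
  by (rule umI[OF gmI]) simp_all

lemma mor_from_zero: "gm N \<Longrightarrow> mor zero_gmod N (\<lambda>n x. zr N n)"
  by (rule mor_zero)

lemma projective_zero: "projective_U zero_gmod"
proof (rule projectiveI[OF um_zero])
  fix M N :: "int gmod" and g f
  assume M: "um M" and N: "um N" and g: "mor M N g" and f: "mor zero_gmod N f"
  have "f n 0 = zr N n" for n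
    using mor_zr[OF um_gm[OF um_zero] um_gm[OF N] f, of n] by simp
  then show "\<exists>h. mor zero_gmod M h \<and> (\<forall>n. \<forall>x\<in>elts zero_gmod n. g n (h n x) = f n x)"
    using mor_from_zero[OF um_gm[OF M]] mor_zr[OF um_gm[OF M] um_gm[OF N] g]
    by (intro exI[of _ "\<lambda>n x. zr M n"]) simp
qed

text \<open>
  \<open>C\<close> has homology \<open>B\<close> in degree 0 and, through \<open>\<omega>\<close>, \<open>B'\<close> in degree 1. A resolution \<open>R\<close> of \<open>B'\<close> maps to
  \<open>C\<close> with a shift by one, and the cone of this map is a resolution of \<open>B\<close>.
\<close>

locale two_stage =
  fixes C :: "nat \<Rightarrow> int gmod" and dC and B :: "int gmod" and aug Z B' \<omega> and R :: "nat \<Rightarrow> int gmod" and e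
  assumes chain_C: "chain_complex C dC" and projC: "\<And>s. projective_U (C s)"
    and exact_C: "exact_positive (\<lambda>s. C (Suc s)) (\<lambda>s. dC (Suc s))"
    and mor_aug: "mor (C 0) B aug" and umB: "um B"
    and aug_surj: "\<And>m. aug m ` elts (C 0) m = elts B m"
    and aug_zr_iff: "\<And>m x. x \<in> elts (C 0) m \<Longrightarrow> aug m x = zr B m \<longleftrightarrow> x \<in> dC 1 m ` elts (C 1) m"
    and Z_def: "\<And>m. Z m = {x \<in> elts (C 1) m. dC 1 m x = zr (C 0) m}"
    and mor_omega: "mor (sub_gmod (C 1) Z) B' \<omega>" and umB': "um B'"
    and omega_surj: "\<And>m. \<omega> m ` Z m = elts B' m"
    and omega_zr_iff: "\<And>m x. x \<in> Z m \<Longrightarrow> \<omega> m x = zr B' m \<longleftrightarrow> x \<in> dC 2 m ` elts (C 2) m"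
    and res_R: "resolution B' R e"
begin

lemmas cd = chain_complexD[OF chain_C] and rd = resolutionD[OF res_R]
  and rcd = chain_complexD[OF resolutionD(2)[OF res_R]]

lemma mor_dC1: "mor (C 1) (C 0) (dC 1)"
  using cd(3)[of 0] by simp

lemma submod_Z: "submod (C 1) Z"
  unfolding Z_def[abs_def] using submod_kernel[OF cd(2,2) mor_dC1] .

text \<open>Projectivity of \<open>R 0\<close> lifts \<open>e 0\<close> through the surjection
  \<omega>. The lift sends boundaries of \<open>R\<close> into the kernel of \<omega>, that is to
  boundaries of \<open>C\<close>, as \<open>chain_lift\<close> demands in degree 0.\<close>

lemma psi_exists:
  "\<exists>\<psi>. chain_map R e (\<lambda>s. C (Suc s)) (\<lambda>s. dC (Suc s)) \<psi> \<and>
    (\<forall>m. \<forall>r\<in>elts (R 0) m. \<psi> 0 m r \<in> Z m \<and> \<omega> m (\<psi> 0 m r) = e 0 m r)"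
proof -
  have umZ: "um (sub_gmod (C 1) Z)" by (rule um_sub[OF cd(1) submod_Z])
  have "e 0 m r \<in> \<omega> m ` elts (sub_gmod (C 1) Z) m" if "r \<in> elts (R 0) m" for m r
    using mor_closed[OF rd(4) that] by (simp add: omega_surj)
  then obtain f0 where f0: "mor (R 0) (sub_gmod (C 1) Z) f0"
    "\<And>m r. r \<in> elts (R 0) m \<Longrightarrow> \<omega> m (f0 m r) = e 0 m r"
    using projective_lift[OF rd(1) umZ umB' mor_omega rd(4)] by blast
  have f0Z: "f0 m r \<in> Z m" if "r \<in> elts (R 0) m" for m r
    using mor_closed[OF f0(1) that] by simp
  have f0C: "mor (R 0) (C (Suc 0)) f0"
    using mor_comp[OF f0(1) mor_sub_incl[OF submod_Z]] by simp
  have cc: "chain_complex (\<lambda>s. C (Suc s)) (\<lambda>s. dC (Suc s))"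
    using chain_C unfolding chain_complex_def by auto
  have im: "f0 m (e 1 m r) \<in> dC (Suc 1) m ` elts (C (Suc 1)) m" if r: "r \<in> elts (R 1) m" for m r
  proof -
    have er: "e 1 m r \<in> elts (R 0) m" using mor_closed[OF rcd(3)[of 0]] r by simp
    have "e 0 m (e 1 m r) = zr B' m" by (rule iffD2[OF rd(6)[OF er] imageI[OF r]])
    then have "\<omega> m (f0 m (e 1 m r)) = zr B' m" using f0(2)[OF er] by simp
    then show ?thesis using omega_zr_iff[OF f0Z[OF er]] by (simp add: numeral_2_eq_2)
  qed
  obtain \<psi> where "\<psi> 0 = f0" "chain_map R e (\<lambda>s. C (Suc s)) (\<lambda>s. dC (Suc s)) \<psi>"
    using chain_lift[OF rd(2,1) cc exact_C f0C im] by blast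
  then show ?thesis using f0(2) f0Z by (intro exI[of _ \<psi>]) simp
qed

definition "\<psi> = (SOME \<psi>. chain_map R e (\<lambda>s. C (Suc s)) (\<lambda>s. dC (Suc s)) \<psi> \<and>
    (\<forall>m. \<forall>r\<in>elts (R 0) m. \<psi> 0 m r \<in> Z m \<and> \<omega> m (\<psi> 0 m r) = e 0 m r))"

lemma mor_psi: "mor (R s) (C (Suc s)) (\<psi> s)"
  and psi_d: "r \<in> elts (R (Suc s)) m \<Longrightarrow> dC (Suc (Suc s)) m (\<psi> (Suc s) m r) = \<psi> s m (e (Suc s) m r)"
  and psi_Z: "r \<in> elts (R 0) m \<Longrightarrow> \<psi> 0 m r \<in> Z m"
  and psi_omega: "r \<in> elts (R 0) m \<Longrightarrow> \<omega> m (\<psi> 0 m r) = e 0 m r"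
  using someI_ex[OF psi_exists, folded \<psi>_def] chain_mapD[of R e "\<lambda>s. C (Suc s)" "\<lambda>s. dC (Suc s)" \<psi>] by blast+

text \<open>The map to \<open>C\<close> raises degrees by 1 and the cone adds another 1, so
  \<open>R j\<close> sits in degree j+2. This is the shift in the term with index s-2.\<close>

definition "R2 s = (case s of 0 \<Rightarrow> zero_gmod | Suc 0 \<Rightarrow> zero_gmod | Suc (Suc j) \<Rightarrow> R j)"
text \<open>The differential leaving \<open>R 0\<close>, in degree 2, is zero and not the
  augmentation \<open>e 0\<close>, whose target \<open>B'\<close> does not belong to the
  complex.\<close>

definition "e2 s = (case s of 0 \<Rightarrow> (\<lambda>n x. 0) | Suc 0 \<Rightarrow> (\<lambda>n x. 0) | Suc (Suc 0) \<Rightarrow> (\<lambda>n x. 0) | Suc (Suc (Suc j)) \<Rightarrow> e (Suc j))"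
definition "\<psi>2 s = (case s of 0 \<Rightarrow> (\<lambda>n x. zr (C 0) n) | Suc j \<Rightarrow> \<psi> j)"

lemma R2_simps [simp]: "R2 0 = zero_gmod" "R2 (Suc 0) = zero_gmod" "R2 (Suc (Suc j)) = R j"
  by (simp_all add: R2_def)

lemma e2_simps [simp]: "e2 (Suc 0) = (\<lambda>n x. 0)" "e2 (Suc (Suc 0)) = (\<lambda>n x. 0)" "e2 (Suc (Suc (Suc j))) = e (Suc j)"
  by (simp_all add: e2_def)

lemma psi2_simps [simp]: "\<psi>2 0 = (\<lambda>n x. zr (C 0) n)" "\<psi>2 (Suc j) = \<psi> j"
  by (simp_all add: \<psi>2_def)

lemma nat3_cases: obtains "s = 0" | "s = Suc 0" | j where "s = Suc (Suc j)"
  by (metis not0_implies_Suc)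

lemma projR2: "projective_U (R2 s)"
  by (cases s rule: nat3_cases) (simp_all add: projective_zero rd(1))

lemma umR2: "um (R2 s)" by (rule projective_um[OF projR2])

lemma mor_e2: "mor (R2 (Suc s)) (R2 s) (e2 (Suc s))"
proof (cases s rule: nat3_cases)
  case 1
  then show ?thesis using mor_zero[OF um_gm[OF um_zero], of zero_gmod] by simp
next
  case 2
  then show ?thesis using mor_zero[OF um_gm[OF um_zero], of "R 0"] by simp
next
  case (3 j)
  then show ?thesis using rcd(3) by simp
qed

lemma e2_e2: "x \<in> elts (R2 (Suc (Suc s))) n \<Longrightarrow> e2 (Suc s) n (e2 (Suc (Suc s)) n x) = zr (R2 s) n"
  by (cases s rule: nat3_cases) (simp_all add: rcd(4))

lemma mor_psi2: "mor (R2 (Suc s)) (C s) (\<psi>2 s)"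
  by (cases s) (simp_all add: mor_psi mor_zero cd(2))

lemma psi2_d: "x \<in> elts (R2 (Suc (Suc s))) n \<Longrightarrow> dC (Suc s) n (\<psi>2 (Suc s) n x) = \<psi>2 s n (e2 (Suc (Suc s)) n x)"
  using psi_Z by (cases s) (simp_all add: psi_d Z_def)

section \<open>The cone and its exactness\<close>

definition "mcone s = dsum (C s) (R2 s)"
definition "d_mcone s = (case s of 0 \<Rightarrow> (\<lambda>n z. aug n (dfst z))
  | Suc r \<Rightarrow> (\<lambda>n z. dpair (pl (C r) n (dC s n (dfst z)) (\<psi>2 r n (dsnd z))) (e2 s n (dsnd z))))"

lemma d_mcone_simps [simp]: "d_mcone 0 n z = aug n (dfst z)"
  "d_mcone (Suc r) n z = dpair (pl (C r) n (dC (Suc r) n (dfst z)) (\<psi>2 r n (dsnd z))) (e2 (Suc r) n (dsnd z))"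
  by (simp_all add: d_mcone_def)

lemma um_mcone: "um (mcone s)"
  unfolding mcone_def by (rule um_dsum[OF cd(1) umR2])

lemma mor_d_mcone: "mor (mcone (Suc s)) (mcone s) (d_mcone (Suc s))"
  unfolding mcone_def d_mcone_def nat.case
  by (intro mor_dpair mor_add cd(2) mor_comp[OF mor_dfst cd(3)] mor_comp[OF mor_dsnd mor_psi2]
      mor_comp[OF mor_dsnd mor_e2])

lemma chain_mcone: "chain_complex mcone d_mcone"
  unfolding chain_complex_def
proof (intro conjI allI ballI um_mcone mor_d_mcone)
  fix s n z assume "z \<in> elts (mcone (Suc (Suc s))) n"
  then obtain x r where z: "z = dpair x r" "x \<in> elts (C (Suc (Suc s))) n" "r \<in> elts (R2 (Suc (Suc s))) n"
    unfolding mcone_def by (rule dsum_E)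
  have 1: "dC (Suc (Suc s)) n x \<in> elts (C (Suc s)) n" by (rule mor_closed[OF cd(3) z(2)])
  have 2: "\<psi>2 (Suc s) n r \<in> elts (C (Suc s)) n" by (rule mor_closed[OF mor_psi2 z(3)])
  have 3: "\<psi>2 s n (e2 (Suc (Suc s)) n r) \<in> elts (C s) n"
    by (rule mor_closed[OF mor_psi2 mor_closed[OF mor_e2 z(3)]])
  show "d_mcone (Suc s) n (d_mcone (Suc (Suc s)) n z) = zr (mcone s) n"
    unfolding z(1) using mor_pl[OF cd(3) 1 2] cd(4)[OF z(2)] psi2_d[OF z(3)] e2_e2[OF z(3)] 3 cd(2)
    by (simp add: mcone_def)
qed

lemma C_boundary:
  assumes "x \<in> elts (C (Suc (Suc s))) n" "dC (Suc (Suc s)) n x = zr (C (Suc s)) n"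
  obtains c where "c \<in> elts (C (Suc (Suc (Suc s)))) n" "x = dC (Suc (Suc (Suc s))) n c"
  using exact_C assms unfolding exact_positive_def by blast

lemma R_boundary:
  assumes "r \<in> elts (R s) n" "if s = 0 then e 0 n r = zr B' n else e s n r = zr (R (s - 1)) n"
  obtains r' where "r' \<in> elts (R (Suc s)) n" "r = e (Suc s) n r'"
proof (cases s)
  case 0
  then have "r \<in> e 1 n ` elts (R 1) n" using assms rd(6)[of r n] by simp
  then show ?thesis using that 0 by auto
next
  case (Suc j)
  then have "r \<in> e (Suc (Suc j)) n ` elts (R (Suc (Suc j))) n"
    using assms rd(3) unfolding exact_positive_def by simp
  then show ?thesis using that Suc by auto
qed

text \<open>The connecting map from the homology of the shifted \<open>R\<close> to that of
  \<open>C\<close> is the isomorphism of H_0 of \<open>R\<close> with H_1 of \<open>C\<close> given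
  by \<omega>, so the two cancel.\<close>

lemma exact_mcone: "exact_positive mcone d_mcone"
  unfolding exact_positive_def
proof (intro allI ballI impI)
  fix s n z assume "z \<in> elts (mcone (Suc s)) n" and dz: "d_mcone (Suc s) n z = zr (mcone s) n"
  then obtain x r where z: "z = dpair x r" "x \<in> elts (C (Suc s)) n" "r \<in> elts (R2 (Suc s)) n"
    unfolding mcone_def by (elim dsum_E)
  have dx: "pl (C s) n (dC (Suc s) n x) (\<psi>2 s n r) = zr (C s) n" and er: "e2 (Suc s) n r = zr (R2 s) n"
    using dz by (simp_all add: z(1) mcone_def)
  have dxc: "dC (Suc s) n x \<in> elts (C s) n" by (rule mor_closed[OF cd(3) z(2)])
  have dx: "dC (Suc s) n x = \<psi>2 s n r"
    using dx pl_eq_zr_iff[OF cd(2) dxc mor_closed[OF mor_psi2 z(3)]] by simp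
  have goal: "z \<in> d_mcone (Suc (Suc s)) n ` elts (mcone (Suc (Suc s))) n"
    if "c \<in> elts (C (Suc (Suc s))) n" "r' \<in> elts (R2 (Suc (Suc s))) n"
      "x = pl (C (Suc s)) n (dC (Suc (Suc s)) n c) (\<psi>2 (Suc s) n r')" "r = e2 (Suc (Suc s)) n r'" for c r'
    using that by (intro image_eqI[of _ _ "dpair c r'"]) (simp_all add: z(1) mcone_def)
  note Zd = submodD[OF submod_Z]
  show "z \<in> d_mcone (Suc (Suc s)) n ` elts (mcone (Suc (Suc s))) n"
  proof (cases s)
    case 0
    \<comment> \<open>The class of the cycle \<open>x\<close> is hit from \<open>R 0\<close>; after
      adding the image of \<open>r'\<close> its value under \<omega> is zero, so it is a
      boundary.\<close>
    have x: "x \<in> Z n" using z(2) dx 0 by (simp add: Z_def)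
    then have "\<omega> n x \<in> elts B' n" using omega_surj by blast
    then obtain r' where r': "r' \<in> elts (R 0) n" "\<omega> n x = e 0 n r'" using rd(5)[of n] by (metis imageE)
    note p = psi_Z[OF r'(1)]
    let ?y = "pl (C 1) n x (\<psi> 0 n r')"
    have y: "?y \<in> Z n" by (rule Zd(3)[OF x p])
    have "\<omega> n ?y = pl B' n (\<omega> n x) (\<omega> n (\<psi> 0 n r'))"
      using mor_pl[OF mor_omega, of x n "\<psi> 0 n r'"] x p by simp
    also have "\<dots> = zr B' n"
      using psi_omega[OF r'(1)] r'(2) mor_closed[OF rd(4) r'(1)] umB' by simp
    finally obtain c where c: "c \<in> elts (C 2) n" "?y = dC 2 n c" using omega_zr_iff[OF y] by auto
    have "x = pl (C 1) n ?y (\<psi> 0 n r')"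
      using Zd(1)[OF x] Zd(1)[OF p] cd(2) by (simp add: pl_assoc)
    then show ?thesis
      using goal[of c r'] c r' z(3) 0 by (simp add: numeral_2_eq_2)
  next
    case (Suc t)
    \<comment> \<open>The component \<open>r\<close> is a boundary. For t = 0 its image in
      \<open>C 1\<close> bounds, so \<omega> annihilates it and \<open>e 0\<close> annihilates
      \<open>r\<close>.\<close>
    obtain r' where r': "r' \<in> elts (R (Suc t)) n" "r = e (Suc t) n r'"
    proof (rule R_boundary[of r t n])
      show "r \<in> elts (R t) n" using z(3) Suc by simp
      show "if t = 0 then e 0 n r = zr B' n else e t n r = zr (R (t - 1)) n"
      proof (cases t)
        case 0
        then have r: "r \<in> elts (R 0) n" and x: "x \<in> elts (C 2) n" using z(2,3) Suc by (simp_all add: numeral_2_eq_2)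
        have "\<psi> 0 n r = dC 2 n x" using dx Suc 0 by (simp add: numeral_2_eq_2)
        then have "\<omega> n (\<psi> 0 n r) = zr B' n" using omega_zr_iff[OF psi_Z[OF r]] x by simp
        then show ?thesis using psi_omega[OF r] 0 by simp
      next
        case (Suc u)
        then show ?thesis using er \<open>s = Suc t\<close> by simp
      qed
    qed
    let ?y = "pl (C (Suc s)) n x (\<psi> (Suc t) n r')"
    have p: "\<psi> (Suc t) n r' \<in> elts (C (Suc s)) n" using mor_closed[OF mor_psi r'(1)] Suc by simp
    have y: "?y \<in> elts (C (Suc s)) n" using z(2) p cd(2) by simp
    have "dC (Suc s) n ?y = pl (C s) n (dC (Suc s) n x) (\<psi> t n (e (Suc t) n r'))"
      using mor_pl[OF cd(3) z(2) p] psi_d[OF r'(1)] Suc by simp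
    also have "\<dots> = zr (C s) n" using dx r'(2) dxc cd(2) Suc by simp
    finally obtain c where c: "c \<in> elts (C (Suc (Suc s))) n" "?y = dC (Suc (Suc s)) n c"
      using C_boundary[of ?y t n] y Suc by auto
    have "x = pl (C (Suc s)) n ?y (\<psi> (Suc t) n r')"
      using z(2) p cd(2) by (simp add: pl_assoc)
    then show ?thesis
      using goal[of c r'] c r' Suc by simp
  qed
qed

lemma resolution_mcone: "resolution B mcone d_mcone"
  unfolding resolution_def
proof (intro conjI allI ballI chain_mcone exact_mcone)
  show "projective_U (mcone s)" for s
    unfolding mcone_def by (rule projective_dsum[OF projC projR2])
  show "mor (mcone 0) B (d_mcone 0)"
    unfolding mcone_def d_mcone_def nat.case by (rule mor_comp[OF mor_dfst mor_aug])
  show "d_mcone 0 n ` elts (mcone 0) n = elts B n" for n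
  proof -
    have "elts (mcone 0) n = (\<lambda>x. dpair x 0) ` elts (C 0) n"
      by (auto simp: mcone_def dsum_elts)
    then show ?thesis by (simp add: image_image aug_surj)
  qed
  fix n z assume "z \<in> elts (mcone 0) n"
  then obtain x where z: "z = dpair x 0" "x \<in> elts (C 0) n" unfolding mcone_def by (elim dsum_E) simp
  have "z \<in> d_mcone 1 n ` elts (mcone 1) n \<longleftrightarrow> x \<in> dC 1 n ` elts (C 1) n"
  proof
    assume "z \<in> d_mcone 1 n ` elts (mcone 1) n"
    then obtain c where "c \<in> elts (C 1) n" "x = pl (C 0) n (dC 1 n c) (zr (C 0) n)"
      by (auto simp: mcone_def z(1) dsum_elts)
    then show "x \<in> dC 1 n ` elts (C 1) n" using mor_closed[OF mor_dC1] cd(2) by simp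
  next
    assume "x \<in> dC 1 n ` elts (C 1) n"
    then obtain c where c: "c \<in> elts (C 1) n" "x = dC 1 n c" by blast
    have "z = d_mcone 1 n (dpair c 0)" using c mor_closed[OF mor_dC1 c(1)] cd(2) by (simp add: z(1))
    moreover have "dpair c 0 \<in> elts (mcone 1) n" using c by (simp add: mcone_def)
    ultimately show "z \<in> d_mcone 1 n ` elts (mcone 1) n" by (rule image_eqI)
  qed
  then show "d_mcone 0 n z = zr B n \<longleftrightarrow> z \<in> d_mcone 1 n ` elts (mcone 1) n"
    using aug_zr_iff[OF z(2)] by (simp add: z(1))
qed

end

section \<open>Cochains\<close>

text \<open>Cochains are treated as plain functions judged by their values on the modules;
  extensionality returns only when the groups are formed.\<close>

definition cocycle :: "(nat \<Rightarrow> 'a gmod) \<Rightarrow> (nat \<Rightarrow> nat \<Rightarrow> 'a \<Rightarrow> 'a) \<Rightarrow> 'b gmod \<Rightarrow> nat \<Rightarrow> (nat \<Rightarrow> 'a \<Rightarrow> 'b) \<Rightarrow> bool" where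
  "cocycle K d N s f \<longleftrightarrow> mor (K s) N f \<and> (\<forall>n. \<forall>x\<in>elts (K (Suc s)) n. f n (d (Suc s) n x) = zr N n)"

definition coboundary :: "(nat \<Rightarrow> 'a gmod) \<Rightarrow> (nat \<Rightarrow> nat \<Rightarrow> 'a \<Rightarrow> 'a) \<Rightarrow> 'b gmod \<Rightarrow> nat \<Rightarrow> (nat \<Rightarrow> 'a \<Rightarrow> 'b) \<Rightarrow> bool" where
  "coboundary K d N s f \<longleftrightarrow> (case s of
      0 \<Rightarrow> \<forall>n. \<forall>x\<in>elts (K 0) n. f n x = zr N n
    | Suc r \<Rightarrow> \<exists>g. mor (K r) N g \<and> (\<forall>n. \<forall>x\<in>elts (K (Suc r)) n. f n x = g n (d (Suc r) n x)))"

definition padd :: "'b gmod \<Rightarrow> (nat \<Rightarrow> 'a \<Rightarrow> 'b) \<Rightarrow> (nat \<Rightarrow> 'a \<Rightarrow> 'b) \<Rightarrow> nat \<Rightarrow> 'a \<Rightarrow> 'b" where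
  "padd N f g n x = pl N n (f n x) (g n x)"

lemma coboundary_0: "coboundary K d N 0 f \<longleftrightarrow> (\<forall>n. \<forall>x\<in>elts (K 0) n. f n x = zr N n)"
  and coboundary_Suc: "coboundary K d N (Suc r) f \<longleftrightarrow>
    (\<exists>g. mor (K r) N g \<and> (\<forall>n. \<forall>x\<in>elts (K (Suc r)) n. f n x = g n (d (Suc r) n x)))"
  by (simp_all add: coboundary_def)

lemma coboundaryI:
  "mor (K r) N g \<Longrightarrow> (\<And>n x. x \<in> elts (K (Suc r)) n \<Longrightarrow> f n x = g n (d (Suc r) n x)) \<Longrightarrow> coboundary K d N (Suc r) f"
  unfolding coboundary_Suc by blast

lemma coboundary_cong:
  assumes "coboundary K d N s f" "\<And>n x. x \<in> elts (K s) n \<Longrightarrow> g n x = f n x"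
  shows "coboundary K d N s g"
  using assms by (cases s) (auto simp: coboundary_0 coboundary_Suc)

lemma coboundary_padd:
  assumes N: "gm N" and "coboundary K d N s f" "coboundary K d N s g"
  shows "coboundary K d N s (padd N f g)"
proof (cases s)
  case 0
  then show ?thesis using assms by (simp add: coboundary_0 padd_def)
next
  case (Suc r)
  obtain u where u: "mor (K r) N u" "\<forall>n. \<forall>x\<in>elts (K (Suc r)) n. f n x = u n (d (Suc r) n x)"
    using assms(2) unfolding Suc coboundary_Suc by (elim exE conjE)
  obtain v where v: "mor (K r) N v" "\<forall>n. \<forall>x\<in>elts (K (Suc r)) n. g n x = v n (d (Suc r) n x)"
    using assms(3) unfolding Suc coboundary_Suc by (elim exE conjE)
  show ?thesis using u v
    unfolding Suc by (intro coboundaryI[of _ _ _ "\<lambda>n x. pl N n (u n x) (v n x)"] mor_add[OF N]) (simp_all add: padd_def)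
qed

text \<open>As sums are differences, this is transitivity of being cohomologous.\<close>

lemma coboundary_add_trans:
  assumes N: "gm N" and "coboundary K d N s (padd N f g)" "coboundary K d N s (padd N g h)"
    and c: "\<And>n x. x \<in> elts (K s) n \<Longrightarrow> f n x \<in> elts N n" "\<And>n x. x \<in> elts (K s) n \<Longrightarrow> g n x \<in> elts N n"
    "\<And>n x. x \<in> elts (K s) n \<Longrightarrow> h n x \<in> elts N n"
  shows "coboundary K d N s (padd N f h)"
proof (rule coboundary_cong[OF coboundary_padd[OF assms(1-3)]])
  fix n x assume "x \<in> elts (K s) n"
  note c = c[OF this]
  show "padd N f h n x = padd N (padd N f g) (padd N g h) n x"
    unfolding padd_def using c N by (simp add: pl_assoc)
qed

lemma coboundary_zero: "gm N \<Longrightarrow> coboundary K d N s (\<lambda>n x. zr N n)"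
  by (cases s) (auto simp: coboundary_0 coboundary_Suc intro: mor_zero)

lemma coboundary_cancel:
  assumes N: "gm N" and "coboundary K d N s (padd N f g)" "coboundary K d N s g"
    and c: "\<And>n x. x \<in> elts (K s) n \<Longrightarrow> f n x \<in> elts N n" "\<And>n x. x \<in> elts (K s) n \<Longrightarrow> g n x \<in> elts N n"
  shows "coboundary K d N s f"
proof (rule coboundary_cong[OF coboundary_padd[OF assms(1-3)]])
  fix n x assume "x \<in> elts (K s) n"
  note c = c[OF this]
  show "f n x = padd N (padd N f g) g n x"
    unfolding padd_def using c N by (simp add: pl_assoc)
qed

lemma cocycle_pullback:
  assumes f: "chain_map L d' K d f" and L: "chain_complex L d'" and w: "cocycle K d N s w"
  shows "cocycle L d' N s (\<lambda>n x. w n (f s n x))"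
  unfolding cocycle_def
proof (intro conjI allI ballI)
  have "mor (K s) N w" using w by (simp add: cocycle_def)
  then show "mor (L s) N (\<lambda>n x. w n (f s n x))" by (rule mor_comp[OF chain_mapD(1)[OF f]])
  fix n x assume x: "x \<in> elts (L (Suc s)) n"
  show "w n (f s n (d' (Suc s) n x)) = zr N n"
    using chain_mapD(2)[OF f x] mor_closed[OF chain_mapD(1)[OF f] x] w by (simp add: cocycle_def flip: chain_mapD(2)[OF f x])
qed

lemma coboundary_pullback:
  assumes f: "chain_map L d' K d f" and w: "coboundary K d N s w"
  shows "coboundary L d' N s (\<lambda>n x. w n (f s n x))"
proof (cases s)
  case 0
  then show ?thesis using w mor_closed[OF chain_mapD(1)[OF f]] by (simp add: coboundary_0)
next
  case (Suc r)
  then obtain g where g: "mor (K r) N g" "\<forall>n. \<forall>x\<in>elts (K (Suc r)) n. w n x = g n (d (Suc r) n x)"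
    using w unfolding coboundary_def by auto
  show ?thesis unfolding Suc
  proof (rule coboundaryI[of L r N "\<lambda>n x. g n (f r n x)"])
    show "mor (L r) N (\<lambda>n x. g n (f r n x))" by (rule mor_comp[OF chain_mapD(1)[OF f] g(1)])
    fix n x assume x: "x \<in> elts (L (Suc r)) n"
    show "w n (f (Suc r) n x) = g n (f r n (d' (Suc r) n x))"
      using g(2) mor_closed[OF chain_mapD(1)[OF f] x] chain_mapD(2)[OF f x] by simp
  qed
qed

lemma chain_map_comp:
  assumes "chain_map K1 d1 K2 d2 f" "chain_map K2 d2 K3 d3 g"
  shows "chain_map K1 d1 K3 d3 (\<lambda>s n x. g s n (f s n x))"
  unfolding chain_map_def
proof (intro conjI allI ballI)
  note f = chain_mapD[OF assms(1)] and g = chain_mapD[OF assms(2)]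
  show "mor (K1 s) (K3 s) (\<lambda>n x. g s n (f s n x))" for s by (rule mor_comp[OF f(1) g(1)])
  fix s n x assume x: "x \<in> elts (K1 (Suc s)) n"
  show "d3 (Suc s) n (g (Suc s) n (f (Suc s) n x)) = g s n (f s n (d1 (Suc s) n x))"
    by (simp only: g(2)[OF mor_closed[OF f(1) x]] f(2)[OF x])
qed

text \<open>A cocycle vanishes on the d k part of the homotopy, and what remains is the coboundary
  of its composite with \<open>k\<close>.\<close>

lemma homotopic_coboundary:
  assumes N: "gm N" and K: "chain_complex K d" and w: "cocycle K d N (Suc s) w"
    and k: "\<forall>s. mor (K s) (K (Suc s)) (k s)"
    and \<phi>: "\<forall>n. \<forall>x\<in>elts (K (Suc s)) n.
      \<phi> n x = pl (K (Suc s)) n x (pl (K (Suc s)) n (d (Suc (Suc s)) n (k (Suc s) n x)) (k s n (d (Suc s) n x)))"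
  shows "coboundary K d N (Suc s) (padd N w (\<lambda>n x. w n (\<phi> n x)))"
proof (rule coboundaryI)
  note Kd = chain_complexD[OF K]
  have m: "mor (K (Suc s)) N w" using w by (simp add: cocycle_def)
  have k: "mor (K s) (K (Suc s)) (k s)" for s using k by blast
  show "mor (K s) N (\<lambda>n x. w n (k s n x))" by (rule mor_comp[OF k m])
  fix n x assume x: "x \<in> elts (K (Suc s)) n"
  have 1: "d (Suc (Suc s)) n (k (Suc s) n x) \<in> elts (K (Suc s)) n" by (rule mor_closed[OF Kd(3) mor_closed[OF k x]])
  have 2: "k s n (d (Suc s) n x) \<in> elts (K (Suc s)) n" by (rule mor_closed[OF k mor_closed[OF Kd(3) x]])
  have "w n (d (Suc (Suc s)) n (k (Suc s) n x)) = zr N n"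
    using w mor_closed[OF k x] by (simp add: cocycle_def)
  then have "w n (\<phi> n x) = pl N n (w n x) (w n (k s n (d (Suc s) n x)))"
    using mor_pl[OF m x] mor_pl[OF m 1 2] 1 2 Kd(2) mor_closed[OF m 2] N x \<phi> by simp
  then show "padd N w (\<lambda>n x. w n (\<phi> n x)) n x = w n (k s n (d (Suc s) n x))"
    using mor_closed[OF m x] mor_closed[OF m 2] N by (simp add: padd_def)
qed

section \<open>Exactness at the level of cochains\<close>

text \<open>\<open>Q\<close> is an arbitrary resolution of \<open>B\<close>, such as the one that
  Ext has chosen. The maps \<open>a\<close> and \<open>b\<close> over the identity of
  \<open>B\<close> are mutually inverse up to homotopy.\<close>

locale cone_sequence = two_stage C dC B aug Z B' \<omega> R e
  for C dC and B :: "int gmod" and aug Z B' \<omega> R e +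
  fixes Q q and N :: "'b gmod" and a b
  assumes res_Q: "resolution B Q q" and umN: "um N"
    and a: "chain_map Q q mcone d_mcone a" "\<And>n x. x \<in> elts (Q 0) n \<Longrightarrow> d_mcone 0 n (a 0 n x) = q 0 n x"
    and b: "chain_map mcone d_mcone Q q b" "\<And>n x. x \<in> elts (mcone 0) n \<Longrightarrow> q 0 n (b 0 n x) = d_mcone 0 n x"
begin

lemmas gmN = um_gm[OF umN] and Qd = resolutionD[OF res_Q] and Dd = resolutionD[OF resolution_mcone]

lemma ab_homotopic:
  assumes "cocycle mcone d_mcone N (Suc s) w"
  shows "coboundary mcone d_mcone N (Suc s) (padd N w (\<lambda>n z. w n (a (Suc s) n (b (Suc s) n z))))"
proof -
  have "\<forall>n. \<forall>z\<in>elts (mcone 0) n. d_mcone 0 n (a 0 n (b 0 n z)) = d_mcone 0 n z"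
    using a(2)[OF mor_closed[OF chain_mapD(1)[OF b(1)]]] b(2) by simp
  from resolution_homotopy[OF resolution_mcone umB chain_map_comp[OF b(1) a(1)] this]
  obtain k where k: "\<forall>s. mor (mcone s) (mcone (Suc s)) (k s)"
    "\<forall>s n. \<forall>x\<in>elts (mcone (Suc s)) n. a (Suc s) n (b (Suc s) n x) = pl (mcone (Suc s)) n x
      (pl (mcone (Suc s)) n (d_mcone (Suc (Suc s)) n (k (Suc s) n x)) (k s n (d_mcone (Suc s) n x)))"
    by (elim exE conjE)
  show ?thesis
    by (rule homotopic_coboundary[OF gmN Dd(2) assms k(1)]) (use k(2) in blast)
qed

lemma ba_homotopic:
  assumes "cocycle Q q N (Suc s) w"
  shows "coboundary Q q N (Suc s) (padd N w (\<lambda>n z. w n (b (Suc s) n (a (Suc s) n z))))"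
proof -
  have "\<forall>n. \<forall>z\<in>elts (Q 0) n. q 0 n (b 0 n (a 0 n z)) = q 0 n z"
    using b(2)[OF mor_closed[OF chain_mapD(1)[OF a(1)]]] a(2) by simp
  from resolution_homotopy[OF res_Q umB chain_map_comp[OF a(1) b(1)] this]
  obtain k where k: "\<forall>s. mor (Q s) (Q (Suc s)) (k s)"
    "\<forall>s n. \<forall>x\<in>elts (Q (Suc s)) n. b (Suc s) n (a (Suc s) n x) = pl (Q (Suc s)) n x
      (pl (Q (Suc s)) n (q (Suc (Suc s)) n (k (Suc s) n x)) (k s n (q (Suc s) n x)))"
    by (elim exE conjE)
  show ?thesis
    by (rule homotopic_coboundary[OF gmN Qd(2) assms k(1)]) (use k(2) in blast)
qed

section \<open>The extension of \<open>R2\<close> by \<open>C\<close> and its effect on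
  cochains\<close>

definition "inl s n x = dpair x (zr (R2 s) n)"

lemma chain_inl: "chain_map C dC mcone d_mcone inl"
  unfolding chain_map_def
proof (intro conjI allI ballI)
  show "mor (C s) (mcone s) (inl s)" for s
    unfolding inl_def[abs_def] mcone_def by (rule mor_inl[OF um_gm[OF umR2]])
  fix s n x assume x: "x \<in> elts (C (Suc s)) n"
  have "\<psi>2 s n (zr (R2 (Suc s)) n) = zr (C s) n" "e2 (Suc s) n (zr (R2 (Suc s)) n) = zr (R2 s) n"
    using mor_zr[OF um_gm[OF umR2] cd(2) mor_psi2] mor_zr[OF um_gm[OF umR2] um_gm[OF umR2] mor_e2] by auto
  then show "d_mcone (Suc s) n (inl (Suc s) n x) = inl s n (dC (Suc s) n x)"
    using mor_closed[OF cd(3) x] cd(2) by (simp add: inl_def)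
qed

lemma chain_dsnd: "chain_map mcone d_mcone R2 e2 (\<lambda>s n. dsnd)"
  unfolding chain_map_def mcone_def by (simp add: mor_dsnd)

lemma cocycle_R2: "cocycle R2 e2 N (Suc (Suc t)) f \<longleftrightarrow> cocycle R e N t f"
  by (simp add: cocycle_def)

lemma coboundary_R2: "coboundary R2 e2 N (Suc (Suc t)) f \<longleftrightarrow> coboundary R e N t f"
proof (cases t)
  case 0
  \<comment> \<open>In degree 2 of the shifted complex coboundaries come from the zero module and
    hence vanish, which is the meaning of a coboundary in degree 0.\<close>
  have "g n 0 = zr N n" if "mor zero_gmod N g" for g n
    using mor_zr[OF um_gm[OF um_zero] gmN that, of n] by simp
  moreover have "mor zero_gmod N (\<lambda>n x. zr N n)" by (rule mor_from_zero[OF gmN])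
  ultimately show ?thesis
    unfolding 0 coboundary_0 coboundary_Suc R2_simps e2_simps by (metis (no_types, lifting))
qed (simp add: coboundary_Suc)

lemma mor_mcone_split:
  assumes "mor (mcone s) N w" "x \<in> elts (C s) n" "r \<in> elts (R2 s) n"
  shows "w n (dpair x r) = pl N n (w n (dpair x (zr (R2 s) n))) (w n (dpair (zr (C s) n) r))"
  using mor_dsum_split[OF cd(2) um_gm[OF umR2] assms(1)[unfolded mcone_def] assms(2,3)] .

lemma mor_on_mcone:
  assumes "mor (C s) N y" "mor (R2 s) N g"
  shows "mor (mcone s) N (\<lambda>n z. pl N n (y n (dfst z)) (g n (dsnd z)))"
  unfolding mcone_def by (rule mor_add[OF gmN mor_comp[OF mor_dfst assms(1)] mor_comp[OF mor_dsnd assms(2)]])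

lemma psi_C: "r \<in> elts (R2 (Suc s)) n \<Longrightarrow> \<psi>2 s n r \<in> elts (C s) n"
  by (rule mor_closed[OF mor_psi2])

text \<open>A cochain on the cone is a pair of \<open>y\<close> on \<open>C\<close> and
  \<open>g\<close> on \<open>R2\<close>; its coboundary is y dC on the first summand and the sum of
  y \<psi> and g e on the second. Equating this with zero and \<open>f\<close> gives the two
  conditions.\<close>

lemma coboundary_mcone_dsnd:
  assumes f: "mor (R2 (Suc s)) N f"
  shows "coboundary mcone d_mcone N (Suc s) (\<lambda>n z. f n (dsnd z)) \<longleftrightarrow>
    (\<exists>y. cocycle C dC N s y \<and> coboundary R2 e2 N (Suc s) (padd N f (\<lambda>n r. y n (\<psi>2 s n r))))"
proof
  assume "coboundary mcone d_mcone N (Suc s) (\<lambda>n z. f n (dsnd z))"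
  then obtain v where v: "mor (mcone s) N v"
    "\<And>n z. z \<in> elts (mcone (Suc s)) n \<Longrightarrow> f n (dsnd z) = v n (d_mcone (Suc s) n z)"
    unfolding coboundary_Suc by blast
  define y where "y n x = v n (dpair x (zr (R2 s) n))" for n x
  define g where "g n r = v n (dpair (zr (C s) n) r)" for n r
  have y: "mor (C s) N y"
    unfolding y_def by (rule mor_comp[OF mor_inl[OF um_gm[OF umR2]] v(1)[unfolded mcone_def]])
  have g: "mor (R2 s) N g"
    unfolding g_def by (rule mor_comp[OF mor_inr[OF cd(2)] v(1)[unfolded mcone_def]])
  have "cocycle C dC N s y"
    unfolding cocycle_def
  proof (intro conjI allI ballI y)
    fix n x assume x: "x \<in> elts (C (Suc s)) n"
    have "inl (Suc s) n x \<in> elts (mcone (Suc s)) n" by (rule mor_closed[OF chain_mapD(1)[OF chain_inl] x])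
    from v(2)[OF this] show "y n (dC (Suc s) n x) = zr N n"
      unfolding chain_mapD(2)[OF chain_inl x] using mor_zr[OF um_gm[OF umR2] gmN f] by (simp add: y_def inl_def)
  qed
  moreover have "coboundary R2 e2 N (Suc s) (padd N f (\<lambda>n r. y n (\<psi>2 s n r)))"
  proof (rule coboundaryI)
    show "mor (R2 s) N g" by (rule g)
    fix n r assume r: "r \<in> elts (R2 (Suc s)) n"
    have z: "dpair (zr (C (Suc s)) n) r \<in> elts (mcone (Suc s)) n"
      using r cd(2) by (simp add: mcone_def)
    note er = mor_closed[OF mor_e2 r]
    have "d_mcone (Suc s) n (dpair (zr (C (Suc s)) n) r) = dpair (\<psi>2 s n r) (e2 (Suc s) n r)"
      using mor_zr[OF cd(2,2,3)] psi_C[OF r] cd(2) by simp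
    then have "f n r = pl N n (y n (\<psi>2 s n r)) (g n (e2 (Suc s) n r))"
      using v(2)[OF z] mor_mcone_split[OF v(1) psi_C[OF r] er] by (simp add: y_def g_def)
    then show "padd N f (\<lambda>n r. y n (\<psi>2 s n r)) n r = g n (e2 (Suc s) n r)"
      using mor_closed[OF y psi_C[OF r]] mor_closed[OF g er] gmN by (simp add: padd_def pl_ac)
  qed
  ultimately show "\<exists>y. cocycle C dC N s y \<and> coboundary R2 e2 N (Suc s) (padd N f (\<lambda>n r. y n (\<psi>2 s n r)))" by blast
next
  assume "\<exists>y. cocycle C dC N s y \<and> coboundary R2 e2 N (Suc s) (padd N f (\<lambda>n r. y n (\<psi>2 s n r)))"
  then obtain y g where y: "cocycle C dC N s y" and g: "mor (R2 s) N g"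
    "\<And>n r. r \<in> elts (R2 (Suc s)) n \<Longrightarrow> padd N f (\<lambda>n r. y n (\<psi>2 s n r)) n r = g n (e2 (Suc s) n r)"
    unfolding coboundary_Suc by blast
  have my: "mor (C s) N y" using y by (simp add: cocycle_def)
  show "coboundary mcone d_mcone N (Suc s) (\<lambda>n z. f n (dsnd z))"
  proof (rule coboundaryI)
    show "mor (mcone s) N (\<lambda>n z. pl N n (y n (dfst z)) (g n (dsnd z)))" by (rule mor_on_mcone[OF my g(1)])
    fix n z assume "z \<in> elts (mcone (Suc s)) n"
    then obtain x r where z: "z = dpair x r" "x \<in> elts (C (Suc s)) n" "r \<in> elts (R2 (Suc s)) n"
      unfolding mcone_def by (rule dsum_E)
    have "y n (pl (C s) n (dC (Suc s) n x) (\<psi>2 s n r)) = y n (\<psi>2 s n r)"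
      using mor_pl[OF my mor_closed[OF cd(3) z(2)] psi_C[OF z(3)]] y z(2) mor_closed[OF my psi_C[OF z(3)]] gmN
      by (simp add: cocycle_def)
    then show "f n (dsnd z) = pl N n (y n (dfst (d_mcone (Suc s) n z))) (g n (dsnd (d_mcone (Suc s) n z)))"
      using g(2)[OF z(3)] mor_closed[OF f z(3)] mor_closed[OF my psi_C[OF z(3)]] gmN
      by (simp add: z(1) padd_def pl_ac flip: g(2)[OF z(3)])
  qed
qed

text \<open>On the second summand the cocycle condition says that restricting to \<open>C\<close>
  and pulling back along \<open>\<psi>2\<close> gives the coboundary of the restriction to
  \<open>R2\<close>. So H after E is zero.\<close>

lemma cocycle_inr_psi:
  assumes w: "cocycle mcone d_mcone N (Suc s) w"
  shows "coboundary R2 e2 N (Suc (Suc s)) (\<lambda>n r. w n (inl (Suc s) n (\<psi>2 (Suc s) n r)))"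
proof (rule coboundaryI)
  have m: "mor (mcone (Suc s)) N w" using w by (simp add: cocycle_def)
  show "mor (R2 (Suc s)) N (\<lambda>n r. w n (dpair (zr (C (Suc s)) n) r))"
    by (rule mor_comp[OF mor_inr[OF cd(2)] m[unfolded mcone_def]])
  fix n r assume r: "r \<in> elts (R2 (Suc (Suc s))) n"
  note er = mor_closed[OF mor_e2 r]
  have "dpair (zr (C (Suc (Suc s))) n) r \<in> elts (mcone (Suc (Suc s))) n" using r cd(2) by (simp add: mcone_def)
  then have "w n (d_mcone (Suc (Suc s)) n (dpair (zr (C (Suc (Suc s))) n) r)) = zr N n"
    using w unfolding cocycle_def by blast
  moreover have "d_mcone (Suc (Suc s)) n (dpair (zr (C (Suc (Suc s))) n) r) = dpair (\<psi>2 (Suc s) n r) (e2 (Suc (Suc s)) n r)"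
    using mor_zr[OF cd(2,2,3)] psi_C[OF r] cd(2) by simp
  ultimately have "pl N n (w n (inl (Suc s) n (\<psi>2 (Suc s) n r))) (w n (dpair (zr (C (Suc s)) n) (e2 (Suc (Suc s)) n r))) = zr N n"
    using mor_mcone_split[OF m psi_C[OF r] er] by (simp add: inl_def)
  moreover have "w n (inl (Suc s) n (\<psi>2 (Suc s) n r)) \<in> elts N n"
    using mor_closed[OF m mor_closed[OF chain_mapD(1)[OF chain_inl] psi_C[OF r]]] .
  moreover have "w n (dpair (zr (C (Suc s)) n) (e2 (Suc (Suc s)) n r)) \<in> elts N n"
    using er cd(2) by (intro mor_closed[OF m]) (simp add: mcone_def)
  ultimately show "w n (inl (Suc s) n (\<psi>2 (Suc s) n r)) = w n (dpair (zr (C (Suc s)) n) (e2 (Suc (Suc s)) n r))"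
    using pl_eq_zr_iff[OF gmN] by blast
qed

text \<open>The comparison maps carry coboundaries between \<open>Q\<close> and the cone, where
  \<open>coboundary_mcone_dsnd\<close> decides the question.\<close>

lemma exact_at_R:
  assumes f: "cocycle R e N t f"
  shows "coboundary Q q N (Suc (Suc t)) (\<lambda>n x. f n (dsnd (a (Suc (Suc t)) n x))) \<longleftrightarrow>
    (\<exists>y. cocycle C dC N (Suc t) y \<and> coboundary R e N t (padd N f (\<lambda>n r. y n (\<psi> t n r))))"
proof -
  let ?s = "Suc (Suc t)"
  let ?w = "\<lambda>n z. f n (dsnd z)"
  have f': "cocycle R2 e2 N ?s f" using f by (simp only: cocycle_R2)
  have w: "cocycle mcone d_mcone N ?s ?w" by (rule cocycle_pullback[OF chain_dsnd Dd(2) f'])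
  have mw: "mor (mcone ?s) N ?w" using w by (simp add: cocycle_def)
  have "coboundary Q q N ?s (\<lambda>n x. ?w n (a ?s n x)) \<longleftrightarrow> coboundary mcone d_mcone N ?s ?w"
  proof
    assume "coboundary mcone d_mcone N ?s ?w"
    then show "coboundary Q q N ?s (\<lambda>n x. ?w n (a ?s n x))" by (rule coboundary_pullback[OF a(1)])
  next
    assume "coboundary Q q N ?s (\<lambda>n x. ?w n (a ?s n x))"
    then have "coboundary mcone d_mcone N ?s (\<lambda>n z. ?w n (a ?s n (b ?s n z)))"
      by (rule coboundary_pullback[OF b(1)])
    then show "coboundary mcone d_mcone N ?s ?w"
    proof (rule coboundary_cancel[OF gmN ab_homotopic[OF w]])
      fix n y assume y: "y \<in> elts (mcone ?s) n"
      show "f n (dsnd y) \<in> elts N n" by (rule mor_closed[OF mw y])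
      show "f n (dsnd (a ?s n (b ?s n y))) \<in> elts N n"
        by (rule mor_closed[OF mw mor_closed[OF chain_mapD(1)[OF a(1)] mor_closed[OF chain_mapD(1)[OF b(1)] y]]])
    qed
  qed
  then show ?thesis
    unfolding coboundary_R2[symmetric]
    using coboundary_mcone_dsnd[of "Suc t" f] f' by (simp add: cocycle_def)
qed

text \<open>A cocycle on the cone whose restriction to \<open>C\<close> is a coboundary can be
  changed by a coboundary until it factors through the second projection.\<close>

lemma exact_at_Q:
  assumes z: "cocycle Q q N (Suc (Suc t)) z"
  shows "coboundary C dC N (Suc (Suc t)) (\<lambda>n x. z n (b (Suc (Suc t)) n (inl (Suc (Suc t)) n x))) \<longleftrightarrow>
    (\<exists>f. cocycle R e N t f \<and> coboundary Q q N (Suc (Suc t)) (padd N z (\<lambda>n x. f n (dsnd (a (Suc (Suc t)) n x)))))"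
proof -
  let ?s = "Suc (Suc t)"
  let ?w = "\<lambda>n y. z n (b ?s n y)"
  have w: "cocycle mcone d_mcone N ?s ?w" by (rule cocycle_pullback[OF b(1) Dd(2) z])
  have mw: "mor (mcone ?s) N ?w" and mz: "mor (Q ?s) N z" using w z by (simp_all add: cocycle_def)
  note ma = chain_mapD(1)[OF a(1)] and mb = chain_mapD(1)[OF b(1)] and mi = chain_mapD(1)[OF chain_inl]
  show ?thesis
  proof
    assume "coboundary C dC N ?s (\<lambda>n x. z n (b ?s n (inl ?s n x)))"
    then obtain v where v: "mor (C (Suc t)) N v" "\<And>n x. x \<in> elts (C ?s) n \<Longrightarrow> z n (b ?s n (inl ?s n x)) = v n (dC ?s n x)"
      unfolding coboundary_Suc by blast
    have vd: "mor (mcone (Suc t)) N (\<lambda>n y. v n (dfst y))"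
      unfolding mcone_def by (rule mor_comp[OF mor_dfst v(1)])
    \<comment> \<open>What is left of \<open>?w\<close> on the second summand after subtracting the
      coboundary of \<open>v\<close>, extended by zero to the cone.\<close>
    define f where "f n r = pl N n (?w n (dpair (zr (C ?s) n) r)) (v n (\<psi>2 (Suc t) n r))" for n r
    have mf: "mor (R2 ?s) N f"
      unfolding f_def by (intro mor_add gmN mor_comp[OF mor_inr[OF cd(2)] mw[unfolded mcone_def]] mor_comp[OF mor_psi2 v(1)])
    have split: "?w n (dpair x r) = pl N n (f n r) (v n (dfst (d_mcone ?s n (dpair x r))))"
      if x: "x \<in> elts (C ?s) n" and r: "r \<in> elts (R2 ?s) n" for n x r
    proof -
      have c1: "v n (\<psi>2 (Suc t) n r) \<in> elts N n" by (rule mor_closed[OF v(1) psi_C[OF r]])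
      have c2: "v n (dC ?s n x) \<in> elts N n" by (rule mor_closed[OF v(1) mor_closed[OF cd(3) x]])
      have c3: "?w n (dpair (zr (C ?s) n) r) \<in> elts N n"
        using r cd(2) by (intro mor_closed[OF mw]) (simp add: mcone_def)
      have "?w n (dpair x r) = pl N n (v n (dC ?s n x)) (?w n (dpair (zr (C ?s) n) r))"
        using mor_mcone_split[OF mw x r] v(2)[OF x] by (simp add: inl_def)
      moreover have "v n (dfst (d_mcone ?s n (dpair x r))) = pl N n (v n (dC ?s n x)) (v n (\<psi>2 (Suc t) n r))"
        using mor_pl[OF v(1) mor_closed[OF cd(3) x] psi_C[OF r]] by simp
      ultimately show ?thesis using c1 c2 c3 gmN by (simp add: f_def pl_ac)
    qed
    have diff: "coboundary mcone d_mcone N ?s (padd N ?w (\<lambda>n y. f n (dsnd y)))"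
    proof (rule coboundaryI)
      show "mor (mcone (Suc t)) N (\<lambda>n y. v n (dfst y))" by (rule vd)
      fix n y assume y: "y \<in> elts (mcone ?s) n"
      then obtain x r where xr: "y = dpair x r" "x \<in> elts (C ?s) n" "r \<in> elts (R2 ?s) n"
        unfolding mcone_def by (rule dsum_E)
      have "v n (dfst (d_mcone ?s n y)) \<in> elts N n"
        using mor_closed[OF vd mor_closed[OF mor_d_mcone y]] .
      then show "padd N ?w (\<lambda>n y. f n (dsnd y)) n y = v n (dfst (d_mcone ?s n y))"
        unfolding padd_def using split[OF xr(2,3)] mor_closed[OF mf xr(3)] gmN
        by (simp only: xr(1) dpair_simps) (simp add: pl_ac del: d_mcone_simps)
    qed
    have "cocycle R2 e2 N ?s f"
      unfolding cocycle_def
    proof (intro conjI allI ballI mf)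
      fix n r assume r: "r \<in> elts (R2 (Suc ?s)) n"
      note er = mor_closed[OF mor_e2 r]
      let ?y = "dpair (\<psi>2 ?s n r) (e2 (Suc ?s) n r)"
      have z0: "dpair (zr (C (Suc ?s)) n) r \<in> elts (mcone (Suc ?s)) n" using r cd(2) by (simp add: mcone_def)
      have dz: "d_mcone (Suc ?s) n (dpair (zr (C (Suc ?s)) n) r) = ?y"
        using mor_zr[OF cd(2,2,3)] psi_C[OF r] cd(2) by simp
      have "?w n ?y = zr N n" using w z0 unfolding cocycle_def dz[symmetric] by blast
      moreover have "d_mcone ?s n ?y = zr (mcone (Suc t)) n"
        using chain_complexD(4)[OF Dd(2) z0] dz by simp
      then have "v n (dfst (d_mcone ?s n ?y)) = zr N n"
        using mor_zr[OF cd(2) gmN v(1)] by (simp add: mcone_def del: d_mcone_simps)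
      ultimately have "zr N n = pl N n (f n (e2 (Suc ?s) n r)) (zr N n)"
        using split[OF psi_C[OF r] er] by (simp only:)
      also have "\<dots> = f n (e2 (Suc ?s) n r)" by (rule pl_zr(1)[OF gmN mor_closed[OF mf er]])
      finally show "f n (e2 (Suc ?s) n r) = zr N n" by (rule sym)
    qed
    then have "cocycle R e N t f" by (simp only: cocycle_R2)
    moreover have "coboundary Q q N ?s (padd N z (\<lambda>n x. f n (dsnd (a ?s n x))))"
    proof (rule coboundary_add_trans[OF gmN ba_homotopic[OF z]])
      show "coboundary Q q N ?s (padd N (\<lambda>n x. z n (b ?s n (a ?s n x))) (\<lambda>n x. f n (dsnd (a ?s n x))))"
        using coboundary_pullback[OF a(1) diff] by (simp add: padd_def[abs_def])
      fix n x assume x: "x \<in> elts (Q ?s) n"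
      show "z n x \<in> elts N n" "z n (b ?s n (a ?s n x)) \<in> elts N n" "f n (dsnd (a ?s n x)) \<in> elts N n"
        using mor_closed[OF mz x] mor_closed[OF mw mor_closed[OF ma x]]
          mor_closed[OF mf mor_closed[OF mor_dsnd mor_closed[OF ma x, unfolded mcone_def]]] by simp_all
    qed
    ultimately show "\<exists>f. cocycle R e N t f \<and> coboundary Q q N ?s (padd N z (\<lambda>n x. f n (dsnd (a ?s n x))))" by blast
  next
    assume "\<exists>f. cocycle R e N t f \<and> coboundary Q q N ?s (padd N z (\<lambda>n x. f n (dsnd (a ?s n x))))"
    then obtain f where f: "cocycle R e N t f" "coboundary Q q N ?s (padd N z (\<lambda>n x. f n (dsnd (a ?s n x))))" by blast
    let ?f = "\<lambda>n y. f n (dsnd y)"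
    have fc: "cocycle mcone d_mcone N ?s ?f"
      using f(1) by (intro cocycle_pullback[OF chain_dsnd Dd(2)]) (simp only: cocycle_R2)
    have mf: "mor (mcone ?s) N ?f" using fc by (simp add: cocycle_def)
    have 1: "coboundary C dC N ?s (padd N (\<lambda>n x. z n (b ?s n (inl ?s n x))) (\<lambda>n x. ?f n (a ?s n (b ?s n (inl ?s n x)))))"
      using coboundary_pullback[OF chain_inl coboundary_pullback[OF b(1) f(2)]] by (simp add: padd_def[abs_def])
    \<comment> \<open>A cochain that factors through the second projection is zero on
      \<open>C\<close>; passing through \<open>b\<close> and then \<open>a\<close> changes this only
      by a coboundary.\<close>
    have 2: "coboundary C dC N ?s (\<lambda>n x. ?f n (a ?s n (b ?s n (inl ?s n x))))"
    proof (rule coboundary_cong[OF coboundary_pullback[OF chain_inl ab_homotopic[OF fc]]])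
      fix n x assume x: "x \<in> elts (C ?s) n"
      have "f n (zr (R2 ?s) n) = zr N n"
        using mor_zr[OF um_gm[OF umR2] gmN, of ?s f n] f(1) by (simp add: cocycle_def)
      then show "?f n (a ?s n (b ?s n (inl ?s n x))) = padd N ?f (\<lambda>n z. ?f n (a ?s n (b ?s n z))) n (inl ?s n x)"
        using mor_closed[OF mf mor_closed[OF ma mor_closed[OF mb mor_closed[OF mi x]]]] gmN
        by (simp add: padd_def inl_def)
    qed
    show "coboundary C dC N ?s (\<lambda>n x. z n (b ?s n (inl ?s n x)))"
    proof (rule coboundary_cancel[OF gmN 1 2])
      fix n x assume "x \<in> elts (C ?s) n"
      note ix = mor_closed[OF mi this]
      show "z n (b ?s n (inl ?s n x)) \<in> elts N n" by (rule mor_closed[OF mw ix])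
      show "?f n (a ?s n (b ?s n (inl ?s n x))) \<in> elts N n"
        by (rule mor_closed[OF mf mor_closed[OF ma mor_closed[OF mb ix]]])
    qed
  qed
qed

text \<open>A cocycle on \<open>C\<close> extends to a cocycle on the cone precisely when its
  pullback along \<psi> is a coboundary, up to cohomology.\<close>

lemma exact_at_C:
  assumes y: "cocycle C dC N (Suc (Suc t)) y"
  shows "coboundary R e N (Suc t) (\<lambda>n r. y n (\<psi> (Suc t) n r)) \<longleftrightarrow>
    (\<exists>z. cocycle Q q N (Suc (Suc t)) z \<and>
      coboundary C dC N (Suc (Suc t)) (padd N y (\<lambda>n x. z n (b (Suc (Suc t)) n (inl (Suc (Suc t)) n x)))))"
proof -
  let ?s = "Suc (Suc t)"
  note ma = chain_mapD(1)[OF a(1)] and mb = chain_mapD(1)[OF b(1)] and mi = chain_mapD(1)[OF chain_inl]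
  have my: "mor (C ?s) N y" using y by (simp add: cocycle_def)
  have psi2: "(\<lambda>n r. y n (\<psi> (Suc t) n r)) = (\<lambda>n r. y n (\<psi>2 ?s n r))" by simp
  show ?thesis
  proof
    assume "coboundary R e N (Suc t) (\<lambda>n r. y n (\<psi> (Suc t) n r))"
    then have "coboundary R2 e2 N (Suc ?s) (\<lambda>n r. y n (\<psi>2 ?s n r))"
      by (simp only: coboundary_R2 psi2)
    then obtain g where g: "mor (R2 ?s) N g"
      "\<And>n r. r \<in> elts (R2 (Suc ?s)) n \<Longrightarrow> y n (\<psi>2 ?s n r) = g n (e2 (Suc ?s) n r)"
      unfolding coboundary_Suc by blast
    \<comment> \<open>The cochain with value zero bounding the pullback of \<open>y\<close> supplies
      the missing component \<open>g\<close> of the extension.\<close>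
    define w where "w n z = pl N n (y n (dfst z)) (g n (dsnd z))" for n z
    have mw: "mor (mcone ?s) N w" unfolding w_def by (rule mor_on_mcone[OF my g(1)])
    have w: "cocycle mcone d_mcone N ?s w"
      unfolding cocycle_def
    proof (intro conjI allI ballI mw)
      fix n z assume "z \<in> elts (mcone (Suc ?s)) n"
      then obtain x r where z: "z = dpair x r" "x \<in> elts (C (Suc ?s)) n" "r \<in> elts (R2 (Suc ?s)) n"
        unfolding mcone_def by (rule dsum_E)
      have "y n (pl (C ?s) n (dC (Suc ?s) n x) (\<psi>2 ?s n r)) = y n (\<psi>2 ?s n r)"
        using mor_pl[OF my mor_closed[OF cd(3) z(2)] psi_C[OF z(3)]] y z(2) mor_closed[OF my psi_C[OF z(3)]] gmN
        by (simp add: cocycle_def)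
      then have "w n (d_mcone (Suc ?s) n z) = pl N n (y n (\<psi>2 ?s n r)) (g n (e2 (Suc ?s) n r))"
        by (simp only: w_def z(1) d_mcone_simps dpair_simps)
      also have "\<dots> = zr N n"
        unfolding g(2)[OF z(3), symmetric] by (rule pl_self[OF gmN mor_closed[OF my psi_C[OF z(3)]]])
      finally show "w n (d_mcone (Suc ?s) n z) = zr N n" .
    qed
    have "coboundary C dC N ?s (padd N y (\<lambda>n x. w n (a ?s n (b ?s n (inl ?s n x)))))"
    proof (rule coboundary_cong[OF coboundary_pullback[OF chain_inl ab_homotopic[OF w]]])
      fix n x assume x: "x \<in> elts (C ?s) n"
      have "w n (inl ?s n x) = y n x"
        using mor_zr[OF um_gm[OF umR2] gmN g(1)] mor_closed[OF my x] gmN by (simp add: w_def inl_def)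
      then show "padd N y (\<lambda>n x. w n (a ?s n (b ?s n (inl ?s n x)))) n x
          = padd N w (\<lambda>n z. w n (a ?s n (b ?s n z))) n (inl ?s n x)" by (simp add: padd_def)
    qed
    moreover have "cocycle Q q N ?s (\<lambda>n x. w n (a ?s n x))" by (rule cocycle_pullback[OF a(1) Qd(2) w])
    ultimately show "\<exists>z. cocycle Q q N ?s z \<and> coboundary C dC N ?s (padd N y (\<lambda>n x. z n (b ?s n (inl ?s n x))))"
      by blast
  next
    assume "\<exists>z. cocycle Q q N ?s z \<and> coboundary C dC N ?s (padd N y (\<lambda>n x. z n (b ?s n (inl ?s n x))))"
    then obtain z u where z: "cocycle Q q N ?s z" and u: "mor (C (Suc t)) N u"
      "\<And>n x. x \<in> elts (C ?s) n \<Longrightarrow> padd N y (\<lambda>n x. z n (b ?s n (inl ?s n x))) n x = u n (dC ?s n x)"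
      unfolding coboundary_Suc by blast
    have w: "cocycle mcone d_mcone N ?s (\<lambda>n x. z n (b ?s n x))" by (rule cocycle_pullback[OF b(1) Dd(2) z])
    have mw: "mor (mcone ?s) N (\<lambda>n x. z n (b ?s n x))" using w by (simp add: cocycle_def)
    have 1: "coboundary R2 e2 N (Suc ?s) (padd N (\<lambda>n r. y n (\<psi>2 ?s n r)) (\<lambda>n r. z n (b ?s n (inl ?s n (\<psi>2 ?s n r)))))"
    proof (rule coboundaryI)
      show "mor (R2 ?s) N (\<lambda>n r. u n (\<psi>2 (Suc t) n r))" by (rule mor_comp[OF mor_psi2 u(1)])
      fix n r assume r: "r \<in> elts (R2 (Suc ?s)) n"
      show "padd N (\<lambda>n r. y n (\<psi>2 ?s n r)) (\<lambda>n r. z n (b ?s n (inl ?s n (\<psi>2 ?s n r)))) n r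
          = u n (\<psi>2 (Suc t) n (e2 (Suc ?s) n r))"
        using u(2)[OF psi_C[OF r]] psi2_d[OF r] by (simp add: padd_def)
    qed
    have "coboundary R2 e2 N (Suc ?s) (\<lambda>n r. y n (\<psi>2 ?s n r))"
    proof (rule coboundary_cancel[OF gmN 1 cocycle_inr_psi[OF w]])
      fix n r assume "r \<in> elts (R2 (Suc ?s)) n"
      note p = psi_C[OF this]
      show "y n (\<psi>2 ?s n r) \<in> elts N n" by (rule mor_closed[OF my p])
      show "z n (b ?s n (inl ?s n (\<psi>2 ?s n r))) \<in> elts N n" by (rule mor_closed[OF mw mor_closed[OF mi p]])
    qed
    then show "coboundary R e N (Suc t) (\<lambda>n r. y n (\<psi> (Suc t) n r))"
      by (simp only: coboundary_R2 psi2)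
  qed
qed

end

section \<open>Maps of quotient groups\<close>

text \<open>The cosets in the union all coincide when \<open>u\<close> maps the one subgroup into
  the other, so the induced map is given without choosing representatives.\<close>

definition induced :: "('b, 'c) monoid_scheme \<Rightarrow> 'b set \<Rightarrow> ('a \<Rightarrow> 'b) \<Rightarrow> 'a set \<Rightarrow> 'b set" where
  "induced H L u A = (\<Union>x\<in>A. L #>\<^bsub>H\<^esub> u x)"

lemma induced_coset:
  assumes G: "comm_group G" "subgroup K G" and H: "comm_group H" "subgroup L H"
    and u: "u \<in> hom G H" "\<forall>x\<in>K. u x \<in> L" and x: "x \<in> carrier G"
  shows "induced H L u (K #>\<^bsub>G\<^esub> x) = L #>\<^bsub>H\<^esub> u x"
proof -
  interpret G: comm_group G by fact
  interpret H: comm_group H by fact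
  have "L #>\<^bsub>H\<^esub> u y = L #>\<^bsub>H\<^esub> u x" if y: "y \<in> K #>\<^bsub>G\<^esub> x" for y
  proof -
    obtain k where k: "k \<in> K" "y = k \<otimes>\<^bsub>G\<^esub> x" using y by (auto simp: r_coset_def)
    have kc: "k \<in> carrier G" using k subgroup.mem_carrier[OF G(2)] by blast
    have c: "u k \<in> carrier H" "u x \<in> carrier H" "L \<subseteq> carrier H"
      using kc x u(1) subgroup.subset[OF H(2)] by (auto simp: hom_def)
    have "L #>\<^bsub>H\<^esub> u y = (L #>\<^bsub>H\<^esub> u k) #>\<^bsub>H\<^esub> u x"
      using k kc x u(1) c by (simp add: hom_mult H.coset_mult_assoc)
    then show ?thesis using H.coset_join2[OF c(1) H(2) bspec[OF u(2) k(1)]] by simp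
  qed
  moreover have "x \<in> K #>\<^bsub>G\<^esub> x" by (rule G.rcos_self[OF x G(2)])
  ultimately show ?thesis unfolding induced_def by blast
qed

lemma induced_hom:
  assumes G: "comm_group G" "subgroup K G" and H: "comm_group H" "subgroup L H"
    and u: "u \<in> hom G H" "\<forall>x\<in>K. u x \<in> L"
  shows "induced H L u \<in> hom (G Mod K) (H Mod L)"
proof (rule homI)
  interpret G: comm_group G by fact
  interpret H: comm_group H by fact
  note ind = induced_coset[OF G H u]
  have uc: "x \<in> carrier G \<Longrightarrow> u x \<in> carrier H" for x using u(1) by (auto simp: hom_def)
  fix A assume "A \<in> carrier (G Mod K)"
  then obtain x where x: "x \<in> carrier G" "A = K #>\<^bsub>G\<^esub> x" by (auto simp: FactGroup_def RCOSETS_def)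
  then show "induced H L u A \<in> carrier (H Mod L)"
    using ind uc H.rcosetsI[OF subgroup.subset[OF H(2)]] by (simp add: FactGroup_def)
  fix A' assume "A' \<in> carrier (G Mod K)"
  then obtain y where y: "y \<in> carrier G" "A' = K #>\<^bsub>G\<^esub> y" by (auto simp: FactGroup_def RCOSETS_def)
  have "A \<otimes>\<^bsub>G Mod K\<^esub> A' = K #>\<^bsub>G\<^esub> (x \<otimes>\<^bsub>G\<^esub> y)"
    unfolding x(2) y(2) FactGroup_def by (simp add: normal.rcos_sum[OF G.subgroup_imp_normal[OF G(2)] x(1) y(1)])
  then have "induced H L u (A \<otimes>\<^bsub>G Mod K\<^esub> A') = L #>\<^bsub>H\<^esub> (u x \<otimes>\<^bsub>H\<^esub> u y)"
    using ind[of "x \<otimes>\<^bsub>G\<^esub> y"] x y u(1) by (simp add: hom_mult)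
  also have "\<dots> = (L #>\<^bsub>H\<^esub> u x) <#>\<^bsub>H\<^esub> (L #>\<^bsub>H\<^esub> u y)"
    using normal.rcos_sum[OF H.subgroup_imp_normal[OF H(2)] uc[OF x(1)] uc[OF y(1)]] by simp
  finally show "induced H L u (A \<otimes>\<^bsub>G Mod K\<^esub> A') = induced H L u A \<otimes>\<^bsub>H Mod L\<^esub> induced H L u A'"
    unfolding x(2) y(2) ind[OF x(1)] ind[OF y(1)] by (simp add: FactGroup_def)
qed

lemma coset_eq_iff_exponent2:
  assumes G: "comm_group G" "subgroup K G" and x: "x \<in> carrier G" "y \<in> carrier G" and y: "y \<otimes>\<^bsub>G\<^esub> y = \<one>\<^bsub>G\<^esub>"
  shows "K #>\<^bsub>G\<^esub> x = K #>\<^bsub>G\<^esub> y \<longleftrightarrow> x \<otimes>\<^bsub>G\<^esub> y \<in> K"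
proof -
  interpret G: comm_group G by fact
  have xyy: "(x \<otimes>\<^bsub>G\<^esub> y) \<otimes>\<^bsub>G\<^esub> y = x" using x y by (simp add: G.m_assoc)
  show ?thesis
  proof
    assume "K #>\<^bsub>G\<^esub> x = K #>\<^bsub>G\<^esub> y"
    then have "x \<in> K #>\<^bsub>G\<^esub> y" using G.rcos_self[OF x(1) G(2)] by simp
    then obtain k where k: "k \<in> K" "x = k \<otimes>\<^bsub>G\<^esub> y" by (auto simp: r_coset_def)
    then have "x \<otimes>\<^bsub>G\<^esub> y = k" using x y subgroup.mem_carrier[OF G(2)] by (simp add: G.m_assoc)
    then show "x \<otimes>\<^bsub>G\<^esub> y \<in> K" using k by simp
  next
    assume K: "x \<otimes>\<^bsub>G\<^esub> y \<in> K"
    have "K #>\<^bsub>G\<^esub> x = (K #>\<^bsub>G\<^esub> (x \<otimes>\<^bsub>G\<^esub> y)) #>\<^bsub>G\<^esub> y"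
      using x xyy subgroup.subset[OF G(2)] by (simp add: G.coset_mult_assoc)
    then show "K #>\<^bsub>G\<^esub> x = K #>\<^bsub>G\<^esub> y" using G.coset_join2[OF _ G(2) K] x by simp
  qed
qed

text \<open>In a group of exponent 2 the classes of y and u x agree when their product lies in
  \<open>K2\<close>, so the hypothesis \<open>exact\<close> expresses both inclusions at the level
  of cochains.\<close>

lemma induced_exact:
  assumes G1: "comm_group G1" "subgroup K1 G1" and G2: "comm_group G2" "subgroup K2 G2"
    and G3: "comm_group G3" "subgroup K3 G3"
    and u: "u \<in> hom G1 G2" "\<forall>x\<in>K1. u x \<in> K2"
    and v: "v \<in> hom G2 G3" "\<forall>x\<in>K2. v x \<in> K3"
    and exp2: "\<forall>y\<in>carrier G2. y \<otimes>\<^bsub>G2\<^esub> y = \<one>\<^bsub>G2\<^esub>"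
    and exact: "\<And>y. y \<in> carrier G2 \<Longrightarrow> v y \<in> K3 \<longleftrightarrow> (\<exists>x\<in>carrier G1. y \<otimes>\<^bsub>G2\<^esub> u x \<in> K2)"
  shows "kernel (G2 Mod K2) (G3 Mod K3) (induced G3 K3 v) = induced G2 K2 u ` carrier (G1 Mod K1)"
proof -
  interpret G3: comm_group G3 by fact
  have uc: "x \<in> carrier G1 \<Longrightarrow> u x \<in> carrier G2" for x using u(1) by (auto simp: hom_def)
  have vc: "x \<in> carrier G2 \<Longrightarrow> v x \<in> carrier G3" for x using v(1) by (auto simp: hom_def)
  have "K3 #>\<^bsub>G3\<^esub> v y = K3 \<longleftrightarrow> (\<exists>x\<in>carrier G1. K2 #>\<^bsub>G2\<^esub> y = K2 #>\<^bsub>G2\<^esub> u x)" if y: "y \<in> carrier G2" for y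
  proof -
    have "K3 #>\<^bsub>G3\<^esub> v y = K3 \<longleftrightarrow> v y \<in> K3"
      using G3.coset_join1[OF _ vc[OF y] G3(2)] G3.coset_join2[OF vc[OF y] G3(2)] by blast
    also have "\<dots> \<longleftrightarrow> (\<exists>x\<in>carrier G1. K2 #>\<^bsub>G2\<^esub> y = K2 #>\<^bsub>G2\<^esub> u x)"
      unfolding exact[OF y] using coset_eq_iff_exponent2[OF G2 y uc bspec[OF exp2 uc]] by blast
    finally show ?thesis .
  qed
  note eq = this
  have "A \<in> kernel (G2 Mod K2) (G3 Mod K3) (induced G3 K3 v) \<longleftrightarrow> A \<in> induced G2 K2 u ` carrier (G1 Mod K1)" for A
  proof
    assume "A \<in> kernel (G2 Mod K2) (G3 Mod K3) (induced G3 K3 v)"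
    then obtain y where y: "y \<in> carrier G2" "A = K2 #>\<^bsub>G2\<^esub> y" "induced G3 K3 v A = K3"
      by (auto simp: kernel_def FactGroup_def RCOSETS_def)
    then have "K3 #>\<^bsub>G3\<^esub> v y = K3" using induced_coset[OF G2 G3 v y(1)] by simp
    then obtain x where x: "x \<in> carrier G1" "A = K2 #>\<^bsub>G2\<^esub> u x" unfolding eq[OF y(1)] y(2) by blast
    have "A = induced G2 K2 u (K1 #>\<^bsub>G1\<^esub> x)" by (simp only: x(2) induced_coset[OF G1 G2 u x(1)])
    then show "A \<in> induced G2 K2 u ` carrier (G1 Mod K1)"
      by (rule image_eqI) (use x(1) in \<open>auto simp: FactGroup_def RCOSETS_def\<close>)
  next
    assume "A \<in> induced G2 K2 u ` carrier (G1 Mod K1)"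
    then obtain B where B: "B \<in> rcosets\<^bsub>G1\<^esub> K1" "A = induced G2 K2 u B" by (auto simp: FactGroup_def)
    then obtain x where x: "x \<in> carrier G1" "B = K1 #>\<^bsub>G1\<^esub> x" by (auto simp: RCOSETS_def)
    have A: "A = K2 #>\<^bsub>G2\<^esub> u x" by (simp only: B(2) x(2) induced_coset[OF G1 G2 u x(1)])
    have "induced G3 K3 v A = K3"
      unfolding A induced_coset[OF G2 G3 v uc[OF x(1)]] using eq[OF uc[OF x(1)]] x(1) by blast
    then show "A \<in> kernel (G2 Mod K2) (G3 Mod K3) (induced G3 K3 v)"
      using A uc[OF x(1)] by (auto simp: kernel_def FactGroup_def RCOSETS_def)
  qed
  then show ?thesis by blast
qed

section \<open>The groups \<open>Ext\<close>\<close>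

lemma Hom_group_simps:
  "carrier (Hom_group M N) = Hom_U M N"
  "f \<otimes>\<^bsub>Hom_group M N\<^esub> g = restr M (padd N f g)"
  "\<one>\<^bsub>Hom_group M N\<^esub> = restr M (\<lambda>n x. zr N n)"
  by (simp_all add: Hom_group_def restr_def[abs_def] padd_def fun_eq_iff)

lemma restr_eq_iff: "restr M f = restr M g \<longleftrightarrow> (\<forall>n. \<forall>x\<in>elts M n. f n x = g n x)"
proof
  show "\<forall>n. \<forall>x\<in>elts M n. f n x = g n x" if "restr M f = restr M g"
    using that restr_apply by metis
  show "restr M f = restr M g" if "\<forall>n. \<forall>x\<in>elts M n. f n x = g n x"
    using that by (auto simp: restr_def fun_eq_iff restrict_def)
qed

text \<open>The numerator of the quotient in \<open>Ext_U\<close>, for an explicitly given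
  resolution.\<close>

definition cochains :: "(nat \<Rightarrow> 'u gmod) \<Rightarrow> (nat \<Rightarrow> nat \<Rightarrow> 'u \<Rightarrow> 'u) \<Rightarrow> 'b gmod \<Rightarrow> nat \<Rightarrow> (nat \<Rightarrow> 'u \<Rightarrow> 'b) monoid" where
  "cochains K d N s = (Hom_group (K s) N)\<lparr>carrier := cocycles K d N s\<rparr>"

definition cohomology :: "(nat \<Rightarrow> 'u gmod) \<Rightarrow> (nat \<Rightarrow> nat \<Rightarrow> 'u \<Rightarrow> 'u) \<Rightarrow> 'b gmod \<Rightarrow> nat \<Rightarrow> (nat \<Rightarrow> 'u \<Rightarrow> 'b) set monoid" where
  "cohomology K d N s = cochains K d N s Mod coboundaries K d N s"

lemma cochains_simps [simp]:
  "carrier (cochains K d N s) = cocycles K d N s"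
  "f \<otimes>\<^bsub>cochains K d N s\<^esub> g = restr (K s) (padd N f g)"
  "\<one>\<^bsub>cochains K d N s\<^esub> = restr (K s) (\<lambda>n x. zr N n)"
  by (simp_all add: cochains_def Hom_group_simps)

lemma mem_cocycles: "f \<in> cocycles K d N s \<longleftrightarrow> f \<in> Hom_U (K s) N \<and> cocycle K d N s f"
  unfolding cocycles_def kernel_def Hom_group_simps comp_U_eq restr_eq_iff cocycle_def Hom_U_iff by blast

lemma coboundary_restr [simp]: "coboundary K d N s (restr (K s) f) \<longleftrightarrow> coboundary K d N s f"
  using coboundary_cong[of K d N s f "restr (K s) f"] coboundary_cong[of K d N s "restr (K s) f" f] by auto

lemma cocycle_cong:
  assumes K: "chain_complex K d" and f: "cocycle K d N s f" and eq: "\<And>n x. x \<in> elts (K s) n \<Longrightarrow> g n x = f n x"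
  shows "cocycle K d N s g"
proof -
  note Kd = chain_complexD[OF K]
  have "mor (K s) N g" using mor_cong[OF Kd(2) _ eq] f by (simp add: cocycle_def)
  moreover have "g n (d (Suc s) n x) = zr N n" if "x \<in> elts (K (Suc s)) n" for n x
    using f that eq[OF mor_closed[OF Kd(3) that]] by (simp add: cocycle_def)
  ultimately show ?thesis by (simp add: cocycle_def)
qed

lemma restr_cocycles:
  assumes "chain_complex K d" "cocycle K d N s f"
  shows "restr (K s) f \<in> cocycles K d N s"
  unfolding mem_cocycles using assms cocycle_cong[OF assms, of "restr (K s) f"] chain_complexD(2)[OF assms(1)]
  by (auto simp: cocycle_def intro: restr_Hom_U)

lemma mem_coboundaries:
  assumes K: "chain_complex K d" and N: "gm N"
  shows "f \<in> coboundaries K d N s \<longleftrightarrow> f \<in> Hom_U (K s) N \<and> coboundary K d N s f"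
proof (cases s)
  case 0
  have "restr (K 0) (\<lambda>n x. zr N n) \<in> Hom_U (K 0) N"
    by (intro restr_Hom_U mor_zero N chain_complexD(2)[OF K])
  then show ?thesis
    using restr_eqI[of f "K 0" N "\<lambda>n x. zr N n"]
    by (auto simp: 0 coboundaries_def coboundary_0 Hom_group_simps)
next
  case (Suc r)
  note Kd = chain_complexD[OF K]
  have "f \<in> coboundaries K d N s \<longleftrightarrow> (\<exists>g\<in>Hom_U (K r) N. f = restr (K s) (\<lambda>n x. g n (d s n x)))"
    by (auto simp: Suc coboundaries_def comp_U_eq)
  also have "\<dots> \<longleftrightarrow> f \<in> Hom_U (K s) N \<and> coboundary K d N s f"
  proof
    assume "\<exists>g\<in>Hom_U (K r) N. f = restr (K s) (\<lambda>n x. g n (d s n x))"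
    then obtain g where g: "mor (K r) N g" "f = restr (K s) (\<lambda>n x. g n (d s n x))" by (auto simp: Hom_U_iff)
    then show "f \<in> Hom_U (K s) N \<and> coboundary K d N s f"
      using mor_comp[OF Kd(3) g(1)] Kd(2) by (auto simp: Suc coboundary_Suc intro: restr_Hom_U)
  next
    assume f: "f \<in> Hom_U (K s) N \<and> coboundary K d N s f"
    then obtain g where g: "mor (K r) N g" "\<And>n x. x \<in> elts (K s) n \<Longrightarrow> f n x = g n (d s n x)"
      by (auto simp: Suc coboundary_Suc)
    have "restr (K s) (\<lambda>n x. restr (K r) g n (d s n x)) = f"
      using f g(2) mor_closed[OF Kd(3)] by (intro restr_eqI[of f]) (auto simp: Suc)
    then show "\<exists>g\<in>Hom_U (K r) N. f = restr (K s) (\<lambda>n x. g n (d s n x))"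
      using restr_Hom_U[OF Kd(2) g(1)] by metis
  qed
  finally show ?thesis .
qed

context
  fixes K d and N :: "'b gmod" assumes K: "chain_complex K d" and N: "um N"
begin

lemma cocycle_zero: "cocycle K d N s (\<lambda>n x. zr N n)"
  unfolding cocycle_def using mor_zero[OF um_gm[OF N]] by simp

lemma cocycle_padd: "cocycle K d N s f \<Longrightarrow> cocycle K d N s g \<Longrightarrow> cocycle K d N s (padd N f g)"
  unfolding cocycle_def padd_def[abs_def] using mor_add[OF um_gm[OF N]] N by auto

lemma coboundary_cocycle:
  assumes "mor (K s) N f" "coboundary K d N s f"
  shows "cocycle K d N s f"
  unfolding cocycle_def
proof (intro conjI allI ballI assms(1))
  note Kd = chain_complexD[OF K]
  fix n x assume x: "x \<in> elts (K (Suc s)) n"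
  note dx = mor_closed[OF Kd(3) x]
  show "f n (d (Suc s) n x) = zr N n"
  proof (cases s)
    case 0
    then show ?thesis using assms(2) dx by (simp add: coboundary_0)
  next
    case (Suc r)
    then obtain g where g: "mor (K r) N g" "\<forall>n. \<forall>x\<in>elts (K s) n. f n x = g n (d s n x)"
      using assms(2) unfolding coboundary_def by auto
    then have "f n (d (Suc s) n x) = g n (zr (K r) n)" using dx Kd(4) x Suc by simp
    then show ?thesis using mor_zr[OF Kd(2) um_gm[OF N] g(1)] by simp
  qed
qed

lemma cocycles_closed: "f \<in> cocycles K d N s \<Longrightarrow> x \<in> elts (K s) n \<Longrightarrow> f n x \<in> elts N n"
  unfolding mem_cocycles cocycle_def by auto

lemma cochains_self:
  assumes "f \<in> carrier (cochains K d N s)"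
  shows "f \<otimes>\<^bsub>cochains K d N s\<^esub> f = \<one>\<^bsub>cochains K d N s\<^esub>"
  using cocycles_closed[of f s] assms N by (simp add: restr_eq_iff padd_def)

lemma comm_group_cochains: "comm_group (cochains K d N s)"
proof (rule comm_groupI)
  note gm = um_gm[OF N]
  fix f g h assume "f \<in> carrier (cochains K d N s)" "g \<in> carrier (cochains K d N s)" "h \<in> carrier (cochains K d N s)"
  then have f: "f \<in> cocycles K d N s" and g: "g \<in> cocycles K d N s" and h: "h \<in> cocycles K d N s" by simp_all
  note c = cocycles_closed[OF f] cocycles_closed[OF g] cocycles_closed[OF h]
  show "f \<otimes>\<^bsub>cochains K d N s\<^esub> g \<in> carrier (cochains K d N s)"
    using f g by (auto simp: mem_cocycles intro!: restr_cocycles[OF K cocycle_padd, unfolded mem_cocycles])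
  show "f \<otimes>\<^bsub>cochains K d N s\<^esub> g \<otimes>\<^bsub>cochains K d N s\<^esub> h = f \<otimes>\<^bsub>cochains K d N s\<^esub> (g \<otimes>\<^bsub>cochains K d N s\<^esub> h)"
    unfolding cochains_simps restr_eq_iff by (simp add: padd_def c gm pl_assoc)
  show "f \<otimes>\<^bsub>cochains K d N s\<^esub> g = g \<otimes>\<^bsub>cochains K d N s\<^esub> f"
    unfolding cochains_simps restr_eq_iff using pl_comm[OF gm] c by (simp add: padd_def)
next
  show "\<one>\<^bsub>cochains K d N s\<^esub> \<in> carrier (cochains K d N s)"
    using restr_cocycles[OF K cocycle_zero] by simp
  fix f assume f: "f \<in> carrier (cochains K d N s)"
  then have "f \<in> Hom_U (K s) N" by (simp add: mem_cocycles)
  then show "\<one>\<^bsub>cochains K d N s\<^esub> \<otimes>\<^bsub>cochains K d N s\<^esub> f = f"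
    unfolding cochains_simps using f cocycles_closed[of f s] N by (intro restr_eqI[of f]) (simp_all add: padd_def)
  show "\<exists>g\<in>carrier (cochains K d N s). g \<otimes>\<^bsub>cochains K d N s\<^esub> f = \<one>\<^bsub>cochains K d N s\<^esub>"
    using cochains_self[OF f] f by blast
qed

lemma coboundaries_restr:
  assumes "mor (K s) N f" "coboundary K d N s f"
  shows "restr (K s) f \<in> coboundaries K d N s"
  using assms chain_complexD(2)[OF K] N by (simp add: mem_coboundaries[OF K] restr_Hom_U)

lemma subgroup_coboundaries: "subgroup (coboundaries K d N s) (cochains K d N s)"
proof -
  interpret G: comm_group "cochains K d N s" by (rule comm_group_cochains)
  have gm: "gm N" using N by simp
  have sub: "coboundaries K d N s \<subseteq> carrier (cochains K d N s)"
    using coboundary_cocycle by (auto simp: mem_coboundaries[OF K gm] mem_cocycles Hom_U_iff)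
  show ?thesis
  proof (rule G.subgroupI[OF sub])
    show "coboundaries K d N s \<noteq> {}"
      using coboundaries_restr[OF mor_zero[OF gm] coboundary_zero[OF gm]] by blast
    fix f assume f: "f \<in> coboundaries K d N s"
    then have "inv\<^bsub>cochains K d N s\<^esub> f = f"
      using sub by (intro G.inv_equality cochains_self) blast+
    then show "inv\<^bsub>cochains K d N s\<^esub> f \<in> coboundaries K d N s" using f by simp
    fix g assume g: "g \<in> coboundaries K d N s"
    have "mor (K s) N (padd N f g)"
      unfolding padd_def[abs_def] using f g by (intro mor_add[OF gm]) (simp_all add: mem_coboundaries[OF K gm] Hom_U_iff)
    moreover have "coboundary K d N s (padd N f g)"
      using f g by (intro coboundary_padd[OF gm]) (simp_all add: mem_coboundaries[OF K gm])
    ultimately show "f \<otimes>\<^bsub>cochains K d N s\<^esub> g \<in> coboundaries K d N s"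
      by (simp add: coboundaries_restr)
  qed
qed

lemma group_cohomology: "group (cohomology K d N s)"
  unfolding cohomology_def
  by (rule normal.factorgroup_is_group[OF comm_group.subgroup_imp_normal[OF comm_group_cochains subgroup_coboundaries]])

lemma tensor_coboundaries_iff:
  assumes "f \<in> cocycles K d N s" "cocycle K d N s g"
  shows "f \<otimes>\<^bsub>cochains K d N s\<^esub> restr (K s) g \<in> coboundaries K d N s \<longleftrightarrow> coboundary K d N s (padd N f g)"
proof -
  have gm: "gm N" using N by simp
  have m: "mor (K s) N (padd N f g)"
    using cocycle_padd assms by (simp add: mem_cocycles cocycle_def)
  have e: "restr (K s) (padd N f (restr (K s) g)) = restr (K s) (padd N f g)"
    by (simp add: restr_eq_iff padd_def)
  show ?thesis
    unfolding cochains_simps e mem_coboundaries[OF K gm]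
    using restr_Hom_U[OF chain_complexD(2)[OF K] m] by simp
qed

end

lemma restr_coboundaries_iff:
  assumes K: "chain_complex K d" and N: "um N" and f: "cocycle K d N s f"
  shows "restr (K s) f \<in> coboundaries K d N s \<longleftrightarrow> coboundary K d N s f"
  using f restr_Hom_U[OF chain_complexD(2)[OF K], of s N f] um_gm[OF N]
  by (simp add: mem_coboundaries[OF K] cocycle_def)

text \<open>The product of cochains is a restricted function, so additivity is asked for every
  \<open>h\<close> that has the values of the sum on the elements of \<open>K s\<close>.\<close>

lemma hom_cochains:
  assumes K: "chain_complex K d" and L: "chain_complex L d'"
    and closed: "\<And>f. cocycle K d N s f \<Longrightarrow> cocycle L d' N' s' (\<Phi> f)"
    and add: "\<And>f g h n x. \<lbrakk>cocycle K d N s f; cocycle K d N s g; \<And>n x. x \<in> elts (K s) n \<Longrightarrow> h n x = pl N n (f n x) (g n x);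
      x \<in> elts (L s') n\<rbrakk> \<Longrightarrow> \<Phi> h n x = pl N' n (\<Phi> f n x) (\<Phi> g n x)"
  shows "(\<lambda>f. restr (L s') (\<Phi> f)) \<in> hom (cochains K d N s) (cochains L d' N' s')"
proof (rule homI)
  fix f assume "f \<in> carrier (cochains K d N s)"
  then have f: "cocycle K d N s f" by (simp add: mem_cocycles)
  then show "restr (L s') (\<Phi> f) \<in> carrier (cochains L d' N' s')"
    using restr_cocycles[OF L closed] by simp
  fix g assume "g \<in> carrier (cochains K d N s)"
  then have g: "cocycle K d N s g" by (simp add: mem_cocycles)
  show "restr (L s') (\<Phi> (f \<otimes>\<^bsub>cochains K d N s\<^esub> g)) =
      restr (L s') (\<Phi> f) \<otimes>\<^bsub>cochains L d' N' s'\<^esub> restr (L s') (\<Phi> g)"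
    unfolding cochains_simps restr_eq_iff
    using add[OF f g, of "restr (K s) (padd N f g)"] by (simp add: padd_def)
qed

section \<open>Cochains on \<open>Omega P\<close> and cochains on \<open>P\<close> with suspended
  coefficients\<close>

context omega_resolution
begin

lemma cocycle_adjoint:
  assumes N: "um N" and y: "cocycle P d (suspension N) s y"
  shows "cocycle C dC N s (\<lambda>m. y (Suc m))"
  unfolding cocycle_def
proof (intro conjI allI ballI)
  have my: "mor (P s) (suspension N) y" using y by (simp add: cocycle_def)
  show "mor (C s) N (\<lambda>m. y (Suc m))"
    unfolding C_def by (rule omega_adjoint_mor[OF cD(1) N my])
  fix m x assume x: "x \<in> elts (C (Suc s)) m"
  note c = C_E[OF x]
  note dx = mor_closed[OF cD(3) c(1)]
  have "dC (Suc s) m x = omega_proj (P s) m (d (Suc s) (Suc m) x)" using dC_proj[OF c(1)] c(2) by simp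
  then have "y (Suc m) (dC (Suc s) m x) = y (Suc m) (d (Suc s) (Suc m) x)"
    using omega_adjoint_proj[OF cD(1) N my dx] by simp
  also have "\<dots> = zr (suspension N) (Suc m)" using y c(1) unfolding cocycle_def by blast
  finally show "y (Suc m) (dC (Suc s) m x) = zr N m" by simp
qed

text \<open>The inverse, on elements, of passing from a cochain \<open>y\<close> to
  \<open>\<lambda>m. y (Suc m)\<close>.\<close>

definition adj :: "'b gmod \<Rightarrow> nat \<Rightarrow> (nat \<Rightarrow> int \<Rightarrow> 'b) \<Rightarrow> nat \<Rightarrow> int \<Rightarrow> 'b" where
  "adj N s y = susp_map N (\<lambda>m x. y m (omega_proj (P s) m x))"

lemma adj_simps [simp]: "adj N s y 0 x = zr N 0" "adj N s y (Suc m) x = y m (omega_proj (P s) m x)"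
  by (simp_all add: adj_def)

lemma adj_C: "x \<in> elts (C s) m \<Longrightarrow> adj N s y (Suc m) x = y m x"
  using C_E(2) by simp

lemma mor_adj: "um N \<Longrightarrow> mor (C s) N y \<Longrightarrow> mor (P s) (suspension N) (adj N s y)"
  unfolding C_def adj_def by (rule omega_adjoint_inv[OF cD(1)])

lemma cocycle_adj:
  assumes N: "um N" and y: "cocycle C dC N s y"
  shows "cocycle P d (suspension N) s (adj N s y)"
  unfolding cocycle_def
proof (intro conjI allI ballI)
  show "mor (P s) (suspension N) (adj N s y)" using mor_adj[OF N] y by (simp add: cocycle_def)
  fix k x assume x: "x \<in> elts (P (Suc s)) k"
  show "adj N s y k (d (Suc s) k x) = zr (suspension N) k"
  proof (cases k)
    case (Suc m)
    have "y m (omega_proj (P s) m (d (Suc s) (Suc m) x)) = zr N m"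
      using y proj_C[of x "Suc s" m] dC_proj[of x s m] x Suc by (simp add: cocycle_def flip: dC_proj)
    then show ?thesis using Suc by simp
  qed simp
qed

lemma coboundary_adjoint:
  assumes N: "um N" and y: "coboundary P d (suspension N) (Suc r) y"
  shows "coboundary C dC N (Suc r) (\<lambda>m. y (Suc m))"
proof -
  obtain g where g: "mor (P r) (suspension N) g" "\<And>k x. x \<in> elts (P (Suc r)) k \<Longrightarrow> y k x = g k (d (Suc r) k x)"
    using y unfolding coboundary_Suc by blast
  show ?thesis
  proof (rule coboundaryI)
    show "mor (C r) N (\<lambda>m. g (Suc m))" unfolding C_def by (rule omega_adjoint_mor[OF cD(1) N g(1)])
    fix m x assume x: "x \<in> elts (C (Suc r)) m"
    note c = C_E[OF x]
    have "dC (Suc r) m x = omega_proj (P r) m (d (Suc r) (Suc m) x)" using dC_proj[OF c(1)] c(2) by simp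
    then show "y (Suc m) x = g (Suc m) (dC (Suc r) m x)"
      using omega_adjoint_proj[OF cD(1) N g(1) mor_closed[OF cD(3) c(1)]] g(2)[OF c(1)] by simp
  qed
qed

lemma coboundary_from_adjoint:
  assumes N: "um N" and my: "mor (P (Suc r)) (suspension N) y"
    and y: "coboundary C dC N (Suc r) (\<lambda>m. y (Suc m))"
  shows "coboundary P d (suspension N) (Suc r) y"
proof -
  obtain g where g: "mor (C r) N g" "\<And>m x. x \<in> elts (C (Suc r)) m \<Longrightarrow> y (Suc m) x = g m (dC (Suc r) m x)"
    using y unfolding coboundary_Suc by blast
  show ?thesis
  proof (rule coboundaryI)
    show "mor (P r) (suspension N) (adj N r g)" by (rule mor_adj[OF N g(1)])
    fix k x assume x: "x \<in> elts (P (Suc r)) k"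
    show "y k x = adj N r g k (d (Suc r) k x)"
    proof (cases k)
      case 0
      then show ?thesis using mor_closed[OF my x] by simp
    next
      case (Suc m)
      then have x: "x \<in> elts (P (Suc r)) (Suc m)" using x by simp
      have "y (Suc m) x = y (Suc m) (omega_proj (P (Suc r)) m x)"
        by (rule omega_adjoint_proj[OF cD(1) N my x, symmetric])
      also have "\<dots> = g m (omega_proj (P r) m (d (Suc r) (Suc m) x))"
        using g(2)[OF proj_C[OF x]] dC_proj[OF x] by simp
      finally show ?thesis using Suc by simp
    qed
  qed
qed

end

section \<open>The EHP sequence\<close>

text \<open>The maps are chosen before \<open>s\<close>, so the windows for consecutive
  \<open>s\<close> overlap in the same homomorphisms and together form one long sequence.\<close>

lemma EHP_sequence:
  fixes N :: "'b gmod"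
  assumes P: "resolution ((suspension ^^ Suc n) F2_module) P d"
    and Q: "resolution ((suspension ^^ n) F2_module) Q q"
    and R: "resolution ((suspension ^^ (2 * n + 1)) F2_module) R e"
    and N: "um N"
  shows "\<exists>Pm Em Hm. \<forall>s\<ge>2. exact_seq
    ([cohomology R e N (s - 1), cohomology P d (suspension N) s, cohomology Q q N s,
      cohomology R e N (s - 2), cohomology P d (suspension N) (s - 1)],
     [Hm s, Em s, Pm s, Hm (s - 1)])"
proof -
  interpret O: omega_resolution n P d by unfold_locales (rule P)
  obtain \<omega> where \<omega>: "mor (sub_gmod (O.C 1) O.Z1) ((suspension ^^ (2 * n + 1)) F2_module) \<omega>"
    "\<forall>m. \<omega> m ` O.Z1 m = elts ((suspension ^^ (2 * n + 1)) F2_module) m"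
    "\<forall>m. \<forall>y\<in>O.Z1 m. \<omega> m y = zr ((suspension ^^ (2 * n + 1)) F2_module) m \<longleftrightarrow> y \<in> O.D1 m"
    using O.omega_exists by (elim exE conjE)
  interpret T: two_stage O.C O.dC "(suspension ^^ n) F2_module" O.aug O.Z1
    "(suspension ^^ (2 * n + 1)) F2_module" \<omega> R e
  proof unfold_locales
    show "\<omega> m y = zr ((suspension ^^ (2 * n + 1)) F2_module) m \<longleftrightarrow> y \<in> O.dC 2 m ` elts (O.C 2) m"
      if "y \<in> O.Z1 m" for m y using \<omega>(3) that by (simp only: O.D1_def)
    show "\<omega> m ` O.Z1 m = elts ((suspension ^^ (2 * n + 1)) F2_module) m" for m using \<omega>(2) by blast
  qed (rule O.chain_C O.projC O.exact_C O.mor_aug O.umB O.aug_surj O.aug_zr_iff O.Z1_def \<omega>(1) R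
      um_suspension_funpow[OF um_F2] | assumption)+
  obtain a where a: "chain_map Q q T.mcone T.d_mcone a"
    "\<forall>n. \<forall>x\<in>elts (Q 0) n. T.d_mcone 0 n (a 0 n x) = q 0 n x"
    by (rule resolution_chain_map[OF Q T.resolution_mcone O.umB]) blast
  obtain b where b: "chain_map T.mcone T.d_mcone Q q b"
    "\<forall>n. \<forall>x\<in>elts (T.mcone 0) n. q 0 n (b 0 n x) = T.d_mcone 0 n x"
    by (rule resolution_chain_map[OF T.resolution_mcone Q O.umB]) blast
  interpret S: cone_sequence O.C O.dC "(suspension ^^ n) F2_module" O.aug O.Z1
    "(suspension ^^ (2 * n + 1)) F2_module" \<omega> R e Q q N a b
    using a b by unfold_locales (use Q N in \<open>blast+\<close>)
  let ?SN = "suspension N"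
  have SN: "um ?SN" by (rule um_suspension[OF N])
  note gmN = um_gm[OF N] and chP = O.resD(2) and chQ = S.Qd(2) and chR = T.rd(2)
  \<comment> \<open>\<open>H\<close> pulls the adjoint cochain back along \<open>T.\<psi>\<close>;
    \<open>E\<close> restricts from the cone to \<open>O.C\<close> and takes the adjoint;
    \<open>F\<close>, which induces the map P, pulls back along the second projection of the
    cone.\<close>
  define H where "H s y m r = y (Suc m) (T.\<psi> (s - 1) m r)" for s and y :: "nat \<Rightarrow> int \<Rightarrow> 'b" and m r
  define E where "E s z = O.adj N s (\<lambda>m x. z m (b s m (S.inl s m x)))" for s and z :: "nat \<Rightarrow> int \<Rightarrow> 'b"
  define F where "F s f m x = f m (dsnd (a s m x))" for s and f :: "nat \<Rightarrow> int \<Rightarrow> 'b" and m x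

  have H_coc: "cocycle R e N t (H (Suc t) y)" if y: "cocycle P d ?SN (Suc t) y" for t y
  proof -
    have y': "cocycle O.C O.dC N (Suc t) (\<lambda>m. y (Suc m))" by (rule O.cocycle_adjoint[OF N y])
    then have my: "mor (O.C (Suc t)) N (\<lambda>m. y (Suc m))" by (simp add: cocycle_def)
    have m: "mor (R t) N (\<lambda>m r. y (Suc m) (T.\<psi> t m r))" by (rule mor_comp[OF T.mor_psi my])
    have z: "y (Suc m) (T.\<psi> t m (e (Suc t) m r)) = zr N m" if r: "r \<in> elts (R (Suc t)) m" for m r
      unfolding T.psi_d[OF r, symmetric] using y' mor_closed[OF T.mor_psi r] unfolding cocycle_def by blast
    show ?thesis unfolding cocycle_def H_def[abs_def] diff_Suc_1 using m z by blast
  qed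
  have H_cob: "coboundary R e N t (H (Suc t) y)" if y: "coboundary P d ?SN (Suc t) y" for t y
  proof -
    obtain g where g: "mor (O.C t) N g"
      "\<And>m x. x \<in> elts (O.C (Suc t)) m \<Longrightarrow> y (Suc m) x = g m (O.dC (Suc t) m x)"
      using O.coboundary_adjoint[OF N y] unfolding coboundary_Suc by blast
    \<comment> \<open>Working in \<open>T.R2\<close> covers t = 0 as well: there the coboundary
      vanishes because \<open>T.\<psi>\<close> takes values in cycles.\<close>
    have "coboundary T.R2 T.e2 N (Suc (Suc t)) (H (Suc t) y)"
    proof (rule coboundaryI)
      show "mor (T.R2 (Suc t)) N (\<lambda>m r. g m (T.\<psi>2 t m r))" by (rule mor_comp[OF T.mor_psi2 g(1)])
      fix m r assume r: "r \<in> elts (T.R2 (Suc (Suc t))) m"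
      have "y (Suc m) (T.\<psi>2 (Suc t) m r) = g m (O.dC (Suc t) m (T.\<psi>2 (Suc t) m r))"
        by (rule g(2)[OF S.psi_C[OF r]])
      also have "\<dots> = g m (T.\<psi>2 t m (T.e2 (Suc (Suc t)) m r))" by (simp only: T.psi2_d[OF r])
      finally show "H (Suc t) y m r = g m (T.\<psi>2 t m (T.e2 (Suc (Suc t)) m r))"
        by (simp add: H_def)
    qed
    then show ?thesis by (simp only: S.coboundary_R2)
  qed
  have E_coc: "cocycle P d ?SN s (E s z)" if z: "cocycle Q q N s z" for s z
    unfolding E_def
    by (rule O.cocycle_adj[OF N cocycle_pullback[OF S.chain_inl O.chain_C cocycle_pullback[OF b(1) S.Dd(2) z]]])
  have E_C: "E s z (Suc m) x = z m (b s m (S.inl s m x))" if "x \<in> elts (O.C s) m" for s z m x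
    unfolding E_def by (rule O.adj_C[OF that])
  have E_cob_iff: "coboundary P d ?SN (Suc r) (padd ?SN y (E (Suc r) z)) \<longleftrightarrow>
      coboundary O.C O.dC N (Suc r) (padd N (\<lambda>m. y (Suc m)) (\<lambda>m x. z m (b (Suc r) m (S.inl (Suc r) m x))))"
    if y: "cocycle P d ?SN (Suc r) y" and z: "cocycle Q q N (Suc r) z" for r y z
  proof -
    let ?y = "padd ?SN y (E (Suc r) z)"
    have my: "mor (P (Suc r)) ?SN ?y"
      using cocycle_padd[OF chP SN y E_coc[OF z]] by (simp add: cocycle_def)
    have eq: "padd N (\<lambda>m. y (Suc m)) (\<lambda>m x. z m (b (Suc r) m (S.inl (Suc r) m x))) m x = ?y (Suc m) x"
      if "x \<in> elts (O.C (Suc r)) m" for m x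
      using E_C[OF that] by (simp add: padd_def)
    show ?thesis
    proof
      assume "coboundary P d ?SN (Suc r) ?y"
      from O.coboundary_adjoint[OF N this] show "coboundary O.C O.dC N (Suc r) (padd N (\<lambda>m. y (Suc m)) (\<lambda>m x. z m (b (Suc r) m (S.inl (Suc r) m x))))"
        by (rule coboundary_cong) (rule eq)
    next
      assume "coboundary O.C O.dC N (Suc r) (padd N (\<lambda>m. y (Suc m)) (\<lambda>m x. z m (b (Suc r) m (S.inl (Suc r) m x))))"
      then have "coboundary O.C O.dC N (Suc r) (\<lambda>m. ?y (Suc m))"
        by (rule coboundary_cong) (rule eq[symmetric])
      then show "coboundary P d ?SN (Suc r) ?y" by (rule O.coboundary_from_adjoint[OF N my])
    qed
  qed
  have E_cob_iff': "coboundary P d ?SN (Suc r) (E (Suc r) z) \<longleftrightarrow>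
      coboundary O.C O.dC N (Suc r) (\<lambda>m x. z m (b (Suc r) m (S.inl (Suc r) m x)))"
    if z: "cocycle Q q N (Suc r) z" for r z
  proof
    assume "coboundary P d ?SN (Suc r) (E (Suc r) z)"
    from O.coboundary_adjoint[OF N this] show "coboundary O.C O.dC N (Suc r) (\<lambda>m x. z m (b (Suc r) m (S.inl (Suc r) m x)))"
      by (rule coboundary_cong) (rule E_C[symmetric])
  next
    assume "coboundary O.C O.dC N (Suc r) (\<lambda>m x. z m (b (Suc r) m (S.inl (Suc r) m x)))"
    then have "coboundary O.C O.dC N (Suc r) (\<lambda>m. E (Suc r) z (Suc m))"
      by (rule coboundary_cong) (rule E_C)
    moreover have "mor (P (Suc r)) ?SN (E (Suc r) z)" using E_coc[OF z] by (simp add: cocycle_def)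
    ultimately show "coboundary P d ?SN (Suc r) (E (Suc r) z)" by (intro O.coboundary_from_adjoint[OF N])
  qed
  have F_coc: "cocycle Q q N (Suc (Suc t)) (F (Suc (Suc t)) f)" if f: "cocycle R e N t f" for t f
  proof -
    have "cocycle T.R2 T.e2 N (Suc (Suc t)) f" using f by (simp only: S.cocycle_R2)
    from cocycle_pullback[OF a(1) chQ cocycle_pullback[OF S.chain_dsnd S.Dd(2) this]]
    show ?thesis unfolding F_def[abs_def] .
  qed
  have F_cob: "coboundary Q q N (Suc (Suc t)) (F (Suc (Suc t)) f)" if f: "coboundary R e N t f" for t f
  proof -
    have "coboundary T.R2 T.e2 N (Suc (Suc t)) f" using f by (simp only: S.coboundary_R2)
    from coboundary_pullback[OF a(1) coboundary_pullback[OF S.chain_dsnd this]]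
    show ?thesis unfolding F_def[abs_def] .
  qed

  let ?H = "\<lambda>s y. restr (R (s - 1)) (H s y)"
  let ?E = "\<lambda>s z. restr (P s) (E s z)"
  let ?F = "\<lambda>s f. restr (Q s) (F s f)"
  have H_hom: "?H (Suc t) \<in> hom (cochains P d ?SN (Suc t)) (cochains R e N t)" for t
    unfolding diff_Suc_1
  proof (rule hom_cochains[OF chP chR H_coc])
    fix f g h :: "nat \<Rightarrow> int \<Rightarrow> 'b" and m r
    assume h: "\<And>k x. x \<in> elts (P (Suc t)) k \<Longrightarrow> h k x = pl ?SN k (f k x) (g k x)" and r: "r \<in> elts (R t) m"
    have "T.\<psi> t m r \<in> elts (P (Suc t)) (Suc m)" by (rule O.C_E(1)[OF mor_closed[OF T.mor_psi r]])
    from h[OF this] show "H (Suc t) h m r = pl N m (H (Suc t) f m r) (H (Suc t) g m r)" by (simp add: H_def)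
  qed
  have E_hom: "?E s \<in> hom (cochains Q q N s) (cochains P d ?SN s)" for s
  proof (rule hom_cochains[OF chQ chP E_coc])
    fix f g h :: "nat \<Rightarrow> int \<Rightarrow> 'b" and k x
    assume h: "\<And>m y. y \<in> elts (Q s) m \<Longrightarrow> h m y = pl N m (f m y) (g m y)" and x: "x \<in> elts (P s) k"
    show "E s h k x = pl ?SN k (E s f k x) (E s g k x)"
    proof (cases k)
      case 0
      then show ?thesis by (simp add: E_def)
    next
      case (Suc m)
      then have "omega_proj (P s) m x \<in> elts (O.C s) m" using x O.proj_C by simp
      then have "b s m (S.inl s m (omega_proj (P s) m x)) \<in> elts (Q s) m"
        by (rule mor_closed[OF chain_mapD(1)[OF b(1)] mor_closed[OF chain_mapD(1)[OF S.chain_inl]]])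
      from h[OF this] show ?thesis using Suc by (simp add: E_def)
    qed
  qed
  have F_hom: "?F (Suc (Suc t)) \<in> hom (cochains R e N t) (cochains Q q N (Suc (Suc t)))" for t
  proof (rule hom_cochains[OF chR chQ F_coc])
    fix f g h :: "nat \<Rightarrow> int \<Rightarrow> 'b" and m x
    assume h: "\<And>k r. r \<in> elts (R t) k \<Longrightarrow> h k r = pl N k (f k r) (g k r)" and x: "x \<in> elts (Q (Suc (Suc t))) m"
    have "dsnd (a (Suc (Suc t)) m x) \<in> elts (T.R2 (Suc (Suc t))) m"
      by (rule mor_closed[OF chain_mapD(1)[OF S.chain_dsnd] mor_closed[OF chain_mapD(1)[OF a(1)] x]])
    then show "F (Suc (Suc t)) h m x = pl N m (F (Suc (Suc t)) f m x) (F (Suc (Suc t)) g m x)"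
      using h by (simp add: F_def)
  qed
  note grp = comm_group_cochains[OF chP SN] comm_group_cochains[OF chQ N] comm_group_cochains[OF chR N]
  note sub = subgroup_coboundaries[OF chP SN] subgroup_coboundaries[OF chQ N] subgroup_coboundaries[OF chR N]
  have memP: "cocycle P d ?SN s f \<and> mor (P s) ?SN f \<and> coboundary P d ?SN s f" if "f \<in> coboundaries P d ?SN s" for s f
    using that coboundary_cocycle[OF chP SN] by (simp add: mem_coboundaries[OF chP um_gm[OF SN]] Hom_U_iff)
  have memQ: "cocycle Q q N s f \<and> mor (Q s) N f \<and> coboundary Q q N s f" if "f \<in> coboundaries Q q N s" for s f
    using that coboundary_cocycle[OF chQ N] by (simp add: mem_coboundaries[OF chQ gmN] Hom_U_iff)
  have memR: "cocycle R e N s f \<and> mor (R s) N f \<and> coboundary R e N s f" if "f \<in> coboundaries R e N s" for s f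
    using that coboundary_cocycle[OF chR N] by (simp add: mem_coboundaries[OF chR gmN] Hom_U_iff)
  have H_B: "\<forall>y\<in>coboundaries P d ?SN (Suc t). ?H (Suc t) y \<in> coboundaries R e N t" for t
    unfolding diff_Suc_1 using memP H_coc H_cob restr_coboundaries_iff[OF chR N] by blast
  have E_B: "\<forall>z\<in>coboundaries Q q N (Suc r). ?E (Suc r) z \<in> coboundaries P d ?SN (Suc r)" for r
  proof
    fix z assume "z \<in> coboundaries Q q N (Suc r)"
    note z = memQ[OF this]
    have "coboundary O.C O.dC N (Suc r) (\<lambda>m x. z m (b (Suc r) m (S.inl (Suc r) m x)))"
      by (rule coboundary_pullback[OF S.chain_inl coboundary_pullback[OF b(1)]]) (use z in blast)
    then show "?E (Suc r) z \<in> coboundaries P d ?SN (Suc r)" using E_cob_iff' E_coc z restr_coboundaries_iff[OF chP SN] by blast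
  qed
  have F_B: "\<forall>f\<in>coboundaries R e N t. ?F (Suc (Suc t)) f \<in> coboundaries Q q N (Suc (Suc t))" for t
    using memR F_coc F_cob restr_coboundaries_iff[OF chQ N] by blast

  let ?iH = "\<lambda>s. induced (cochains R e N (s - 1)) (coboundaries R e N (s - 1)) (?H s)"
  let ?iE = "\<lambda>s. induced (cochains P d ?SN s) (coboundaries P d ?SN s) (?E s)"
  let ?iF = "\<lambda>s. induced (cochains Q q N s) (coboundaries Q q N s) (?F s)"
  have iH: "?iH (Suc t) \<in> hom (cohomology P d ?SN (Suc t)) (cohomology R e N t)" for t
    using induced_hom[OF grp(1) sub(1) grp(3) sub(3) H_hom H_B] unfolding cohomology_def diff_Suc_1 by blast
  have iE: "?iE (Suc r) \<in> hom (cohomology Q q N (Suc r)) (cohomology P d ?SN (Suc r))" for r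
    unfolding cohomology_def by (rule induced_hom[OF grp(2) sub(2) grp(1) sub(1) E_hom E_B])
  have iF: "?iF (Suc (Suc t)) \<in> hom (cohomology R e N t) (cohomology Q q N (Suc (Suc t)))" for t
    unfolding cohomology_def by (rule induced_hom[OF grp(3) sub(3) grp(2) sub(2) F_hom F_B])
  have exR: "kernel (cohomology R e N t) (cohomology Q q N (Suc (Suc t))) (?iF (Suc (Suc t)))
      = ?iH (Suc t) ` carrier (cohomology P d ?SN (Suc t))" for t
    unfolding cohomology_def diff_Suc_1
  proof (rule induced_exact[OF grp(1) sub(1) grp(3) sub(3) grp(2) sub(2) H_hom[unfolded diff_Suc_1]
        H_B[unfolded diff_Suc_1] F_hom F_B ballI[OF cochains_self[OF chR N]]])
    fix f assume "f \<in> carrier (cochains R e N t)"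
    then have f: "f \<in> cocycles R e N t" "cocycle R e N t f" by (simp_all add: mem_cocycles)
    have "?F (Suc (Suc t)) f \<in> coboundaries Q q N (Suc (Suc t)) \<longleftrightarrow> coboundary Q q N (Suc (Suc t)) (F (Suc (Suc t)) f)"
      by (rule restr_coboundaries_iff[OF chQ N F_coc[OF f(2)]])
    also have "\<dots> \<longleftrightarrow> (\<exists>y. cocycle O.C O.dC N (Suc t) y \<and> coboundary R e N t (padd N f (\<lambda>n r. y n (T.\<psi> t n r))))"
      using S.exact_at_R[OF f(2)] unfolding F_def[abs_def] .
    also have "\<dots> \<longleftrightarrow> (\<exists>y\<in>carrier (cochains P d ?SN (Suc t)).
        f \<otimes>\<^bsub>cochains R e N t\<^esub> restr (R t) (H (Suc t) y) \<in> coboundaries R e N t)"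
    proof
      assume "\<exists>y. cocycle O.C O.dC N (Suc t) y \<and> coboundary R e N t (padd N f (\<lambda>n r. y n (T.\<psi> t n r)))"
      then obtain y where y: "cocycle O.C O.dC N (Suc t) y" "coboundary R e N t (padd N f (\<lambda>n r. y n (T.\<psi> t n r)))" by blast
      let ?y = "restr (P (Suc t)) (O.adj N (Suc t) y)"
      have yc: "?y \<in> cocycles P d ?SN (Suc t)" by (rule restr_cocycles[OF chP O.cocycle_adj[OF N y(1)]])
      have "coboundary R e N t (padd N f (H (Suc t) ?y))"
      proof (rule coboundary_cong[OF y(2)])
        fix m r assume r: "r \<in> elts (R t) m"
        note p = mor_closed[OF T.mor_psi r]
        have "?y (Suc m) (T.\<psi> t m r) = y m (T.\<psi> t m r)"
          unfolding restr_apply[OF O.C_E(1)[OF p]] by (rule O.adj_C[OF p])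
        then show "padd N f (H (Suc t) ?y) m r = padd N f (\<lambda>n r. y n (T.\<psi> t n r)) m r"
          by (simp add: padd_def H_def)
      qed
      then show "\<exists>y\<in>carrier (cochains P d ?SN (Suc t)).
          f \<otimes>\<^bsub>cochains R e N t\<^esub> restr (R t) (H (Suc t) y) \<in> coboundaries R e N t"
        using yc tensor_coboundaries_iff[OF chR N f(1) H_coc] by (intro bexI[of _ ?y]) (simp_all add: mem_cocycles)
    next
      assume "\<exists>y\<in>carrier (cochains P d ?SN (Suc t)).
          f \<otimes>\<^bsub>cochains R e N t\<^esub> restr (R t) (H (Suc t) y) \<in> coboundaries R e N t"
      then obtain y where y: "cocycle P d ?SN (Suc t) y" and yB: "f \<otimes>\<^bsub>cochains R e N t\<^esub> restr (R t) (H (Suc t) y) \<in> coboundaries R e N t"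
        by (auto simp: mem_cocycles)
      have "coboundary R e N t (padd N f (H (Suc t) y))"
        using yB unfolding tensor_coboundaries_iff[OF chR N f(1) H_coc[OF y]] .
      then show "\<exists>y. cocycle O.C O.dC N (Suc t) y \<and> coboundary R e N t (padd N f (\<lambda>n r. y n (T.\<psi> t n r)))"
        using O.cocycle_adjoint[OF N y] unfolding H_def[abs_def] diff_Suc_1 by blast
    qed
    finally show "?F (Suc (Suc t)) f \<in> coboundaries Q q N (Suc (Suc t)) \<longleftrightarrow> (\<exists>y\<in>carrier (cochains P d ?SN (Suc t)).
        f \<otimes>\<^bsub>cochains R e N t\<^esub> restr (R t) (H (Suc t) y) \<in> coboundaries R e N t)" .
  qed
  have exQ: "kernel (cohomology Q q N (Suc (Suc t))) (cohomology P d ?SN (Suc (Suc t))) (?iE (Suc (Suc t)))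
      = ?iF (Suc (Suc t)) ` carrier (cohomology R e N t)" for t
    unfolding cohomology_def
  proof (rule induced_exact[OF grp(3) sub(3) grp(2) sub(2) grp(1) sub(1) F_hom F_B E_hom E_B ballI[OF cochains_self[OF chQ N]]])
    let ?s = "Suc (Suc t)"
    fix z assume "z \<in> carrier (cochains Q q N ?s)"
    then have z: "z \<in> cocycles Q q N ?s" "cocycle Q q N ?s z" by (simp_all add: mem_cocycles)
    have "?E ?s z \<in> coboundaries P d ?SN ?s \<longleftrightarrow> coboundary P d ?SN ?s (E ?s z)"
      by (rule restr_coboundaries_iff[OF chP SN E_coc[OF z(2)]])
    also have "\<dots> \<longleftrightarrow> (\<exists>f. cocycle R e N t f \<and> coboundary Q q N ?s (padd N z (F ?s f)))"
      unfolding E_cob_iff'[OF z(2)] S.exact_at_Q[OF z(2)] F_def[abs_def] ..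
    also have "\<dots> \<longleftrightarrow> (\<exists>f\<in>carrier (cochains R e N t). z \<otimes>\<^bsub>cochains Q q N ?s\<^esub> ?F ?s f \<in> coboundaries Q q N ?s)"
    proof
      assume "\<exists>f. cocycle R e N t f \<and> coboundary Q q N ?s (padd N z (F ?s f))"
      then obtain f where f: "cocycle R e N t f" "coboundary Q q N ?s (padd N z (F ?s f))" by blast
      let ?f = "restr (R t) f"
      have fc: "?f \<in> cocycles R e N t" by (rule restr_cocycles[OF chR f(1)])
      have "coboundary Q q N ?s (padd N z (F ?s ?f))"
      proof (rule coboundary_cong[OF f(2)])
        fix m x assume x: "x \<in> elts (Q ?s) m"
        have "dsnd (a ?s m x) \<in> elts (T.R2 ?s) m"
          by (rule mor_closed[OF chain_mapD(1)[OF S.chain_dsnd] mor_closed[OF chain_mapD(1)[OF a(1)] x]])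
        then show "padd N z (F ?s ?f) m x = padd N z (F ?s f) m x" by (simp add: padd_def F_def)
      qed
      then show "\<exists>f\<in>carrier (cochains R e N t). z \<otimes>\<^bsub>cochains Q q N ?s\<^esub> ?F ?s f \<in> coboundaries Q q N ?s"
        using fc tensor_coboundaries_iff[OF chQ N z(1) F_coc] by (intro bexI[of _ ?f]) (simp_all add: mem_cocycles)
    next
      assume "\<exists>f\<in>carrier (cochains R e N t). z \<otimes>\<^bsub>cochains Q q N ?s\<^esub> ?F ?s f \<in> coboundaries Q q N ?s"
      then obtain f where f: "cocycle R e N t f" and fB: "z \<otimes>\<^bsub>cochains Q q N ?s\<^esub> ?F ?s f \<in> coboundaries Q q N ?s"
        by (auto simp: mem_cocycles)
      have "coboundary Q q N ?s (padd N z (F ?s f))"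
        using fB unfolding tensor_coboundaries_iff[OF chQ N z(1) F_coc[OF f]] .
      then show "\<exists>f. cocycle R e N t f \<and> coboundary Q q N ?s (padd N z (F ?s f))" using f by blast
    qed
    finally show "?E ?s z \<in> coboundaries P d ?SN ?s \<longleftrightarrow>
        (\<exists>f\<in>carrier (cochains R e N t). z \<otimes>\<^bsub>cochains Q q N ?s\<^esub> ?F ?s f \<in> coboundaries Q q N ?s)" .
  qed
  have exP: "kernel (cohomology P d ?SN (Suc (Suc t))) (cohomology R e N (Suc t)) (?iH (Suc (Suc t)))
      = ?iE (Suc (Suc t)) ` carrier (cohomology Q q N (Suc (Suc t)))" for t
    unfolding cohomology_def diff_Suc_1
  proof (rule induced_exact[OF grp(2) sub(2) grp(1) sub(1) grp(3) sub(3) E_hom E_B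
        H_hom[unfolded diff_Suc_1] H_B[unfolded diff_Suc_1] ballI[OF cochains_self[OF chP SN]]])
    let ?s = "Suc (Suc t)"
    fix y assume "y \<in> carrier (cochains P d ?SN ?s)"
    then have y: "y \<in> cocycles P d ?SN ?s" "cocycle P d ?SN ?s y" by (simp_all add: mem_cocycles)
    have "restr (R (Suc t)) (H ?s y) \<in> coboundaries R e N (Suc t) \<longleftrightarrow> coboundary R e N (Suc t) (H ?s y)"
      by (rule restr_coboundaries_iff[OF chR N H_coc[OF y(2)]])
    also have "\<dots> \<longleftrightarrow> (\<exists>z. cocycle Q q N ?s z \<and>
        coboundary O.C O.dC N ?s (padd N (\<lambda>m. y (Suc m)) (\<lambda>n x. z n (b ?s n (S.inl ?s n x)))))"
      using S.exact_at_C[OF O.cocycle_adjoint[OF N y(2)]] unfolding H_def[abs_def] diff_Suc_1 .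
    also have "\<dots> \<longleftrightarrow> (\<exists>z. cocycle Q q N ?s z \<and> coboundary P d ?SN ?s (padd ?SN y (E ?s z)))"
      using E_cob_iff[OF y(2)] by blast
    also have "\<dots> \<longleftrightarrow> (\<exists>z\<in>carrier (cochains Q q N ?s). y \<otimes>\<^bsub>cochains P d ?SN ?s\<^esub> ?E ?s z \<in> coboundaries P d ?SN ?s)"
    proof
      assume "\<exists>z. cocycle Q q N ?s z \<and> coboundary P d ?SN ?s (padd ?SN y (E ?s z))"
      then obtain z where z: "cocycle Q q N ?s z" "coboundary P d ?SN ?s (padd ?SN y (E ?s z))" by blast
      let ?z = "restr (Q ?s) z"
      have zc: "?z \<in> cocycles Q q N ?s" by (rule restr_cocycles[OF chQ z(1)])
      have "coboundary P d ?SN ?s (padd ?SN y (E ?s ?z))"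
      proof (rule coboundary_cong[OF z(2)])
        fix k x assume x: "x \<in> elts (P ?s) k"
        show "padd ?SN y (E ?s ?z) k x = padd ?SN y (E ?s z) k x"
        proof (cases k)
          case 0
          then show ?thesis by (simp add: padd_def E_def)
        next
          case (Suc m)
          then have "omega_proj (P ?s) m x \<in> elts (O.C ?s) m" using x O.proj_C by simp
          then have "b ?s m (S.inl ?s m (omega_proj (P ?s) m x)) \<in> elts (Q ?s) m"
            by (rule mor_closed[OF chain_mapD(1)[OF b(1)] mor_closed[OF chain_mapD(1)[OF S.chain_inl]]])
          then show ?thesis using Suc by (simp add: padd_def E_def)
        qed
      qed
      then show "\<exists>z\<in>carrier (cochains Q q N ?s). y \<otimes>\<^bsub>cochains P d ?SN ?s\<^esub> ?E ?s z \<in> coboundaries P d ?SN ?s"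
        using zc tensor_coboundaries_iff[OF chP SN y(1) E_coc] by (intro bexI[of _ ?z]) (simp_all add: mem_cocycles)
    next
      assume "\<exists>z\<in>carrier (cochains Q q N ?s). y \<otimes>\<^bsub>cochains P d ?SN ?s\<^esub> ?E ?s z \<in> coboundaries P d ?SN ?s"
      then obtain z where z: "cocycle Q q N ?s z" and zB: "y \<otimes>\<^bsub>cochains P d ?SN ?s\<^esub> ?E ?s z \<in> coboundaries P d ?SN ?s"
        by (auto simp: mem_cocycles)
      have "coboundary P d ?SN ?s (padd ?SN y (E ?s z))"
        using zB unfolding tensor_coboundaries_iff[OF chP SN y(1) E_coc[OF z]] .
      then show "\<exists>z. cocycle Q q N ?s z \<and> coboundary P d ?SN ?s (padd ?SN y (E ?s z))" using z by blast
    qed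
    finally show "restr (R (Suc t)) (H ?s y) \<in> coboundaries R e N (Suc t) \<longleftrightarrow>
        (\<exists>z\<in>carrier (cochains Q q N ?s). y \<otimes>\<^bsub>cochains P d ?SN ?s\<^esub> ?E ?s z \<in> coboundaries P d ?SN ?s)" .
  qed
  have grpH: "group (cohomology P d ?SN s)" "group (cohomology Q q N s)" "group (cohomology R e N s)" for s
    using group_cohomology[OF chP SN] group_cohomology[OF chQ N] group_cohomology[OF chR N] by blast+
  show ?thesis
  proof (intro exI allI impI)
    fix s :: nat assume "2 \<le> s"
    then obtain t where s: "s = Suc (Suc t)" by (metis Suc_diff_le add_2_eq_Suc le_Suc_ex)
    \<comment> \<open>In \<open>exact_seq\<close> the last target comes first in the list, so the
      window is built up from \<open>H (s - 1)\<close> by extension at the front.\<close>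
    have 1: "exact_seq ([cohomology R e N t, cohomology P d ?SN (Suc t)], [?iH (Suc t)])"
      by (intro exact_seq.unity group_hom.intro grpH group_hom_axioms.intro iH)
    have 2: "exact_seq ([cohomology Q q N s, cohomology R e N t, cohomology P d ?SN (Suc t)], [?iF s, ?iH (Suc t)])"
      unfolding s by (rule exact_seq.extension[OF 1 grpH(2) iF exR])
    have 3: "exact_seq ([cohomology P d ?SN s, cohomology Q q N s, cohomology R e N t, cohomology P d ?SN (Suc t)],
        [?iE s, ?iF s, ?iH (Suc t)])"
      using exact_seq.extension[OF 2[unfolded s] grpH(1) iE exQ] unfolding s .
    have "exact_seq ([cohomology R e N (Suc t), cohomology P d ?SN s, cohomology Q q N s, cohomology R e N t, cohomology P d ?SN (Suc t)],
        [?iH s, ?iE s, ?iF s, ?iH (Suc t)])"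
      using exact_seq.extension[OF 3[unfolded s] grpH(3) iH exP] unfolding s .
    then show "exact_seq ([cohomology R e N (s - 1), cohomology P d ?SN s, cohomology Q q N s,
        cohomology R e N (s - 2), cohomology P d ?SN (s - 1)], [?iH s, ?iE s, ?iF s, ?iH (s - 1)])"
      by (simp add: s)
  qed
qed

text \<open>As a resolution exists, the pair picked by \<open>SOME\<close> is one; the choice does
  not involve \<open>s\<close>, so one resolution serves all degrees.\<close>

lemma Ext_U_eq_cohomology:
  fixes A :: "int gmod"
  assumes "um A"
  shows "\<exists>P d. resolution A P d \<and> (\<forall>s. Ext_U s A N = cohomology P d N s)"
proof -
  obtain P d where "resolution A P d" by (rule resolution_exists[OF assms])
  then have "\<exists>z. case z of (P, d) \<Rightarrow> projective_resolution A P d"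
    using projective_resolution_if_resolution by fastforce
  then have "case (SOME (P, d). projective_resolution A P d) of (P, d) \<Rightarrow> projective_resolution A P d"
    by (rule someI_ex)
  moreover obtain P d where e: "(SOME (P, d). projective_resolution A P d) = (P, d)" by fastforce
  ultimately have "resolution A P d" using resolution_if_projective_resolution by simp
  moreover have "\<forall>s. Ext_U s A N = cohomology P d N s"
    by (simp add: Ext_U_def e cohomology_def cochains_def)
  ultimately show ?thesis by blast
qed

theorem theorem9p4:
  fixes M :: "'a gmod" and n t :: nat
  assumes "unstable_module M"
  shows "\<exists>P E H. \<forall>s\<ge>2.
    exact_seq
      ([E2 (s - 1) t (2 * n + 1) M, E2 s (t + 1) (n + 1) M, E2 s t n M,
        E2 (s - 2) t (2 * n + 1) M, E2 (s - 1) (t + 1) (n + 1) M],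
       [H s, E s, P s, H (s - 1)])"
proof -
  let ?A = "\<lambda>k. (suspension ^^ k) F2_module" and ?N = "(suspension ^^ t) M"
  have um: "um (?A k)" for k by simp
  have N: "um ?N" using assms by simp
  obtain P d where P: "resolution (?A (Suc n)) P d" "\<forall>s. Ext_U s (?A (Suc n)) (suspension ?N) = cohomology P d (suspension ?N) s"
    using Ext_U_eq_cohomology[OF um[of "Suc n"], of "suspension ?N"] by (elim exE conjE)
  obtain Q q where Q: "resolution (?A n) Q q" "\<forall>s. Ext_U s (?A n) ?N = cohomology Q q ?N s"
    using Ext_U_eq_cohomology[OF um[of "n"], of "?N"] by (elim exE conjE)
  obtain R e where R: "resolution (?A (2 * n + 1)) R e" "\<forall>s. Ext_U s (?A (2 * n + 1)) ?N = cohomology R e ?N s"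
    using Ext_U_eq_cohomology[OF um[of "2 * n + 1"], of "?N"] by (elim exE conjE)
  \<comment> \<open>The exponents t+1 and n+1 unfold to an outermost suspension, in the coefficients
    and in the sphere.\<close>
  have E2: "E2 s (t + 1) (n + 1) M = cohomology P d (suspension ?N) s" "E2 s t n M = cohomology Q q ?N s"
    "E2 s t (2 * n + 1) M = cohomology R e ?N s" for s
    using P(2) Q(2) R(2) by (simp_all add: E2_def)
  show ?thesis unfolding E2 by (rule EHP_sequence[OF P(1) Q(1) R(1) N])
qed

end
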